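(* Let $\alpha,\nu,\theta>0$ and $K\in W^{1,\infty}(\mathbb{R})$. There are constants $C_1,C_2>0$ depending only on $\alpha,\theta,\nu$ and $\|K\|_{W^{1,\infty}}$ such that the following holds. Let $I>0$, let $f^{\mathrm{in}}\in L^1(\mathbb{R}^2)$ be non-negative with mass $\mathcal{M}=\iint_{\mathbb{R}^2}f^{\mathrm{in}}\,\mathrm{d}x\,\mathrm{d}v>0$, let $f$ be the solution of the nonlinear Vlasov-Fokker-Planck equation (see context) with initial data $f^{\mathrm{in}}$, and let $f^\infty$ be a steady state of mass $\mathcal{M}$ of the form described in the context. If $$I\mathcal{M}\le C_1\qquad\text{and}\qquad \sqrt{\mathcal{M}}\,\|f^{\mathrm{in}}-f^\infty\|_{L^2(\mu^\infty)}\le C_2,$$ then there exist $\lambda>0$ depending only on $\alpha,\theta,\nu$ and $\|K\|_{W^{1,\infty}}$, and a constant $C_3>1$ depending additionally on $\mathcal{M}$, such that $$\|f(t)-f^\infty\|_{L^2(\mu^\infty)}\le C_3\,e^{-\lambda t}\,\|f^{\mathrm{in}}-f^\infty\|_{L^2(\mu^\infty)}\qquad\text{for all }t\ge0 .$$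
   Context: The nonlinear Vlasov-Fokker-Planck equation for $f=f(t,x,v)$, $t\ge 0$, $(x,v)\in\mathbb{R}^2$, is $$\partial_tf+v\,\partial_xf+(F_f(t,x)-\alpha x)\,\partial_vf=2\nu\,\partial_v(vf+\theta\,\partial_vf),\qquad F_f(t,x)=-I\iint_{\mathbb{R}^2}\partial_xK(x-y)f(t,y,w)\,\mathrm{d}y\,\mathrm{d}w,\qquad f(0)=f^{\mathrm{in}},$$ where $K$ is not assumed to be even. Its solution is the global, non-negative, mass-conserving one in $\mathcal{C}([0,\infty),L^1(\mathbb{R}^2))\cap\mathcal{C}^\infty((0,\infty)\times\mathbb{R}^2)$. The steady states considered (Haissinski steady states) are $f^\infty(x,v)=\frac{\mathcal{M}}{\sqrt{2\pi\theta}}e^{-\frac{v^2}{2\theta}}\sigma^\infty(x)$, where $\sigma^\infty$ is a fixed point of $$\mathcal{T}(\sigma)(x):=\frac{e^{-\frac{\alpha x^2}{2\theta}-\frac{I\mathcal{M}}{\theta}K\ast\sigma(x)}}{\int_{\mathbb{R}}e^{-\frac{\alpha y^2}{2\theta}-\frac{I\mathcal{M}}{\theta}K\ast\sigma(y)}\,\mathrm{d}y}$$ (so $\sigma^\infty>0$, $\int_{\mathbb{R}}\sigma^\infty=1$), with $\sup_{x}|\partial_x^n\sigma^\infty(x)e^{\beta x^2/2}|<\infty$ for all $n\in\mathbb{N}$ and $0<\beta<\alpha/\theta$. The space $L^2(\mu^\infty)$ is the $L^2$ space for the measure $\mathrm{d}\mu^\infty=(f^\infty)^{-1}\,\mathrm{d}x\,\mathrm{d}v$,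 with norm $\|g\|_{L^2(\mu^\infty)}=\|g\,(f^\infty)^{-1/2}\|_{L^2(\mathbb{R}^2)}$. *)

theory Defs
  imports "HOL-Analysis.Analysis" "HOL-Probability.Essential_Supremum"
begin

section \<open>Smooth functions\<close>

(* Meant for open S: all iterated directional derivatives up to order n exist
   (as Frechet derivatives) and are continuous on S. *)
primrec Ck_on :: "nat \<Rightarrow> ('a::real_normed_vector \<Rightarrow> real) \<Rightarrow> 'a set \<Rightarrow> bool" where
  "Ck_on 0 f S \<longleftrightarrow> continuous_on S f"
| "Ck_on (Suc n) f S \<longleftrightarrow>
     (\<forall>x\<in>S. f differentiable (at x)) \<and>
     (\<forall>h. Ck_on n (\<lambda>x. frechet_derivative f (at x) h) S)"

definition smooth_fun_on :: "('a::real_normed_vector \<Rightarrow> real) \<Rightarrow> 'a set \<Rightarrow> bool" where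
  "smooth_fun_on f S \<longleftrightarrow> (\<forall>n. Ck_on n f S)"

section \<open>The Sobolev space $W^{1,\infty}(\mathbb{R})$\<close>

(* esssup is infinite for functions that are not Borel measurable. *)
definition in_Linf :: "(real \<Rightarrow> real) \<Rightarrow> bool" where
  "in_Linf g \<longleftrightarrow> esssup lborel (\<lambda>x. ereal \<bar>g x\<bar>) < \<infinity> \<and> g \<in> borel_measurable lborel"

definition Linf_norm :: "(real \<Rightarrow> real) \<Rightarrow> real" where
  "Linf_norm g = real_of_ereal (esssup lborel (\<lambda>x. ereal \<bar>g x\<bar>))"

definition test_fun :: "(real \<Rightarrow> real) \<Rightarrow> bool" where
  "test_fun \<phi> \<longleftrightarrow> smooth_fun_on \<phi> UNIV \<and> compact (closure {x. \<phi> x \<noteq> 0})"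

definition is_weak_deriv :: "(real \<Rightarrow> real) \<Rightarrow> (real \<Rightarrow> real) \<Rightarrow> bool" where
  "is_weak_deriv g g' \<longleftrightarrow>
     (\<forall>\<phi>. test_fun \<phi> \<longrightarrow>
        (\<integral>x. g x * deriv \<phi> x \<partial>lborel) = - (\<integral>x. g' x * \<phi> x \<partial>lborel))"

definition in_W1inf :: "(real \<Rightarrow> real) \<Rightarrow> bool" where
  "in_W1inf K \<longleftrightarrow> in_Linf K \<and> (\<exists>K'. in_Linf K' \<and> is_weak_deriv K K')"

(* For K in W^{1,infinity} the weak derivative is unique up to null sets; every use
   below is under an integral or an essential supremum. *)
definition weak_deriv :: "(real \<Rightarrow> real) \<Rightarrow> real \<Rightarrow> real" where
  "weak_deriv K = (SOME K'. in_Linf K' \<and> is_weak_deriv K K')"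

definition W1inf_norm :: "(real \<Rightarrow> real) \<Rightarrow> real" where
  "W1inf_norm K = Linf_norm K + Linf_norm (weak_deriv K)"

section \<open>The nonlinear Vlasov-Fokker-Planck equation\<close>

definition force :: "real \<Rightarrow> (real \<Rightarrow> real) \<Rightarrow> (real \<Rightarrow> real \<times> real \<Rightarrow> real) \<Rightarrow> real \<Rightarrow> real \<Rightarrow> real" where
  "force I K f t x = - I * (\<integral>z. weak_deriv K (x - fst z) * f t z \<partial>lborel)"

definition vfp_equation ::
  "real \<Rightarrow> real \<Rightarrow> real \<Rightarrow> real \<Rightarrow> (real \<Rightarrow> real) \<Rightarrow> (real \<Rightarrow> real \<times> real \<Rightarrow> real) \<Rightarrow> bool" where
  "vfp_equation \<alpha> \<nu> \<theta> I K f \<longleftrightarrow>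
     (\<forall>t>0. \<forall>x v.
        deriv (\<lambda>s. f s (x, v)) t
        + v * deriv (\<lambda>y. f t (y, v)) x
        + (force I K f t x - \<alpha> * x) * deriv (\<lambda>w. f t (x, w)) v
        = 2 * \<nu> * deriv (\<lambda>w. w * f t (x, w) + \<theta> * deriv (\<lambda>u. f t (x, u)) w) v)"

definition continuous_in_L1 :: "(real \<Rightarrow> real \<times> real \<Rightarrow> real) \<Rightarrow> bool" where
  "continuous_in_L1 f \<longleftrightarrow>
     (\<forall>t\<ge>0. integrable lborel (f t)) \<and>
     (\<forall>t\<ge>0. ((\<lambda>s. \<integral>z. \<bar>f s z - f t z\<bar> \<partial>lborel) \<longlongrightarrow> 0) (at t within {0..}))"

(* Functions of the phase space variables are L^1 classes, so pointwise conditions at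
   fixed time are almost everywhere; values of f at negative times are irrelevant. *)
definition vfp_solution ::
  "real \<Rightarrow> real \<Rightarrow> real \<Rightarrow> real \<Rightarrow> (real \<Rightarrow> real) \<Rightarrow> (real \<times> real \<Rightarrow> real) \<Rightarrow>
   (real \<Rightarrow> real \<times> real \<Rightarrow> real) \<Rightarrow> bool" where
  "vfp_solution \<alpha> \<nu> \<theta> I K f_in f \<longleftrightarrow>
     continuous_in_L1 f \<and>
     smooth_fun_on (\<lambda>(t, z). f t z) ({0<..} \<times> UNIV) \<and>
     vfp_equation \<alpha> \<nu> \<theta> I K f \<and>
     (AE z in lborel. f 0 z = f_in z) \<and>
     (\<forall>t\<ge>0. AE z in lborel. 0 \<le> f t z) \<and>
     (\<forall>t\<ge>0. (\<integral>z. f t z \<partial>lborel) = (\<integral>z. f_in z \<partial>lborel))"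

section \<open>Haissinski steady states\<close>

definition conv :: "(real \<Rightarrow> real) \<Rightarrow> (real \<Rightarrow> real) \<Rightarrow> real \<Rightarrow> real" where
  "conv K \<sigma> x = (\<integral>y. K (x - y) * \<sigma> y \<partial>lborel)"

definition haissinski_map ::
  "real \<Rightarrow> real \<Rightarrow> real \<Rightarrow> real \<Rightarrow> (real \<Rightarrow> real) \<Rightarrow> (real \<Rightarrow> real) \<Rightarrow> real \<Rightarrow> real" where
  "haissinski_map \<alpha> \<theta> I M K \<sigma> x =
     exp (- (\<alpha> * x\<^sup>2 / (2 * \<theta>)) - I * M / \<theta> * conv K \<sigma> x) /
     (\<integral>y. exp (- (\<alpha> * y\<^sup>2 / (2 * \<theta>)) - I * M / \<theta> * conv K \<sigma> y) \<partial>lborel)"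

(* Positivity and unit mass of sigma follow from the fixed point equation. *)
definition steady_density ::
  "real \<Rightarrow> real \<Rightarrow> real \<Rightarrow> real \<Rightarrow> (real \<Rightarrow> real) \<Rightarrow> (real \<Rightarrow> real) \<Rightarrow> bool" where
  "steady_density \<alpha> \<theta> I M K \<sigma> \<longleftrightarrow>
     integrable lborel \<sigma> \<and>
     (\<forall>x. haissinski_map \<alpha> \<theta> I M K \<sigma> x = \<sigma> x) \<and>
     smooth_fun_on \<sigma> UNIV \<and>
     (\<forall>n. \<forall>\<beta>. 0 < \<beta> \<and> \<beta> < \<alpha> / \<theta> \<longrightarrow>
        bdd_above (range (\<lambda>x. \<bar>(deriv ^^ n) \<sigma> x * exp (\<beta> * x\<^sup>2 / 2)\<bar>)))"

definition steady_state :: "real \<Rightarrow> real \<Rightarrow> (real \<Rightarrow> real) \<Rightarrow> real \<times> real \<Rightarrow> real" where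
  "steady_state \<theta> M \<sigma> = (\<lambda>(x, v). M / sqrt (2 * pi * \<theta>) * exp (- (v\<^sup>2 / (2 * \<theta>))) * \<sigma> x)"

definition is_haissinski ::
  "real \<Rightarrow> real \<Rightarrow> real \<Rightarrow> real \<Rightarrow> (real \<Rightarrow> real) \<Rightarrow> (real \<times> real \<Rightarrow> real) \<Rightarrow> bool" where
  "is_haissinski \<alpha> \<theta> I M K f_inf \<longleftrightarrow>
     (\<exists>\<sigma>. steady_density \<alpha> \<theta> I M K \<sigma> \<and> f_inf = steady_state \<theta> M \<sigma>)"

section \<open>The weighted space $L^2(\mu^\infty)$\<close>

definition mu_inf :: "(real \<times> real \<Rightarrow> real) \<Rightarrow> (real \<times> real) measure" where
  "mu_inf f_inf = density lborel (\<lambda>z. ennreal (1 / f_inf z))"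

definition in_L2 :: "'a measure \<Rightarrow> ('a \<Rightarrow> real) \<Rightarrow> bool" where
  "in_L2 m g \<longleftrightarrow> g \<in> borel_measurable m \<and> integrable m (\<lambda>z. (g z)\<^sup>2)"

(* The Bochner integral is 0 for non-integrable functions, so this is only meaningful
   together with in_L2. *)
definition L2_norm :: "'a measure \<Rightarrow> ('a \<Rightarrow> real) \<Rightarrow> real" where
  "L2_norm m g = sqrt (\<integral>z. (g z)\<^sup>2 \<partial>m)"

end

theory Submission
  imports Defs "HOL-Probability.Probability" "HOL-Real_Asymp.Real_Asymp"
    "HOL-Computational_Algebra.Polynomial"
begin

text \<open>
  After rescaling space and velocity so that the harmonic Maxwellian becomes the standard Gaussian
  \<open>\<gamma>\<close>, the difference g between the solution and the steady state solves the linear kinetic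
  Fokker-Planck equation with an additional term \<open>\<partial>\<^sub>v J\<close>, where J is linear in g with a coefficient of
  size O(I M). The backward semigroup P of the linear equation has an explicit Gaussian (Mehler)
  kernel, so that the velocity gradient satisfies |\<open>\<partial>\<^sub>v P\<^sub>t \<phi>\<close>| \<open>\<le>\<close> (C/t)^(1/2) (\<open>P\<^sub>t \<phi>\<^sup>2\<close>)^(1/2), and
  some \<open>P\<^sub>T\<close> contracts mean-zero functions by 1/4 in \<open>L\<^sup>2(\<gamma>)\<close>. Testing g(t) against
  \<open>P\<^bsub>T-t\<^esub> \<phi>\<close> for bounded, compactly supported \<open>\<phi>\<close> turns the equation into Duhamel's formula;
  since t^(-1/2) is integrable, the contribution of J over [0, T] is at most a small multiple of the
  supremum of the norm of g, which can be absorbed. The norm is therefore halved on each interval of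
  length T. For small I M the weights 1/f_inf and \<open>1/\<gamma>\<close> are comparable. Since the total mass bounds the
  force for all times, the estimate is linear in g and the initial distance may be arbitrary.
\<close>

section \<open>The damped oscillator and the covariance of the kernel\<close>

text \<open>Noise acts on v only and reaches x through transport, so a plain energy estimate does
  not control x. The explicit kernel takes the place of a modified (hypocoercive) norm: the force
  term costs one v-derivative, and the price t^(-1/2) of that derivative is integrable. Two
  obstacles shape the rest. First, for positive times the solution is only known to be smooth and in
  L^1; neither moments nor the weighted norm are available. Hence g is tested against functions
  bounded by some k, for which suprema are finite beforehand; the final estimates are free of k, and
  arbitrary k recovers the weighted norm. The cutoff is logarithmic because its errors then need no
  moments. Second, the interaction is quadratic. The splitting F_f f - F_inf f_inf = F_f g + (F_f -
  F_inf) f_inf leaves a coefficient bounded through the mass and one bounded through the L^1 norm of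
  g. Smallness is tuned to 1/4 (contraction) + 2/8 (Duhamel error for a norm at most doubled) = 1/2
  per window.\<close>

lemma damped_oscillator_exists:
  fixes \<alpha> \<nu> :: real
  assumes "\<alpha> > 0" "\<nu> > 0"
  obtains s s1 :: "real \<Rightarrow> real" where
    "\<And>t. (s has_real_derivative s1 t) (at t)"
    "\<And>t. (s1 has_real_derivative (- 2 * \<nu> * s1 t - \<alpha> * s t)) (at t)"
    "s 0 = 0" "s1 0 = 1" "(s \<longlongrightarrow> 0) at_top" "(s1 \<longlongrightarrow> 0) at_top"
proof -
  \<comment> \<open>The discriminant of r^2 + 2 \<nu> r + \<alpha> separates over-, critically and
    underdamped motion. In each regime \<open>s\<close> solves s'' + 2 \<nu> s' + \<alpha> s = 0
    with unit initial velocity, and all roots have negative real part.\<close>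
  consider "\<nu>\<^sup>2 > \<alpha>" | "\<nu>\<^sup>2 = \<alpha>" | "\<nu>\<^sup>2 < \<alpha>" by linarith
  then show thesis
  proof cases
    case 1
    define \<delta> where "\<delta> = sqrt (\<nu>\<^sup>2 - \<alpha>)"
    have \<delta>: "\<delta> > 0" "\<delta> * \<delta> = \<nu> * \<nu> - \<alpha>"
      using 1 by (auto simp: \<delta>_def power2_eq_square)
    have lt: "\<delta> < \<nu>"
    proof (rule ccontr)
      assume "\<not> \<delta> < \<nu>"
      then have "\<nu> * \<nu> \<le> \<delta> * \<delta>" using assms by (intro mult_mono) auto
      then show False using \<delta> assms by simp
    qed
    define e1 where "e1 = (\<lambda>t. exp (- (\<nu> - \<delta>) * t) / (2 * \<delta>))"
    define e2 where "e2 = (\<lambda>t. exp (- (\<nu> + \<delta>) * t) / (2 * \<delta>))"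
    have de1: "(e1 has_real_derivative (- (\<nu> - \<delta>) * e1 t)) (at t)" for t
      unfolding e1_def using \<delta>(1) by (auto intro!: derivative_eq_intros simp: field_simps)
    have de2: "(e2 has_real_derivative (- (\<nu> + \<delta>) * e2 t)) (at t)" for t
      unfolding e2_def using \<delta>(1) by (auto intro!: derivative_eq_intros simp: field_simps)
    have p: "\<nu> - \<delta> > 0" "\<nu> + \<delta> > 0" using lt \<delta> assms by auto
    have l: "(e1 \<longlongrightarrow> 0) at_top" "(e2 \<longlongrightarrow> 0) at_top"
      unfolding e1_def e2_def using p \<delta>(1) by real_asymp+
    show thesis
    proof (rule that[of "\<lambda>t. e1 t - e2 t" "\<lambda>t. - (\<nu> - \<delta>) * e1 t + (\<nu> + \<delta>) * e2 t"])
      show "((\<lambda>t. e1 t - e2 t) has_real_derivative (- (\<nu> - \<delta>) * e1 t + (\<nu> + \<delta>) * e2 t)) (at t)" for t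
        by (rule derivative_eq_intros de1 de2 refl)+ (simp add: algebra_simps)
      have al: "\<alpha> = \<nu> * \<nu> - \<delta> * \<delta>" using \<delta>(2) by simp
      show "((\<lambda>t. - (\<nu> - \<delta>) * e1 t + (\<nu> + \<delta>) * e2 t) has_real_derivative
        (- 2 * \<nu> * (- (\<nu> - \<delta>) * e1 t + (\<nu> + \<delta>) * e2 t) - \<alpha> * (e1 t - e2 t))) (at t)" for t
        unfolding al by (rule derivative_eq_intros de1 de2 refl)+ (simp add: algebra_simps)
      show "e1 0 - e2 0 = 0" by (simp add: e1_def e2_def)
      show "- (\<nu> - \<delta>) * e1 0 + (\<nu> + \<delta>) * e2 0 = 1" using \<delta>(1) by (simp add: e1_def e2_def field_simps)
      show "((\<lambda>t. e1 t - e2 t) \<longlongrightarrow> 0) at_top" using tendsto_diff[OF l] by simp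
      show "((\<lambda>t. - (\<nu> - \<delta>) * e1 t + (\<nu> + \<delta>) * e2 t) \<longlongrightarrow> 0) at_top"
        using tendsto_add[OF tendsto_mult_left[OF l(1), of "- (\<nu> - \<delta>)"] tendsto_mult_left[OF l(2), of "\<nu> + \<delta>"]] by simp
    qed
  next
    case 2
    show thesis
    proof (rule that[of "\<lambda>t. t * exp (- \<nu> * t)" "\<lambda>t. (1 - \<nu> * t) * exp (- \<nu> * t)"])
      show "((\<lambda>t. t * exp (- \<nu> * t)) has_real_derivative (1 - \<nu> * t) * exp (- \<nu> * t)) (at t)" for t
        by (auto intro!: derivative_eq_intros simp: algebra_simps)
      show "((\<lambda>t. (1 - \<nu> * t) * exp (- \<nu> * t)) has_real_derivative
        (- 2 * \<nu> * ((1 - \<nu> * t) * exp (- \<nu> * t)) - \<alpha> * (t * exp (- \<nu> * t)))) (at t)" for t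
        unfolding 2[symmetric] by (auto intro!: derivative_eq_intros simp: algebra_simps power2_eq_square)
      show "((\<lambda>t. t * exp (- \<nu> * t)) \<longlongrightarrow> 0) at_top" using assms by real_asymp
      show "((\<lambda>t. (1 - \<nu> * t) * exp (- \<nu> * t)) \<longlongrightarrow> 0) at_top" using assms by real_asymp
    qed auto
  next
    case 3
    define \<delta> where "\<delta> = sqrt (\<alpha> - \<nu>\<^sup>2)"
    have \<delta>: "\<delta> > 0" "\<delta> * \<delta> = \<alpha> - \<nu> * \<nu>" using 3 by (auto simp: \<delta>_def power2_eq_square)
    define e1 where "e1 = (\<lambda>t. exp (- \<nu> * t) * sin (\<delta> * t) / \<delta>)"
    define e2 where "e2 = (\<lambda>t. exp (- \<nu> * t) * cos (\<delta> * t))"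
    have de1: "(e1 has_real_derivative (e2 t - \<nu> * e1 t)) (at t)" for t
      unfolding e1_def e2_def using \<delta>(1) by (auto intro!: derivative_eq_intros simp: field_simps)
    have de2: "(e2 has_real_derivative (- \<nu> * e2 t - \<delta> * \<delta> * e1 t)) (at t)" for t
      unfolding e1_def e2_def using \<delta>(1) by (auto intro!: derivative_eq_intros simp: field_simps)
    have l0: "((\<lambda>t. exp (- \<nu> * t)) \<longlongrightarrow> 0) at_top" using assms by real_asymp
    have l1: "(e1 \<longlongrightarrow> 0) at_top"
    proof (rule tendsto_0_le[OF l0, of _ "1 / \<delta>"], rule always_eventually, rule allI)
      fix t show "norm (e1 t) \<le> norm (exp (- \<nu> * t)) * (1 / \<delta>)"
        using \<delta>(1) by (simp add: e1_def abs_mult divide_right_mono mult_left_le)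
    qed
    have l2: "(e2 \<longlongrightarrow> 0) at_top"
    proof (rule tendsto_0_le[OF l0, of _ 1], rule always_eventually, rule allI)
      fix t show "norm (e2 t) \<le> norm (exp (- \<nu> * t)) * 1"
        by (simp add: e2_def abs_mult mult_left_le)
    qed
    show thesis
    proof (rule that[of e1 "\<lambda>t. e2 t - \<nu> * e1 t"])
      show "(e1 has_real_derivative (e2 t - \<nu> * e1 t)) (at t)" for t by (rule de1)
      have al: "\<alpha> = \<nu> * \<nu> + \<delta> * \<delta>" using \<delta>(2) by simp
      show "((\<lambda>t. e2 t - \<nu> * e1 t) has_real_derivative
        (- 2 * \<nu> * (e2 t - \<nu> * e1 t) - \<alpha> * e1 t)) (at t)" for t
        unfolding al by (rule derivative_eq_intros de1 de2 refl)+ (simp add: algebra_simps)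
      show "e1 0 = 0" "e2 0 - \<nu> * e1 0 = 1" by (auto simp: e1_def e2_def)
      show "(e1 \<longlongrightarrow> 0) at_top" by (rule l1)
      show "((\<lambda>t. e2 t - \<nu> * e1 t) \<longlongrightarrow> 0) at_top"
        using tendsto_diff[OF l2 tendsto_mult_left[OF l1, of \<nu>]] by simp
    qed
  qed
qed

text \<open>The rows (a, b) and (-b, d) form the matrix exponential of t times the drift with rows
  (0, \<omega>) and (-\<omega>, -2 \<nu>). The relation \<open>diff_ad\<close> says that this
  exponential commutes with the drift.\<close>

locale oscillator =
  fixes \<omega> \<nu> :: real and a b d :: "real \<Rightarrow> real"
  assumes pos: "\<omega> > 0" "\<nu> > 0"
    and deriv_a: "\<And>t. (a has_real_derivative (- \<omega> * b t)) (at t)"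
    and deriv_b: "\<And>t. (b has_real_derivative (\<omega> * d t)) (at t)"
    and deriv_d: "\<And>t. (d has_real_derivative (- \<omega> * b t - 2 * \<nu> * d t)) (at t)"
    and diff_ad: "\<And>t. \<omega> * (a t - d t) = 2 * \<nu> * b t"
    and init: "a 0 = 1" "b 0 = 0" "d 0 = 1"
    and lim: "(a \<longlongrightarrow> 0) at_top" "(b \<longlongrightarrow> 0) at_top" "(d \<longlongrightarrow> 0) at_top"

lemma oscillator_exists:
  assumes "\<omega> > 0" "\<nu> > 0"
  obtains a b d where "oscillator \<omega> \<nu> a b d"
proof -
  obtain s s1 :: "real \<Rightarrow> real" where s:
    "\<And>t. (s has_real_derivative s1 t) (at t)"
    "\<And>t. (s1 has_real_derivative (- 2 * \<nu> * s1 t - \<omega>\<^sup>2 * s t)) (at t)"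
    "s 0 = 0" "s1 0 = 1" "(s \<longlongrightarrow> 0) at_top" "(s1 \<longlongrightarrow> 0) at_top"
    using damped_oscillator_exists[of "\<omega>\<^sup>2" \<nu>] assms by auto
  \<comment> \<open>For spring constant \<omega>^2 all entries come from \<open>s\<close>: b =
    \<omega> s and d = s', and then \<open>diff_ad\<close> forces a = s' + 2 \<nu> s.\<close>
  show thesis
  proof (rule that[of "\<lambda>t. s1 t + 2 * \<nu> * s t" "\<lambda>t. \<omega> * s t" s1], unfold_locales)
    show "((\<lambda>t. s1 t + 2 * \<nu> * s t) has_real_derivative (- \<omega> * (\<omega> * s t))) (at t)" for t
      by (rule derivative_eq_intros s refl)+ (simp add: power2_eq_square)
    show "((\<lambda>t. \<omega> * s t) has_real_derivative (\<omega> * s1 t)) (at t)" for t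
      by (rule derivative_eq_intros s refl)+ simp
    show "(s1 has_real_derivative (- \<omega> * (\<omega> * s t) - 2 * \<nu> * s1 t)) (at t)" for t
      by (rule DERIV_cong[OF s(2)]) (simp add: power2_eq_square)
    show "((\<lambda>t. s1 t + 2 * \<nu> * s t) \<longlongrightarrow> 0) at_top"
      using tendsto_add[OF s(6) tendsto_mult_left[OF s(5), of "2 * \<nu>"]] by simp
    show "((\<lambda>t. \<omega> * s t) \<longlongrightarrow> 0) at_top"
      using tendsto_mult_left[OF s(5), of \<omega>] by simp
  qed (use s assms in \<open>auto simp: algebra_simps\<close>)
qed

context oscillator
begin

text \<open>In units where the equilibrium is the standard Gaussian, the process
  dx = \<open>\<omega>\<close> v dt, dv = (- \<open>\<omega>\<close> x - 2 \<open>\<nu>\<close> v) dt + 2 sqrt \<open>\<nu>\<close> dW started from (x, v) has mean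
  (a x + b v, - b x + d v) and covariance matrix with entries cp, cq, cr and determinant cD.
  The velocity gradient of the semigroup costs the factor sqrt (cN / cD), of order 1 / sqrt t.\<close>

definition cp :: "real \<Rightarrow> real" where "cp t = 1 - (a t)\<^sup>2 - (b t)\<^sup>2"
definition cq :: "real \<Rightarrow> real" where "cq t = b t * (a t - d t)"
definition cr :: "real \<Rightarrow> real" where "cr t = 1 - (b t)\<^sup>2 - (d t)\<^sup>2"
definition cD :: "real \<Rightarrow> real" where "cD t = cp t * cr t - (cq t)\<^sup>2"
definition cN :: "real \<Rightarrow> real" where
  "cN t = cr t * (b t)\<^sup>2 - 2 * cq t * b t * d t + cp t * (d t)\<^sup>2"

text \<open>Together with \<open>deriv_cr\<close> and \<open>deriv_cq\<close> this is the Lyapunov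
  equation: the covariance grows at rate 4 \<nu> times the rank-one matrix of the vector (b, d), the
  response of the end point to a kick in velocity. \<open>deriv_quad\<close> is its quadratic
  form.\<close>

lemma deriv_cp: "(cp has_real_derivative (4 * \<nu> * (b t)\<^sup>2)) (at t)"
proof -
  have "(cp has_real_derivative (- (2 * a t * (- \<omega> * b t)) - 2 * b t * (\<omega> * d t))) (at t)"
    unfolding cp_def[abs_def]
    by (rule derivative_eq_intros deriv_a deriv_b refl)+ (simp add: algebra_simps)
  moreover have "- (2 * a t * (- \<omega> * b t)) - 2 * b t * (\<omega> * d t) = 2 * b t * (\<omega> * (a t - d t))"
    by (simp add: algebra_simps)
  ultimately show ?thesis unfolding diff_ad by (simp add: power2_eq_square mult_ac)
qed

lemma deriv_cr: "(cr has_real_derivative (4 * \<nu> * (d t)\<^sup>2)) (at t)"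
  unfolding cr_def[abs_def]
  by (rule derivative_eq_intros deriv_b deriv_d refl)+ (simp add: algebra_simps power2_eq_square)

lemma deriv_cq: "(cq has_real_derivative (4 * \<nu> * b t * d t)) (at t)"
proof -
  have "(cq has_real_derivative ((\<omega> * d t) * (a t - d t) + b t * (- \<omega> * b t - (- \<omega> * b t - 2 * \<nu> * d t)))) (at t)"
    unfolding cq_def[abs_def]
    by (rule derivative_eq_intros deriv_a deriv_b deriv_d refl)+ (simp add: algebra_simps)
  moreover have "(\<omega> * d t) * (a t - d t) + b t * (- \<omega> * b t - (- \<omega> * b t - 2 * \<nu> * d t))
     = d t * (\<omega> * (a t - d t)) + 2 * \<nu> * b t * d t" by (simp add: algebra_simps)
  moreover have "d t * (2 * \<nu> * b t) + 2 * \<nu> * b t * d t = 4 * \<nu> * b t * d t" by simp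
  ultimately show ?thesis unfolding diff_ad by metis
qed

lemma deriv_cD: "(cD has_real_derivative (4 * \<nu> * cN t)) (at t)"
  unfolding cD_def[abs_def] cN_def
  by (rule derivative_eq_intros deriv_cp deriv_cq deriv_cr refl)+ (simp add: algebra_simps power2_eq_square)

lemma deriv_quad:
  "((\<lambda>t. y1\<^sup>2 * cp t + 2 * y1 * y2 * cq t + y2\<^sup>2 * cr t) has_real_derivative
     (4 * \<nu> * (y1 * b t + y2 * d t)\<^sup>2)) (at t)"
  by (rule derivative_eq_intros deriv_cp deriv_cq deriv_cr refl)+ (simp add: algebra_simps power2_eq_square)

text \<open>Kalman's rank condition by hand. The form starts at 0 and is nondecreasing, so if it is
  not positive at t, its rate, and with it y1 b + y2 d, vanishes on (0, t). The value and the
  derivative of that function at 0 are y2 and (once y2 = 0) \<omega> y1.\<close>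

lemma quad_pos:
  assumes t: "t > 0" and y: "y1 \<noteq> 0 \<or> y2 \<noteq> 0"
  shows "y1\<^sup>2 * cp t + 2 * y1 * y2 * cq t + y2\<^sup>2 * cr t > 0"
proof (rule ccontr)
  let ?f = "\<lambda>t. y1\<^sup>2 * cp t + 2 * y1 * y2 * cq t + y2\<^sup>2 * cr t"
  let ?\<beta> = "\<lambda>t. y1 * b t + y2 * d t"
  assume "\<not> ?f t > 0"
  then have le: "?f t \<le> 0" by simp
  have mono: "?f u \<le> ?f v" if "u \<le> v" for u v
  proof (rule DERIV_nonneg_imp_nondecreasing[OF that])
    fix x show "\<exists>y. (?f has_real_derivative y) (at x) \<and> 0 \<le> y"
      using deriv_quad[of y1 y2 x] pos by (intro exI[of _ "4 * \<nu> * (?\<beta> x)\<^sup>2"]) auto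
  qed
  have f0: "?f 0 = 0" by (simp add: cp_def cq_def cr_def init)
  have fz: "?f u = 0" if "0 \<le> u" "u \<le> t" for u
    using mono[OF that(1)] mono[OF that(2)] le f0 by linarith
  have bz: "?\<beta> u = 0" if u: "0 < u" "u < t" for u
  proof -
    have "(?f has_real_derivative 0) (at u)"
      by (rule has_field_derivative_transform_within_open[of "\<lambda>_. 0" _ _ "{0<..<t}"]) (use u fz in auto)
    then have "4 * \<nu> * (?\<beta> u)\<^sup>2 = 0" using deriv_quad[of y1 y2 u] DERIV_unique by blast
    then show ?thesis using pos by simp
  qed
  have d\<beta>: "(?\<beta> has_real_derivative (y1 * (\<omega> * d u) + y2 * (- \<omega> * b u - 2 * \<nu> * d u))) (at u)" for u
    by (rule derivative_eq_intros deriv_b deriv_d refl)+ simp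
  \<comment> \<open>The identities hold on the open interval only, so their values at time 0 are
    reached as right limits.\<close>
  have ev: "eventually (\<lambda>x. ?\<beta> x = 0) (at_right 0)"
    using eventually_at_right_real[OF t] by eventually_elim (use bz in auto)
  have "(?\<beta> \<longlongrightarrow> ?\<beta> 0) (at_right 0)"
    using DERIV_isCont[OF d\<beta>[of 0]] by (simp add: isCont_def filterlim_at_split)
  moreover have "(?\<beta> \<longlongrightarrow> 0) (at_right 0)" by (rule tendsto_eventually[OF ev])
  ultimately have "?\<beta> 0 = 0" by (rule tendsto_unique[OF trivial_limit_at_right_real])
  then have y2: "y2 = 0" by (simp add: init)
  have dbz: "y1 * (\<omega> * d u) = 0" if u: "0 < u" "u < t" for u
  proof -
    have "(?\<beta> has_real_derivative 0) (at u)"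
      by (rule has_field_derivative_transform_within_open[of "\<lambda>_. 0" _ _ "{0<..<t}"]) (use u bz in auto)
    then show ?thesis using d\<beta>[of u] DERIV_unique y2 by fastforce
  qed
  have ev2: "eventually (\<lambda>x. y1 * (\<omega> * d x) = 0) (at_right 0)"
    using eventually_at_right_real[OF t] by eventually_elim (use dbz in auto)
  have "((\<lambda>x. y1 * (\<omega> * d x)) \<longlongrightarrow> 0) (at_right 0)" by (rule tendsto_eventually[OF ev2])
  moreover have "((\<lambda>x. y1 * (\<omega> * d x)) \<longlongrightarrow> y1 * (\<omega> * d 0)) (at_right 0)"
    using DERIV_isCont[OF deriv_d[of 0]] by (intro tendsto_intros) (simp add: isCont_def filterlim_at_split)
  ultimately have "y1 * (\<omega> * d 0) = 0" by (rule tendsto_unique[OF trivial_limit_at_right_real, rotated])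
  then show False using y y2 pos by (simp add: init)
qed

lemma cp_pos: "t > 0 \<Longrightarrow> cp t > 0" using quad_pos[of t 1 0] by simp
lemma cr_pos: "t > 0 \<Longrightarrow> cr t > 0" using quad_pos[of t 0 1] by simp

lemma cD_pos: assumes "t > 0" shows "cD t > 0"
proof -
  \<comment> \<open>The covariance matrix sends (-cq, cp) to (0, cD), so the form at this vector is
    cp times the determinant.\<close>
  have "(- cq t)\<^sup>2 * cp t + 2 * (- cq t) * cp t * cq t + (cp t)\<^sup>2 * cr t > 0"
    by (rule quad_pos) (use assms cp_pos[of t] in auto)
  then have "cp t * cD t > 0" by (simp add: cD_def algebra_simps power2_eq_square)
  then show ?thesis using cp_pos[OF assms] by (simp add: zero_less_mult_iff)
qed

lemma cN_nonneg: assumes "t > 0" shows "cN t \<ge> 0"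
proof -
  have "cp t * cN t = (cp t * d t - cq t * b t)\<^sup>2 + cD t * (b t)\<^sup>2"
    by (simp add: cN_def cD_def algebra_simps power2_eq_square)
  also have "\<dots> \<ge> 0" using cD_pos[OF assms] by simp
  finally show ?thesis using cp_pos[OF assms] by (simp add: zero_le_mult_iff)
qed

text \<open>The quantitative version of \<open>quad_pos\<close>. The function \<beta> = y1 b + y2 d
  solves the damped oscillator equation, so \<beta>(t) equals the integral of \<zeta> \<beta> over
  [0, t] for a weight \<zeta> of size 1/t. By Cauchy-Schwarz \<beta>(t)^2 is at most C/t times the
  integral of \<beta>^2, which \<open>deriv_quad\<close> identifies with the form.\<close>

lemma control_bound:
  assumes "T0 > 0"
  obtains C where "C > 0"
    "\<And>t y1 y2. 0 < t \<Longrightarrow> t \<le> T0 \<Longrightarrow>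
       (y1 * b t + y2 * d t)\<^sup>2 \<le> C / t * (y1\<^sup>2 * cp t + 2 * y1 * y2 * cq t + y2\<^sup>2 * cr t)"
proof -
  \<comment> \<open>Since |\<eta>| \<le> t, |\<eta>'| \<le> 3 and |\<eta>''| \<le> 10 / t, this
    constant bounds t |\<zeta>| on [0, t] for all t \<le> T0.\<close>
  define C0 where "C0 = 10 + 6 * \<nu> * T0 + \<omega>\<^sup>2 * T0\<^sup>2"
  have C0: "C0 > 0" using pos assms by (simp add: C0_def add_pos_nonneg)
  show thesis
  proof (rule that[of "C0\<^sup>2 / (4 * \<nu>)"])
    show "C0\<^sup>2 / (4 * \<nu>) > 0" using C0 pos by simp
    fix t y1 y2 :: real assume t: "0 < t" "t \<le> T0"
    let ?f = "\<lambda>t. y1\<^sup>2 * cp t + 2 * y1 * y2 * cq t + y2\<^sup>2 * cr t"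
    let ?\<beta> = "\<lambda>s. y1 * b s + y2 * d s"
    let ?\<beta>' = "\<lambda>s. y1 * (\<omega> * d s) + y2 * (- \<omega> * b s - 2 * \<nu> * d s)"
    \<comment> \<open>The cubic has \<eta>(0) = \<eta>'(0) = \<eta>(t) = 0 and \<eta>'(t) = -1, so
      the boundary expression \<open>\<Theta>\<close> vanishes at 0 and equals \<beta>(t) at t. Its
      derivative contains \<beta> only, because the oscillator equation eliminates
      \<beta>''.\<close>
    define \<eta> where "\<eta> = (\<lambda>s. s\<^sup>2 * (t - s) / t\<^sup>2)"
    define \<eta>' where "\<eta>' = (\<lambda>s. (2 * s * t - 3 * s\<^sup>2) / t\<^sup>2)"
    define \<eta>'' where "\<eta>'' = (\<lambda>s. (2 * t - 6 * s) / t\<^sup>2)"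
    define \<zeta> where "\<zeta> = (\<lambda>s. - \<omega>\<^sup>2 * \<eta> s - \<eta>'' s + 2 * \<nu> * \<eta>' s)"
    have d\<eta>: "(\<eta> has_real_derivative \<eta>' s) (at s)" for s
      unfolding \<eta>_def \<eta>'_def using t by (auto intro!: derivative_eq_intros simp: field_simps power2_eq_square)
    have d\<eta>': "(\<eta>' has_real_derivative \<eta>'' s) (at s)" for s
      unfolding \<eta>'_def \<eta>''_def using t by (auto intro!: derivative_eq_intros simp: field_simps power2_eq_square)
    define \<Theta> where "\<Theta> = (\<lambda>s. \<eta> s * ?\<beta>' s - \<eta>' s * ?\<beta> s + 2 * \<nu> * \<eta> s * ?\<beta> s)"
    have d\<Theta>: "(\<Theta> has_real_derivative (\<zeta> s * ?\<beta> s)) (at s)" for s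
      unfolding \<Theta>_def \<zeta>_def
      by (rule derivative_eq_intros deriv_b deriv_d d\<eta> d\<eta>' refl)+ (simp add: algebra_simps power2_eq_square)
    have \<zeta>: "\<bar>\<zeta> s\<bar> \<le> C0 / t" if s: "0 \<le> s" "s \<le> t" for s
    proof -
      have s2: "s\<^sup>2 \<le> t\<^sup>2" using s by (simp add: power_mono)
      have st: "s * t \<le> t\<^sup>2" using s t by (simp add: power2_eq_square)
      have t2: "t\<^sup>2 > 0" using t by simp
      have e1: "\<bar>\<eta> s\<bar> \<le> t"
      proof -
        have "s\<^sup>2 * (t - s) \<le> t\<^sup>2 * t" using s s2 by (intro mult_mono) auto
        then have "\<eta> s \<le> t" using t2 by (simp add: \<eta>_def divide_le_eq mult.commute)
        moreover have "\<eta> s \<ge> 0" using s t by (simp add: \<eta>_def)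
        ultimately show ?thesis by simp
      qed
      have e2: "\<bar>\<eta>' s\<bar> \<le> 3"
      proof -
        have "0 \<le> s * t" "0 \<le> s\<^sup>2" using s t by auto
        then have "2 * (s * t) - 3 * s\<^sup>2 \<le> 3 * t\<^sup>2" "- (3 * t\<^sup>2) \<le> 2 * (s * t) - 3 * s\<^sup>2"
          using s2 st by linarith+
        then have "\<bar>2 * s * t - 3 * s\<^sup>2\<bar> \<le> 3 * t\<^sup>2" by (simp add: abs_le_iff)
        then show ?thesis using t2 by (simp add: \<eta>'_def abs_divide divide_le_eq)
      qed
      have e3: "\<bar>\<eta>'' s\<bar> \<le> 10 / t"
      proof -
        have "\<bar>2 * t - 6 * s\<bar> \<le> 10 * t" using s by (auto simp: abs_le_iff)
        then have "\<bar>\<eta>'' s\<bar> \<le> 10 * t / t\<^sup>2" using t2 by (simp add: \<eta>''_def abs_divide divide_right_mono)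
        then show ?thesis using t by (simp add: power2_eq_square)
      qed
      have "\<bar>\<zeta> s\<bar> \<le> \<omega>\<^sup>2 * \<bar>\<eta> s\<bar> + \<bar>\<eta>'' s\<bar> + 2 * \<nu> * \<bar>\<eta>' s\<bar>"
      proof -
        have "\<bar>\<zeta> s\<bar> \<le> \<bar>- \<omega>\<^sup>2 * \<eta> s\<bar> + \<bar>\<eta>'' s\<bar> + \<bar>2 * \<nu> * \<eta>' s\<bar>" unfolding \<zeta>_def by linarith
        then show ?thesis using pos by (simp add: abs_mult)
      qed
      also have "\<dots> \<le> \<omega>\<^sup>2 * t + 10 / t + 2 * \<nu> * 3"
        using e1 e2 e3 pos by (intro add_mono mult_left_mono) auto
      also have "\<dots> = (\<omega>\<^sup>2 * t\<^sup>2 + 10 + 6 * \<nu> * t) / t" using t by (simp add: field_simps power2_eq_square)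
      also have "\<dots> \<le> C0 / t"
      proof -
        have "\<omega>\<^sup>2 * t\<^sup>2 \<le> \<omega>\<^sup>2 * T0\<^sup>2" "6 * \<nu> * t \<le> 6 * \<nu> * T0"
          using t pos by (auto intro!: mult_left_mono power_mono)
        then show ?thesis unfolding C0_def using t by (intro divide_right_mono) auto
      qed
      finally show ?thesis .
    qed
    let ?B = "?\<beta> t"
    have \<Theta>t: "\<Theta> t = ?B" using t by (simp add: \<Theta>_def \<eta>_def \<eta>'_def field_simps power2_eq_square)
    have \<Theta>0: "\<Theta> 0 = 0" by (simp add: \<Theta>_def \<eta>_def \<eta>'_def)
    \<comment> \<open>Cauchy-Schwarz in differential form: Young's inequality with parameter L is
      applied to the integrand \<zeta> \<beta>, and integration is replaced by monotonicity of the
      difference of primitives. The sign \<sigma> handles both signs of \<beta>(t).\<close>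
    have key: "\<sigma> * ?B \<le> L * ?f t / (8 * \<nu>) + C0\<^sup>2 / (2 * L * t)"
      if L: "L > 0" and sg: "\<sigma> * \<sigma> = 1" for L \<sigma>
    proof -
      let ?g = "\<lambda>s. L / (8 * \<nu>) * ?f s + C0\<^sup>2 / (2 * L * t\<^sup>2) * s - \<sigma> * \<Theta> s"
      have "?g 0 \<le> ?g t"
      proof (rule DERIV_nonneg_imp_nondecreasing[where f = ?g])
        show "0 \<le> t" using t by simp
        fix s assume s: "0 \<le> s" "s \<le> t"
        let ?D = "L / (8 * \<nu>) * (4 * \<nu> * (?\<beta> s)\<^sup>2) + C0\<^sup>2 / (2 * L * t\<^sup>2) - \<sigma> * (\<zeta> s * ?\<beta> s)"
        have 1: "(?g has_real_derivative ?D) (at s)"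
          by (rule DERIV_diff[OF DERIV_add[OF DERIV_cmult[OF deriv_quad] DERIV_cmult_Id] DERIV_cmult[OF d\<Theta>]])
        have "(\<zeta> s)\<^sup>2 \<le> (C0 / t)\<^sup>2" using \<zeta>[OF s] by (rule power2_le_iff_abs_le[THEN iffD2, rotated]) (use C0 t in simp)
        then have "(\<zeta> s)\<^sup>2 / (2 * L) \<le> (C0 / t)\<^sup>2 / (2 * L)" using L by (intro divide_right_mono) auto
        also have "\<dots> = C0\<^sup>2 / (2 * L * t\<^sup>2)" by (simp add: power_divide)
        finally have z2: "(\<zeta> s)\<^sup>2 / (2 * L) \<le> C0\<^sup>2 / (2 * L * t\<^sup>2)" .
        have "0 \<le> (L * ?\<beta> s - \<sigma> * \<zeta> s)\<^sup>2 / (2 * L)" using L by simp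
        also have "\<dots> = L / 2 * (?\<beta> s)\<^sup>2 - \<sigma> * (\<zeta> s * ?\<beta> s) + (\<sigma> * \<sigma>) * (\<zeta> s)\<^sup>2 / (2 * L)"
        proof -
          have "(L * B - \<sigma> * z)\<^sup>2 / (2 * L) = L / 2 * B\<^sup>2 - \<sigma> * (z * B) + (\<sigma> * \<sigma>) * z\<^sup>2 / (2 * L)" for B z :: real
            using L by (simp add: field_simps power2_eq_square)
          then show ?thesis .
        qed
        finally have "0 \<le> L / 2 * (?\<beta> s)\<^sup>2 - \<sigma> * (\<zeta> s * ?\<beta> s) + C0\<^sup>2 / (2 * L * t\<^sup>2)" using z2 sg by simp
        moreover have "L / (8 * \<nu>) * (4 * \<nu> * (?\<beta> s)\<^sup>2) = L / 2 * (?\<beta> s)\<^sup>2" using pos by simp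
        ultimately have "0 \<le> ?D" by linarith
        then show "\<exists>y. (?g has_real_derivative y) (at s) \<and> 0 \<le> y" using 1 by blast
      qed
      moreover have "?f 0 = 0" by (simp add: cp_def cq_def cr_def init)
      moreover have "C0\<^sup>2 / (2 * L * t\<^sup>2) * t = C0\<^sup>2 / (2 * L * t)" using t L by (simp add: power2_eq_square)
      ultimately show ?thesis using \<Theta>t \<Theta>0 by simp
    qed
    show "?B\<^sup>2 \<le> C0\<^sup>2 / (4 * \<nu>) / t * ?f t"
    proof (cases "?B = 0")
      case True
      have "?f t \<ge> 0" using quad_pos[OF t(1), of y1 y2] by (cases "y1 = 0 \<and> y2 = 0") auto
      then show ?thesis using True t pos by simp
    next
      case False
      then have "y1 \<noteq> 0 \<or> y2 \<noteq> 0" by auto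
      then have fp: "?f t > 0" by (rule quad_pos[OF t(1)])
      define F where "F = ?f t"
      define B where "B = \<bar>?B\<bar>"
      have B: "B > 0" using False by (simp add: B_def)
      have F: "F > 0" using fp by (simp add: F_def)
      have keyB: "B \<le> L * F / (8 * \<nu>) + C0\<^sup>2 / (2 * L * t)" if "L > 0" for L
        using key[OF that, of 1] key[OF that, of "-1"] unfolding B_def F_def by (simp add: abs_le_iff)
      \<comment> \<open>This L makes the first term of \<open>keyB\<close> equal to B / 2, which is
        absorbed on the left.\<close>
      let ?L = "4 * \<nu> * B / F"
      have L: "?L > 0" using B F pos by simp
      have l1: "?L * F / (8 * \<nu>) = B / 2" using F pos by simp
      have l2: "C0\<^sup>2 / (2 * ?L * t) = C0\<^sup>2 * F / (4 * \<nu> * t) / B / 2" using F by simp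
      define G where "G = C0\<^sup>2 * F / (4 * \<nu> * t)"
      have "B \<le> B / 2 + G / B / 2" using keyB[OF L] unfolding l1 l2 G_def .
      then have "B \<le> G / B" by argo
      then have "B * B \<le> G" using B by (simp only: pos_le_divide_eq)
      moreover have "B * B = ?B\<^sup>2" by (simp add: B_def power2_eq_square)
      ultimately show ?thesis by (simp add: F_def G_def mult_ac)
    qed
  qed
qed

lemma cN_bound:
  assumes "T0 > 0"
  obtains C where "C > 0" "\<And>t. 0 < t \<Longrightarrow> t \<le> T0 \<Longrightarrow> cN t / cD t \<le> C / t"
proof -
  obtain C where C: "C > 0" "\<And>t y1 y2. 0 < t \<Longrightarrow> t \<le> T0 \<Longrightarrow>
       (y1 * b t + y2 * d t)\<^sup>2 \<le> C / t * (y1\<^sup>2 * cp t + 2 * y1 * y2 * cq t + y2\<^sup>2 * cr t)"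
    using control_bound[OF assms] by metis
  show thesis
  proof (rule that[OF C(1)])
    fix t :: real assume t: "0 < t" "t \<le> T0"
    \<comment> \<open>The vector is the adjugate of the covariance applied to (b, d); it turns the
      control bound into cN^2 \<le> (C / t) cD cN.\<close>
    let ?y1 = "cr t * b t - cq t * d t" and ?y2 = "cp t * d t - cq t * b t"
    have e1: "?y1 * b t + ?y2 * d t = cN t" by (simp add: cN_def algebra_simps power2_eq_square)
    have e2: "?y1\<^sup>2 * cp t + 2 * ?y1 * ?y2 * cq t + ?y2\<^sup>2 * cr t = cD t * cN t"
      unfolding cN_def cD_def by algebra
    have "cN t * cN t \<le> (C / t * cD t) * cN t" using C(2)[OF t, of ?y1 ?y2] unfolding e1 e2
      by (simp add: power2_eq_square mult_ac)
    then have "cN t \<le> C / t * cD t \<or> cN t = 0" using cN_nonneg[OF t(1)] by (simp only: mult_le_cancel_right) linarith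
    then have "cN t \<le> C / t * cD t" using cD_pos[OF t(1)] C(1) t by auto
    then show "cN t / cD t \<le> C / t" using cD_pos[OF t(1)] by (simp add: divide_le_eq)
  qed
qed

end

section \<open>The Mehler kernel\<close>

definition gauss :: "real \<times> real \<Rightarrow> real" where
  "gauss z = exp (- ((fst z)\<^sup>2 + (snd z)\<^sup>2) / 2) / (2 * pi)"

lemma gauss_pos: "gauss z > 0" by (simp add: gauss_def)

lemma continuous_on_gauss [continuous_intros]: "continuous_on S gauss"
  unfolding gauss_def by (intro continuous_intros) auto

lemma gauss_measurable [measurable]: "gauss \<in> borel_measurable borel"
  by (intro borel_measurable_continuous_onI continuous_intros)

lemma gauss_prod: "gauss (x, y) = std_normal_density x * std_normal_density y"
  unfolding gauss_def std_normal_density_def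
  by (simp add: exp_add[symmetric] field_simps)

lemma nn_integral_lborel2:
  assumes [measurable]: "f \<in> borel_measurable borel"
  shows "(\<integral>\<^sup>+z. f z \<partial>(lborel :: (real \<times> real) measure)) = (\<integral>\<^sup>+x. \<integral>\<^sup>+y. f (x, y) \<partial>lborel \<partial>lborel)"
proof -
  have "(\<integral>\<^sup>+z. f z \<partial>(lborel :: (real \<times> real) measure)) = (\<integral>\<^sup>+z. f z \<partial>(lborel \<Otimes>\<^sub>M lborel))"
    by (simp add: lborel_prod)
  also have "\<dots> = (\<integral>\<^sup>+x. \<integral>\<^sup>+y. f (x, y) \<partial>lborel \<partial>lborel)"
    by (rule lborel.nn_integral_fst[symmetric]) (simp add: lborel_prod)
  finally show ?thesis .
qed

lemma nn_integral_std_normal: "(\<integral>\<^sup>+x. ennreal (std_normal_density x) \<partial>lborel) = 1"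
  using prob_space.emeasure_space_1[OF prob_space_normal_density[of 1 0]]
  by (simp add: emeasure_density)

definition gauss2 :: "(real \<times> real) measure" where "gauss2 = density lborel (\<lambda>z. ennreal (gauss z))"

lemma prob_space_gauss2: "prob_space gauss2"
proof
  have "emeasure gauss2 (space gauss2) = (\<integral>\<^sup>+x. \<integral>\<^sup>+y. ennreal (gauss (x, y)) \<partial>lborel \<partial>lborel)"
    unfolding gauss2_def by (subst emeasure_density) (auto simp: nn_integral_lborel2)
  also have "\<dots> = (\<integral>\<^sup>+x. ennreal (std_normal_density x) * (\<integral>\<^sup>+y. ennreal (std_normal_density y) \<partial>lborel) \<partial>lborel)"
    by (simp add: gauss_prod ennreal_mult nn_integral_cmult)
  also have "\<dots> = 1" by (simp add: nn_integral_std_normal)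
  finally show "emeasure gauss2 (space gauss2) = 1" .
qed

lemma sets_gauss2 [measurable_cong]: "sets gauss2 = sets borel" by (simp add: gauss2_def)

lemma integrable_gauss2:
  assumes [measurable]: "f \<in> borel_measurable borel"
  shows "integrable gauss2 f \<longleftrightarrow> integrable lborel (\<lambda>z. gauss z * f z)"
  unfolding gauss2_def by (subst integrable_density) (auto simp: less_imp_le gauss_pos)

lemma integral_gauss2:
  assumes [measurable]: "f \<in> borel_measurable borel"
  shows "integral\<^sup>L gauss2 f = (\<integral>z. gauss z * f z \<partial>lborel)"
  unfolding gauss2_def by (subst integral_density) (auto simp: less_imp_le gauss_pos)

text \<open>The affine map is the Cholesky factor of the covariance matrix with entries p, q, q, r.\<close>

lemma distr_gauss2_affine:
  fixes p q r D m1 m2 :: real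
  assumes p: "p > 0" and D: "D > 0" "D = p * r - q\<^sup>2"
  shows "density lborel (\<lambda>w. ennreal (exp (- (r * (fst w - m1)\<^sup>2 - 2 * q * (fst w - m1) * (snd w - m2) + p * (snd w - m2)\<^sup>2) / (2 * D))
            / (2 * pi * sqrt D)))
       = distr gauss2 borel (\<lambda>\<xi>. (m1 + sqrt p * fst \<xi>, m2 + q / sqrt p * fst \<xi> + sqrt (D / p) * snd \<xi>))"
    (is "density lborel ?k = distr gauss2 borel ?L")
proof -
  define k where "k = ?k"
  have "(\<lambda>w. exp (- (r * (fst w - m1)\<^sup>2 - 2 * q * (fst w - m1) * (snd w - m2) + p * (snd w - m2)\<^sup>2) / (2 * D))
            / (2 * pi * sqrt D)) \<in> borel_measurable borel"
    using D by (intro borel_measurable_continuous_onI continuous_intros) auto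
  then have km [measurable]: "k \<in> borel_measurable borel" unfolding k_def by (rule measurable_compose) simp
  have e: "ennreal \<bar>A\<bar> * (ennreal \<bar>B\<bar> * ennreal C) = ennreal (A * (B * C))" if "A \<ge> 0" "B \<ge> 0" "C \<ge> 0" for A B C :: real
    using that by (simp add: ennreal_mult)
  have c3: "m2 + A + B - m2 = A + B" for A B by simp
  have "density lborel k = distr gauss2 borel ?L"
  proof (rule measure_eqI)
    fix A assume "A \<in> sets (density lborel k)"
    then have [measurable]: "A \<in> sets borel" by simp
    have L [measurable]: "?L \<in> borel_measurable borel"
      by (intro borel_measurable_continuous_onI continuous_intros)
    \<comment> \<open>The Jacobian sqrt p sqrt (D / p) = sqrt D cancels the normalising factor, and
      the substitution turns the quadratic form into D (x^2 + y^2).\<close>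
    have key: "sqrt p * (sqrt (D / p) * (exp (- (r * (sqrt p * x)\<^sup>2 - 2 * q * (sqrt p * x) * (q / sqrt p * x + sqrt (D / p) * y)
        + p * (q / sqrt p * x + sqrt (D / p) * y)\<^sup>2) / (2 * D)) / (2 * pi * sqrt D))) = gauss (x, y)" for x y
    proof -
      define P where "P = sqrt p" define E where "E = sqrt D"
      have PE: "P > 0" "E > 0" "p = P * P" "D = E * E" using p D by (auto simp: P_def E_def)
      have s: "sqrt (D / p) = E / P" by (simp add: E_def P_def real_sqrt_divide)
      have sD: "sqrt D = E" "sqrt p = P" by (simp_all add: E_def P_def)
      have r: "r = (E * E + q * q) / (P * P)" using D(2) PE by (simp add: field_simps power2_eq_square)
      have ex: "r * (P * x)\<^sup>2 - 2 * q * (P * x) * (q / P * x + E / P * y) + p * (q / P * x + E / P * y)\<^sup>2 = (E * E) * (x\<^sup>2 + y\<^sup>2)"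
        unfolding r PE(3) using PE(1) by (simp add: field_simps power2_eq_square)
      have fin: "P * (E / P * (exp (- ((E * E) * (x\<^sup>2 + y\<^sup>2)) / (2 * (E * E))) / (2 * pi * E))) = gauss (x, y)"
        unfolding gauss_def using PE(1,2) by (simp add: field_simps)
      show ?thesis unfolding s sD ex using fin PE(4) by simp
    qed
    have "emeasure (density lborel k) A = (\<integral>\<^sup>+x. \<integral>\<^sup>+y. k (x, y) * indicator A (x, y) \<partial>lborel \<partial>lborel)"
      by (subst emeasure_density) (simp_all add: nn_integral_lborel2 del: fst_conv snd_conv)
    also have "\<dots> = ennreal \<bar>sqrt p\<bar> * (\<integral>\<^sup>+x. \<integral>\<^sup>+y. k (m1 + sqrt p * x, y) * indicator A (m1 + sqrt p * x, y) \<partial>lborel \<partial>lborel)"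
      by (rule nn_integral_real_affine) (use p in auto)
    also have "\<dots> = ennreal \<bar>sqrt p\<bar> * (\<integral>\<^sup>+x. ennreal \<bar>sqrt (D / p)\<bar> * (\<integral>\<^sup>+y. k (m1 + sqrt p * x, (m2 + q / sqrt p * x) + sqrt (D / p) * y)
         * indicator A (m1 + sqrt p * x, (m2 + q / sqrt p * x) + sqrt (D / p) * y) \<partial>lborel) \<partial>lborel)"
      by (intro arg_cong[where f = "\<lambda>u. ennreal \<bar>sqrt p\<bar> * u"] nn_integral_cong nn_integral_real_affine) (use p D(1) in auto)
    also have "\<dots> = (\<integral>\<^sup>+x. \<integral>\<^sup>+y. ennreal \<bar>sqrt p\<bar> * (ennreal \<bar>sqrt (D / p)\<bar> * (k (m1 + sqrt p * x, (m2 + q / sqrt p * x) + sqrt (D / p) * y)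
         * indicator A (m1 + sqrt p * x, (m2 + q / sqrt p * x) + sqrt (D / p) * y))) \<partial>lborel \<partial>lborel)"
      by (simp add: nn_integral_cmult)
    also have "\<dots> = (\<integral>\<^sup>+x. \<integral>\<^sup>+y. ennreal (gauss (x, y)) * indicator (?L -` A) (x, y) \<partial>lborel \<partial>lborel)"
    proof (intro nn_integral_cong)
      fix x y :: real
      have "ennreal \<bar>sqrt p\<bar> * (ennreal \<bar>sqrt (D / p)\<bar> * k (m1 + sqrt p * x, (m2 + q / sqrt p * x) + sqrt (D / p) * y))
          = ennreal (gauss (x, y))"
        unfolding key[symmetric] k_def fst_conv snd_conv add_diff_cancel_left' c3
        by (rule e) (use p D(1) in auto)
      then show "ennreal \<bar>sqrt p\<bar> * (ennreal \<bar>sqrt (D / p)\<bar> * (k (m1 + sqrt p * x, (m2 + q / sqrt p * x) + sqrt (D / p) * y)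
         * indicator A (m1 + sqrt p * x, (m2 + q / sqrt p * x) + sqrt (D / p) * y))) = ennreal (gauss (x, y)) * indicator (?L -` A) (x, y)"
        by (simp add: mult.assoc[symmetric] indicator_def)
    qed
    also have "\<dots> = (\<integral>\<^sup>+z. ennreal (gauss z) * indicator (?L -` A) z \<partial>lborel)"
      using measurable_sets_borel[OF L, of A] by (subst nn_integral_lborel2) auto
    also have "\<dots> = emeasure gauss2 (?L -` A \<inter> space gauss2)"
      unfolding gauss2_def using measurable_sets_borel[OF L, of A]
      by (subst emeasure_density) auto
    also have "\<dots> = emeasure (distr gauss2 borel ?L) A"
      by (rule emeasure_distr[symmetric]) (simp_all only: measurable_cong_sets[OF sets_gauss2 refl] L \<open>A \<in> sets borel\<close>)
    finally show "emeasure (density lborel k) A = emeasure (distr gauss2 borel ?L) A" .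
  qed simp
  then show ?thesis unfolding k_def .
qed

section \<open>The kernel, its derivatives and the backward equation\<close>

context oscillator
begin

text \<open>\<open>r1\<close> and \<open>r2\<close> are the deviations of the end point w from the
  mean of the process started at z. \<open>g1\<close> and \<open>g2\<close> apply the adjugate
  covariance to them, so \<open>Qf / cD\<close> is the squared Mahalanobis distance of w from that
  mean.\<close>

definition r1 :: "real \<Rightarrow> real \<times> real \<Rightarrow> real \<times> real \<Rightarrow> real" where
  "r1 t z w = fst w - (a t * fst z + b t * snd z)"
definition r2 :: "real \<Rightarrow> real \<times> real \<Rightarrow> real \<times> real \<Rightarrow> real" where
  "r2 t z w = snd w - (- b t * fst z + d t * snd z)"
definition g1 :: "real \<Rightarrow> real \<times> real \<Rightarrow> real \<times> real \<Rightarrow> real" where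
  "g1 t z w = cr t * r1 t z w - cq t * r2 t z w"
definition g2 :: "real \<Rightarrow> real \<times> real \<Rightarrow> real \<times> real \<Rightarrow> real" where
  "g2 t z w = cp t * r2 t z w - cq t * r1 t z w"
definition Qf :: "real \<Rightarrow> real \<times> real \<Rightarrow> real \<times> real \<Rightarrow> real" where
  "Qf t z w = cr t * (r1 t z w)\<^sup>2 - 2 * cq t * r1 t z w * r2 t z w + cp t * (r2 t z w)\<^sup>2"
definition K :: "real \<Rightarrow> real \<times> real \<Rightarrow> real \<times> real \<Rightarrow> real" where
  "K t z w = exp (- Qf t z w / (2 * cD t)) / (2 * pi * sqrt (cD t))"
text \<open>\<open>Nv\<close> and \<open>Nx\<close> are the logarithmic derivatives of the kernel in
  the starting velocity and position.\<close>

definition Nv :: "real \<Rightarrow> real \<times> real \<Rightarrow> real \<times> real \<Rightarrow> real" where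
  "Nv t z w = (b t * g1 t z w + d t * g2 t z w) / cD t"
definition Nx :: "real \<Rightarrow> real \<times> real \<Rightarrow> real \<times> real \<Rightarrow> real" where
  "Nx t z w = (a t * g1 t z w - b t * g2 t z w) / cD t"
definition Kv :: "real \<Rightarrow> real \<times> real \<Rightarrow> real \<times> real \<Rightarrow> real" where
  "Kv t z w = K t z w * Nv t z w"
definition Kx :: "real \<Rightarrow> real \<times> real \<Rightarrow> real \<times> real \<Rightarrow> real" where
  "Kx t z w = K t z w * Nx t z w"
definition Kvv :: "real \<Rightarrow> real \<times> real \<Rightarrow> real \<times> real \<Rightarrow> real" where
  "Kvv t z w = K t z w * ((Nv t z w)\<^sup>2 - cN t / cD t)"
text \<open>The backward generator in z applied to the kernel. The backward equation is thus built
  into the definition, and its content moves to \<open>deriv_Kt\<close>, which identifies this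
  expression as the time derivative.\<close>

definition Kt :: "real \<Rightarrow> real \<times> real \<Rightarrow> real \<times> real \<Rightarrow> real" where
  "Kt t z w = \<omega> * snd z * Kx t z w - (\<omega> * fst z + 2 * \<nu> * snd z) * Kv t z w + 2 * \<nu> * Kvv t z w"

lemma deriv_Kx:
  assumes "t > 0"
  shows "((\<lambda>x. K t (x, v) w) has_real_derivative Kx t (x, v) w) (at x)"
proof -
  have "((\<lambda>x. Qf t (x, v) w) has_real_derivative (- 2 * (a t * g1 t (x, v) w - b t * g2 t (x, v) w))) (at x)"
    unfolding Qf_def g1_def g2_def r1_def r2_def
    by (auto intro!: derivative_eq_intros simp: algebra_simps)
  from DERIV_cdivide[OF DERIV_fun_exp[OF DERIV_cdivide[OF DERIV_minus[OF this], of "2 * cD t"]], of "2 * pi * sqrt (cD t)"]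
  show ?thesis unfolding Kx_def K_def Nx_def
    by (rule DERIV_cong) (use cD_pos[OF assms] in \<open>simp add: field_simps\<close>)
qed

lemma deriv_Nv:
  assumes "t > 0"
  shows "((\<lambda>v. Nv t (x, v) w) has_real_derivative (- cN t / cD t)) (at v)"
  unfolding Nv_def g1_def g2_def r1_def r2_def cN_def
  using cD_pos[OF assms] by (auto intro!: derivative_eq_intros simp: divide_simps) (simp add: algebra_simps power2_eq_square)

lemma deriv_Kv:
  assumes "t > 0"
  shows "((\<lambda>v. K t (x, v) w) has_real_derivative Kv t (x, v) w) (at v)"
proof -
  have "((\<lambda>v. Qf t (x, v) w) has_real_derivative (- 2 * (b t * g1 t (x, v) w + d t * g2 t (x, v) w))) (at v)"
    unfolding Qf_def g1_def g2_def r1_def r2_def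
    by (auto intro!: derivative_eq_intros simp: algebra_simps)
  from DERIV_cdivide[OF DERIV_fun_exp[OF DERIV_cdivide[OF DERIV_minus[OF this], of "2 * cD t"]], of "2 * pi * sqrt (cD t)"]
  show ?thesis unfolding Kv_def K_def Nv_def
    by (rule DERIV_cong) (use cD_pos[OF assms] in \<open>simp add: field_simps\<close>)
qed

lemma deriv_Kvv:
  assumes "t > 0"
  shows "((\<lambda>v. Kv t (x, v) w) has_real_derivative Kvv t (x, v) w) (at v)"
  unfolding Kv_def Kvv_def
  by (rule derivative_eq_intros deriv_Kv[OF assms] deriv_Nv[OF assms] refl)+
     (simp add: Kv_def algebra_simps power2_eq_square)

text \<open>Lagrange's identity in the plane with the adjugate covariance as metric: (r,r)(e,e) -
  det (r x e)^2 = (r,e)^2 for e = (b, d), the determinant of the adjugate being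
  \<open>cD\<close>.\<close>

lemma gram_identity:
  "Qf t z w * cN t - cD t * (d t * r1 t z w - b t * r2 t z w)\<^sup>2 = (b t * g1 t z w + d t * g2 t z w)\<^sup>2"
  unfolding Qf_def cN_def cD_def g1_def g2_def by algebra

lemma deriv_Kt:
  assumes "t > 0"
  shows "((\<lambda>t. K t (x, v) w) has_real_derivative Kt t (x, v) w) (at t)"
proof -
  let ?z = "(x, v)"
  let ?\<rho>1 = "\<omega> * b t * x - \<omega> * d t * v"
  let ?\<rho>2 = "\<omega> * d t * x + (\<omega> * b t + 2 * \<nu> * d t) * v"
  have d1: "((\<lambda>t. r1 t ?z w) has_real_derivative ?\<rho>1) (at t)"
    unfolding r1_def by (rule derivative_eq_intros deriv_a deriv_b refl)+ simp
  have d2: "((\<lambda>t. r2 t ?z w) has_real_derivative ?\<rho>2) (at t)"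
    unfolding r2_def by (rule derivative_eq_intros deriv_d deriv_b refl)+ (simp add: algebra_simps)
  \<comment> \<open>The rank-one growth of the covariance enters the adjugate form as the square of
    the cross product of (b, d) with the deviation; the other two terms come from the moving
    mean.\<close>
  let ?Q' = "4 * \<nu> * (d t * r1 t ?z w - b t * r2 t ?z w)\<^sup>2 + 2 * g1 t ?z w * ?\<rho>1 + 2 * g2 t ?z w * ?\<rho>2"
  have dQ: "((\<lambda>t. Qf t ?z w) has_real_derivative ?Q') (at t)"
    unfolding Qf_def g1_def g2_def
    by (rule derivative_eq_intros deriv_cp deriv_cq deriv_cr d1 d2 refl)+ (simp add: algebra_simps power2_eq_square)
  have D: "cD t > 0" by (rule cD_pos[OF assms])
  let ?E' = "- ?Q' / (2 * cD t) + Qf t ?z w * (4 * \<nu> * cN t) / (2 * (cD t)\<^sup>2)"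
  have dE: "((\<lambda>t. - Qf t ?z w / (2 * cD t)) has_real_derivative ?E') (at t)"
    using D by (auto intro!: derivative_eq_intros dQ deriv_cD simp: power2_eq_square) (simp add: field_simps)
  have dS: "((\<lambda>t. 2 * pi * sqrt (cD t)) has_real_derivative (2 * pi * sqrt (cD t) * (4 * \<nu> * cN t / (2 * cD t)))) (at t)"
  proof -
    have "((\<lambda>t. 2 * pi * sqrt (cD t)) has_real_derivative (2 * pi * (inverse (sqrt (cD t)) / 2 * (4 * \<nu> * cN t)))) (at t)"
      by (rule DERIV_cmult, rule DERIV_chain2[OF DERIV_real_sqrt[OF D] deriv_cD])
    moreover have "inverse (sqrt (cD t)) = sqrt (cD t) / cD t" using D by (simp add: field_simps real_sqrt_mult_self)
    ultimately show ?thesis by (simp add: mult_ac)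
  qed
  have s: "2 * pi * sqrt (cD t) \<noteq> 0" using D by simp
  have q: "((\<lambda>t. K t ?z w) has_real_derivative
     ((exp (- Qf t ?z w / (2 * cD t)) * ?E') * (2 * pi * sqrt (cD t)) - exp (- Qf t ?z w / (2 * cD t)) * (2 * pi * sqrt (cD t) * (4 * \<nu> * cN t / (2 * cD t))))
       / ((2 * pi * sqrt (cD t)) * (2 * pi * sqrt (cD t)))) (at t)"
    unfolding K_def by (rule DERIV_divide[OF DERIV_fun_exp[OF dE] dS s])
  have c: "(e * E' * S - e * (S * n)) / (S * S) = e / S * (E' - n)" if "S \<noteq> 0" for e E' S n :: real
    using that by (simp add: field_simps)
  have q2: "((\<lambda>t. K t ?z w) has_real_derivative K t ?z w * (?E' - 4 * \<nu> * cN t / (2 * cD t))) (at t)"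
    using q unfolding c[OF s] K_def .
  \<comment> \<open>The bracket is collected exactly in the form of \<open>gram_identity\<close>, so
    that the diffusion part becomes \<open>Nv\<close>^2 - cN / cD, the factor of
    \<open>Kvv\<close>.\<close>
  have "?E' - 4 * \<nu> * cN t / (2 * cD t)
      = - (g1 t ?z w * ?\<rho>1 + g2 t ?z w * ?\<rho>2) / cD t
        + 2 * \<nu> * ((Qf t ?z w * cN t - cD t * (d t * r1 t ?z w - b t * r2 t ?z w)\<^sup>2) / (cD t)\<^sup>2 - cN t / cD t)"
    using D by (simp add: field_simps power2_eq_square)
  also have "\<dots> = - (g1 t ?z w * ?\<rho>1 + g2 t ?z w * ?\<rho>2) / cD t + 2 * \<nu> * ((Nv t ?z w)\<^sup>2 - cN t / cD t)"
    unfolding gram_identity Nv_def by (simp add: power_divide)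
  also have "- (g1 t ?z w * ?\<rho>1 + g2 t ?z w * ?\<rho>2) / cD t = \<omega> * v * Nx t ?z w - (\<omega> * x + 2 * \<nu> * v) * Nv t ?z w"
  proof -
    have "- (G1 * ?\<rho>1 + G2 * ?\<rho>2) = \<omega> * v * (a t * G1 - b t * G2) - (\<omega> * x + 2 * \<nu> * v) * (b t * G1 + d t * G2)" for G1 G2
    proof -
      have "\<omega> * v * (a t * G1 - b t * G2) = v * G1 * (\<omega> * (a t - d t)) + \<omega> * v * d t * G1 - \<omega> * v * b t * G2"
        by (simp add: algebra_simps)
      then show ?thesis unfolding diff_ad by (simp add: algebra_simps)
    qed
    then show ?thesis unfolding Nx_def Nv_def by (simp add: diff_divide_distrib[symmetric])
  qed
  finally have "?E' - 4 * \<nu> * cN t / (2 * cD t)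
     = \<omega> * v * Nx t ?z w - (\<omega> * x + 2 * \<nu> * v) * Nv t ?z w + 2 * \<nu> * ((Nv t ?z w)\<^sup>2 - cN t / cD t)" .
  then have "K t ?z w * (?E' - 4 * \<nu> * cN t / (2 * cD t)) = Kt t ?z w"
    unfolding Kt_def Kx_def Kv_def Kvv_def by (simp only:) (simp add: algebra_simps)
  then show ?thesis using q2 by simp
qed

lemma cont_abd [continuous_intros]: "continuous_on S a" "continuous_on S b" "continuous_on S d"
  by (auto intro!: continuous_at_imp_continuous_on DERIV_isCont deriv_a deriv_b deriv_d)

lemma cont_abd_compose [continuous_intros]:
  assumes "continuous_on S f"
  shows "continuous_on S (\<lambda>x. a (f x))" "continuous_on S (\<lambda>x. b (f x))" "continuous_on S (\<lambda>x. d (f x))"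
  using assms by (auto intro!: continuous_on_compose2[OF cont_abd(1)[of UNIV]] continuous_on_compose2[OF cont_abd(2)[of UNIV]] continuous_on_compose2[OF cont_abd(3)[of UNIV]])

lemma cont_K:
  assumes S: "\<And>x. x \<in> S \<Longrightarrow> f x > 0" and c: "continuous_on S f" "continuous_on S g" "continuous_on S h"
  shows "continuous_on S (\<lambda>x. K (f x) (g x) (h x))" (is ?K)
    and "continuous_on S (\<lambda>x. Kx (f x) (g x) (h x))"
    and "continuous_on S (\<lambda>x. Kv (f x) (g x) (h x))"
    and "continuous_on S (\<lambda>x. Kvv (f x) (g x) (h x))"
    and "continuous_on S (\<lambda>x. Kt (f x) (g x) (h x))"
proof -
  note [continuous_intros] = c
  have p: "continuous_on S (\<lambda>x. cp (f x))" unfolding cp_def by (intro continuous_intros)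
  have q: "continuous_on S (\<lambda>x. cq (f x))" unfolding cq_def by (intro continuous_intros)
  have r: "continuous_on S (\<lambda>x. cr (f x))" unfolding cr_def by (intro continuous_intros)
  note [continuous_intros] = p q r
  have D: "continuous_on S (\<lambda>x. cD (f x))" unfolding cD_def by (intro continuous_intros)
  have N: "continuous_on S (\<lambda>x. cN (f x))" unfolding cN_def by (intro continuous_intros)
  have r12: "continuous_on S (\<lambda>x. r1 (f x) (g x) (h x))" "continuous_on S (\<lambda>x. r2 (f x) (g x) (h x))"
    unfolding r1_def r2_def by (intro continuous_intros)+
  note [continuous_intros] = D N r12
  have g12: "continuous_on S (\<lambda>x. g1 (f x) (g x) (h x))" "continuous_on S (\<lambda>x. g2 (f x) (g x) (h x))"
       "continuous_on S (\<lambda>x. Qf (f x) (g x) (h x))"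
    unfolding g1_def g2_def Qf_def by (intro continuous_intros)+
  note [continuous_intros] = g12
  have D0: "cD (f x) \<noteq> 0" if "x \<in> S" for x using cD_pos[OF S[OF that]] by simp
  have K: "continuous_on S (\<lambda>x. K (f x) (g x) (h x))" unfolding K_def using D0 by (intro continuous_intros) auto
  have N12: "continuous_on S (\<lambda>x. Nv (f x) (g x) (h x))" "continuous_on S (\<lambda>x. Nx (f x) (g x) (h x))"
    unfolding Nv_def Nx_def using D0 by (intro continuous_intros; simp)+
  note [continuous_intros] = K N12
  show ?K by (rule K)
  show x: "continuous_on S (\<lambda>x. Kx (f x) (g x) (h x))"
    and v: "continuous_on S (\<lambda>x. Kv (f x) (g x) (h x))"
    and vv: "continuous_on S (\<lambda>x. Kvv (f x) (g x) (h x))"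
    unfolding Kx_def Kv_def Kvv_def using D0 by (intro continuous_intros; simp)+
  note [continuous_intros] = x v vv
  show "continuous_on S (\<lambda>x. Kt (f x) (g x) (h x))"
    unfolding Kt_def by (intro continuous_intros)
qed

lemma K_pos: "t > 0 \<Longrightarrow> K t z w > 0" using cD_pos[of t] by (simp add: K_def)

lemma K_measurable [measurable]:
  assumes "t > 0"
  shows "K t z \<in> borel_measurable borel" "Kv t z \<in> borel_measurable borel"
    "(\<lambda>(z, w). K t z w) \<in> borel_measurable borel"
  using assms by (auto intro!: borel_measurable_continuous_onI cont_K continuous_intros simp: case_prod_beta)

section \<open>The kernel as the law of a Gaussian vector\<close>

definition Lmap :: "real \<Rightarrow> real \<times> real \<Rightarrow> real \<times> real \<Rightarrow> real \<times> real" where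
  "Lmap t z \<xi> = (a t * fst z + b t * snd z + sqrt (cp t) * fst \<xi>,
     - b t * fst z + d t * snd z + cq t / sqrt (cp t) * fst \<xi> + sqrt (cD t / cp t) * snd \<xi>)"

lemma Lmap_measurable [measurable]: "Lmap t z \<in> borel_measurable borel"
  unfolding Lmap_def by (intro borel_measurable_continuous_onI continuous_intros)

text \<open>Realises the end point as an affine image of a standard Gaussian vector, so that
  integrals against the kernel live on the fixed probability space \<open>gauss2\<close>.\<close>

lemma distr_K: assumes "t > 0"
  shows "density lborel (\<lambda>w. ennreal (K t z w)) = distr gauss2 borel (Lmap t z)"
  using distr_gauss2_affine[OF cp_pos[OF assms] cD_pos[OF assms], of "cr t" "cq t" "a t * fst z + b t * snd z" "- b t * fst z + d t * snd z"]
  unfolding K_def Qf_def r1_def r2_def Lmap_def cD_def by simp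

lemma integral_K:
  assumes t: "t > 0" and [measurable]: "f \<in> borel_measurable borel"
  shows "(\<integral>w. K t z w * f w \<partial>lborel) = (\<integral>\<xi>. f (Lmap t z \<xi>) \<partial>gauss2)"
    and "integrable lborel (\<lambda>w. K t z w * f w) \<longleftrightarrow> integrable gauss2 (\<lambda>\<xi>. f (Lmap t z \<xi>))"
proof -
  note [measurable] = K_measurable[OF t]
  have "(\<integral>w. K t z w * f w \<partial>lborel) = integral\<^sup>L (density lborel (\<lambda>w. ennreal (K t z w))) f"
    by (subst integral_density) (auto simp: less_imp_le K_pos[OF t])
  also have "\<dots> = (\<integral>\<xi>. f (Lmap t z \<xi>) \<partial>gauss2)"
    unfolding distr_K[OF t] by (subst integral_distr) auto
  finally show "(\<integral>w. K t z w * f w \<partial>lborel) = (\<integral>\<xi>. f (Lmap t z \<xi>) \<partial>gauss2)" .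
  have "integrable lborel (\<lambda>w. K t z w * f w) \<longleftrightarrow> integrable (density lborel (\<lambda>w. ennreal (K t z w))) f"
    by (subst integrable_density) (auto simp: less_imp_le K_pos[OF t])
  also have "\<dots> \<longleftrightarrow> integrable gauss2 (\<lambda>\<xi>. f (Lmap t z \<xi>))"
    unfolding distr_K[OF t] by (subst integrable_distr_eq) auto
  finally show "integrable lborel (\<lambda>w. K t z w * f w) \<longleftrightarrow> integrable gauss2 (\<lambda>\<xi>. f (Lmap t z \<xi>))" .
qed

end

section \<open>The backward semigroup\<close>

lemma integrable_mult_of_squares:
  fixes f g :: "'a \<Rightarrow> real"
  assumes [measurable]: "f \<in> borel_measurable M" "g \<in> borel_measurable M"
    and i: "integrable M (\<lambda>x. (f x)\<^sup>2)" "integrable M (\<lambda>x. (g x)\<^sup>2)"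
  shows "integrable M (\<lambda>x. f x * g x)"
proof (rule Bochner_Integration.integrable_bound[OF Bochner_Integration.integrable_add[OF i]])
  have "\<bar>x * y\<bar> \<le> x\<^sup>2 + y\<^sup>2" for x y :: real
  proof -
    have "2 * \<bar>x\<bar> * \<bar>y\<bar> \<le> \<bar>x\<bar>\<^sup>2 + \<bar>y\<bar>\<^sup>2" by (rule sum_squares_bound)
    then show ?thesis using mult_nonneg_nonneg[of "\<bar>x\<bar>" "\<bar>y\<bar>"] unfolding abs_mult power2_abs by linarith
  qed
  then show "AE x in M. norm (f x * g x) \<le> norm ((f x)\<^sup>2 + (g x)\<^sup>2)" by (intro AE_I2) simp
qed measurable

lemma integral_Cauchy_Schwarz:
  fixes f g :: "'a \<Rightarrow> real"
  assumes [measurable]: "f \<in> borel_measurable M" "g \<in> borel_measurable M"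
    and i: "integrable M (\<lambda>x. (f x)\<^sup>2)" "integrable M (\<lambda>x. (g x)\<^sup>2)"
  shows "(\<integral>x. f x * g x \<partial>M)\<^sup>2 \<le> (\<integral>x. (f x)\<^sup>2 \<partial>M) * (\<integral>x. (g x)\<^sup>2 \<partial>M)"
proof -
  let ?A = "\<integral>x. (f x)\<^sup>2 \<partial>M" and ?B = "\<integral>x. f x * g x \<partial>M" and ?C = "\<integral>x. (g x)\<^sup>2 \<partial>M"
  have fg: "integrable M (\<lambda>x. f x * g x)" by (rule integrable_mult_of_squares) (use i in auto)
  have q: "0 \<le> ?A - 2 * l * ?B + l\<^sup>2 * ?C" for l
  proof -
    have "0 \<le> (\<integral>x. (f x - l * g x)\<^sup>2 \<partial>M)" by simp
    also have "\<dots> = (\<integral>x. (f x)\<^sup>2 - 2 * l * (f x * g x) + l\<^sup>2 * (g x)\<^sup>2 \<partial>M)"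
      by (intro Bochner_Integration.integral_cong) (auto simp: power2_eq_square algebra_simps)
    also have "\<dots> = ?A - 2 * l * ?B + l\<^sup>2 * ?C" using i fg by simp
    finally show ?thesis .
  qed
  have C0: "?C \<ge> 0" by simp
  show ?thesis
  proof (cases "?C = 0")
    case True
    have "?B = 0"
    proof (rule ccontr)
      assume "?B \<noteq> 0"
      then show False using q[of "(?A + 1) / (2 * ?B)"] True by simp
    qed
    then show ?thesis using True by simp
  next
    case False
    then have C: "?C > 0" using C0 by linarith
    have "0 \<le> ?A - ?B\<^sup>2 / ?C" using q[of "?B / ?C"] C by (simp add: power2_eq_square)
    then show ?thesis using C by (simp add: field_simps)
  qed
qed

lemma nn_integral_std_normal_square: "(\<integral>\<^sup>+x. ennreal (std_normal_density x * x\<^sup>2) \<partial>lborel) = 1"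
proof -
  have "integrable lborel (\<lambda>x. std_normal_density x * x\<^sup>2)" "(\<integral>x. std_normal_density x * x\<^sup>2 \<partial>lborel) = 1"
    using std_normal_moment_even[of 1] by (auto simp: has_bochner_integral_iff)
  then show ?thesis by (subst nn_integral_eq_integral) auto
qed

lemma gauss2_second_moments:
  "integrable gauss2 (\<lambda>z. (fst z)\<^sup>2)" "integrable gauss2 (\<lambda>z. (snd z)\<^sup>2)"
  "(\<integral>z. (fst z)\<^sup>2 \<partial>gauss2) = 1" "(\<integral>z. (snd z)\<^sup>2 \<partial>gauss2) = 1"
proof -
  have [measurable]: "(\<lambda>z::real\<times>real. (fst z)\<^sup>2) \<in> borel_measurable borel" "(\<lambda>z::real\<times>real. (snd z)\<^sup>2) \<in> borel_measurable borel"
    by (auto intro!: borel_measurable_continuous_onI continuous_intros)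
  have "(\<integral>\<^sup>+z. ennreal ((fst z)\<^sup>2) \<partial>gauss2) = (\<integral>\<^sup>+x. \<integral>\<^sup>+y. ennreal (std_normal_density y) * ennreal (std_normal_density x * x\<^sup>2) \<partial>lborel \<partial>lborel)"
    unfolding gauss2_def
    by (subst nn_integral_density) (auto simp: nn_integral_lborel2 gauss_prod ennreal_mult[symmetric] mult_ac)
  also have "\<dots> = 1" by (simp add: nn_integral_multc nn_integral_std_normal nn_integral_std_normal_square)
  finally have 1: "(\<integral>\<^sup>+z. ennreal ((fst z)\<^sup>2) \<partial>gauss2) = 1" .
  have "(\<integral>\<^sup>+z. ennreal ((snd z)\<^sup>2) \<partial>gauss2) = (\<integral>\<^sup>+x. \<integral>\<^sup>+y. ennreal (std_normal_density x) * ennreal (std_normal_density y * y\<^sup>2) \<partial>lborel \<partial>lborel)"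
    unfolding gauss2_def
    by (subst nn_integral_density) (auto simp: nn_integral_lborel2 gauss_prod ennreal_mult[symmetric] mult_ac)
  also have "\<dots> = 1" by (simp add: nn_integral_cmult nn_integral_std_normal nn_integral_std_normal_square)
  finally have 2: "(\<integral>\<^sup>+z. ennreal ((snd z)\<^sup>2) \<partial>gauss2) = 1" .
  show "integrable gauss2 (\<lambda>z. (fst z)\<^sup>2)" "integrable gauss2 (\<lambda>z. (snd z)\<^sup>2)"
    using 1 2 by (auto intro!: integrableI_nonneg)
  show "(\<integral>z. (fst z)\<^sup>2 \<partial>gauss2) = 1" "(\<integral>z. (snd z)\<^sup>2 \<partial>gauss2) = 1"
    using 1 2 by (simp_all add: integral_eq_nn_integral)
qed

interpretation gauss2: prob_space gauss2 by (rule prob_space_gauss2)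

lemma bounded_integrable_gauss2:
  fixes \<phi> :: "real \<times> real \<Rightarrow> real" and k :: real
  assumes [measurable]: "\<phi> \<in> borel_measurable borel" and k: "\<And>w. \<bar>\<phi> w\<bar> \<le> k"
  shows "integrable gauss2 \<phi>"
  by (rule gauss2.integrable_const_bound[where B = k]) (use k in auto)

section \<open>Bounds for the semigroup and its velocity gradient\<close>

context oscillator
begin

definition P :: "real \<Rightarrow> (real \<times> real \<Rightarrow> real) \<Rightarrow> real \<times> real \<Rightarrow> real" where
  "P t \<phi> z = (\<integral>w. K t z w * \<phi> w \<partial>lborel)"
definition DP :: "real \<Rightarrow> (real \<times> real \<Rightarrow> real) \<Rightarrow> real \<times> real \<Rightarrow> real" where
  "DP t \<phi> z = (\<integral>w. Kv t z w * \<phi> w \<partial>lborel)"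

lemma P_gauss2: "t > 0 \<Longrightarrow> \<phi> \<in> borel_measurable borel \<Longrightarrow> P t \<phi> z = (\<integral>\<xi>. \<phi> (Lmap t z \<xi>) \<partial>gauss2)"
  unfolding P_def by (rule integral_K)

lemma P_bound:
  fixes \<phi> :: "real \<times> real \<Rightarrow> real" and k :: real
  assumes t: "t > 0" and [measurable]: "\<phi> \<in> borel_measurable borel" and k: "\<And>w. \<bar>\<phi> w\<bar> \<le> k"
  shows "\<bar>P t \<phi> z\<bar> \<le> k"
proof -
  have i: "integrable gauss2 (\<lambda>\<xi>. \<phi> (Lmap t z \<xi>))"
    by (rule bounded_integrable_gauss2[where k = k]) (use k in auto)
  have "\<bar>P t \<phi> z\<bar> \<le> (\<integral>\<xi>. \<bar>\<phi> (Lmap t z \<xi>)\<bar> \<partial>gauss2)"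
    unfolding P_gauss2[OF t assms(2)] by (rule integral_abs_bound)
  also have "\<dots> \<le> (\<integral>\<xi>. k \<partial>gauss2)" using i k by (intro integral_mono) auto
  also have "\<dots> = k" by (simp add: gauss2.prob_space)
  finally show ?thesis .
qed

lemma P_square:
  fixes \<phi> :: "real \<times> real \<Rightarrow> real" and k :: real
  assumes t: "t > 0" and [measurable]: "\<phi> \<in> borel_measurable borel" and k: "\<And>w. \<bar>\<phi> w\<bar> \<le> k"
  shows "(P t \<phi> z)\<^sup>2 \<le> P t (\<lambda>w. (\<phi> w)\<^sup>2) z"
proof -
  have k2: "\<bar>(\<phi> w)\<^sup>2\<bar> \<le> k\<^sup>2" for w using k[of w] power_mono[OF k[of w], of 2] by simp
  have i: "integrable gauss2 (\<lambda>\<xi>. (\<phi> (Lmap t z \<xi>))\<^sup>2)"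
    by (rule bounded_integrable_gauss2[where k = "k\<^sup>2"]) (use k2 in auto)
  have "(\<integral>\<xi>. \<phi> (Lmap t z \<xi>) * 1 \<partial>gauss2)\<^sup>2 \<le> (\<integral>\<xi>. (\<phi> (Lmap t z \<xi>))\<^sup>2 \<partial>gauss2) * (\<integral>\<xi>. 1\<^sup>2 \<partial>gauss2)"
    by (rule integral_Cauchy_Schwarz) (use i in auto)
  then show ?thesis using t by (simp add: P_gauss2 gauss2.prob_space)
qed

text \<open>In Gaussian coordinates the logarithmic derivative is linear in \<xi>, with coefficients
  whose squares sum to cN / cD by \<open>cN_split\<close>. The v-derivative of the semigroup is thus
  an expectation of \<phi> times a linear Gaussian weight, without any derivative of \<phi>.\<close>

lemma Nv_Lmap:
  assumes t: "t > 0"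
  shows "Nv t z (Lmap t z \<xi>) = b t / sqrt (cp t) * fst \<xi> + (d t * cp t - b t * cq t) / sqrt (cp t * cD t) * snd \<xi>"
proof -
  define Pp where "Pp = sqrt (cp t)" define E where "E = sqrt (cD t)"
  have PE: "Pp > 0" "E > 0" "cp t = Pp * Pp" "cD t = E * E"
    using cp_pos[OF t] cD_pos[OF t] by (auto simp: Pp_def E_def)
  have r: "cr t = (E * E + cq t * cq t) / (Pp * Pp)"
    using PE cD_def[of t] by (simp add: field_simps power2_eq_square)
  have e: "r1 t z (Lmap t z \<xi>) = Pp * fst \<xi>" "r2 t z (Lmap t z \<xi>) = cq t / Pp * fst \<xi> + E / Pp * snd \<xi>"
    using PE(1,2) by (simp_all add: r1_def r2_def Lmap_def Pp_def[symmetric] E_def[symmetric] real_sqrt_divide)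
  have s: "sqrt (cp t * cD t) = Pp * E" by (simp add: Pp_def E_def real_sqrt_mult)
  show ?thesis unfolding Nv_def g1_def g2_def e s r Pp_def[symmetric] using PE
    by (simp add: field_simps)
qed

lemma cN_split: assumes t: "t > 0"
  shows "(b t / sqrt (cp t))\<^sup>2 + ((d t * cp t - b t * cq t) / sqrt (cp t * cD t))\<^sup>2 = cN t / cD t"
proof -
  have pd: "cp t > 0" "cD t > 0" using cp_pos[OF t] cD_pos[OF t] .
  have "cp t * cN t = (cp t * d t - cq t * b t)\<^sup>2 + cD t * (b t)\<^sup>2"
    by (simp add: cN_def cD_def algebra_simps power2_eq_square)
  then have "cN t / cD t = ((cp t * d t - cq t * b t)\<^sup>2 + cD t * (b t)\<^sup>2) / (cp t * cD t)"
    using pd by (simp add: field_simps)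
  also have "\<dots> = (d t * cp t - b t * cq t)\<^sup>2 / (cp t * cD t) + (b t)\<^sup>2 / cp t"
    using pd by (simp add: add_divide_distrib mult_ac)
  finally show ?thesis using pd by (simp add: power_divide)
qed

text \<open>Cauchy-Schwarz applied to the representation by the Gaussian weight. The factor 2 comes
  from bounding the square of a sum, which avoids the mixed moment of \<xi>.\<close>

lemma DP_square:
  fixes \<phi> :: "real \<times> real \<Rightarrow> real" and k :: real
  assumes t: "t > 0" and [measurable]: "\<phi> \<in> borel_measurable borel" and k: "\<And>w. \<bar>\<phi> w\<bar> \<le> k"
  shows "(DP t \<phi> z)\<^sup>2 \<le> 2 * (cN t / cD t) * P t (\<lambda>w. (\<phi> w)\<^sup>2) z"
proof -
  have k2: "\<bar>(\<phi> w)\<^sup>2\<bar> \<le> k\<^sup>2" for w using power_mono[OF k[of w], of 2] by simp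
  have i: "integrable gauss2 (\<lambda>\<xi>. (\<phi> (Lmap t z \<xi>))\<^sup>2)"
    by (rule bounded_integrable_gauss2[where k = "k\<^sup>2"]) (use k2 in auto)
  define c1 where "c1 = b t / sqrt (cp t)"
  define c2 where "c2 = (d t * cp t - b t * cq t) / sqrt (cp t * cD t)"
  have [measurable]: "Nv t z \<in> borel_measurable borel"
    unfolding Nv_def g1_def g2_def r1_def r2_def
    by (intro borel_measurable_continuous_onI continuous_intros) (use cD_pos[OF t] in auto)
  have [measurable]: "(\<lambda>w. \<phi> w * Nv t z w) \<in> borel_measurable borel" by measurable
  have N: "Nv t z (Lmap t z \<xi>) = c1 * fst \<xi> + c2 * snd \<xi>" for \<xi> unfolding Nv_Lmap[OF t] c1_def c2_def ..
  have b: "(c1 * fst \<xi> + c2 * snd \<xi>)\<^sup>2 \<le> 2 * c1\<^sup>2 * (fst \<xi>)\<^sup>2 + 2 * c2\<^sup>2 * (snd \<xi>)\<^sup>2" for \<xi>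
    using zero_le_power2[of "c1 * fst \<xi> - c2 * snd \<xi>"] by (simp add: power2_eq_square algebra_simps)
  have ib: "integrable gauss2 (\<lambda>\<xi>. 2 * c1\<^sup>2 * (fst \<xi>)\<^sup>2 + 2 * c2\<^sup>2 * (snd \<xi>)\<^sup>2)"
    using gauss2_second_moments by auto
  have m: "(\<lambda>\<xi>. Nv t z (Lmap t z \<xi>)) \<in> borel_measurable gauss2" by measurable
  have iN: "integrable gauss2 (\<lambda>\<xi>. (Nv t z (Lmap t z \<xi>))\<^sup>2)"
    by (rule Bochner_Integration.integrable_bound[OF ib]) (use m b N in \<open>auto intro!: order_trans[OF b abs_ge_self]\<close>)
  have "DP t \<phi> z = (\<integral>w. K t z w * (\<phi> w * Nv t z w) \<partial>lborel)" unfolding DP_def Kv_def by (simp add: mult_ac)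
  also have "\<dots> = (\<integral>\<xi>. \<phi> (Lmap t z \<xi>) * Nv t z (Lmap t z \<xi>) \<partial>gauss2)" by (rule integral_K[OF t]) measurable
  finally have "(DP t \<phi> z)\<^sup>2 = (\<integral>\<xi>. \<phi> (Lmap t z \<xi>) * Nv t z (Lmap t z \<xi>) \<partial>gauss2)\<^sup>2" by simp
  also have "\<dots> \<le> (\<integral>\<xi>. (\<phi> (Lmap t z \<xi>))\<^sup>2 \<partial>gauss2) * (\<integral>\<xi>. (Nv t z (Lmap t z \<xi>))\<^sup>2 \<partial>gauss2)"
    by (rule integral_Cauchy_Schwarz) (use i iN m in auto)
  also have "\<dots> \<le> (\<integral>\<xi>. (\<phi> (Lmap t z \<xi>))\<^sup>2 \<partial>gauss2) * (\<integral>\<xi>. 2 * c1\<^sup>2 * (fst \<xi>)\<^sup>2 + 2 * c2\<^sup>2 * (snd \<xi>)\<^sup>2 \<partial>gauss2)"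
    by (intro mult_left_mono integral_mono iN ib) (simp_all only: N b integral_nonneg_AE AE_I2 zero_le_power2)
  also have "(\<integral>\<xi>. 2 * c1\<^sup>2 * (fst \<xi>)\<^sup>2 + 2 * c2\<^sup>2 * (snd \<xi>)\<^sup>2 \<partial>gauss2) = 2 * (c1\<^sup>2 + c2\<^sup>2)"
    using gauss2_second_moments by simp
  also have "c1\<^sup>2 + c2\<^sup>2 = cN t / cD t" unfolding c1_def c2_def by (rule cN_split[OF t])
  finally show ?thesis using t by (simp add: P_gauss2 mult.commute)
qed

text \<open>Time reversal: exchanging b and -b turns the kernel into its adjoint with respect to the Gaussian.\<close>

lemma gauss_K_reversal:
  assumes t: "t > 0"
  shows "gauss z * K t z w = gauss w * (exp (- (cr t * (fst z - (a t * fst w - b t * snd w))\<^sup>2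
     - 2 * (- cq t) * (fst z - (a t * fst w - b t * snd w)) * (snd z - (b t * fst w + d t * snd w))
     + cp t * (snd z - (b t * fst w + d t * snd w))\<^sup>2) / (2 * cD t)) / (2 * pi * sqrt (cD t)))"
    (is "_ = _ * (exp (- ?Q / _) / _)")
proof -
  have D: "cD t > 0" by (rule cD_pos[OF t])
  have id: "cD t * ((fst z)\<^sup>2 + (snd z)\<^sup>2) + Qf t z w = cD t * ((fst w)\<^sup>2 + (snd w)\<^sup>2) + ?Q"
    unfolding Qf_def r1_def r2_def cD_def cp_def cq_def cr_def by algebra
  have "- ((fst z)\<^sup>2 + (snd z)\<^sup>2) / 2 + - Qf t z w / (2 * cD t)
      = - (cD t * ((fst z)\<^sup>2 + (snd z)\<^sup>2) + Qf t z w) / (2 * cD t)" using D by (simp add: field_simps)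
  also have "\<dots> = - ((fst w)\<^sup>2 + (snd w)\<^sup>2) / 2 + - ?Q / (2 * cD t)"
    unfolding id using D by (simp add: field_simps)
  finally have e: "exp (- ((fst z)\<^sup>2 + (snd z)\<^sup>2) / 2) * exp (- Qf t z w / (2 * cD t))
     = exp (- ((fst w)\<^sup>2 + (snd w)\<^sup>2) / 2) * exp (- ?Q / (2 * cD t))"
    unfolding exp_add[symmetric] by (rule arg_cong)
  have "gauss z * K t z w = (exp (- ((fst z)\<^sup>2 + (snd z)\<^sup>2) / 2) * exp (- Qf t z w / (2 * cD t))) / (2 * pi * (2 * pi * sqrt (cD t)))"
    unfolding gauss_def K_def by simp
  then show ?thesis unfolding e gauss_def by simp
qed

text \<open>After reversal the integrand is \<open>gauss w\<close> times a Gaussian probability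
  density in z, whose covariance has -cq in place of cq. This is the invariance of the Gaussian at
  the level of kernels.\<close>

lemma nn_integral_gauss_K:
  assumes t: "t > 0"
  shows "(\<integral>\<^sup>+z. ennreal (gauss z * K t z w) \<partial>lborel) = ennreal (gauss w)"
proof -
  let ?Q = "\<lambda>z. cr t * (fst z - (a t * fst w - b t * snd w))\<^sup>2
     - 2 * (- cq t) * (fst z - (a t * fst w - b t * snd w)) * (snd z - (b t * fst w + d t * snd w))
     + cp t * (snd z - (b t * fst w + d t * snd w))\<^sup>2"
  let ?k = "\<lambda>z. exp (- ?Q z / (2 * cD t)) / (2 * pi * sqrt (cD t))"
  define k where "k = ?k"
  have m [measurable]: "k \<in> borel_measurable borel" unfolding k_def
    by (intro borel_measurable_continuous_onI continuous_intros) (use cD_pos[OF t] in auto)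
  have "density lborel (\<lambda>z. ennreal (k z)) = distr gauss2 borel (\<lambda>\<xi>. (a t * fst w - b t * snd w + sqrt (cp t) * fst \<xi>,
     b t * fst w + d t * snd w + - cq t / sqrt (cp t) * fst \<xi> + sqrt (cD t / cp t) * snd \<xi>))"
    unfolding k_def by (rule distr_gauss2_affine) (use cp_pos[OF t] cD_pos[OF t] in \<open>auto simp: cD_def\<close>)
  moreover have "(\<lambda>\<xi>. (a t * fst w - b t * snd w + sqrt (cp t) * fst \<xi>,
     b t * fst w + d t * snd w + - cq t / sqrt (cp t) * fst \<xi> + sqrt (cD t / cp t) * snd \<xi>)) \<in> measurable gauss2 borel"
    unfolding measurable_cong_sets[OF sets_gauss2 refl]
    by (intro borel_measurable_continuous_onI continuous_intros)
  ultimately have "prob_space (density lborel (\<lambda>z. ennreal (k z)))"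
    using gauss2.prob_space_distr by simp
  then have 1: "(\<integral>\<^sup>+z. ennreal (k z) \<partial>lborel) = 1"
    using prob_space.emeasure_space_1[of "density lborel (\<lambda>z. ennreal (k z))"] m by (subst (asm) emeasure_density) auto
  have "(\<integral>\<^sup>+z. ennreal (gauss z * K t z w) \<partial>lborel) = (\<integral>\<^sup>+z. ennreal (gauss w) * ennreal (k z) \<partial>lborel)"
    unfolding gauss_K_reversal[OF t] k_def using gauss_pos[of w]
    by (intro nn_integral_cong ennreal_mult) (use cD_pos[OF t] in auto)
  also have "\<dots> = ennreal (gauss w)" by (subst nn_integral_cmult) (simp_all add: 1)
  finally show ?thesis .
qed

lemma P_measurable:
  assumes t: "t > 0" and f: "f \<in> borel_measurable borel"
  shows "P t f \<in> borel_measurable borel" "DP t f \<in> borel_measurable borel"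
proof -
  have s: "borel_measurable (borel \<Otimes>\<^sub>M lborel) = borel_measurable (borel :: (((real \<times> real) \<times> (real \<times> real)) measure))"
    by (rule measurable_cong_sets[OF trans[OF sets_pair_measure_cong[OF refl sets_lborel] arg_cong[OF borel_prod, of sets]] refl])
  have fs: "(\<lambda>p. f (snd p)) \<in> borel_measurable (borel :: (((real \<times> real) \<times> (real \<times> real)) measure))"
    by (rule measurable_compose[OF borel_measurable_continuous_onI f]) (intro continuous_intros)
  have k: "(\<lambda>p. K t (fst p) (snd p)) \<in> borel_measurable (borel :: (((real \<times> real) \<times> (real \<times> real)) measure))"
    "(\<lambda>p. Kv t (fst p) (snd p)) \<in> borel_measurable (borel :: (((real \<times> real) \<times> (real \<times> real)) measure))"
    using t by (auto intro!: borel_measurable_continuous_onI cont_K continuous_intros)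
  show "P t f \<in> borel_measurable borel" unfolding P_def
    by (rule lborel.borel_measurable_lebesgue_integral, unfold s case_prod_beta', rule borel_measurable_times[OF k(1) fs])
  show "DP t f \<in> borel_measurable borel" unfolding DP_def
    by (rule lborel.borel_measurable_lebesgue_integral, unfold s case_prod_beta', rule borel_measurable_times[OF k(2) fs])
qed

lemma P_invariant:
  fixes f :: "real \<times> real \<Rightarrow> real" and k :: real
  assumes t: "t > 0" and [measurable]: "f \<in> borel_measurable borel" and k: "\<And>w. 0 \<le> f w" "\<And>w. f w \<le> k"
  shows "integrable lborel (\<lambda>z. gauss z * P t f z)"
    and "(\<integral>z. gauss z * P t f z \<partial>lborel) = (\<integral>w. gauss w * f w \<partial>lborel)"
proof -
  note [measurable] = K_measurable[OF t]
  have mP [measurable]: "P t f \<in> borel_measurable borel" by (rule P_measurable[OF t assms(2)])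
  have P0: "P t f z \<ge> 0" for z unfolding P_def by (intro integral_nonneg_AE AE_I2 mult_nonneg_nonneg less_imp_le[OF K_pos[OF t]] k)
  have fb: "\<bar>f w\<bar> \<le> k" for w using k[of w] by simp
  have i: "integrable lborel (\<lambda>w. K t z w * f w)" for z
    unfolding integral_K(2)[OF t assms(2)] by (rule bounded_integrable_gauss2[where k = k]) (use fb in auto)
  have ig: "integrable lborel (\<lambda>w. gauss w * f w)"
    using bounded_integrable_gauss2[of f k] fb by (simp add: integrable_gauss2)
  have "(\<integral>\<^sup>+z. ennreal (gauss z * P t f z) \<partial>lborel) = (\<integral>\<^sup>+z. \<integral>\<^sup>+w. ennreal (gauss z * K t z w) * ennreal (f w) \<partial>lborel \<partial>lborel)"
  proof (intro nn_integral_cong)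
    fix z
    have "ennreal (P t f z) = (\<integral>\<^sup>+w. ennreal (K t z w * f w) \<partial>lborel)"
      unfolding P_def by (rule nn_integral_eq_integral[symmetric, OF i]) (intro AE_I2 mult_nonneg_nonneg less_imp_le[OF K_pos[OF t]] k)
    then show "ennreal (gauss z * P t f z) = (\<integral>\<^sup>+w. ennreal (gauss z * K t z w) * ennreal (f w) \<partial>lborel)"
      using gauss_pos[of z] P0[of z] K_pos[OF t, of z] k
      by (simp add: ennreal_mult' nn_integral_cmult[symmetric] mult.assoc less_imp_le)
  qed
  also have "\<dots> = (\<integral>\<^sup>+w. \<integral>\<^sup>+z. ennreal (gauss z * K t z w) * ennreal (f w) \<partial>lborel \<partial>lborel)"
  \<comment> \<open>Tonelli needs only joint measurability here: the kernel is jointly continuous,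
    and f enters through one variable.\<close>
  proof (rule lborel_pair.Fubini'[symmetric])
    have "(\<lambda>p. ennreal (gauss (fst p) * K t (fst p) (snd p)) * ennreal (f (snd p))) \<in> borel_measurable (borel :: (((real \<times> real) \<times> (real \<times> real)) measure))"
    proof (intro borel_measurable_times_ennreal measurable_compose[OF _ measurable_ennreal])
      show "(\<lambda>p. gauss (fst p) * K t (fst p) (snd p)) \<in> borel_measurable (borel :: (((real \<times> real) \<times> (real \<times> real)) measure))"
        using t by (intro borel_measurable_continuous_onI cont_K continuous_intros continuous_on_compose2[OF continuous_on_gauss[of UNIV]]) auto
      show "(\<lambda>p. f (snd p)) \<in> borel_measurable (borel :: (((real \<times> real) \<times> (real \<times> real)) measure))"
        by (rule measurable_compose[OF borel_measurable_continuous_onI assms(2)]) (intro continuous_intros)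
    qed
    then show "(\<lambda>(z, w). ennreal (gauss z * K t z w) * ennreal (f w)) \<in> borel_measurable (lborel \<Otimes>\<^sub>M lborel)"
      by (simp add: lborel_prod case_prod_beta)
  qed
  also have "\<dots> = (\<integral>\<^sup>+w. ennreal (gauss w) * ennreal (f w) \<partial>lborel)"
  proof (intro nn_integral_cong)
    fix w
    have "(\<lambda>z. gauss z * K t z w) \<in> borel_measurable borel"
      using t by (intro borel_measurable_continuous_onI cont_K continuous_intros) auto
    then show "(\<integral>\<^sup>+z. ennreal (gauss z * K t z w) * ennreal (f w) \<partial>lborel) = ennreal (gauss w) * ennreal (f w)"
      by (subst nn_integral_multc) (auto simp: nn_integral_gauss_K[OF t])
  qed
  also have "\<dots> = ennreal (\<integral>w. gauss w * f w \<partial>lborel)"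
    using k gauss_pos by (subst nn_integral_eq_integral[OF ig, symmetric]) (auto simp: ennreal_mult' less_imp_le intro!: AE_I2 mult_nonneg_nonneg)
  finally have e: "(\<integral>\<^sup>+z. ennreal (gauss z * P t f z) \<partial>lborel) = ennreal (\<integral>w. gauss w * f w \<partial>lborel)" .
  have nn: "0 \<le> gauss z * P t f z" for z using gauss_pos[of z] P0[of z] by simp
  show "integrable lborel (\<lambda>z. gauss z * P t f z)"
    by (rule integrableI_nonneg) (use nn e in auto)
  show "(\<integral>z. gauss z * P t f z \<partial>lborel) = (\<integral>w. gauss w * f w \<partial>lborel)"
    using e nn k gauss_pos by (subst integral_eq_nn_integral) (auto intro!: integral_nonneg_AE AE_I2 mult_nonneg_nonneg simp: less_imp_le)
qed

end

section \<open>Integrals against compactly supported functions\<close>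

abbreviation box2 :: "real \<Rightarrow> (real \<times> real) set" where "box2 N \<equiv> cbox (- N, - N) (N, N)"

text \<open>Compact support is encoded by an explicit box, on which Lebesgue integrals coincide with
  gauge integrals and the rules for parameter integrals over boxes apply.\<close>

definition Cc :: "(real \<times> real \<Rightarrow> real) \<Rightarrow> bool" where
  "Cc \<phi> \<longleftrightarrow> continuous_on UNIV \<phi> \<and> (\<exists>N. \<forall>z. z \<notin> box2 N \<longrightarrow> \<phi> z = 0)"

lemma Cc_mult: "Cc \<phi> \<Longrightarrow> continuous_on UNIV f \<Longrightarrow> Cc (\<lambda>z. f z * \<phi> z)"
  unfolding Cc_def by (auto intro!: continuous_intros)

lemma Cc_measurable [measurable_dest]: "Cc \<phi> \<Longrightarrow> \<phi> \<in> borel_measurable borel"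
  unfolding Cc_def by (auto intro: borel_measurable_continuous_onI)

lemma integrable_box2:
  assumes "continuous_on (box2 N) f"
  shows "integrable lborel (\<lambda>z. indicator (box2 N) z *\<^sub>R (f z :: real))"
  by (rule borel_integrable_compact[OF compact_cbox assms])

lemma integral_box2:
  fixes f \<phi> :: "real \<times> real \<Rightarrow> real"
  assumes f: "continuous_on UNIV f" and \<phi>: "continuous_on UNIV \<phi>" "\<And>z. z \<notin> box2 N \<Longrightarrow> \<phi> z = 0"
  shows "integrable lborel (\<lambda>z. f z * \<phi> z)" "(\<integral>z. f z * \<phi> z \<partial>lborel) = integral (box2 N) (\<lambda>z. f z * \<phi> z)"
proof -
  have c: "continuous_on (box2 N) (\<lambda>z. f z * \<phi> z)"
    by (intro continuous_intros continuous_on_subset[OF f] continuous_on_subset[OF \<phi>(1)]) auto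
  have e: "f z * \<phi> z = indicator (box2 N) z *\<^sub>R (f z * \<phi> z)" for z
    using \<phi>(2)[of z] by (cases "z \<in> box2 N") auto
  note i = integrable_box2[OF c]
  show "integrable lborel (\<lambda>z. f z * \<phi> z)" using i unfolding e[symmetric] .
  have "(\<integral>z. f z * \<phi> z \<partial>lborel) = (\<integral>z. indicator (box2 N) z *\<^sub>R (f z * \<phi> z) \<partial>lborel)"
    by (rule Bochner_Integration.integral_cong[OF refl e])
  also have "\<dots> = integral (box2 N) (\<lambda>z. f z * \<phi> z)"
    using set_borel_integral_eq_integral(2)[of "box2 N" "\<lambda>z. f z * \<phi> z"] i
    unfolding set_integrable_def set_lebesgue_integral_def by simp
  finally show "(\<integral>z. f z * \<phi> z \<partial>lborel) = integral (box2 N) (\<lambda>z. f z * \<phi> z)" .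
qed

lemma Cc_integrable_mult: "Cc \<phi> \<Longrightarrow> continuous_on UNIV f \<Longrightarrow> integrable lborel (\<lambda>z. f z * \<phi> z)"
  unfolding Cc_def using integral_box2(1) by blast

lemma Cc_integrable: "Cc \<phi> \<Longrightarrow> integrable lborel \<phi>"
  using Cc_integrable_mult[of \<phi> "\<lambda>_. 1"] by simp

lemma Cc_bounded: assumes "Cc \<phi>" obtains k where "k > 0" "\<And>z. \<bar>\<phi> z\<bar> \<le> k"
proof -
  obtain N where c: "continuous_on UNIV \<phi>" "\<And>z. z \<notin> box2 N \<Longrightarrow> \<phi> z = 0"
    using assms unfolding Cc_def by blast
  have "compact (\<phi> ` box2 N)"
    by (intro compact_continuous_image continuous_on_subset[OF c(1)]) auto
  then obtain B where B: "B > 0" "\<And>y. y \<in> \<phi> ` box2 N \<Longrightarrow> norm y \<le> B"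
    using compact_imp_bounded bounded_pos by metis
  show thesis
  proof (rule that[OF B(1)])
    fix z show "\<bar>\<phi> z\<bar> \<le> B" using B c(2)[of z] by (cases "z \<in> box2 N") auto
  qed
qed

text \<open>Since \<phi> lives on a box, joint continuity of the derivative suffices for
  differentiating under the integral; no dominating function has to be found.\<close>

lemma Cc_leibniz:
  fixes H H' :: "real \<Rightarrow> real \<times> real \<Rightarrow> real"
  assumes \<phi>: "Cc \<phi>" and U: "open U" "convex U" "s0 \<in> U"
    and d: "\<And>s w. s \<in> U \<Longrightarrow> ((\<lambda>s. H s w) has_real_derivative H' s w) (at s)"
    and c: "\<And>s. s \<in> U \<Longrightarrow> continuous_on UNIV (H s)"
    and c': "continuous_on (U \<times> UNIV) (\<lambda>(s, w). H' s w)"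
  shows "((\<lambda>s. \<integral>w. H s w * \<phi> w \<partial>lborel) has_real_derivative (\<integral>w. H' s0 w * \<phi> w \<partial>lborel)) (at s0)"
proof -
  obtain N where N: "continuous_on UNIV \<phi>" "\<And>z. z \<notin> box2 N \<Longrightarrow> \<phi> z = 0"
    using \<phi> unfolding Cc_def by blast
  have cp: "continuous_on (U \<times> UNIV) (\<lambda>p. H' (fst p) (snd p))" using c' by (simp add: case_prod_beta')
  have c's: "continuous_on UNIV (H' s)" if "s \<in> U" for s
    by (rule continuous_on_compose2[OF cp, of UNIV "\<lambda>w. (s, w)", simplified]) (use that in \<open>auto intro!: continuous_intros\<close>)
  have "((\<lambda>s. integral (box2 N) (\<lambda>w. H s w * \<phi> w)) has_real_derivative integral (box2 N) (\<lambda>w. H' s0 w * \<phi> w)) (at s0 within U)"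
  proof (rule leibniz_rule_field_derivative)
    fix s w assume s: "s \<in> U"
    show "((\<lambda>s. H s w * \<phi> w) has_real_derivative H' s w * \<phi> w) (at s within U)"
      by (rule has_field_derivative_at_within, rule DERIV_cmult_right[OF d[OF s]])
  next
    fix s assume s: "s \<in> U"
    show "(\<lambda>w. H s w * \<phi> w) integrable_on box2 N"
      by (intro integrable_continuous continuous_intros continuous_on_subset[OF c[OF s]] continuous_on_subset[OF N(1)]) auto
  next
    have "continuous_on (U \<times> box2 N) (\<lambda>p. H' (fst p) (snd p) * \<phi> (snd p))"
      by (intro continuous_intros continuous_on_subset[OF cp] continuous_on_compose2[OF N(1)]) auto
    then show "continuous_on (U \<times> box2 N) (\<lambda>(s, w). H' s w * \<phi> w)" by (simp add: case_prod_beta')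
  qed (use U in auto)
  then have "((\<lambda>s. integral (box2 N) (\<lambda>w. H s w * \<phi> w)) has_real_derivative integral (box2 N) (\<lambda>w. H' s0 w * \<phi> w)) (at s0)"
    using at_within_open[OF U(3,1)] by simp
  then have "((\<lambda>s. integral (box2 N) (\<lambda>w. H s w * \<phi> w)) has_real_derivative (\<integral>w. H' s0 w * \<phi> w \<partial>lborel)) (at s0)"
    using integral_box2(2)[OF c's[OF U(3)] N] by simp
  then show ?thesis
    by (rule has_field_derivative_transform_within_open[OF _ U(1,3)]) (rule integral_box2(2)[OF c N, symmetric])
qed

lemma Cc_continuous_param:
  fixes F :: "'a::topological_space \<Rightarrow> real \<times> real \<Rightarrow> real"
  assumes \<phi>: "Cc \<phi>" and c: "continuous_on (U \<times> UNIV) (\<lambda>(x, w). F x w)"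
  shows "continuous_on U (\<lambda>x. \<integral>w. F x w * \<phi> w \<partial>lborel)"
proof -
  obtain N where N: "continuous_on UNIV \<phi>" "\<And>z. z \<notin> box2 N \<Longrightarrow> \<phi> z = 0"
    using \<phi> unfolding Cc_def by blast
  have cp: "continuous_on (U \<times> UNIV) (\<lambda>p. F (fst p) (snd p))" using c by (simp add: case_prod_beta')
  have cs: "continuous_on UNIV (F x)" if "x \<in> U" for x
    by (rule continuous_on_compose2[OF cp, of UNIV "\<lambda>w. (x, w)", simplified]) (use that in \<open>auto intro!: continuous_intros\<close>)
  have "continuous_on (U \<times> box2 N) (\<lambda>p. F (fst p) (snd p) * \<phi> (snd p))"
    by (intro continuous_intros continuous_on_subset[OF cp] continuous_on_compose2[OF N(1)]) auto
  then have "continuous_on U (\<lambda>x. integral (box2 N) (\<lambda>w. F x w * \<phi> w))"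
    by (intro integral_continuous_on_param) (simp add: case_prod_beta')
  then show ?thesis
    using integral_box2(2)[OF cs N] by (simp cong: continuous_on_cong)
qed

section \<open>Classical derivatives of the semigroup and its limit at time 0\<close>

context oscillator
begin

definition DxP :: "real \<Rightarrow> (real \<times> real \<Rightarrow> real) \<Rightarrow> real \<times> real \<Rightarrow> real" where
  "DxP t \<phi> z = (\<integral>w. Kx t z w * \<phi> w \<partial>lborel)"
definition DDP :: "real \<Rightarrow> (real \<times> real \<Rightarrow> real) \<Rightarrow> real \<times> real \<Rightarrow> real" where
  "DDP t \<phi> z = (\<integral>w. Kvv t z w * \<phi> w \<partial>lborel)"
definition DtP :: "real \<Rightarrow> (real \<times> real \<Rightarrow> real) \<Rightarrow> real \<times> real \<Rightarrow> real" where
  "DtP t \<phi> z = (\<integral>w. Kt t z w * \<phi> w \<partial>lborel)"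

lemma deriv_P:
  assumes \<phi>: "Cc \<phi>" and t: "t > 0"
  shows "((\<lambda>x. P t \<phi> (x, v)) has_real_derivative DxP t \<phi> (x, v)) (at x)"
    and "((\<lambda>v. P t \<phi> (x, v)) has_real_derivative DP t \<phi> (x, v)) (at v)"
    and "((\<lambda>v. DP t \<phi> (x, v)) has_real_derivative DDP t \<phi> (x, v)) (at v)"
    and "((\<lambda>t. P t \<phi> (x, v)) has_real_derivative DtP t \<phi> (x, v)) (at t)"
proof -
  show "((\<lambda>x. P t \<phi> (x, v)) has_real_derivative DxP t \<phi> (x, v)) (at x)"
    unfolding P_def DxP_def
    by (rule Cc_leibniz[OF \<phi> open_UNIV convex_UNIV UNIV_I deriv_Kx[OF t]])
       (use t in \<open>auto intro!: cont_K continuous_intros simp: case_prod_beta'\<close>)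
  show "((\<lambda>v. P t \<phi> (x, v)) has_real_derivative DP t \<phi> (x, v)) (at v)"
    unfolding P_def DP_def
    by (rule Cc_leibniz[OF \<phi> open_UNIV convex_UNIV UNIV_I deriv_Kv[OF t]])
       (use t in \<open>auto intro!: cont_K continuous_intros simp: case_prod_beta'\<close>)
  show "((\<lambda>v. DP t \<phi> (x, v)) has_real_derivative DDP t \<phi> (x, v)) (at v)"
    unfolding DP_def DDP_def
    by (rule Cc_leibniz[OF \<phi> open_UNIV convex_UNIV UNIV_I deriv_Kvv[OF t]])
       (use t in \<open>auto intro!: cont_K continuous_intros simp: case_prod_beta'\<close>)
  show "((\<lambda>t. P t \<phi> (x, v)) has_real_derivative DtP t \<phi> (x, v)) (at t)"
    unfolding P_def DtP_def
    by (rule Cc_leibniz[OF \<phi>, of "{0<..}"])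
       (use t in \<open>auto intro!: deriv_Kt cont_K continuous_intros simp: case_prod_beta'\<close>)
qed

lemma DtP_eq:
  assumes \<phi>: "Cc \<phi>" and t: "t > 0"
  shows "DtP t \<phi> z = \<omega> * snd z * DxP t \<phi> z - (\<omega> * fst z + 2 * \<nu> * snd z) * DP t \<phi> z + 2 * \<nu> * DDP t \<phi> z"
proof -
  have i: "integrable lborel (\<lambda>w. Kx t z w * \<phi> w)" "integrable lborel (\<lambda>w. Kv t z w * \<phi> w)"
     "integrable lborel (\<lambda>w. Kvv t z w * \<phi> w)"
    using t by (auto intro!: Cc_integrable_mult[OF \<phi>] cont_K continuous_intros)
  have "DtP t \<phi> z = (\<integral>w. \<omega> * snd z * (Kx t z w * \<phi> w) - (\<omega> * fst z + 2 * \<nu> * snd z) * (Kv t z w * \<phi> w)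
      + 2 * \<nu> * (Kvv t z w * \<phi> w) \<partial>lborel)"
    unfolding DtP_def Kt_def by (intro Bochner_Integration.integral_cong) (auto simp: algebra_simps)
  also have "\<dots> = \<omega> * snd z * DxP t \<phi> z - (\<omega> * fst z + 2 * \<nu> * snd z) * DP t \<phi> z + 2 * \<nu> * DDP t \<phi> z"
    unfolding DxP_def DP_def DDP_def using i by simp
  finally show ?thesis .
qed

lemma cont_P:
  assumes \<phi>: "Cc \<phi>"
  shows "continuous_on ({0<..} \<times> UNIV) (\<lambda>(t, z). P t \<phi> z)"
    and "continuous_on ({0<..} \<times> UNIV) (\<lambda>(t, z). DxP t \<phi> z)"
    and "continuous_on ({0<..} \<times> UNIV) (\<lambda>(t, z). DP t \<phi> z)"
    and "continuous_on ({0<..} \<times> UNIV) (\<lambda>(t, z). DDP t \<phi> z)"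
    and "continuous_on ({0<..} \<times> UNIV) (\<lambda>(t, z). DtP t \<phi> z)"
  unfolding P_def DxP_def DP_def DDP_def DtP_def case_prod_beta'
  by (rule Cc_continuous_param[OF \<phi>], auto intro!: cont_K continuous_intros simp: case_prod_beta')+

lemma Lmap_small_time:
  assumes X: "X \<longlonglongrightarrow> 0" "\<And>n. X n > (0::real)"
  shows "(\<lambda>n. Lmap (X n) z \<xi>) \<longlonglongrightarrow> z"
proof -
  have c: "(\<lambda>n. a (X n)) \<longlonglongrightarrow> 1" "(\<lambda>n. b (X n)) \<longlonglongrightarrow> 0" "(\<lambda>n. d (X n)) \<longlonglongrightarrow> 1"
    using isCont_tendsto_compose[OF DERIV_isCont[OF deriv_a] X(1)] isCont_tendsto_compose[OF DERIV_isCont[OF deriv_b] X(1)]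
      isCont_tendsto_compose[OF DERIV_isCont[OF deriv_d] X(1)] by (simp_all add: init)
  have p: "(\<lambda>n. sqrt (cp (X n))) \<longlonglongrightarrow> 0"
    unfolding cp_def by (rule tendsto_eq_intros c refl)+ simp
  have r: "(\<lambda>n. sqrt (cr (X n))) \<longlonglongrightarrow> 0"
    unfolding cr_def by (rule tendsto_eq_intros c refl)+ simp
  \<comment> \<open>At time 0 this quotient has the form 0 / 0. Positivity of \<open>cD\<close>
    gives cq^2 \<le> cp cr, so it is dominated by sqrt cr.\<close>
  have q: "(\<lambda>n. cq (X n) / sqrt (cp (X n))) \<longlonglongrightarrow> 0"
  proof (rule tendsto_0_le[OF r, of _ 1], rule always_eventually, rule allI)
    fix n
    have pp: "cp (X n) > 0" "cD (X n) > 0" "cr (X n) > 0" using cp_pos[OF X(2)] cD_pos[OF X(2)] cr_pos[OF X(2)] by auto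
    have "\<bar>cq (X n)\<bar> \<le> sqrt (cp (X n) * cr (X n))"
      using pp(2) unfolding cD_def by (intro real_le_rsqrt) simp
    then show "norm (cq (X n) / sqrt (cp (X n))) \<le> norm (sqrt (cr (X n))) * 1"
      using pp by (simp add: divide_le_eq real_sqrt_mult mult.commute)
  qed
  have e: "(\<lambda>n. sqrt (cD (X n) / cp (X n))) \<longlonglongrightarrow> 0"
  proof (rule tendsto_0_le[OF r, of _ 1], rule always_eventually, rule allI)
    fix n
    have pp: "cp (X n) > 0" "cD (X n) > 0" "cr (X n) > 0" using cp_pos[OF X(2)] cD_pos[OF X(2)] cr_pos[OF X(2)] by auto
    have "cD (X n) / cp (X n) \<le> cr (X n)" using pp unfolding cD_def by (simp add: divide_le_eq mult.commute)
    then show "norm (sqrt (cD (X n) / cp (X n))) \<le> norm (sqrt (cr (X n))) * 1"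
      using pp by simp
  qed
  have "(\<lambda>n. Lmap (X n) z \<xi>) \<longlonglongrightarrow> (1 * fst z + 0 * snd z + 0 * fst \<xi>, - 0 * fst z + 1 * snd z + 0 * fst \<xi> + 0 * snd \<xi>)"
    unfolding Lmap_def by (intro tendsto_intros c p q e)
  then show ?thesis by simp
qed

lemma P_small_time:
  assumes X: "X \<longlonglongrightarrow> 0" "\<And>n. X n > (0::real)" and \<phi>: "Cc \<phi>"
  shows "(\<lambda>n. P (X n) \<phi> z) \<longlonglongrightarrow> \<phi> z"
proof -
  note [measurable] = Cc_measurable[OF \<phi>]
  obtain k where k: "\<And>z. \<bar>\<phi> z\<bar> \<le> k" using Cc_bounded[OF \<phi>] by metis
  have "(\<lambda>n. \<integral>\<xi>. \<phi> (Lmap (X n) z \<xi>) \<partial>gauss2) \<longlonglongrightarrow> (\<integral>\<xi>. \<phi> z \<partial>gauss2)"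
  proof (rule integral_dominated_convergence[where w = "\<lambda>_. k"])
    show "AE \<xi> in gauss2. (\<lambda>n. \<phi> (Lmap (X n) z \<xi>)) \<longlonglongrightarrow> \<phi> z"
    proof (intro AE_I2 isCont_tendsto_compose[OF _ Lmap_small_time[OF X]])
      show "isCont \<phi> z" using \<phi> by (simp add: Cc_def continuous_on_eq_continuous_at del: split_paired_All)
    qed
  qed (use k in auto)
  then show ?thesis by (simp add: P_gauss2[OF X(2)] gauss2.prob_space)
qed

end

section \<open>Contraction in the Gaussian space\<close>

lemma integrable_exp_quad:
  "integrable lborel (\<lambda>z :: real \<times> real. exp (- ((fst z)\<^sup>2 + (snd z)\<^sup>2) / 10))"
proof -
  \<comment> \<open>The density of the centred Gaussian with variance 5 in each coordinate; its
    exponent is -(x^2 + y^2) / 10.\<close>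
  let ?k = "\<lambda>w::real \<times> real. exp (- (5 * (fst w - 0)\<^sup>2 - 2 * 0 * (fst w - 0) * (snd w - 0) + 5 * (snd w - 0)\<^sup>2) / (2 * 25)) / (2 * pi * sqrt 25)"
  have m [measurable]: "?k \<in> borel_measurable borel"
    by (intro borel_measurable_continuous_onI continuous_intros) auto
  have "density lborel (\<lambda>w. ennreal (?k w)) = distr gauss2 borel (\<lambda>\<xi>. (0 + sqrt 5 * fst \<xi>, 0 + 0 / sqrt 5 * fst \<xi> + sqrt (25 / 5) * snd \<xi>))"
    by (rule distr_gauss2_affine) auto
  moreover have "(\<lambda>\<xi>. (0 + sqrt 5 * fst \<xi>, 0 + 0 / sqrt 5 * fst \<xi> + sqrt (25 / 5) * snd \<xi>)) \<in> measurable gauss2 borel"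
    unfolding measurable_cong_sets[OF sets_gauss2 refl]
    by (intro borel_measurable_continuous_onI continuous_intros)
  ultimately have "prob_space (density lborel (\<lambda>z. ennreal (?k z)))"
    using gauss2.prob_space_distr by simp
  then have "(\<integral>\<^sup>+z. ennreal (?k z) \<partial>lborel) = 1"
    using prob_space.emeasure_space_1[of "density lborel (\<lambda>z. ennreal (?k z))"] m by (subst (asm) emeasure_density) auto
  then have "integrable lborel ?k"
    using m by (intro integrableI_nonneg) auto
  then have "integrable lborel (\<lambda>w. (2 * pi * sqrt 25) * ?k w)" by (rule integrable_mult_right)
  moreover have "(\<lambda>w. (2 * pi * sqrt 25) * ?k w) = (\<lambda>w. exp (- ((fst w)\<^sup>2 + (snd w)\<^sup>2) / 10))"
    by (rule ext) (simp add: field_simps)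
  ultimately show ?thesis by (simp only:)
qed

lemma integrable_exp_quad2:
  "integrable lborel (\<lambda>p :: (real \<times> real) \<times> (real \<times> real).
     exp (- ((fst (fst p))\<^sup>2 + (snd (fst p))\<^sup>2) / 10) * exp (- ((fst (snd p))\<^sup>2 + (snd (snd p))\<^sup>2) / 10))"
proof (rule integrableI_nonneg)
  let ?g = "\<lambda>z :: real \<times> real. exp (- ((fst z)\<^sup>2 + (snd z)\<^sup>2) / 10)"
  have m [measurable]: "?g \<in> borel_measurable borel"
    by (intro borel_measurable_continuous_onI continuous_intros) auto
  have m2: "(\<lambda>p. ?g (fst p) * ?g (snd p)) \<in> borel_measurable borel"
    by (intro borel_measurable_continuous_onI continuous_intros) auto
  then show "(\<lambda>p. ?g (fst p) * ?g (snd p)) \<in> borel_measurable lborel" by simp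
  have "(\<integral>\<^sup>+p. ennreal (?g (fst p) * ?g (snd p)) \<partial>lborel) = (\<integral>\<^sup>+p. ennreal (?g (fst p) * ?g (snd p)) \<partial>(lborel \<Otimes>\<^sub>M lborel))"
    by (simp add: lborel_prod)
  also have "\<dots> = (\<integral>\<^sup>+z. \<integral>\<^sup>+w. ennreal (?g (fst (z, w)) * ?g (snd (z, w))) \<partial>lborel \<partial>lborel)"
    by (rule lborel.nn_integral_fst[symmetric]) (use m2 in \<open>simp add: lborel_prod\<close>)
  also have "\<dots> = (\<integral>\<^sup>+z. \<integral>\<^sup>+w. ennreal (?g z) * ennreal (?g w) \<partial>lborel \<partial>lborel)"
    by (simp only: fst_conv snd_conv ennreal_mult' exp_ge_zero)
  also have "\<dots> = (\<integral>\<^sup>+z. ennreal (?g z) \<partial>lborel) * (\<integral>\<^sup>+w. ennreal (?g w) \<partial>lborel)"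
    using m by (subst nn_integral_cmult) (auto intro!: nn_integral_multc)
  also have "\<dots> < \<infinity>"
  proof -
    have "(\<integral>\<^sup>+z. ennreal (?g z) \<partial>lborel) < \<infinity>"
      using integrable_exp_quad by (simp add: integrable_iff_bounded)
    then show ?thesis by (simp add: ennreal_mult_less_top)
  qed
  finally show "(\<integral>\<^sup>+p. ennreal (?g (fst p) * ?g (snd p)) \<partial>lborel) < \<infinity>" .
qed auto

context oscillator
begin

text \<open>Relative to the Gaussian, P has kernel \<open>K / gauss\<close>. The integral of
  \<open>HS t\<close> is the squared Hilbert-Schmidt norm in L^2 of the Gaussian of
  \<open>P t\<close> minus the projection onto constants, hence a bound for the squared operator
  norm of that difference.\<close>

definition HS :: "real \<Rightarrow> (real \<times> real) \<times> (real \<times> real) \<Rightarrow> real" where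
  "HS t p = gauss (fst p) * (K t (fst p) (snd p) - gauss (snd p))\<^sup>2 / gauss (snd p)"

lemma HS_measurable: "t > 0 \<Longrightarrow> HS t \<in> borel_measurable borel"
  unfolding HS_def
  by (intro borel_measurable_continuous_onI continuous_intros cont_K continuous_on_compose2[OF continuous_on_gauss[of UNIV]])
     (auto simp: less_imp_neq[OF gauss_pos, symmetric])

lemma lim_c:
  "(cp \<longlongrightarrow> 1) at_top" "(cq \<longlongrightarrow> 0) at_top" "(cr \<longlongrightarrow> 1) at_top" "(cD \<longlongrightarrow> 1) at_top"
proof -
  show p: "(cp \<longlongrightarrow> 1) at_top" unfolding cp_def[abs_def] by (rule tendsto_eq_intros lim refl)+ simp
  show q: "(cq \<longlongrightarrow> 0) at_top" unfolding cq_def[abs_def] by (rule tendsto_eq_intros lim refl)+ simp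
  show r: "(cr \<longlongrightarrow> 1) at_top" unfolding cr_def[abs_def] by (rule tendsto_eq_intros lim refl)+ simp
  show "(cD \<longlongrightarrow> 1) at_top" unfolding cD_def[abs_def] by (rule tendsto_eq_intros p q r refl)+ simp
qed

lemma K_lim: "((\<lambda>t. K t z w) \<longlongrightarrow> gauss w) at_top"
proof -
  have r: "((\<lambda>t. r1 t z w) \<longlongrightarrow> fst w) at_top"
    unfolding r1_def by (rule tendsto_eq_intros lim refl)+ simp
  have r': "((\<lambda>t. r2 t z w) \<longlongrightarrow> snd w) at_top"
    unfolding r2_def by (rule tendsto_eq_intros lim refl)+ simp
  have q: "((\<lambda>t. Qf t z w) \<longlongrightarrow> (fst w)\<^sup>2 + (snd w)\<^sup>2) at_top"
    unfolding Qf_def by (rule tendsto_eq_intros lim_c r r' refl)+ simp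
  have "((\<lambda>t. - Qf t z w / (2 * cD t)) \<longlongrightarrow> - ((fst w)\<^sup>2 + (snd w)\<^sup>2) / 2) at_top"
    by (rule tendsto_eq_intros lim_c q refl | simp)+
  from tendsto_divide[OF tendsto_exp[OF this] tendsto_mult_left[OF tendsto_real_sqrt[OF lim_c(4)], of "2 * pi"]]
  show ?thesis unfolding K_def gauss_def by simp
qed

lemma eventually_close:
  assumes "(f \<longlongrightarrow> (l::real)) at_top" "e > 0" shows "eventually (\<lambda>t. \<bar>f t - l\<bar> < e) at_top"
  using tendstoD[OF assms] by (simp add: dist_real_def)

text \<open>A majorant uniform in large t for dominated convergence. The danger is the factor 1 /
  \<open>gauss w\<close>, which grows like exp (|w|^2 / 2); the squared kernel decays almost like
  exp (-|w|^2) once the mean is nearly 0 and the covariance nearly the identity.\<close>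

lemma HS_bound:
  "eventually (\<lambda>t. \<forall>z w. HS t (z, w) \<le> 4 * (exp (- ((fst z)\<^sup>2 + (snd z)\<^sup>2) / 10) * exp (- ((fst w)\<^sup>2 + (snd w)\<^sup>2) / 10))) at_top"
proof -
  have rat: "((\<lambda>t. cr t / cD t) \<longlongrightarrow> 1) at_top" "((\<lambda>t. cp t / cD t) \<longlongrightarrow> 1) at_top" "((\<lambda>t. cq t / cD t) \<longlongrightarrow> 0) at_top"
    by (rule tendsto_eq_intros lim_c refl | simp)+
  have ev: "eventually (\<lambda>t. \<bar>cr t / cD t - 1\<bar> < 1 / 20) at_top" "eventually (\<lambda>t. \<bar>cp t / cD t - 1\<bar> < 1 / 20) at_top"
      "eventually (\<lambda>t. \<bar>cq t / cD t - 0\<bar> < 1 / 20) at_top" "eventually (\<lambda>t. \<bar>cD t - 1\<bar> < 1 / 2) at_top"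
      "eventually (\<lambda>t. \<bar>a t - 0\<bar> < 1 / 8) at_top" "eventually (\<lambda>t. \<bar>b t - 0\<bar> < 1 / 8) at_top"
      "eventually (\<lambda>t. \<bar>d t - 0\<bar> < 1 / 8) at_top"
    by (rule eventually_close rat lim lim_c | simp)+
  have "eventually (\<lambda>t. \<forall>x v w1 w2. HS t ((x, v), (w1, w2)) \<le> 4 * (exp (- (x\<^sup>2 + v\<^sup>2) / 10) * exp (- (w1\<^sup>2 + w2\<^sup>2) / 10))) at_top"
    using ev
  proof (eventually_elim, intro allI)
    fix t x v w1 w2 :: real
    assume "\<bar>cr t / cD t - 1\<bar> < 1 / 20" "\<bar>cp t / cD t - 1\<bar> < 1 / 20" "\<bar>cq t / cD t - 0\<bar> < 1 / 20"
      "\<bar>cD t - 1\<bar> < 1 / 2" "\<bar>a t - 0\<bar> < 1 / 8" "\<bar>b t - 0\<bar> < 1 / 8" "\<bar>d t - 0\<bar> < 1 / 8"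
    then have h: "\<bar>cr t / cD t - 1\<bar> < 1 / 20" "\<bar>cp t / cD t - 1\<bar> < 1 / 20" "\<bar>cq t / cD t\<bar> < 1 / 20"
      "\<bar>cD t - 1\<bar> < 1 / 2" "\<bar>a t\<bar> < 1 / 8" "\<bar>b t\<bar> < 1 / 8" "\<bar>d t\<bar> < 1 / 8" by simp_all
    define Z where "Z = x\<^sup>2 + v\<^sup>2"
    define W where "W = w1\<^sup>2 + w2\<^sup>2"
    define u1 where "u1 = a t * x + b t * v"
    define u2 where "u2 = - b t * x + d t * v"
    have D: "cD t > 1/2" using h(4) by linarith
    have sq: "y\<^sup>2 \<le> 1 / 64" if "\<bar>y\<bar> < 1 / 8" for y :: real
      using power_mono[of "\<bar>y\<bar>" "1/8" 2] that by (simp add: power2_eq_square)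
    have cs: "(y1 * x + y2 * v)\<^sup>2 \<le> Z / 32" if "\<bar>y1\<bar> < 1/8" "\<bar>y2\<bar> < 1/8" for y1 y2
    proof -
      have "(y1 * x + y2 * v)\<^sup>2 + (y1 * v - y2 * x)\<^sup>2 = (y1\<^sup>2 + y2\<^sup>2) * Z"
        unfolding Z_def by (simp add: power2_eq_square algebra_simps)
      also have "\<dots> \<le> (1 / 32) * Z" using sq[OF that(1)] sq[OF that(2)]
        by (intro mult_right_mono) (auto simp: Z_def)
      finally show ?thesis using zero_le_power2[of "y1 * v - y2 * x"] by linarith
    qed
    have u: "u1\<^sup>2 \<le> Z / 32" "u2\<^sup>2 \<le> Z / 32"
      unfolding u1_def u2_def by (rule cs; use h in simp)+
    define R1 where "R1 = w1 - u1"
    define R2 where "R2 = w2 - u2"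
    have R: "R1\<^sup>2 \<ge> 2/3 * w1\<^sup>2 - 2 * u1\<^sup>2" "R2\<^sup>2 \<ge> 2/3 * w2\<^sup>2 - 2 * u2\<^sup>2"
    proof -
      have "(w - u)\<^sup>2 \<ge> 2/3 * w\<^sup>2 - 2 * u\<^sup>2" for w u :: real
      proof -
        have "(w - u)\<^sup>2 - (2/3 * w\<^sup>2 - 2 * u\<^sup>2) = (w - 3 * u)\<^sup>2 / 3" by (simp add: power2_eq_square field_simps)
        then show ?thesis using zero_le_power2[of "w - 3 * u"] by linarith
      qed
      then show "R1\<^sup>2 \<ge> 2/3 * w1\<^sup>2 - 2 * u1\<^sup>2" "R2\<^sup>2 \<ge> 2/3 * w2\<^sup>2 - 2 * u2\<^sup>2" by (auto simp: R1_def R2_def)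
    qed
    have Q: "Qf t (x, v) (w1, w2) / cD t = cr t / cD t * R1\<^sup>2 - 2 * (cq t / cD t) * (R1 * R2) + cp t / cD t * R2\<^sup>2"
      unfolding Qf_def r1_def r2_def R1_def R2_def u1_def u2_def by (simp add: add_divide_distrib diff_divide_distrib)
    have Q1: "19/20 * R1\<^sup>2 \<le> cr t / cD t * R1\<^sup>2" "19/20 * R2\<^sup>2 \<le> cp t / cD t * R2\<^sup>2"
    proof -
      have "19/20 \<le> cr t / cD t" "19/20 \<le> cp t / cD t" using h(1,2) by linarith+
      note this[THEN mult_right_mono, OF zero_le_power2]
      then show "19/20 * R1\<^sup>2 \<le> cr t / cD t * R1\<^sup>2" "19/20 * R2\<^sup>2 \<le> cp t / cD t * R2\<^sup>2" by this
    qed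
    have Q2: "2 * (cq t / cD t) * (R1 * R2) \<le> 1/20 * (R1\<^sup>2 + R2\<^sup>2)"
    proof -
      have "2 * (cq t / cD t) * (R1 * R2) \<le> \<bar>cq t / cD t\<bar> * (2 * \<bar>R1\<bar> * \<bar>R2\<bar>)"
        by (rule order_trans[OF abs_ge_self]) (simp add: abs_mult mult_ac)
      also have "\<dots> \<le> 1/20 * (\<bar>R1\<bar>\<^sup>2 + \<bar>R2\<bar>\<^sup>2)"
        using h(3) by (intro mult_mono sum_squares_bound) auto
      finally show ?thesis by simp
    qed
    \<comment> \<open>The tolerances give (19/20 - 1/20) (2/3) = 3/5 as coefficient of W, and 3/5 >
      1/2 leaves exp (-W / 10) after division by \<open>gauss w\<close>. The loss in Z stays below
      the Z / 2 available from \<open>gauss z\<close>.\<close>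
    have Q3: "Qf t (x, v) (w1, w2) / cD t \<ge> 3/5 * W - 1/4 * Z"
      unfolding Q using Q1 Q2 R u zero_le_power2[of x] zero_le_power2[of v] unfolding W_def Z_def by argo
    let ?E = "exp (- Z / 10) * exp (- W / 10)"
    have K2: "(K t (x, v) (w1, w2))\<^sup>2 \<le> exp (- (3/5 * W - 1/4 * Z)) / (2 * pi\<^sup>2)"
    proof -
      have "(K t (x, v) (w1, w2))\<^sup>2 = exp (- (Qf t (x, v) (w1, w2) / cD t)) / (4 * pi\<^sup>2 * cD t)"
        unfolding K_def using D by (simp add: power_divide power_mult_distrib exp_double[symmetric])
      also have "\<dots> \<le> exp (- (3/5 * W - 1/4 * Z)) / (2 * pi\<^sup>2)"
        using Q3 D by (intro frac_le) auto
      finally show ?thesis .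
    qed
    have g: "gauss (x, v) = exp (- Z / 2) / (2 * pi)" "gauss (w1, w2) = exp (- W / 2) / (2 * pi)"
      by (simp_all add: gauss_def Z_def W_def)
    have ZW: "Z \<ge> 0" "W \<ge> 0" by (auto simp: Z_def W_def)
    have pi1: "1 \<le> 2 * pi\<^sup>2" "1 \<le> 2 * pi * (2 * pi)"
    proof -
      have "1 \<le> pi" using pi_gt3 by linarith
      then have "1 \<le> pi\<^sup>2" by simp
      then show "1 \<le> 2 * pi\<^sup>2" "1 \<le> 2 * pi * (2 * pi)" by (auto simp: power2_eq_square)
    qed
    have T1: "gauss (x, v) * (K t (x, v) (w1, w2))\<^sup>2 / gauss (w1, w2) \<le> ?E"
    proof -
      have "gauss (x, v) * (K t (x, v) (w1, w2))\<^sup>2 / gauss (w1, w2) = exp (- Z / 2) * exp (W / 2) * (K t (x, v) (w1, w2))\<^sup>2"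
        unfolding g by (simp add: exp_minus field_simps)
      also have "\<dots> \<le> exp (- Z / 2) * exp (W / 2) * (exp (- (3/5 * W - 1/4 * Z)) / (2 * pi\<^sup>2))"
        using K2 by (intro mult_left_mono) auto
      also have "\<dots> = exp (- Z / 4 - W / 10) / (2 * pi\<^sup>2)"
        by (simp add: exp_add[symmetric] field_simps)
      also have "\<dots> \<le> exp (- Z / 4 - W / 10) / 1" using pi1 by (intro divide_left_mono) auto
      also have "\<dots> \<le> exp (- Z / 10 + - W / 10)" using ZW by simp
      finally show ?thesis unfolding exp_add .
    qed
    have T2: "gauss (x, v) * gauss (w1, w2) \<le> ?E"
    proof -
      have "gauss (x, v) * gauss (w1, w2) = exp (- Z / 2 - W / 2) / (2 * pi * (2 * pi))"
        unfolding g by (simp add: exp_add[symmetric] field_simps)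
      also have "\<dots> \<le> exp (- Z / 2 - W / 2) / 1" using pi1 by (intro divide_left_mono) auto
      also have "\<dots> \<le> exp (- Z / 10 + - W / 10)" using ZW by simp
      finally show ?thesis unfolding exp_add .
    qed
    have gp: "gauss (x, v) > 0" "gauss (w1, w2) > 0" by (rule gauss_pos)+
    have s2: "(k - y)\<^sup>2 \<le> 2 * k\<^sup>2 + 2 * y\<^sup>2" for k y :: real
      using zero_le_power2[of "k + y"] by (simp add: power2_eq_square algebra_simps)
    have "HS t ((x, v), (w1, w2)) \<le> gauss (x, v) * (2 * (K t (x, v) (w1, w2))\<^sup>2 + 2 * (gauss (w1, w2))\<^sup>2) / gauss (w1, w2)"
      unfolding HS_def fst_conv snd_conv using gp s2 by (intro divide_right_mono mult_left_mono) auto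
    also have "\<dots> = 2 * (gauss (x, v) * (K t (x, v) (w1, w2))\<^sup>2 / gauss (w1, w2)) + 2 * (gauss (x, v) * gauss (w1, w2))"
      using gp by (simp add: field_simps power2_eq_square)
    also have "\<dots> \<le> 4 * ?E" using T1 T2 by linarith
    finally show "HS t ((x, v), (w1, w2)) \<le> 4 * (exp (- (x\<^sup>2 + v\<^sup>2) / 10) * exp (- (w1\<^sup>2 + w2\<^sup>2) / 10))"
      by (simp add: Z_def W_def)
  qed
  then show ?thesis by (simp only: split_paired_All fst_conv snd_conv)
qed

lemma HS_lim: "((\<lambda>t. \<integral>p. HS t p \<partial>lborel) \<longlongrightarrow> 0) at_top"
proof -
  \<comment> \<open>Dominated convergence asks for measurability at every t, while
    \<open>HS_measurable\<close> needs t > 0; truncating time at 1 does not affect the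
    limit.\<close>
  have "((\<lambda>t. \<integral>p. HS (max 1 t) p \<partial>lborel) \<longlongrightarrow> (\<integral>p. 0 \<partial>(lborel :: ((real \<times> real) \<times> (real \<times> real)) measure))) at_top"
  proof (rule integral_dominated_convergence_at_top[where w = "\<lambda>p. 4 * (exp (- ((fst (fst p))\<^sup>2 + (snd (fst p))\<^sup>2) / 10) * exp (- ((fst (snd p))\<^sup>2 + (snd (snd p))\<^sup>2) / 10))"])
    show "HS (max 1 t) \<in> borel_measurable lborel" for t
      using HS_measurable[of "max 1 t"] by simp
    show "integrable lborel (\<lambda>p :: (real \<times> real) \<times> (real \<times> real). 4 * (exp (- ((fst (fst p))\<^sup>2 + (snd (fst p))\<^sup>2) / 10) * exp (- ((fst (snd p))\<^sup>2 + (snd (snd p))\<^sup>2) / 10)))"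
      by (rule integrable_mult_right[OF integrable_exp_quad2])
    show "\<forall>\<^sub>F t in at_top. AE p in lborel. norm (HS (max 1 t) p) \<le> 4 * (exp (- ((fst (fst p))\<^sup>2 + (snd (fst p))\<^sup>2) / 10) * exp (- ((fst (snd p))\<^sup>2 + (snd (snd p))\<^sup>2) / 10))"
      using HS_bound eventually_ge_at_top[of 1]
    proof eventually_elim
      case (elim t)
      have "norm (HS (max 1 t) p) = HS t p" for p
        using elim gauss_pos by (simp add: HS_def max_absorb2 less_imp_le abs_mult)
      then show ?case using elim by (intro AE_I2) (metis prod.collapse)
    qed
    show "AE p in lborel. ((\<lambda>t. HS (max 1 t) p) \<longlongrightarrow> 0) at_top"
    proof (rule AE_I2)
      fix p :: "(real \<times> real) \<times> (real \<times> real)"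
      have "((\<lambda>t. HS t p) \<longlongrightarrow> gauss (fst p) * (gauss (snd p) - gauss (snd p))\<^sup>2 / gauss (snd p)) at_top"
        unfolding HS_def by (intro tendsto_intros K_lim) (simp add: less_imp_neq[OF gauss_pos, symmetric])
      then have l: "((\<lambda>t. HS t p) \<longlongrightarrow> 0) at_top" by simp
      have "eventually (\<lambda>t. HS t p = HS (max 1 t) p) at_top"
        using eventually_ge_at_top[of 1] by eventually_elim (simp add: max_absorb2)
      then show "((\<lambda>t. HS (max 1 t) p) \<longlongrightarrow> 0) at_top" using l tendsto_cong by fastforce
    qed
  qed simp
  then have l: "((\<lambda>t. \<integral>p. HS (max 1 t) p \<partial>lborel) \<longlongrightarrow> 0) at_top" by simp
  have "eventually (\<lambda>t. (\<integral>p. HS (max 1 t) p \<partial>lborel) = (\<integral>p. HS t p \<partial>lborel)) at_top"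
    using eventually_ge_at_top[of 1] by eventually_elim (simp add: max_absorb2)
  then show ?thesis using l by (rule Lim_transform_eventually[rotated])
qed

text \<open>The operator norm is dominated by the Hilbert-Schmidt norm, which tends to 0. The
  threshold 1/16 for its square means contraction by 1/4.\<close>

lemma contraction_time:
  obtains T where "T > 0"
    "\<And>\<phi> k. \<phi> \<in> borel_measurable borel \<Longrightarrow> (\<And>w. \<bar>\<phi> w\<bar> \<le> k) \<Longrightarrow>
      (\<integral>z. gauss z * (P T \<phi> z - (\<integral>w. gauss w * \<phi> w \<partial>lborel))\<^sup>2 \<partial>lborel) \<le> 1/16 * (\<integral>w. gauss w * (\<phi> w)\<^sup>2 \<partial>lborel)"
proof -
  have "eventually (\<lambda>t. \<bar>(\<integral>p. HS t p \<partial>lborel) - 0\<bar> < 1/16) at_top"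
    by (rule eventually_close[OF HS_lim]) simp
  with HS_bound eventually_gt_at_top[of 0]
  have "eventually (\<lambda>t. t > 0 \<and> (\<integral>p. HS t p \<partial>lborel) < 1/16 \<and>
      (\<forall>z w. HS t (z, w) \<le> 4 * (exp (- ((fst z)\<^sup>2 + (snd z)\<^sup>2) / 10) * exp (- ((fst w)\<^sup>2 + (snd w)\<^sup>2) / 10)))) at_top"
    by eventually_elim auto
  then obtain T where T: "T > 0" "(\<integral>p. HS T p \<partial>lborel) < 1/16"
    "\<And>z w. HS T (z, w) \<le> 4 * (exp (- ((fst z)\<^sup>2 + (snd z)\<^sup>2) / 10) * exp (- ((fst w)\<^sup>2 + (snd w)\<^sup>2) / 10))"
    using eventually_happens'[OF trivial_limit_at_top_linorder] by blast
  have HS0: "HS T p \<ge> 0" for p using gauss_pos by (simp add: HS_def less_imp_le)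
  have iHS: "integrable lborel (HS T)"
  proof (rule Bochner_Integration.integrable_bound[OF integrable_mult_right[OF integrable_exp_quad2, of 4]])
    show "HS T \<in> borel_measurable lborel" using HS_measurable[OF T(1)] by simp
    show "AE p in lborel. norm (HS T p) \<le> norm (4 * (exp (- ((fst (fst p))\<^sup>2 + (snd (fst p))\<^sup>2) / 10) * exp (- ((fst (snd p))\<^sup>2 + (snd (snd p))\<^sup>2) / 10)))"
    proof (rule AE_I2)
      fix p :: "(real \<times> real) \<times> (real \<times> real)"
      show "norm (HS T p) \<le> norm (4 * (exp (- ((fst (fst p))\<^sup>2 + (snd (fst p))\<^sup>2) / 10) * exp (- ((fst (snd p))\<^sup>2 + (snd (snd p))\<^sup>2) / 10)))"
        using T(3)[of "fst p" "snd p"] HS0[of p] by (simp only: prod.collapse real_norm_def abs_of_nonneg)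
    qed
  qed
  have iHS': "integrable (lborel \<Otimes>\<^sub>M lborel) (HS T)" using iHS by (simp add: lborel_prod)
  show thesis
  proof (rule that[OF T(1)])
    fix \<phi> :: "real \<times> real \<Rightarrow> real" and k :: real
    assume m [measurable]: "\<phi> \<in> borel_measurable borel" and k: "\<And>w. \<bar>\<phi> w\<bar> \<le> k"
    note [measurable] = K_measurable[OF T(1)]
    let ?m = "\<integral>w. gauss w * \<phi> w \<partial>lborel"
    let ?S = "\<integral>w. gauss w * (\<phi> w)\<^sup>2 \<partial>lborel"
    have k2: "\<bar>(\<phi> w)\<^sup>2\<bar> \<le> k\<^sup>2" for w using power_mono[OF k[of w], of 2] by simp
    have i1: "integrable lborel (\<lambda>w. gauss w * \<phi> w)"
      using bounded_integrable_gauss2[of \<phi> k] k by (simp add: integrable_gauss2)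
    have i2: "integrable lborel (\<lambda>w. gauss w * (\<phi> w)\<^sup>2)"
      using bounded_integrable_gauss2[of "\<lambda>w. (\<phi> w)\<^sup>2" "k\<^sup>2"] k2 by (simp add: integrable_gauss2)
    have i3: "integrable lborel (\<lambda>w. K T z w * \<phi> w)" for z
      unfolding integral_K(2)[OF T(1) m] by (rule bounded_integrable_gauss2[of _ k]) (use k in auto)
    have pt: "gauss z * (P T \<phi> z - ?m)\<^sup>2 \<le> (\<integral>w. HS T (z, w) \<partial>lborel) * ?S"
      if iz: "integrable lborel (\<lambda>w. HS T (z, w))" for z
    proof -
      \<comment> \<open>The weight sqrt (\<open>gauss w\<close>) is split off so that the squares of
        the two factors are \<open>HS / gauss z\<close> and the weighted square of \<phi>.
        Integrability in w is guaranteed for almost every z only, which is why it is a premise of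
        \<open>pt\<close>.\<close>
      let ?f = "\<lambda>w. (K T z w - gauss w) / sqrt (gauss w)" and ?g = "\<lambda>w. sqrt (gauss w) * \<phi> w"
      have sg: "sqrt (gauss w) > 0" "(sqrt (gauss w))\<^sup>2 = gauss w" for w using gauss_pos[of w] by auto
      have f2: "(?f w)\<^sup>2 = HS T (z, w) / gauss z" for w
        using gauss_pos[of z] sg(2)[of w] by (simp add: HS_def power_divide)
      have g2: "(?g w)\<^sup>2 = gauss w * (\<phi> w)\<^sup>2" for w
        using sg(2)[of w] by (simp add: power_mult_distrib)
      have "P T \<phi> z - ?m = (\<integral>w. K T z w * \<phi> w - gauss w * \<phi> w \<partial>lborel)"
        unfolding P_def using i1 i3 by simp
      also have "\<dots> = (\<integral>w. ?f w * ?g w \<partial>lborel)"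
      proof (rule Bochner_Integration.integral_cong[OF refl])
        fix w show "K T z w * \<phi> w - gauss w * \<phi> w = ?f w * ?g w" using sg(1)[of w] by (simp add: field_simps)
      qed
      finally have "(P T \<phi> z - ?m)\<^sup>2 = (\<integral>w. ?f w * ?g w \<partial>lborel)\<^sup>2" by simp
      also have "\<dots> \<le> (\<integral>w. (?f w)\<^sup>2 \<partial>lborel) * (\<integral>w. (?g w)\<^sup>2 \<partial>lborel)"
      proof (rule integral_Cauchy_Schwarz)
        show "?f \<in> borel_measurable lborel" "?g \<in> borel_measurable lborel" by measurable
        show "integrable lborel (\<lambda>w. (?f w)\<^sup>2)" unfolding f2 using iz by simp
        show "integrable lborel (\<lambda>w. (?g w)\<^sup>2)" unfolding g2 by (rule i2)
      qed
      also have "\<dots> = (\<integral>w. HS T (z, w) \<partial>lborel) / gauss z * ?S" unfolding f2 g2 by simp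
      finally show ?thesis using gauss_pos[of z] by (simp add: field_simps)
    qed
    have "(\<integral>z. gauss z * (P T \<phi> z - ?m)\<^sup>2 \<partial>lborel) \<le> (\<integral>z. (\<integral>w. HS T (z, w) \<partial>lborel) * ?S \<partial>lborel)"
    proof (rule integral_mono_AE)
      have "\<bar>(P T \<phi> z - ?m)\<^sup>2\<bar> \<le> (2 * k)\<^sup>2" for z
      proof -
        have "\<bar>?m\<bar> \<le> (\<integral>\<xi>. \<bar>\<phi> \<xi>\<bar> \<partial>gauss2)"
          unfolding integral_gauss2[OF m, symmetric] by (rule integral_abs_bound)
        also have "\<dots> \<le> (\<integral>\<xi>. k \<partial>gauss2)"
          using bounded_integrable_gauss2[OF m k] k by (intro integral_mono) auto
        finally have "\<bar>?m\<bar> \<le> k" by (simp add: gauss2.prob_space)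
        then have "\<bar>P T \<phi> z - ?m\<bar> \<le> 2 * k" using P_bound[OF T(1) m k, of z] by linarith
        then show ?thesis using power_mono[of "\<bar>P T \<phi> z - ?m\<bar>" "2 * k" 2] by simp
      qed
      then have "integrable gauss2 (\<lambda>z. (P T \<phi> z - ?m)\<^sup>2)"
        using P_measurable(1)[OF T(1) m] by (intro bounded_integrable_gauss2[of _ "(2 * k)\<^sup>2"]) auto
      then show "integrable lborel (\<lambda>z. gauss z * (P T \<phi> z - ?m)\<^sup>2)"
        using P_measurable(1)[OF T(1) m] by (subst (asm) integrable_gauss2) auto
      show "integrable lborel (\<lambda>z. (\<integral>w. HS T (z, w) \<partial>lborel) * ?S)"
        using lborel_pair.integrable_fst'[OF iHS'] by (intro integrable_mult_left) auto
      show "AE z in lborel. gauss z * (P T \<phi> z - ?m)\<^sup>2 \<le> (\<integral>w. HS T (z, w) \<partial>lborel) * ?S"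
        using lborel_pair.AE_integrable_fst'[OF iHS'] by eventually_elim (rule pt)
    qed
    also have "\<dots> = (\<integral>p. HS T p \<partial>lborel) * ?S"
      using lborel_pair.integral_fst'[OF iHS'] by (simp add: lborel_prod)
    also have "\<dots> \<le> 1/16 * ?S"
      using T(2) gauss_pos by (intro mult_right_mono integral_nonneg_AE AE_I2) (auto simp: less_imp_le)
    finally show "(\<integral>z. gauss z * (P T \<phi> z - ?m)\<^sup>2 \<partial>lborel) \<le> 1/16 * ?S" .
  qed
qed

end

section \<open>Cutoff functions and the weak formulation\<close>

text \<open>Powers of the positive part of order at least 2 are differentiable also at the kink. The
  cutoff uses the third power, so that it still has two continuous derivatives in v.\<close>

lemma DERIV_max_power:
  "((\<lambda>y::real. (max 0 y) ^ Suc (Suc n)) has_real_derivative (real (Suc (Suc n)) * (max 0 y) ^ Suc n)) (at y)"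
proof -
  consider "y > 0" | "y < 0" | "y = 0" by linarith
  then show ?thesis
  proof cases
    case 1
    have "((\<lambda>y. y ^ Suc (Suc n)) has_real_derivative (real (Suc (Suc n)) * y ^ Suc n)) (at y)"
      by (rule DERIV_cong[OF DERIV_pow]) simp
    then have "((\<lambda>y. (max 0 y) ^ Suc (Suc n)) has_real_derivative (real (Suc (Suc n)) * y ^ Suc n)) (at y)"
      by (rule has_field_derivative_transform_within_open[of _ _ _ "{0<..}"]) (use 1 in \<open>auto simp: max_def\<close>)
    then show ?thesis using 1 by (simp add: max_def)
  next
    case 2
    have "((\<lambda>y. (max 0 y) ^ Suc (Suc n)) has_real_derivative 0) (at y)"
      by (rule has_field_derivative_transform_within_open[of "\<lambda>_. 0" _ _ "{..<0}"]) (use 2 in \<open>auto simp: max_def\<close>)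
    then show ?thesis using 2 by (simp add: max_def)
  next
    case 3
    have "((\<lambda>h::real. ((max 0 (0 + h)) ^ Suc (Suc n) - (max 0 0) ^ Suc (Suc n)) / h) \<longlongrightarrow> 0) (at 0)"
    proof (rule tendsto_0_le[of "\<lambda>h. \<bar>h\<bar> ^ Suc n" _ _ 1])
      have "((\<lambda>h::real. \<bar>h\<bar> ^ Suc n) \<longlongrightarrow> \<bar>0\<bar> ^ Suc n) (at 0)" by (intro tendsto_intros)
      then show "((\<lambda>h::real. \<bar>h\<bar> ^ Suc n) \<longlongrightarrow> 0) (at 0)" by simp
      show "\<forall>\<^sub>F h::real in at 0. norm (((max 0 (0 + h)) ^ Suc (Suc n) - (max 0 0) ^ Suc (Suc n)) / h) \<le> norm (\<bar>h\<bar> ^ Suc n) * 1"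
      proof (rule always_eventually, rule allI)
        fix h :: real
        show "norm (((max 0 (0 + h)) ^ Suc (Suc n) - (max 0 0) ^ Suc (Suc n)) / h) \<le> norm (\<bar>h\<bar> ^ Suc n) * 1"
          by (cases "h > 0") (auto simp: max_def abs_mult mult_nonpos_nonneg)
      qed
    qed
    then show ?thesis unfolding 3 DERIV_def by simp
  qed
qed

text \<open>The logarithm makes v times the v-derivative of the cutoff small, and as a function of
  the energy the cutoff is invariant under the free transport.\<close>

definition rho :: "real \<times> real \<Rightarrow> real" where "rho z = 1 + (fst z)\<^sup>2 + (snd z)\<^sup>2"
definition chiy :: "real \<Rightarrow> real \<times> real \<Rightarrow> real" where "chiy R z = max 0 (1 - ln (rho z) / R)"
definition chi :: "real \<Rightarrow> real \<times> real \<Rightarrow> real" where "chi R z = (chiy R z) ^ 3"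
definition chix :: "real \<Rightarrow> real \<times> real \<Rightarrow> real" where
  "chix R z = 3 * (chiy R z) ^ 2 * (- (2 * fst z / rho z) / R)"
definition chiv :: "real \<Rightarrow> real \<times> real \<Rightarrow> real" where
  "chiv R z = 3 * (chiy R z) ^ 2 * (- (2 * snd z / rho z) / R)"
definition chivv :: "real \<Rightarrow> real \<times> real \<Rightarrow> real" where
  "chivv R z = 6 * chiy R z * (2 * snd z / rho z / R)\<^sup>2 - 3 * (chiy R z) ^ 2 * ((2 * rho z - 4 * (snd z)\<^sup>2) / (rho z)\<^sup>2 / R)"

lemma rho_ge: "rho z \<ge> 1" by (simp add: rho_def)

lemma rho_pos: "rho z > 0" using rho_ge[of z] by linarith

lemma chiy_range: "R > 0 \<Longrightarrow> 0 \<le> chiy R z" "R > 0 \<Longrightarrow> chiy R z \<le> 1"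
  using rho_ge[of z] by (auto simp: chiy_def)

lemma deriv_chix: assumes "R > 0" shows "((\<lambda>x. chi R (x, v)) has_real_derivative chix R (x, v)) (at x)"
proof -
  have "((\<lambda>x. 1 - ln (rho (x, v)) / R) has_real_derivative (- (2 * x / rho (x, v)) / R)) (at x)"
    unfolding rho_def using assms by (auto intro!: derivative_eq_intros simp: add_pos_nonneg)
  from DERIV_chain2[OF DERIV_max_power[of 1] this]
  show ?thesis unfolding chi_def chix_def chiy_def by (simp add: numeral_eq_Suc)
qed

lemma deriv_ln_rho: "R > 0 \<Longrightarrow> ((\<lambda>v. 1 - ln (rho (x, v)) / R) has_real_derivative (- (2 * v / rho (x, v)) / R)) (at v)"
  unfolding rho_def by (auto intro!: derivative_eq_intros simp: add_pos_nonneg)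

lemma deriv_chiv: assumes "R > 0" shows "((\<lambda>v. chi R (x, v)) has_real_derivative chiv R (x, v)) (at v)"
  using DERIV_chain2[OF DERIV_max_power[of 1] deriv_ln_rho[OF assms, of x v]]
  unfolding chi_def chiv_def chiy_def by (simp add: numeral_eq_Suc)

lemma deriv_chivv: assumes "R > 0" shows "((\<lambda>v. chiv R (x, v)) has_real_derivative chivv R (x, v)) (at v)"
proof -
  have 1: "((\<lambda>v. (chiy R (x, v))\<^sup>2) has_real_derivative (2 * chiy R (x, v) * (- (2 * v / rho (x, v)) / R))) (at v)"
    using DERIV_chain2[OF DERIV_max_power[of 0] deriv_ln_rho[OF assms, of x v]]
    unfolding chiy_def by (simp add: numeral_eq_Suc)
  have r: "rho (x, v) \<noteq> 0" using rho_pos[of "(x, v)"] by simp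
  have 2: "((\<lambda>v. - (2 * v / rho (x, v)) / R) has_real_derivative (- ((2 * rho (x, v) - 4 * v\<^sup>2) / (rho (x, v))\<^sup>2) / R)) (at v)"
  proof -
    have dr: "((\<lambda>v. rho (x, v)) has_real_derivative (2 * v)) (at v)"
      unfolding rho_def by (auto intro!: derivative_eq_intros)
    have "((\<lambda>v. - (2 * v / rho (x, v)) / R) has_real_derivative (- ((2 * rho (x, v) - 2 * v * (2 * v)) / (rho (x, v) * rho (x, v))) / R)) (at v)"
      using r by (intro DERIV_cdivide DERIV_minus DERIV_divide dr) (auto intro!: derivative_eq_intros)
    then show ?thesis by (simp add: power2_eq_square)
  qed
  show ?thesis unfolding chiv_def chivv_def snd_conv
    by (rule DERIV_cong[OF DERIV_mult[OF DERIV_cmult[OF 1] 2]]) (simp add: power2_eq_square algebra_simps)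
qed

lemma cont_chi:
  assumes "R > 0"
  shows "continuous_on UNIV (chi R)" "continuous_on UNIV (chix R)" "continuous_on UNIV (chiv R)" "continuous_on UNIV (chivv R)"
proof -
  have r: "continuous_on UNIV rho" unfolding rho_def by (intro continuous_intros)
  have n: "rho z \<noteq> 0" for z using rho_pos[of z] by simp
  have y: "continuous_on UNIV (chiy R)" unfolding chiy_def using n assms by (intro continuous_intros r) auto
  show "continuous_on UNIV (chi R)" "continuous_on UNIV (chix R)" "continuous_on UNIV (chiv R)" "continuous_on UNIV (chivv R)"
    unfolding chi_def chix_def chiv_def chivv_def using n assms by (auto intro!: continuous_intros r y)
qed

lemma chiy_outside:
  assumes R: "R > 0" and z: "z \<notin> box2 (exp R)"
  shows "chiy R z = 0"
proof -
  have "\<bar>fst z\<bar> > exp R \<or> \<bar>snd z\<bar> > exp R" using z by (cases z) auto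
  moreover have "y\<^sup>2 \<ge> exp R" if "\<bar>y\<bar> > exp R" for y
  proof -
    have "1 \<le> exp R" using R by simp
    then have "exp R * 1 \<le> \<bar>y\<bar> * \<bar>y\<bar>" using that by (intro mult_mono) linarith+
    then show ?thesis by (simp add: power2_eq_square)
  qed
  ultimately have "rho z \<ge> exp R" unfolding rho_def using zero_le_power2[of "fst z"] zero_le_power2[of "snd z"]
    by (smt (verit))
  then have "ln (rho z) \<ge> R" using rho_pos[of z] by (simp add: ln_ge_iff)
  then show ?thesis using R by (simp add: chiy_def)
qed

lemma chi_outside:
  assumes "R > 0" "z \<notin> box2 (exp R)"
  shows "chi R z = 0" "chix R z = 0" "chiv R z = 0" "chivv R z = 0"
  using chiy_outside[OF assms] by (auto simp: chi_def chix_def chiv_def chivv_def)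

lemma Cc_chi: "R > 0 \<Longrightarrow> Cc (chi R)"
  unfolding Cc_def using cont_chi(1) chi_outside(1) by blast

lemma chi_range: "R > 0 \<Longrightarrow> 0 \<le> chi R z" "R > 0 \<Longrightarrow> chi R z \<le> 1"
  using chiy_range[of R z] by (auto simp: chi_def power_le_one)

text \<open>The gradient of ln rho, its product with v and its v-derivative are all bounded, so each
  derivative of the cutoff is O(1/R), even after multiplication by v. The numerical constants are
  generous; only the factor 1/R matters.\<close>

lemma chi_bounds:
  assumes R: "R \<ge> 1"
  shows "\<bar>chiv R z\<bar> \<le> 6 / R" "\<bar>snd z * chiv R z\<bar> \<le> 6 / R" "\<bar>chivv R z\<bar> \<le> 42 / R"
proof -
  have R0: "R > 0" using R by simp
  note y = chiy_range[OF R0, of z]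
  have y2: "0 \<le> (chiy R z)\<^sup>2" "(chiy R z)\<^sup>2 \<le> 1" using y by (auto simp: power_le_one)
  define v where "v = snd z"
  define r where "r = rho z"
  have r: "r > 0" "v\<^sup>2 \<le> r" "1 \<le> r" using rho_pos[of z] by (auto simp: r_def rho_def v_def)
  have "\<bar>2 * v\<bar> \<le> 1 + v\<^sup>2" using zero_le_power2[of "\<bar>v\<bar> - 1"] by (simp add: power2_diff)
  also have "\<dots> \<le> r" by (simp add: r_def rho_def v_def)
  finally have q1: "\<bar>2 * v / r\<bar> \<le> 1" using r by (simp add: abs_divide divide_le_eq)
  have q2: "\<bar>2 * v * v / r\<bar> \<le> 2" using r by (simp add: abs_divide abs_mult divide_le_eq power2_eq_square[symmetric])
  have "\<bar>chiv R z\<bar> = 3 * (chiy R z)\<^sup>2 * \<bar>2 * v / r\<bar> / R"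
    using R0 by (simp add: chiv_def v_def r_def abs_mult abs_divide)
  also have "\<dots> \<le> 3 * 1 * 1 / R" using y2 q1 R0 by (intro divide_right_mono mult_mono) auto
  finally show "\<bar>chiv R z\<bar> \<le> 6 / R" using R0 by (simp add: divide_right_mono field_simps)
  have "\<bar>snd z * chiv R z\<bar> = 3 * (chiy R z)\<^sup>2 * \<bar>2 * v * v / r\<bar> / R"
    using R0 by (simp add: chiv_def v_def r_def abs_mult abs_divide mult_ac)
  also have "\<dots> \<le> 3 * 1 * 2 / R" using y2 q2 R0 by (intro divide_right_mono mult_mono) auto
  finally show "\<bar>snd z * chiv R z\<bar> \<le> 6 / R" by simp
  have q3: "(2 * v / r / R)\<^sup>2 \<le> 1 / R"
  proof -
    have "(2 * v / r)\<^sup>2 \<le> 1" using q1 by (simp add: abs_square_le_1)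
    then have "(2 * v / r / R)\<^sup>2 \<le> 1 / R\<^sup>2" using R0 unfolding power_divide[of "2 * v / r" R] by (intro divide_right_mono) auto
    also have "\<dots> \<le> 1 / R" using R R0 by (intro divide_left_mono) (auto simp: power2_eq_square)
    finally show ?thesis .
  qed
  have q4: "\<bar>(2 * r - 4 * v\<^sup>2) / r\<^sup>2\<bar> \<le> 6"
  proof -
    have "\<bar>2 * r - 4 * v\<^sup>2\<bar> \<le> 6 * r" unfolding abs_le_iff using r zero_le_power2[of v] by (intro conjI) linarith+
    also have "\<dots> \<le> 6 * r\<^sup>2" using r by (simp add: power2_eq_square)
    finally show ?thesis using r by (simp add: abs_divide divide_le_eq)
  qed
  have "\<bar>chivv R z\<bar> \<le> 6 * chiy R z * (2 * v / r / R)\<^sup>2 + 3 * (chiy R z)\<^sup>2 * (\<bar>(2 * r - 4 * v\<^sup>2) / r\<^sup>2\<bar> / R)"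
    unfolding chivv_def v_def[symmetric] r_def[symmetric] using y R0
    by (intro order_trans[OF abs_triangle_ineq4] add_mono) (auto simp: abs_mult abs_divide)
  also have "\<dots> \<le> 6 * 1 * (1 / R) + 3 * 1 * (6 / R)"
    using y y2 q3 q4 R0 by (intro add_mono mult_mono divide_right_mono) auto
  also have "\<dots> \<le> 42 / R" using R0 by (simp add: field_simps)
  finally show "\<bar>chivv R z\<bar> \<le> 42 / R" .
qed

lemma chi_lim: "(\<lambda>n. chi (real (Suc n)) z) \<longlonglongrightarrow> 1"
proof -
  have e: "(\<lambda>n. 1 - ln (rho z) * inverse (real (Suc n))) \<longlonglongrightarrow> 1 - ln (rho z) * 0"
    by (rule tendsto_diff[OF tendsto_const tendsto_mult_left[OF LIMSEQ_inverse_real_of_nat]])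
  from tendsto_power[OF tendsto_max[OF tendsto_const[of 0] e], of 3]
  show ?thesis by (simp add: chi_def chiy_def divide_inverse)
qed

section \<open>Integration by parts and the weak formulation\<close>

lemma ibp_aux:
  fixes F f :: "real \<Rightarrow> real"
  assumes d: "\<And>x. (F has_real_derivative f x) (at x)" and c: "continuous_on UNIV f"
    and z: "\<And>x. \<bar>x\<bar> > N \<Longrightarrow> F x = 0" "\<And>x. \<bar>x\<bar> > N \<Longrightarrow> f x = 0"
  shows "(\<integral>x. f x \<partial>lborel) = 0"
proof -
  let ?M = "\<bar>N\<bar> + 1"
  have "(\<integral>x. f x \<partial>lborel) = (\<integral>x. f x * indicator {- ?M .. ?M} x \<partial>lborel)"
  proof (rule Bochner_Integration.integral_cong[OF refl])
    fix x show "f x = f x * indicator {- ?M .. ?M} x"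
      using z(2)[of x] by (cases "\<bar>x\<bar> > N") (auto simp: indicator_def)
  qed
  also have "\<dots> = F ?M - F (- ?M)"
    by (rule integral_FTC_Icc_real) (use d c in \<open>auto simp: continuous_on_eq_continuous_at\<close>)
  also have "\<dots> = 0" using z(1)[of ?M] z(1)[of "- ?M"] by simp
  finally show ?thesis .
qed

lemma integral_deriv_x_zero:
  fixes F Fx :: "real \<times> real \<Rightarrow> real"
  assumes d: "\<And>x v. ((\<lambda>x. F (x, v)) has_real_derivative Fx (x, v)) (at x)" and c: "continuous_on UNIV Fx"
    and z: "\<And>z. z \<notin> box2 N \<Longrightarrow> F z = 0" "\<And>z. z \<notin> box2 N \<Longrightarrow> Fx z = 0"
  shows "integrable lborel Fx" "(\<integral>z. Fx z \<partial>lborel) = 0"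
proof -
  have "Cc Fx" unfolding Cc_def using c z(2) by blast
  then show i: "integrable lborel Fx" by (rule Cc_integrable)
  then have i': "integrable (lborel \<Otimes>\<^sub>M lborel) (\<lambda>(x, v). Fx (x, v))" by (simp add: lborel_prod)
  have "(\<integral>z. Fx z \<partial>lborel) = (\<integral>v. \<integral>x. Fx (x, v) \<partial>lborel \<partial>lborel)"
    using lborel_pair.integral_snd[OF i'] by (simp add: lborel_prod)
  also have "\<dots> = (\<integral>v. 0 \<partial>(lborel :: real measure))"
  proof (rule Bochner_Integration.integral_cong[OF refl])
    fix v
    show "(\<integral>x. Fx (x, v) \<partial>lborel) = 0"
    proof (rule ibp_aux[OF d, of _ N])
      fix x assume "\<bar>x\<bar> > N"
      then have "(x, v) \<notin> box2 N" by auto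
      then show "F (x, v) = 0" "Fx (x, v) = 0" by (rule z)+
    qed (auto intro!: continuous_on_compose2[OF c] continuous_intros)
  qed
  finally show "(\<integral>z. Fx z \<partial>lborel) = 0" by simp
qed

lemma integral_deriv_v_zero:
  fixes F Fv :: "real \<times> real \<Rightarrow> real"
  assumes d: "\<And>x v. ((\<lambda>v. F (x, v)) has_real_derivative Fv (x, v)) (at v)" and c: "continuous_on UNIV Fv"
    and z: "\<And>z. z \<notin> box2 N \<Longrightarrow> F z = 0" "\<And>z. z \<notin> box2 N \<Longrightarrow> Fv z = 0"
  shows "integrable lborel Fv" "(\<integral>z. Fv z \<partial>lborel) = 0"
proof -
  have "Cc Fv" unfolding Cc_def using c z(2) by blast
  then show i: "integrable lborel Fv" by (rule Cc_integrable)
  then have i': "integrable (lborel \<Otimes>\<^sub>M lborel) Fv" by (simp add: lborel_prod)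
  have "(\<integral>z. Fv z \<partial>lborel) = (\<integral>x. \<integral>v. Fv (x, v) \<partial>lborel \<partial>lborel)"
    using lborel_pair.integral_fst'[OF i'] by (simp add: lborel_prod)
  also have "\<dots> = (\<integral>x. 0 \<partial>(lborel :: real measure))"
  proof (rule Bochner_Integration.integral_cong[OF refl])
    fix x
    show "(\<integral>v. Fv (x, v) \<partial>lborel) = 0"
    proof (rule ibp_aux[OF d, of _ N])
      fix v assume "\<bar>v\<bar> > N"
      then have "(x, v) \<notin> box2 N" by auto
      then show "F (x, v) = 0" "Fv (x, v) = 0" by (rule z)+
    qed (auto intro!: continuous_on_compose2[OF c] continuous_intros)
  qed
  finally show "(\<integral>z. Fv z \<partial>lborel) = 0" by simp
qed

text \<open>The forward operator acting on g and the backward operator acting on p are adjoint in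
  L^2(dx dv), so without c the integrand is a divergence up to the J term. With the cutoff, the
  commutators with diffusion and friction survive, while the commutator with transport cancels by
  \<open>rad\<close>.\<close>

lemma weak_identity:
  fixes g gt gx gv gvv J Jv p pt px pv pvv c cx cv cvv :: "real \<times> real \<Rightarrow> real"
  assumes dg: "\<And>x v. ((\<lambda>x. g (x, v)) has_real_derivative gx (x, v)) (at x)"
      "\<And>x v. ((\<lambda>v. g (x, v)) has_real_derivative gv (x, v)) (at v)"
      "\<And>x v. ((\<lambda>v. gv (x, v)) has_real_derivative gvv (x, v)) (at v)"
      "\<And>x v. ((\<lambda>v. J (x, v)) has_real_derivative Jv (x, v)) (at v)"
    and dp: "\<And>x v. ((\<lambda>x. p (x, v)) has_real_derivative px (x, v)) (at x)"
      "\<And>x v. ((\<lambda>v. p (x, v)) has_real_derivative pv (x, v)) (at v)"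
      "\<And>x v. ((\<lambda>v. pv (x, v)) has_real_derivative pvv (x, v)) (at v)"
    and dc: "\<And>x v. ((\<lambda>x. c (x, v)) has_real_derivative cx (x, v)) (at x)"
      "\<And>x v. ((\<lambda>v. c (x, v)) has_real_derivative cv (x, v)) (at v)"
      "\<And>x v. ((\<lambda>v. cv (x, v)) has_real_derivative cvv (x, v)) (at v)"
    and C: "continuous_on UNIV g" "continuous_on UNIV gx" "continuous_on UNIV gv" "continuous_on UNIV gvv"
      "continuous_on UNIV J" "continuous_on UNIV Jv"
      "continuous_on UNIV p" "continuous_on UNIV px" "continuous_on UNIV pv" "continuous_on UNIV pvv"
      "continuous_on UNIV c" "continuous_on UNIV cx" "continuous_on UNIV cv" "continuous_on UNIV cvv"
    and z: "\<And>z. z \<notin> box2 N \<Longrightarrow> c z = 0" "\<And>z. z \<notin> box2 N \<Longrightarrow> cx z = 0"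
      "\<And>z. z \<notin> box2 N \<Longrightarrow> cv z = 0" "\<And>z. z \<notin> box2 N \<Longrightarrow> cvv z = 0"
    and rad: "\<And>z. snd z * cx z = fst z * cv z"
    and pdeg: "\<And>z. gt z = - \<omega> * snd z * gx z + \<omega> * fst z * gv z - Jv z + 2 * \<nu> * (g z + snd z * gv z + gvv z)"
    and pdep: "\<And>z. pt z = \<omega> * snd z * px z - (\<omega> * fst z + 2 * \<nu> * snd z) * pv z + 2 * \<nu> * pvv z"
  shows "(\<integral>z. (gt z * p z - g z * pt z) * c z \<partial>lborel) =
     (\<integral>z. g z * (p z * (2 * \<nu> * cvv z - 2 * \<nu> * (snd z * cv z)) + 4 * \<nu> * pv z * cv z) + J z * (pv z * c z + p z * cv z) \<partial>lborel)"
proof -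
  note [continuous_intros] = C
  \<comment> \<open>\<open>A\<close> and \<open>B\<close> are the x- and v-fluxes whose divergence
    makes up the difference of both integrands; \<open>Q\<close> and \<open>Qv\<close> are the first
    and second v-derivatives of p c. Compact support of c makes both flux integrals vanish.\<close>
  define A where "A = (\<lambda>z. - \<omega> * snd z * (g z * (p z * c z)))"
  define Ax where "Ax = (\<lambda>z. - \<omega> * snd z * (gx z * (p z * c z) + g z * (px z * c z + p z * cx z)))"
  define Q where "Q = (\<lambda>z. pv z * c z + p z * cv z)"
  define Qv where "Qv = (\<lambda>z. pvv z * c z + 2 * pv z * cv z + p z * cvv z)"
  define B where "B = (\<lambda>z. \<omega> * fst z * (g z * (p z * c z)) - J z * (p z * c z) + 2 * \<nu> * (snd z * (g z * (p z * c z)))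
     + 2 * \<nu> * (gv z * (p z * c z) - g z * Q z))"
  define Bv where "Bv = (\<lambda>z. \<omega> * fst z * (gv z * (p z * c z) + g z * Q z) - (Jv z * (p z * c z) + J z * Q z)
     + 2 * \<nu> * (g z * (p z * c z) + snd z * (gv z * (p z * c z) + g z * Q z))
     + 2 * \<nu> * (gvv z * (p z * c z) - g z * Qv z))"
  have cQ: "continuous_on UNIV Q" "continuous_on UNIV Qv" unfolding Q_def Qv_def by (intro continuous_intros)+
  note [continuous_intros] = cQ
  have dpc: "((\<lambda>v. p (x, v) * c (x, v)) has_real_derivative Q (x, v)) (at v)" for x v
    unfolding Q_def by (rule derivative_eq_intros dp dc refl)+ simp
  have dQ: "((\<lambda>v. Q (x, v)) has_real_derivative Qv (x, v)) (at v)" for x v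
    unfolding Q_def Qv_def by (rule derivative_eq_intros dp dc refl)+ (simp add: algebra_simps)
  have dA: "((\<lambda>x. A (x, v)) has_real_derivative Ax (x, v)) (at x)" for x v
    unfolding A_def Ax_def fst_conv snd_conv by (rule derivative_eq_intros dg dp dc refl)+ (simp add: algebra_simps)
  have dB: "((\<lambda>v. B (x, v)) has_real_derivative Bv (x, v)) (at v)" for x v
    unfolding B_def Bv_def fst_conv snd_conv by (rule derivative_eq_intros dg dpc dQ refl)+ (simp add: algebra_simps)
  have cA: "continuous_on UNIV Ax" "continuous_on UNIV Bv" unfolding Ax_def Bv_def by (intro continuous_intros)+
  have zA: "A z = 0" "Ax z = 0" "B z = 0" "Bv z = 0" "Q z = 0" if "z \<notin> box2 N" for z
    using z[OF that] by (simp_all add: A_def Ax_def B_def Bv_def Q_def Qv_def)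
  note iA = integral_deriv_x_zero[OF dA cA(1) zA(1,2)]
  note iB = integral_deriv_v_zero[OF dB cA(2) zA(3,4)]
  let ?t = "\<lambda>z. g z * (p z * (2 * \<nu> * cvv z - 2 * \<nu> * (snd z * cv z)) + 4 * \<nu> * pv z * cv z) + J z * (pv z * c z + p z * cv z)"
  have "Cc ?t" unfolding Cc_def using z by (auto intro!: continuous_intros exI[of _ N])
  then have it: "integrable lborel ?t" by (rule Cc_integrable)
  have "(\<integral>z. (gt z * p z - g z * pt z) * c z \<partial>lborel) = (\<integral>z. ?t z + Ax z + Bv z \<partial>lborel)"
  proof (rule Bochner_Integration.integral_cong[OF refl])
    fix z
    have "(gt z * p z - g z * pt z) * c z - (?t z + Ax z + Bv z) = g z * p z * \<omega> * (snd z * cx z - fst z * cv z)"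
      unfolding pdeg pdep Ax_def Bv_def Q_def Qv_def by (simp add: algebra_simps)
    then show "(gt z * p z - g z * pt z) * c z = ?t z + Ax z + Bv z" unfolding rad by simp
  qed
  also have "\<dots> = (\<integral>z. ?t z \<partial>lborel)" using it iA iB by simp
  finally show ?thesis .
qed

section \<open>Duality with bounded test functions\<close>

text \<open>The unit ball of L^2 of the Gaussian gives by duality the norm with weight 1 /
  \<open>gauss\<close>. The additional bound k makes the pairing with a merely integrable function
  finite; it may be of any size, since no estimate of the norm depends on it.\<close>

definition admissible :: "real \<Rightarrow> (real \<times> real \<Rightarrow> real) \<Rightarrow> bool" where
  "admissible k \<phi> \<longleftrightarrow> Cc \<phi> \<and> (\<forall>z. \<bar>\<phi> z\<bar> \<le> k) \<and> (\<integral>z. gauss z * (\<phi> z)\<^sup>2 \<partial>lborel) \<le> 1"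

lemma gauss_mult_integrable:
  fixes f :: "real \<times> real \<Rightarrow> real"
  assumes [measurable]: "f \<in> borel_measurable borel" and k: "\<And>w. \<bar>f w\<bar> \<le> k"
  shows "integrable lborel (\<lambda>w. gauss w * f w)"
  using bounded_integrable_gauss2[of f k] k by (simp add: integrable_gauss2)

lemma integral_gauss: "integrable lborel gauss" "(\<integral>z. gauss z \<partial>lborel) = 1"
  using gauss_mult_integrable[of "\<lambda>_. 1" 1] integral_gauss2[of "\<lambda>_. 1"] gauss2.prob_space by simp_all

lemma integrable_bounded_mult:
  fixes g f :: "'a \<Rightarrow> real"
  assumes i: "integrable M g" and [measurable]: "f \<in> borel_measurable M" and k: "\<And>w. \<bar>f w\<bar> \<le> k"
  shows "integrable M (\<lambda>w. f w * g w)" "\<bar>\<integral>w. f w * g w \<partial>M\<bar> \<le> k * (\<integral>w. \<bar>g w\<bar> \<partial>M)"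
proof -
  have m [measurable]: "g \<in> borel_measurable M" using i by (rule borel_measurable_integrable)
  have ik: "integrable M (\<lambda>w. k * \<bar>g w\<bar>)" using i by auto
  have le: "\<bar>f w * g w\<bar> \<le> k * \<bar>g w\<bar>" for w
    using mult_right_mono[OF k[of w], of "\<bar>g w\<bar>"] by (simp add: abs_mult)
  show j: "integrable M (\<lambda>w. f w * g w)"
    by (rule Bochner_Integration.integrable_bound[OF ik]) (use le in \<open>auto intro!: order_trans[OF le abs_ge_self]\<close>)
  have "\<bar>\<integral>w. f w * g w \<partial>M\<bar> \<le> (\<integral>w. \<bar>f w * g w\<bar> \<partial>M)" by (rule integral_abs_bound)
  also have "\<dots> \<le> (\<integral>w. k * \<bar>g w\<bar> \<partial>M)" using ik j le by (intro integral_mono) auto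
  finally show "\<bar>\<integral>w. f w * g w \<partial>M\<bar> \<le> k * (\<integral>w. \<bar>g w\<bar> \<partial>M)" by simp
qed

lemma bounded_mult_integrable:
  fixes g f :: "real \<times> real \<Rightarrow> real"
  assumes i: "integrable lborel g" and [measurable]: "f \<in> borel_measurable borel" and k: "\<And>w. \<bar>f w\<bar> \<le> k"
  shows "integrable lborel (\<lambda>w. g w * f w)" "\<bar>\<integral>w. g w * f w \<partial>lborel\<bar> \<le> k * (\<integral>w. \<bar>g w\<bar> \<partial>lborel)"
  using integrable_bounded_mult[of lborel g f k] i k by (simp_all add: mult.commute)

lemma admissible_scaled:
  assumes A: "\<And>\<phi>. admissible k \<phi> \<Longrightarrow> \<bar>\<integral>z. g z * \<phi> z \<partial>lborel\<bar> \<le> A"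
    and \<phi>: "Cc \<phi>" "\<And>z. \<bar>\<phi> z\<bar> \<le> k * e" "(\<integral>z. gauss z * (\<phi> z)\<^sup>2 \<partial>lborel) \<le> e\<^sup>2" and e: "e > 0"
  shows "\<bar>\<integral>z. g z * \<phi> z \<partial>lborel\<bar> \<le> A * e"
proof -
  have "admissible k (\<lambda>z. 1 / e * \<phi> z)"
    unfolding admissible_def
  proof (intro conjI allI)
    show "Cc (\<lambda>z. 1 / e * \<phi> z)" by (rule Cc_mult[OF \<phi>(1)]) (intro continuous_intros)
    show "\<bar>1 / e * \<phi> z\<bar> \<le> k" for z using \<phi>(2)[of z] e by (simp add: abs_mult divide_le_eq)
    have "(\<integral>z. gauss z * (1 / e * \<phi> z)\<^sup>2 \<partial>lborel) = (\<integral>z. (1 / e)\<^sup>2 * (gauss z * (\<phi> z)\<^sup>2) \<partial>lborel)"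
      by (intro Bochner_Integration.integral_cong) (auto simp: power_mult_distrib power_divide)
    also have "\<dots> = (1 / e)\<^sup>2 * (\<integral>z. gauss z * (\<phi> z)\<^sup>2 \<partial>lborel)" by (rule integral_mult_right_zero)
    also have "\<dots> \<le> (1 / e)\<^sup>2 * e\<^sup>2" using \<phi>(3) by (intro mult_left_mono) auto
    also have "\<dots> = 1" using e by (simp add: power_divide)
    finally show "(\<integral>z. gauss z * (1 / e * \<phi> z)\<^sup>2 \<partial>lborel) \<le> 1" .
  qed
  from A[OF this] have "\<bar>\<integral>z. 1 / e * (g z * \<phi> z) \<partial>lborel\<bar> \<le> A" by (simp add: mult_ac)
  then show ?thesis using e by (simp add: abs_mult divide_le_eq)
qed

lemma admissible_mono: "admissible k \<phi> \<Longrightarrow> k \<le> k' \<Longrightarrow> admissible k' \<phi>"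
  unfolding admissible_def by (meson order_trans)

text \<open>A smoothed and truncated sign of g is bounded by 1 and hence, the Gaussian being a
  probability, admissible as soon as k \<ge> 1. Pairings at one fixed level k therefore already
  control the L^1 norm.\<close>

lemma admissible_L1:
  assumes A: "\<And>\<phi>. admissible k \<phi> \<Longrightarrow> \<bar>\<integral>z. g z * \<phi> z \<partial>lborel\<bar> \<le> A" and k: "k \<ge> 1"
    and g: "continuous_on UNIV g" "integrable lborel g"
  shows "(\<integral>z. \<bar>g z\<bar> \<partial>lborel) \<le> A"
proof -
  define \<phi> where "\<phi> = (\<lambda>n z. g z / (\<bar>g z\<bar> + inverse (real (Suc n))) * chi (real (Suc n)) z)"
  have pos: "\<bar>g z\<bar> + inverse (real (Suc n)) > 0" for z n by (intro add_nonneg_pos) auto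
  have c: "continuous_on UNIV (\<lambda>z. g z / (\<bar>g z\<bar> + inverse (real (Suc n))))" for n
    using less_imp_neq[OF pos, symmetric] by (intro continuous_intros g) auto
  have cc: "Cc (\<phi> n)" for n unfolding \<phi>_def by (rule Cc_mult[OF Cc_chi c]) simp
  have b: "\<bar>\<phi> n z\<bar> \<le> 1" for n z
  proof -
    have "\<bar>g z / (\<bar>g z\<bar> + inverse (real (Suc n)))\<bar> \<le> 1" using pos[of z n] by (simp add: abs_divide)
    moreover have "\<bar>chi (real (Suc n)) z\<bar> \<le> 1" using chi_range[of "real (Suc n)" z] by simp
    ultimately show ?thesis unfolding \<phi>_def abs_mult by (intro mult_le_one) auto
  qed
  have s: "\<bar>(\<phi> n z)\<^sup>2\<bar> \<le> 1" for n z using power_mono[OF b[of n z], of 2] by simp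
  have adm: "admissible k (\<phi> n)" for n
  proof -
    have m: "(\<lambda>z. (\<phi> n z)\<^sup>2) \<in> borel_measurable borel" using Cc_measurable[OF cc[of n]] by measurable
    have "(\<integral>z. gauss z * (\<phi> n z)\<^sup>2 \<partial>lborel) \<le> (\<integral>z. gauss z \<partial>lborel)"
      using integral_gauss(1) gauss_mult_integrable[OF m s] s[of n] gauss_pos by (intro integral_mono) (auto intro!: mult_left_le simp: less_imp_le)
    then show ?thesis unfolding admissible_def integral_gauss(2) using cc order_trans[OF b k] by blast
  qed
  have lim: "(\<lambda>n. \<integral>z. g z * \<phi> n z \<partial>lborel) \<longlonglongrightarrow> (\<integral>z. \<bar>g z\<bar> \<partial>lborel)"
  proof (rule integral_dominated_convergence[where w = "\<lambda>z. \<bar>g z\<bar>"])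
    show "(\<lambda>z. \<bar>g z\<bar>) \<in> borel_measurable lborel" using g(2) by (auto dest: borel_measurable_integrable)
    show "(\<lambda>z. g z * \<phi> n z) \<in> borel_measurable lborel" for n
      using borel_measurable_integrable[OF g(2)] Cc_measurable[OF cc[of n]] by simp
    show "integrable lborel (\<lambda>z. \<bar>g z\<bar>)" using g(2) by simp
    show "AE z in lborel. norm (g z * \<phi> n z) \<le> \<bar>g z\<bar>" for n
      using b[of n] by (intro AE_I2) (auto simp: abs_mult intro!: mult_left_le)
    show "AE z in lborel. (\<lambda>n. g z * \<phi> n z) \<longlonglongrightarrow> \<bar>g z\<bar>"
    proof (rule AE_I2)
      fix z
      show "(\<lambda>n. g z * \<phi> n z) \<longlonglongrightarrow> \<bar>g z\<bar>"
      proof (cases "g z = 0")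
        case False
        have "(\<lambda>n. g z * (g z / (\<bar>g z\<bar> + inverse (real (Suc n))) * chi (real (Suc n)) z)) \<longlonglongrightarrow> g z * (g z / (\<bar>g z\<bar> + 0) * 1)"
          by (rule tendsto_mult[OF tendsto_const tendsto_mult[OF tendsto_divide[OF tendsto_const tendsto_add[OF tendsto_const LIMSEQ_inverse_real_of_nat]] chi_lim]])
             (use False in simp)
        moreover have "g z * (g z / (\<bar>g z\<bar> + 0) * 1) = \<bar>g z\<bar>" using False by (cases "g z > 0") auto
        ultimately show ?thesis unfolding \<phi>_def by simp
      qed simp
    qed
  qed
  show ?thesis
    by (rule LIMSEQ_le_const2[OF lim]) (use A[OF adm] in \<open>auto simp: abs_le_iff\<close>)
qed

text \<open>The extremal test function is g / \<open>gauss\<close>, truncated and normalised. Its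
  sup norm is finite but grows with the truncation, so the bound is required for every k. Fatou's
  lemma removes the truncation and yields integrability along with the bound.\<close>

lemma admissible_L2:
  assumes B: "\<And>k \<phi>. admissible k \<phi> \<Longrightarrow> \<bar>\<integral>z. g z * \<phi> z \<partial>lborel\<bar> \<le> B" and g: "continuous_on UNIV g"
  shows "integrable lborel (\<lambda>z. (g z)\<^sup>2 / gauss z)" "(\<integral>z. (g z)\<^sup>2 / gauss z \<partial>lborel) \<le> B\<^sup>2"
proof -
  note gz = less_imp_neq[OF gauss_pos, symmetric]
  have cgg: "continuous_on UNIV (\<lambda>z. (g z)\<^sup>2 / gauss z)" "continuous_on UNIV (\<lambda>z. g z / gauss z)"
    using gz by (auto intro!: continuous_intros g)
  then have [measurable]: "(\<lambda>z. (g z)\<^sup>2 / gauss z) \<in> borel_measurable borel" by (auto intro: borel_measurable_continuous_onI)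
  have [measurable]: "chi (real (Suc n)) \<in> borel_measurable borel" for n
    by (rule Cc_measurable[OF Cc_chi]) simp
  define J where "J = (\<lambda>n. \<integral>z. (g z)\<^sup>2 / gauss z * (chi (real (Suc n)) z)\<^sup>2 \<partial>lborel)"
  have iJ: "integrable lborel (\<lambda>z. (g z)\<^sup>2 / gauss z * (chi (real (Suc n)) z)\<^sup>2)" for n
    unfolding power2_eq_square[of "chi (real (Suc n)) z" for z]
    by (rule Cc_integrable, rule Cc_mult[OF Cc_mult[OF Cc_chi]]) (use cgg cont_chi(1)[of "real (Suc n)"] in auto)
  have J0: "J n \<ge> 0" for n unfolding J_def using gauss_pos by (intro integral_nonneg_AE AE_I2) (auto simp: less_imp_le)
  have J: "J n \<le> B\<^sup>2" for n
  proof (cases "J n = 0")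
    case False
    then have Jp: "J n > 0" using J0[of n] by simp
    let ?c = "chi (real (Suc n))"
    let ?\<phi> = "\<lambda>z. g z / gauss z * ?c z"
    have c: "Cc ?\<phi>" by (rule Cc_mult[OF Cc_chi cgg(2)]) simp
    obtain k where k: "k > 0" "\<And>z. \<bar>?\<phi> z\<bar> \<le> k" using Cc_bounded[OF c] by blast
    have e: "gauss z * (?\<phi> z)\<^sup>2 = (g z)\<^sup>2 / gauss z * (?c z)\<^sup>2" for z
      using gz[of z] by (simp add: power2_eq_square field_simps)
    have "\<bar>\<integral>z. g z * ?\<phi> z \<partial>lborel\<bar> \<le> B * sqrt (J n)"
    proof (rule admissible_scaled[where k = "k / sqrt (J n)"])
      show "\<bar>\<integral>z. g z * \<phi> z \<partial>lborel\<bar> \<le> B" if "admissible (k / sqrt (J n)) \<phi>" for \<phi> by (rule B[OF that])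
      show "Cc ?\<phi>" by (rule c)
      show "\<bar>?\<phi> z\<bar> \<le> k / sqrt (J n) * sqrt (J n)" for z using k(2)[of z] Jp by simp
      show "(\<integral>z. gauss z * (?\<phi> z)\<^sup>2 \<partial>lborel) \<le> (sqrt (J n))\<^sup>2" unfolding e using J0[of n] by (simp add: J_def)
      show "sqrt (J n) > 0" using Jp by simp
    qed
    moreover have "J n \<le> (\<integral>z. g z * ?\<phi> z \<partial>lborel)"
      unfolding J_def
    proof (rule integral_mono[OF iJ])
      show "integrable lborel (\<lambda>z. g z * ?\<phi> z)" by (rule Cc_integrable_mult[OF c g])
      fix z
      have "(?c z)\<^sup>2 \<le> ?c z" using chi_range[of "real (Suc n)" z] by (simp add: power2_eq_square mult_left_le)
      then have "(g z)\<^sup>2 / gauss z * (?c z)\<^sup>2 \<le> (g z)\<^sup>2 / gauss z * ?c z"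
        using gauss_pos[of z] by (intro mult_left_mono) (auto simp: less_imp_le)
      then show "(g z)\<^sup>2 / gauss z * (?c z)\<^sup>2 \<le> g z * ?\<phi> z" by (simp add: power2_eq_square)
    qed
    ultimately have "J n \<le> B * sqrt (J n)" by linarith
    moreover have "J n = sqrt (J n) * sqrt (J n)" using J0[of n] by simp
    ultimately have "sqrt (J n) * sqrt (J n) \<le> B * sqrt (J n)" by linarith
    then have "sqrt (J n) \<le> B" using Jp mult_le_cancel_right_pos[of "sqrt (J n)"] by (meson real_sqrt_gt_zero)
    then have "(sqrt (J n))\<^sup>2 \<le> B\<^sup>2" using J0[of n] by (intro power_mono) auto
    then show ?thesis using J0[of n] by simp
  qed simp
  have "(\<integral>\<^sup>+z. ennreal ((g z)\<^sup>2 / gauss z) \<partial>lborel) = (\<integral>\<^sup>+z. liminf (\<lambda>n. ennreal ((g z)\<^sup>2 / gauss z * (chi (real (Suc n)) z)\<^sup>2)) \<partial>lborel)"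
  proof (intro nn_integral_cong)
    fix z
    have "(\<lambda>n. ennreal ((g z)\<^sup>2 / gauss z * (chi (real (Suc n)) z)\<^sup>2)) \<longlonglongrightarrow> ennreal ((g z)\<^sup>2 / gauss z * 1\<^sup>2)"
      by (intro tendsto_ennrealI tendsto_mult tendsto_power chi_lim tendsto_const)
    then show "ennreal ((g z)\<^sup>2 / gauss z) = liminf (\<lambda>n. ennreal ((g z)\<^sup>2 / gauss z * (chi (real (Suc n)) z)\<^sup>2))"
      using lim_imp_Liminf[OF trivial_limit_sequentially] by fastforce
  qed
  also have "\<dots> \<le> liminf (\<lambda>n. \<integral>\<^sup>+z. ennreal ((g z)\<^sup>2 / gauss z * (chi (real (Suc n)) z)\<^sup>2) \<partial>lborel)"
    by (rule nn_integral_liminf) measurable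
  also have "\<dots> = liminf (\<lambda>n. ennreal (J n))"
    unfolding J_def using gauss_pos by (subst nn_integral_eq_integral[OF iJ]) (auto simp: less_imp_le)
  also have "\<dots> \<le> ennreal (B\<^sup>2)"
    by (rule Liminf_le) (use J in \<open>auto intro!: always_eventually simp: ennreal_leI\<close>)
  finally have le: "(\<integral>\<^sup>+z. ennreal ((g z)\<^sup>2 / gauss z) \<partial>lborel) \<le> ennreal (B\<^sup>2)" .
  have nn: "0 \<le> (g z)\<^sup>2 / gauss z" for z using gauss_pos[of z] by simp
  show i: "integrable lborel (\<lambda>z. (g z)\<^sup>2 / gauss z)"
    by (rule integrableI_nonneg) (use nn order_le_less_trans[OF le ennreal_less_top] in auto)
  have "ennreal (\<integral>z. (g z)\<^sup>2 / gauss z \<partial>lborel) \<le> ennreal (B\<^sup>2)"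
    using le nn by (subst nn_integral_eq_integral[OF i, symmetric]) auto
  then show "(\<integral>z. (g z)\<^sup>2 / gauss z \<partial>lborel) \<le> B\<^sup>2" by (simp add: ennreal_le_iff)
qed

lemma L2_pairing:
  fixes g \<phi> :: "real \<times> real \<Rightarrow> real"
  assumes g: "g \<in> borel_measurable borel" "integrable lborel (\<lambda>z. (g z)\<^sup>2 / gauss z)"
    and \<phi>: "\<phi> \<in> borel_measurable borel" "\<And>z. \<bar>\<phi> z\<bar> \<le> k" "(\<integral>z. gauss z * (\<phi> z)\<^sup>2 \<partial>lborel) \<le> e\<^sup>2" and e: "e \<ge> 0"
  shows "\<bar>\<integral>z. g z * \<phi> z \<partial>lborel\<bar> \<le> sqrt (\<integral>z. (g z)\<^sup>2 / gauss z \<partial>lborel) * e"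
proof -
  note [measurable] = g(1) \<phi>(1)
  have s: "sqrt (gauss z) > 0" "(sqrt (gauss z))\<^sup>2 = gauss z" for z using gauss_pos[of z] by auto
  let ?f = "\<lambda>z. g z / sqrt (gauss z)" and ?h = "\<lambda>z. sqrt (gauss z) * \<phi> z"
  have e1: "(?f z)\<^sup>2 = (g z)\<^sup>2 / gauss z" "(?h z)\<^sup>2 = gauss z * (\<phi> z)\<^sup>2" for z
    unfolding power_divide power_mult_distrib s by simp_all
  have k2: "\<bar>(\<phi> w)\<^sup>2\<bar> \<le> k\<^sup>2" for w using power_mono[OF \<phi>(2)[of w], of 2] by simp
  have "(\<integral>z. g z * \<phi> z \<partial>lborel) = (\<integral>z. ?f z * ?h z \<partial>lborel)"
    using s(1) by (intro Bochner_Integration.integral_cong) (auto simp: less_imp_neq[symmetric])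
  then have "(\<integral>z. g z * \<phi> z \<partial>lborel)\<^sup>2 = (\<integral>z. ?f z * ?h z \<partial>lborel)\<^sup>2" by simp
  also have "\<dots> \<le> (\<integral>z. (?f z)\<^sup>2 \<partial>lborel) * (\<integral>z. (?h z)\<^sup>2 \<partial>lborel)"
  proof (rule integral_Cauchy_Schwarz)
    show "?f \<in> borel_measurable lborel" "?h \<in> borel_measurable lborel" by measurable
    show "integrable lborel (\<lambda>z. (?f z)\<^sup>2)" unfolding e1 by (rule g)
    show "integrable lborel (\<lambda>z. (?h z)\<^sup>2)" unfolding e1 by (rule gauss_mult_integrable[OF _ k2]) measurable
  qed
  also have "\<dots> \<le> (\<integral>z. (g z)\<^sup>2 / gauss z \<partial>lborel) * e\<^sup>2"
    unfolding e1 using gauss_pos by (intro mult_left_mono \<phi> integral_nonneg_AE AE_I2) (auto simp: less_imp_le)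
  finally have "sqrt ((\<integral>z. g z * \<phi> z \<partial>lborel)\<^sup>2) \<le> sqrt ((\<integral>z. (g z)\<^sup>2 / gauss z \<partial>lborel) * e\<^sup>2)" by (rule real_sqrt_le_mono)
  then show ?thesis using e by (simp add: real_sqrt_mult)
qed

section \<open>Small perturbations of the linear flow\<close>

text \<open>In rescaled variables g is the difference of solution and steady state and u is the
  steady state. F is the full force of the solution and G the difference of the two forces. The
  factor 1 / M in the bound on G compensates the mass contained in u.\<close>

locale perturbation = oscillator +
  fixes g gt gx gv gvv J Jv :: "real \<Rightarrow> real \<times> real \<Rightarrow> real"
    and F G :: "real \<Rightarrow> real \<Rightarrow> real" and u :: "real \<times> real \<Rightarrow> real" and \<epsilon> M :: real
  assumes \<epsilon>: "\<epsilon> > 0" and M: "M > 0"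
    and dgt: "\<And>t z. t > 0 \<Longrightarrow> ((\<lambda>t. g t z) has_real_derivative gt t z) (at t)"
    and dgx: "\<And>t x v. t > 0 \<Longrightarrow> ((\<lambda>x. g t (x, v)) has_real_derivative gx t (x, v)) (at x)"
    and dgv: "\<And>t x v. t > 0 \<Longrightarrow> ((\<lambda>v. g t (x, v)) has_real_derivative gv t (x, v)) (at v)"
    and dgvv: "\<And>t x v. t > 0 \<Longrightarrow> ((\<lambda>v. gv t (x, v)) has_real_derivative gvv t (x, v)) (at v)"
    and dJ: "\<And>t x v. t > 0 \<Longrightarrow> ((\<lambda>v. J t (x, v)) has_real_derivative Jv t (x, v)) (at v)"
    and cg: "continuous_on ({0<..} \<times> UNIV) (\<lambda>(t, z). g t z)"
    and cgt: "continuous_on ({0<..} \<times> UNIV) (\<lambda>(t, z). gt t z)"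
    and cgs: "\<And>t. t > 0 \<Longrightarrow> continuous_on UNIV (gx t)" "\<And>t. t > 0 \<Longrightarrow> continuous_on UNIV (gv t)"
      "\<And>t. t > 0 \<Longrightarrow> continuous_on UNIV (gvv t)" "\<And>t. t > 0 \<Longrightarrow> continuous_on UNIV (J t)"
      "\<And>t. t > 0 \<Longrightarrow> continuous_on UNIV (Jv t)" "\<And>t. t > 0 \<Longrightarrow> continuous_on UNIV (F t)"
      "\<And>t. t > 0 \<Longrightarrow> continuous_on UNIV (G t)" and cu: "continuous_on UNIV u"
    and pde: "\<And>t z. t > 0 \<Longrightarrow> gt t z = - \<omega> * snd z * gx t z + \<omega> * fst z * gv t z - Jv t z
        + 2 * \<nu> * (g t z + snd z * gv t z + gvv t z)"
    and J: "\<And>t z. t > 0 \<Longrightarrow> J t z = F t (fst z) * g t z + G t (fst z) * u z"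
    and F: "\<And>t x. t > 0 \<Longrightarrow> \<bar>F t x\<bar> \<le> \<epsilon>"
    and G: "\<And>t x. t > 0 \<Longrightarrow> \<bar>G t x\<bar> \<le> \<epsilon> / M * (\<integral>z. \<bar>g t z\<bar> \<partial>lborel)"
    and u: "\<And>z. 0 \<le> u z" "\<And>z. u z \<le> 2 * M * gauss z"
    and ig: "\<And>t. t \<ge> 0 \<Longrightarrow> integrable lborel (g t)"
    and L1: "\<And>t. t \<ge> 0 \<Longrightarrow> ((\<lambda>s. \<integral>z. \<bar>g s z - g t z\<bar> \<partial>lborel) \<longlongrightarrow> 0) (at t within {0..})"
    and mass: "\<And>t. t \<ge> 0 \<Longrightarrow> (\<integral>z. g t z \<partial>lborel) = 0"
begin

section \<open>The dual pairing and its time derivative\<close>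

definition L :: "real \<Rightarrow> real" where "L t = (\<integral>z. \<bar>g t z\<bar> \<partial>lborel)"

lemma cg_slice: "t > 0 \<Longrightarrow> continuous_on UNIV (g t)"
  by (rule continuous_on_compose2[OF cg, of UNIV "\<lambda>z. (t, z)", simplified]) (auto intro!: continuous_intros)

lemma cP_slice:
  assumes "Cc \<phi>" "t > 0"
  shows "continuous_on UNIV (P t \<phi>)" "continuous_on UNIV (DxP t \<phi>)" "continuous_on UNIV (DP t \<phi>)" "continuous_on UNIV (DDP t \<phi>)"
  using cont_P[OF assms(1)] assms(2)
  by (auto intro!: continuous_on_compose2[of "{0<..} \<times> UNIV" "\<lambda>(t, z). P t \<phi> z" UNIV "\<lambda>z. (t, z)", simplified]
    continuous_on_compose2[of "{0<..} \<times> UNIV" "\<lambda>(t, z). DxP t \<phi> z" UNIV "\<lambda>z. (t, z)", simplified]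
    continuous_on_compose2[of "{0<..} \<times> UNIV" "\<lambda>(t, z). DP t \<phi> z" UNIV "\<lambda>z. (t, z)", simplified]
    continuous_on_compose2[of "{0<..} \<times> UNIV" "\<lambda>(t, z). DDP t \<phi> z" UNIV "\<lambda>z. (t, z)", simplified] continuous_intros)

text \<open>Without the perturbation J and for R = \<open>\<infinity>\<close>, m is constant in \<open>\<tau>\<close>.\<close>

definition m :: "real \<Rightarrow> real \<Rightarrow> (real \<times> real \<Rightarrow> real) \<Rightarrow> real \<Rightarrow> real" where
  "m R T \<phi> \<tau> = (\<integral>z. g \<tau> z * P (T - \<tau>) \<phi> z * chi R z \<partial>lborel)"

text \<open>The right-hand side of \<open>weak_identity\<close> for p =
  \<open>P (T - \<tau>) \<phi>\<close>: cutoff commutators and the contribution of J are all that is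
  left of the time derivative of \<open>m\<close>.\<close>

definition m' :: "real \<Rightarrow> real \<Rightarrow> (real \<times> real \<Rightarrow> real) \<Rightarrow> real \<Rightarrow> real" where
  "m' R T \<phi> \<tau> = (\<integral>z. g \<tau> z * (P (T - \<tau>) \<phi> z * (2 * \<nu> * chivv R z - 2 * \<nu> * (snd z * chiv R z)) + 4 * \<nu> * DP (T - \<tau>) \<phi> z * chiv R z)
      + J \<tau> z * (DP (T - \<tau>) \<phi> z * chi R z + P (T - \<tau>) \<phi> z * chiv R z) \<partial>lborel)"

lemma deriv_m:
  assumes \<phi>: "Cc \<phi>" and R: "R > 0" and t: "0 < \<tau>" "\<tau> < T"
  shows "(m R T \<phi> has_real_derivative m' R T \<phi> \<tau>) (at \<tau>)"
proof -
  let ?H' = "\<lambda>s z. gt s z * P (T - s) \<phi> z - g s z * DtP (T - s) \<phi> z"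
  have "((\<lambda>s. \<integral>z. (g s z * P (T - s) \<phi> z) * chi R z \<partial>lborel) has_real_derivative (\<integral>z. ?H' \<tau> z * chi R z \<partial>lborel)) (at \<tau>)"
  proof (rule Cc_leibniz[OF Cc_chi[OF R], of "{0<..<T}"])
    fix s :: real and z :: "real \<times> real" assume s: "s \<in> {0<..<T}"
    obtain x v where z: "z = (x, v)" by (cases z)
    have "((\<lambda>s. P (T - s) \<phi> (x, v)) has_real_derivative (DtP (T - s) \<phi> (x, v) * - 1)) (at s)"
      by (rule DERIV_chain2[OF deriv_P(4)[OF \<phi>]]) (use s in \<open>auto intro!: derivative_eq_intros\<close>)
    from DERIV_mult[OF dgt[of s "(x, v)"] this]
    show "((\<lambda>s. g s z * P (T - s) \<phi> z) has_real_derivative ?H' s z) (at s)"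
      using s z by (simp add: algebra_simps)
  next
    fix s assume s: "s \<in> {0<..<T}"
    show "continuous_on UNIV (\<lambda>z. g s z * P (T - s) \<phi> z)"
      using s by (intro continuous_intros cg_slice cP_slice \<phi>) auto
  next
    have c1: "continuous_on ({0<..} \<times> UNIV) (\<lambda>p. g (fst p) (snd p))" "continuous_on ({0<..} \<times> UNIV) (\<lambda>p. gt (fst p) (snd p))"
      "continuous_on ({0<..} \<times> UNIV) (\<lambda>p. P (fst p) \<phi> (snd p))" "continuous_on ({0<..} \<times> UNIV) (\<lambda>p. DtP (fst p) \<phi> (snd p))"
      using cg cgt cont_P[OF \<phi>] by (simp_all add: case_prod_beta')
    have "continuous_on ({0<..<T} \<times> UNIV) (\<lambda>p. gt (fst p) (snd p) * P (T - fst p) \<phi> (snd p) - g (fst p) (snd p) * DtP (T - fst p) \<phi> (snd p))"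
      by (intro continuous_intros continuous_on_subset[OF c1(1)] continuous_on_subset[OF c1(2)]
          continuous_on_compose2[OF c1(3), where f = "\<lambda>p. (T - fst p, snd p)", simplified]
          continuous_on_compose2[OF c1(4), where f = "\<lambda>p. (T - fst p, snd p)", simplified]) auto
    then show "continuous_on ({0<..<T} \<times> UNIV) (\<lambda>(s, z). ?H' s z)" by (simp add: case_prod_beta')
  qed (use t in auto)
  also have "(\<integral>z. ?H' \<tau> z * chi R z \<partial>lborel) = m' R T \<phi> \<tau>"
    unfolding m'_def
  proof (rule weak_identity[where N = "exp R" and \<omega> = \<omega> and gx = "gx \<tau>" and gv = "gv \<tau>" and gvv = "gvv \<tau>" and Jv = "Jv \<tau>"
      and px = "DxP (T - \<tau>) \<phi>" and pvv = "DDP (T - \<tau>) \<phi>" and cx = "chix R"])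
    show "gt \<tau> z = - \<omega> * snd z * gx \<tau> z + \<omega> * fst z * gv \<tau> z - Jv \<tau> z + 2 * \<nu> * (g \<tau> z + snd z * gv \<tau> z + gvv \<tau> z)" for z
      by (rule pde[OF t(1)])
    show "snd z * chix R z = fst z * chiv R z" for z by (simp add: chix_def chiv_def)
    show "DtP (T - \<tau>) \<phi> z = \<omega> * snd z * DxP (T - \<tau>) \<phi> z - (\<omega> * fst z + 2 * \<nu> * snd z) * DP (T - \<tau>) \<phi> z + 2 * \<nu> * DDP (T - \<tau>) \<phi> z" for z
      by (rule DtP_eq[OF \<phi>]) (use t in simp)
  qed (use t R in \<open>auto intro!: dgx dgv dgvv dJ deriv_P[OF \<phi>] deriv_chix deriv_chiv deriv_chivv cg_slice cgs cP_slice[OF \<phi>] cont_chi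
      pde simp: chi_outside simp del: mem_box split_paired_All\<close>)
  finally show ?thesis unfolding m_def[abs_def] .
qed

text \<open>\<open>DP_square\<close> combined with the invariance of the Gaussian. The same factor c
  appears in the sup bound and in the L^2 bound, so division by c makes the gradient satisfy the two
  size conditions of \<open>admissible\<close> with the old k.\<close>

lemma gauss_DP:
  assumes adm: "admissible k \<phi>" and t: "t > 0" and c: "2 * (cN t / cD t) \<le> c\<^sup>2" "c \<ge> 0"
  shows "\<bar>DP t \<phi> z\<bar> \<le> k * c" "integrable lborel (\<lambda>z. gauss z * (DP t \<phi> z)\<^sup>2)" "(\<integral>z. gauss z * (DP t \<phi> z)\<^sup>2 \<partial>lborel) \<le> c\<^sup>2"
    "(\<integral>z. gauss z * \<bar>DP t \<phi> z\<bar> \<partial>lborel) \<le> c"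
proof -
  have \<phi>: "Cc \<phi>" "\<And>z. \<bar>\<phi> z\<bar> \<le> k" "(\<integral>z. gauss z * (\<phi> z)\<^sup>2 \<partial>lborel) \<le> 1" using adm by (auto simp: admissible_def)
  have k0: "k \<ge> 0" using \<phi>(2)[of 0] by linarith
  note [measurable] = Cc_measurable[OF \<phi>(1)]
  have m [measurable]: "DP t \<phi> \<in> borel_measurable borel" by (rule P_measurable[OF t]) measurable
  have k2: "\<bar>(\<phi> w)\<^sup>2\<bar> \<le> k\<^sup>2" for w using power_mono[OF \<phi>(2)[of w], of 2] by simp
  have P2: "\<bar>P t (\<lambda>w. (\<phi> w)\<^sup>2) z\<bar> \<le> k\<^sup>2" for z by (rule P_bound[OF t _ k2]) measurable
  have P20: "0 \<le> P t (\<lambda>w. (\<phi> w)\<^sup>2) z" for z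
    unfolding P_def using K_pos[OF t, of z] by (intro integral_nonneg_AE AE_I2) (auto simp: less_imp_le)
  have s: "(DP t \<phi> z)\<^sup>2 \<le> c\<^sup>2 * P t (\<lambda>w. (\<phi> w)\<^sup>2) z" for z
    by (rule order_trans[OF DP_square[OF t Cc_measurable[OF \<phi>(1)] \<phi>(2), where z = z] mult_right_mono[OF c(1) P20[of z]]])
  have "(DP t \<phi> z)\<^sup>2 \<le> c\<^sup>2 * k\<^sup>2" for z
    by (rule order_trans[OF s mult_left_mono[OF abs_le_D1[OF P2]]]) simp
  then have "(DP t \<phi> z)\<^sup>2 \<le> (k * c)\<^sup>2" for z by (simp add: power_mult_distrib mult.commute)
  then show b: "\<bar>DP t \<phi> z\<bar> \<le> k * c" for z
    using abs_le_square_iff[of "DP t \<phi> z" "k * c"] k0 c(2) by simp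
  have b2: "\<bar>(DP t \<phi> z)\<^sup>2\<bar> \<le> (k * c)\<^sup>2" for z using power_mono[OF b[of z], of 2] by simp
  show i2: "integrable lborel (\<lambda>z. gauss z * (DP t \<phi> z)\<^sup>2)" by (rule gauss_mult_integrable[OF _ b2]) measurable
  have iP: "integrable lborel (\<lambda>z. gauss z * P t (\<lambda>w. (\<phi> w)\<^sup>2) z)"
    "(\<integral>z. gauss z * P t (\<lambda>w. (\<phi> w)\<^sup>2) z \<partial>lborel) = (\<integral>w. gauss w * (\<phi> w)\<^sup>2 \<partial>lborel)"
    by (rule P_invariant[OF t, where k = "k\<^sup>2"]; use k2 in simp)+
  have "(\<integral>z. gauss z * (DP t \<phi> z)\<^sup>2 \<partial>lborel) \<le> (\<integral>z. c\<^sup>2 * (gauss z * P t (\<lambda>w. (\<phi> w)\<^sup>2) z) \<partial>lborel)"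
  proof (rule integral_mono[OF i2 integrable_mult_right[OF iP(1)]])
    show "gauss z * (DP t \<phi> z)\<^sup>2 \<le> c\<^sup>2 * (gauss z * P t (\<lambda>w. (\<phi> w)\<^sup>2) z)" for z
      using mult_left_mono[OF s[of z] less_imp_le[OF gauss_pos[of z]]] by (simp add: mult_ac)
  qed
  also have "\<dots> \<le> c\<^sup>2 * 1" using iP(2) \<phi>(3) by (simp add: mult_left_le)
  finally show b3: "(\<integral>z. gauss z * (DP t \<phi> z)\<^sup>2 \<partial>lborel) \<le> c\<^sup>2" by simp
  have "(\<integral>z. \<bar>DP t \<phi> z\<bar> * 1 \<partial>gauss2)\<^sup>2 \<le> (\<integral>z. \<bar>DP t \<phi> z\<bar>\<^sup>2 \<partial>gauss2) * (\<integral>z. 1\<^sup>2 \<partial>gauss2)"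
    by (rule integral_Cauchy_Schwarz) (use i2 in \<open>auto simp: integrable_gauss2\<close>)
  also have "\<dots> \<le> c\<^sup>2" using b3 by (simp add: integral_gauss2 gauss2.prob_space)
  finally have "(\<integral>z. gauss z * \<bar>DP t \<phi> z\<bar> \<partial>lborel)\<^sup>2 \<le> c\<^sup>2" by (simp add: integral_gauss2)
  then show "(\<integral>z. gauss z * \<bar>DP t \<phi> z\<bar> \<partial>lborel) \<le> c" using c(2) power2_le_imp_le by blast
qed

text \<open>The main part 3 \<epsilon> A c consists of \<epsilon> A c from F g and 2 \<epsilon> L c
  from G u, using u \<le> 2 M \<open>gauss\<close> and L \<le> A. Everything else carries a
  derivative of the cutoff and is O(1/R); k is allowed to appear only there.\<close>

lemma m'_bound:
  assumes adm: "admissible k \<phi>" and k: "k \<ge> 1" and R: "R \<ge> 1" and t: "0 < \<tau>" "\<tau> < T"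
    and c: "2 * (cN (T - \<tau>) / cD (T - \<tau>)) \<le> c\<^sup>2" "c > 0"
    and A: "\<And>\<phi>. admissible k \<phi> \<Longrightarrow> \<bar>\<integral>z. g \<tau> z * \<phi> z \<partial>lborel\<bar> \<le> A"
  shows "\<bar>m' R T \<phi> \<tau>\<bar> \<le> 3 * \<epsilon> * A * c + k * A / R * ((96 * \<nu> + 18 * \<epsilon>) + 24 * \<nu> * c)"
proof -
  have \<phi>: "Cc \<phi>" "\<And>z. \<bar>\<phi> z\<bar> \<le> k" using adm by (auto simp: admissible_def)
  have R0: "R > 0" and T: "T - \<tau> > 0" using R t by auto
  let ?p = "P (T - \<tau>) \<phi>" and ?q = "DP (T - \<tau>) \<phi>"
  note q = gauss_DP[OF adm T c(1) less_imp_le[OF c(2)]]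
  have p: "\<bar>?p z\<bar> \<le> k" for z by (rule P_bound[OF T Cc_measurable[OF \<phi>(1)] \<phi>(2)])
  have cp: "continuous_on UNIV ?p" "continuous_on UNIV ?q" using cP_slice[OF \<phi>(1) T] by auto
  note cc = cont_chi[OF R0]
  have cu': "continuous_on UNIV (\<lambda>z. F \<tau> (fst z))" "continuous_on UNIV (\<lambda>z. G \<tau> (fst z))"
    using t by (auto intro!: continuous_on_compose2[OF cgs(6)] continuous_on_compose2[OF cgs(7)] continuous_intros)
  note [continuous_intros] = cp cc cu' cu cg_slice[OF t(1)]
  have \<tau>0: "\<tau> \<ge> 0" using t by simp
  have gi: "integrable lborel (g \<tau>)" by (rule ig[OF \<tau>0])
  have LA: "L \<tau> \<le> A" unfolding L_def by (rule admissible_L1[OF A k cg_slice[OF t(1)] gi])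
  have L0: "L \<tau> \<ge> 0" by (simp add: L_def)
  \<comment> \<open>\<open>Z1\<close> collects the cutoff commutators; \<open>Z2\<close> and
    \<open>Z3\<close> are the two parts of J against the gradient of the semigroup;
    \<open>Z4\<close> and \<open>Z5\<close> are the same parts against the derivative of the
    cutoff.\<close>
  define Z1 where "Z1 = (\<lambda>z. ?p z * (2 * \<nu> * chivv R z - 2 * \<nu> * (snd z * chiv R z)) + 4 * \<nu> * ?q z * chiv R z)"
  define Z2 where "Z2 = (\<lambda>z. (F \<tau> (fst z) * ?q z) * chi R z)"
  define Z3 where "Z3 = (\<lambda>z. (G \<tau> (fst z) * ?q z) * chi R z)"
  define Z4 where "Z4 = (\<lambda>z. (F \<tau> (fst z) * ?p z) * chiv R z)"
  define Z5 where "Z5 = (\<lambda>z. (G \<tau> (fst z) * ?p z) * chiv R z)"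
  have cZ: "continuous_on UNIV Z1" "continuous_on UNIV Z2" "continuous_on UNIV Z3" "continuous_on UNIV Z4" "continuous_on UNIV Z5"
    unfolding Z1_def Z2_def Z3_def Z4_def Z5_def by (intro continuous_intros)+
  have zZ: "Z1 z = 0" "Z2 z = 0" "Z3 z = 0" "Z4 z = 0" "Z5 z = 0" if "z \<notin> box2 (exp R)" for z
    unfolding Z1_def Z2_def Z3_def Z4_def Z5_def using chi_outside[OF R0 that] by simp_all
  have CZ: "Cc Z1" "Cc Z2" "Cc Z3" "Cc Z4" "Cc Z5" unfolding Cc_def using cZ zZ by blast+
  have mZ: "Z1 \<in> borel_measurable borel" "Z4 \<in> borel_measurable borel" using CZ Cc_measurable by auto
  have e: "m' R T \<phi> \<tau> = (\<integral>z. g \<tau> z * Z1 z + g \<tau> z * Z2 z + u z * Z3 z + g \<tau> z * Z4 z + u z * Z5 z \<partial>lborel)"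
    unfolding m'_def Z1_def Z2_def Z3_def Z4_def Z5_def J[OF t(1)]
    by (intro Bochner_Integration.integral_cong refl) (simp add: algebra_simps)
  have i: "integrable lborel (\<lambda>z. g \<tau> z * Z1 z)" "integrable lborel (\<lambda>z. g \<tau> z * Z2 z)" "integrable lborel (\<lambda>z. u z * Z3 z)"
    "integrable lborel (\<lambda>z. g \<tau> z * Z4 z)" "integrable lborel (\<lambda>z. u z * Z5 z)"
    using CZ by (auto intro!: Cc_integrable_mult cu cg_slice[OF t(1)])
  have e2: "m' R T \<phi> \<tau> = (\<integral>z. g \<tau> z * Z1 z \<partial>lborel) + (\<integral>z. g \<tau> z * Z2 z \<partial>lborel) + (\<integral>z. u z * Z3 z \<partial>lborel)
     + (\<integral>z. g \<tau> z * Z4 z \<partial>lborel) + (\<integral>z. u z * Z5 z \<partial>lborel)"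
    unfolding e using i by simp
  have b1: "\<bar>\<integral>z. g \<tau> z * Z1 z \<partial>lborel\<bar> \<le> (k * \<nu> * (96 + 24 * c) / R) * L \<tau>"
    unfolding L_def
  proof (rule bounded_mult_integrable[OF gi mZ(1)])
    fix z
    note cb = chi_bounds[OF R, of z]
    have "\<bar>Z1 z\<bar> \<le> \<bar>?p z\<bar> * (2 * \<nu> * \<bar>chivv R z\<bar> + 2 * \<nu> * \<bar>snd z * chiv R z\<bar>) + 4 * \<nu> * \<bar>?q z\<bar> * \<bar>chiv R z\<bar>"
    proof -
      have "\<bar>Z1 z\<bar> \<le> \<bar>?p z\<bar> * \<bar>2 * \<nu> * chivv R z - 2 * \<nu> * (snd z * chiv R z)\<bar> + \<bar>4 * \<nu> * ?q z * chiv R z\<bar>"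
        unfolding Z1_def abs_mult[symmetric] by (rule abs_triangle_ineq)
      also have "\<dots> \<le> \<bar>?p z\<bar> * (\<bar>2 * \<nu> * chivv R z\<bar> + \<bar>2 * \<nu> * (snd z * chiv R z)\<bar>) + \<bar>4 * \<nu> * ?q z * chiv R z\<bar>"
        by (intro add_right_mono mult_left_mono abs_triangle_ineq4) auto
      finally show ?thesis using pos by (simp add: abs_mult)
    qed
    also have "\<dots> \<le> k * (2 * \<nu> * (42 / R) + 2 * \<nu> * (6 / R)) + 4 * \<nu> * (k * c) * (6 / R)"
      using cb p[of z] q(1)[of z] pos k c(2) R0 by (intro add_mono mult_mono) auto
    also have "\<dots> = k * \<nu> * (96 + 24 * c) / R" using R0 by (simp add: field_simps)
    finally show "\<bar>Z1 z\<bar> \<le> k * \<nu> * (96 + 24 * c) / R" .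
  qed
  \<comment> \<open>\<open>Z2 / (\<epsilon> c)\<close> is again admissible with the same k, so the
    hypothesis on A applies to it. This is what closes the estimate without loss in k.\<close>
  have b2: "\<bar>\<integral>z. g \<tau> z * Z2 z \<partial>lborel\<bar> \<le> A * (\<epsilon> * c)"
  proof (rule admissible_scaled[OF A])
    have b: "\<bar>Z2 z\<bar> \<le> \<epsilon> * \<bar>?q z\<bar>" for z
    proof -
      have "\<bar>Z2 z\<bar> = \<bar>F \<tau> (fst z)\<bar> * \<bar>?q z\<bar> * \<bar>chi R z\<bar>" by (simp add: Z2_def abs_mult)
      also have "\<dots> \<le> \<epsilon> * \<bar>?q z\<bar> * 1"
        using F[OF t(1)] \<epsilon> chi_range[OF R0, of z] by (intro mult_mono) auto
      finally show ?thesis by simp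
    qed
    show "\<bar>Z2 z\<bar> \<le> k * (\<epsilon> * c)" for z
      using order_trans[OF b mult_left_mono[OF q(1)[of z] less_imp_le[OF \<epsilon>]]] by (simp add: mult_ac)
    have b2: "(Z2 z)\<^sup>2 \<le> \<epsilon>\<^sup>2 * (?q z)\<^sup>2" for z
      using power_mono[OF b[of z], of 2] by (simp add: power_mult_distrib)
    have "(\<integral>z. gauss z * (Z2 z)\<^sup>2 \<partial>lborel) \<le> (\<integral>z. \<epsilon>\<^sup>2 * (gauss z * (?q z)\<^sup>2) \<partial>lborel)"
    proof (rule integral_mono)
      show "integrable lborel (\<lambda>z. gauss z * (Z2 z)\<^sup>2)"
        unfolding power2_eq_square mult.assoc[symmetric]
        by (rule Cc_integrable_mult[OF CZ(2)]) (intro continuous_intros cZ)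
      show "integrable lborel (\<lambda>z. \<epsilon>\<^sup>2 * (gauss z * (?q z)\<^sup>2))" using q(2) by simp
      show "gauss z * (Z2 z)\<^sup>2 \<le> \<epsilon>\<^sup>2 * (gauss z * (?q z)\<^sup>2)" for z
        using mult_left_mono[OF b2[of z] less_imp_le[OF gauss_pos[of z]]] by (simp add: mult_ac)
    qed
    also have "\<dots> = \<epsilon>\<^sup>2 * (\<integral>z. gauss z * (?q z)\<^sup>2 \<partial>lborel)" by simp
    also have "\<dots> \<le> \<epsilon>\<^sup>2 * c\<^sup>2" using q(3) by (intro mult_left_mono) auto
    finally show "(\<integral>z. gauss z * (Z2 z)\<^sup>2 \<partial>lborel) \<le> (\<epsilon> * c)\<^sup>2" by (simp add: power_mult_distrib)
    show "\<epsilon> * c > 0" using \<epsilon> c by simp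
  qed (use CZ in auto)
  have uz: "\<bar>u z\<bar> \<le> 2 * M * gauss z" for z using u[of z] by simp
  have iq: "integrable lborel (\<lambda>z. gauss z * \<bar>?q z\<bar>)"
    using q(1) cp(2) by (intro gauss_mult_integrable[where k = "k * c"]) (auto intro!: borel_measurable_continuous_onI continuous_intros)
  have Gb: "\<bar>G \<tau> x\<bar> \<le> \<epsilon> / M * L \<tau>" for x unfolding L_def by (rule G[OF t(1)])
  have eML: "\<epsilon> / M * L \<tau> \<ge> 0" using \<epsilon> M L0 by simp
  have b3: "\<bar>\<integral>z. u z * Z3 z \<partial>lborel\<bar> \<le> 2 * \<epsilon> * L \<tau> * c"
  proof -
    have pt: "\<bar>u z * Z3 z\<bar> \<le> 2 * \<epsilon> * L \<tau> * (gauss z * \<bar>?q z\<bar>)" for z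
    proof -
      have "\<bar>u z * Z3 z\<bar> = \<bar>u z\<bar> * (\<bar>G \<tau> (fst z)\<bar> * \<bar>?q z\<bar> * \<bar>chi R z\<bar>)" by (simp add: Z3_def abs_mult)
      also have "\<dots> \<le> (2 * M * gauss z) * ((\<epsilon> / M * L \<tau>) * \<bar>?q z\<bar> * 1)"
        using uz[of z] Gb[of "fst z"] chi_range[OF R0, of z] eML mult_nonneg_nonneg[OF eML abs_ge_zero[of "?q z"]] M gauss_pos[of z] by (intro mult_mono) (auto simp: less_imp_le)
      also have "\<dots> = 2 * \<epsilon> * L \<tau> * (gauss z * \<bar>?q z\<bar>)" using M by simp
      finally show ?thesis .
    qed
    have "\<bar>\<integral>z. u z * Z3 z \<partial>lborel\<bar> \<le> (\<integral>z. \<bar>u z * Z3 z\<bar> \<partial>lborel)" by (rule integral_abs_bound)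
    also have "\<dots> \<le> (\<integral>z. 2 * \<epsilon> * L \<tau> * (gauss z * \<bar>?q z\<bar>) \<partial>lborel)"
      using i(3) iq pt by (intro integral_mono) auto
    also have "\<dots> \<le> 2 * \<epsilon> * L \<tau> * c" using q(4) \<epsilon> L0 by (simp add: mult_left_mono)
    finally show ?thesis .
  qed
  have b4: "\<bar>\<integral>z. g \<tau> z * Z4 z \<partial>lborel\<bar> \<le> (\<epsilon> * k * (6 / R)) * L \<tau>"
    unfolding L_def
  proof (rule bounded_mult_integrable[OF gi mZ(2)])
    fix z
    have "\<bar>Z4 z\<bar> = \<bar>F \<tau> (fst z)\<bar> * \<bar>?p z\<bar> * \<bar>chiv R z\<bar>" by (simp add: Z4_def abs_mult)
    also have "\<dots> \<le> \<epsilon> * k * (6 / R)" using F[OF t(1)] p[of z] chi_bounds(1)[OF R, of z] \<epsilon> k by (intro mult_mono) auto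
    finally show "\<bar>Z4 z\<bar> \<le> \<epsilon> * k * (6 / R)" .
  qed
  have b5: "\<bar>\<integral>z. u z * Z5 z \<partial>lborel\<bar> \<le> 2 * \<epsilon> * L \<tau> * (k * (6 / R))"
  proof -
    have pt: "\<bar>u z * Z5 z\<bar> \<le> 2 * \<epsilon> * L \<tau> * (k * (6 / R)) * gauss z" for z
    proof -
      have "\<bar>u z * Z5 z\<bar> = \<bar>u z\<bar> * (\<bar>G \<tau> (fst z)\<bar> * \<bar>?p z\<bar> * \<bar>chiv R z\<bar>)" by (simp add: Z5_def abs_mult)
      also have "\<dots> \<le> (2 * M * gauss z) * ((\<epsilon> / M * L \<tau>) * k * (6 / R))"
        using uz[of z] Gb[of "fst z"] p[of z] chi_bounds(1)[OF R, of z] eML mult_nonneg_nonneg[OF eML order_trans[OF zero_le_one k]] M gauss_pos[of z] k by (intro mult_mono) (auto simp: less_imp_le)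
      also have "\<dots> = 2 * \<epsilon> * L \<tau> * (k * (6 / R)) * gauss z" using M by simp
      finally show ?thesis .
    qed
    have "\<bar>\<integral>z. u z * Z5 z \<partial>lborel\<bar> \<le> (\<integral>z. \<bar>u z * Z5 z\<bar> \<partial>lborel)" by (rule integral_abs_bound)
    also have "\<dots> \<le> (\<integral>z. 2 * \<epsilon> * L \<tau> * (k * (6 / R)) * gauss z \<partial>lborel)"
      using i(5) integral_gauss(1) pt by (intro integral_mono) auto
    also have "\<dots> = 2 * \<epsilon> * L \<tau> * (k * (6 / R))" using integral_gauss(2) by simp
    finally show ?thesis .
  qed
  have "\<bar>m' R T \<phi> \<tau>\<bar> \<le> (k * \<nu> * (96 + 24 * c) / R) * L \<tau> + A * (\<epsilon> * c) + 2 * \<epsilon> * L \<tau> * c + (\<epsilon> * k * (6 / R)) * L \<tau> + 2 * \<epsilon> * L \<tau> * (k * (6 / R))"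
    unfolding e2 using b1 b2 b3 b4 b5 by linarith
  also have "\<dots> = A * (\<epsilon> * c) + L \<tau> * (2 * \<epsilon> * c + k / R * (\<nu> * (96 + 24 * c) + 18 * \<epsilon>))"
    using R0 by (simp add: field_simps)
  also have "\<dots> \<le> A * (\<epsilon> * c) + A * (2 * \<epsilon> * c + k / R * (\<nu> * (96 + 24 * c) + 18 * \<epsilon>))"
    using LA \<epsilon> c k R0 pos by (intro add_left_mono mult_right_mono) auto
  also have "\<dots> = 3 * \<epsilon> * A * c + k * A / R * ((96 * \<nu> + 18 * \<epsilon>) + 24 * \<nu> * c)"
    using R0 by (simp add: field_simps)
  finally show ?thesis .
qed

end

text \<open>The constant 48 comes from Duhamel's formula: the time integral of the main part is 3
  \<epsilon> A times 2 sqrt (2 C T0), and this is to be at most A / 8.\<close>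

locale small_perturbation = perturbation +
  fixes T0 C :: real
  assumes T0: "T0 > 0" and C: "C > 0"
    and ND: "\<And>t. 0 < t \<Longrightarrow> t \<le> T0 \<Longrightarrow> cN t / cD t \<le> C / t"
    and contr: "\<And>\<phi> k. \<phi> \<in> borel_measurable borel \<Longrightarrow> (\<And>w. \<bar>\<phi> w\<bar> \<le> k) \<Longrightarrow>
      (\<integral>z. gauss z * (P T0 \<phi> z - (\<integral>w. gauss w * \<phi> w \<partial>lborel))\<^sup>2 \<partial>lborel) \<le> 1/16 * (\<integral>w. gauss w * (\<phi> w)\<^sup>2 \<partial>lborel)"
    and small: "48 * \<epsilon> * sqrt (2 * C * T0) \<le> 1"
begin

section \<open>Duhamel's formula and absorption\<close>

lemma m_diff:
  assumes adm: "admissible k \<phi>" and k: "k \<ge> 1" and R: "R \<ge> 1" and t: "0 < s" "s \<le> \<tau>1" "\<tau>1 < T" "T \<le> s + T0"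
    and A: "\<And>\<tau> \<phi>. s \<le> \<tau> \<Longrightarrow> \<tau> < T \<Longrightarrow> admissible k \<phi> \<Longrightarrow> \<bar>\<integral>z. g \<tau> z * \<phi> z \<partial>lborel\<bar> \<le> A" and A0: "A \<ge> 0"
  shows "\<bar>m R T \<phi> \<tau>1 - m R T \<phi> s\<bar> \<le> (3 * \<epsilon> * A + 24 * \<nu> * k * A / R) * (2 * sqrt (2 * C * T0)) + k * A / R * (96 * \<nu> + 18 * \<epsilon>) * T0"
proof -
  define D where "D = (3 * \<epsilon> * A + 24 * \<nu> * k * A / R) * sqrt (2 * C)"
  define E where "E = k * A / R * (96 * \<nu> + 18 * \<epsilon>)"
  have DE: "D \<ge> 0" "E \<ge> 0" using A0 \<epsilon> pos k R C by (auto simp: D_def E_def)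
  \<comment> \<open>An explicit primitive of the singular bound D / sqrt (T - \<tau>) + E; comparing
    derivatives replaces integration. The comparison stops at \<tau>1 < T because the kernel is
    singular at T.\<close>
  define \<Phi> where "\<Phi> = (\<lambda>\<tau>. - 2 * D * sqrt (T - \<tau>) + E * \<tau>)"
  have d\<Phi>: "(\<Phi> has_real_derivative (D / sqrt (T - \<tau>) + E)) (at \<tau>)" if "\<tau> < T" for \<tau>
    unfolding \<Phi>_def using that by (auto intro!: derivative_eq_intros simp: field_simps)
  have dm: "(m R T \<phi> has_real_derivative m' R T \<phi> \<tau>) (at \<tau>)" if "s \<le> \<tau>" "\<tau> < T" for \<tau>
    by (rule deriv_m) (use that t R adm in \<open>auto simp: admissible_def\<close>)
  have b: "\<bar>m' R T \<phi> \<tau>\<bar> \<le> D / sqrt (T - \<tau>) + E" if \<tau>: "s \<le> \<tau>" "\<tau> < T" for \<tau>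
  proof -
    define c where "c = sqrt (2 * C) / sqrt (T - \<tau>)"
    have c: "c > 0" using C \<tau> by (simp add: c_def)
    have c2: "c\<^sup>2 = 2 * (C / (T - \<tau>))" using C \<tau> by (simp add: c_def power_divide)
    have "\<bar>m' R T \<phi> \<tau>\<bar> \<le> 3 * \<epsilon> * A * c + k * A / R * ((96 * \<nu> + 18 * \<epsilon>) + 24 * \<nu> * c)"
    proof (rule m'_bound[OF adm k R _ \<tau>(2) _ c])
      show "2 * (cN (T - \<tau>) / cD (T - \<tau>)) \<le> c\<^sup>2" unfolding c2 using ND[of "T - \<tau>"] \<tau> t by simp
    qed (use A \<tau> t in auto)
    also have "\<dots> = D / sqrt (T - \<tau>) + E" unfolding D_def E_def c_def by (simp add: field_simps add_divide_distrib)
    finally show ?thesis .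
  qed
  have 1: "\<Phi> s - m R T \<phi> s \<le> \<Phi> \<tau>1 - m R T \<phi> \<tau>1"
  proof (rule DERIV_nonneg_imp_nondecreasing[OF t(2)])
    fix \<tau> assume "s \<le> \<tau>" "\<tau> \<le> \<tau>1"
    then have \<tau>: "s \<le> \<tau>" "\<tau> < T" using t by auto
    show "\<exists>y. ((\<lambda>\<tau>. \<Phi> \<tau> - m R T \<phi> \<tau>) has_real_derivative y) (at \<tau>) \<and> 0 \<le> y"
      using DERIV_diff[OF d\<Phi>[OF \<tau>(2)] dm[OF \<tau>]] b[OF \<tau>] by (intro exI conjI) (assumption, linarith)
  qed
  have 2: "\<Phi> s + m R T \<phi> s \<le> \<Phi> \<tau>1 + m R T \<phi> \<tau>1"
  proof (rule DERIV_nonneg_imp_nondecreasing[OF t(2)])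
    fix \<tau> assume "s \<le> \<tau>" "\<tau> \<le> \<tau>1"
    then have \<tau>: "s \<le> \<tau>" "\<tau> < T" using t by auto
    show "\<exists>y. ((\<lambda>\<tau>. \<Phi> \<tau> + m R T \<phi> \<tau>) has_real_derivative y) (at \<tau>) \<and> 0 \<le> y"
      using DERIV_add[OF d\<Phi>[OF \<tau>(2)] dm[OF \<tau>]] b[OF \<tau>] by (intro exI conjI) (assumption, linarith)
  qed
  have "\<bar>m R T \<phi> \<tau>1 - m R T \<phi> s\<bar> \<le> \<Phi> \<tau>1 - \<Phi> s" using 1 2 by linarith
  also have "\<dots> = 2 * D * (sqrt (T - s) - sqrt (T - \<tau>1)) + E * (\<tau>1 - s)" by (simp add: \<Phi>_def algebra_simps)
  also have "\<dots> \<le> 2 * D * sqrt T0 + E * T0"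
  proof (intro add_mono mult_left_mono)
    have "sqrt (T - s) \<le> sqrt T0" "0 \<le> sqrt (T - \<tau>1)" using t by auto
    then show "sqrt (T - s) - sqrt (T - \<tau>1) \<le> sqrt T0" by linarith
  qed (use DE t in auto)
  also have "\<dots> = (3 * \<epsilon> * A + 24 * \<nu> * k * A / R) * (2 * sqrt (2 * C * T0)) + k * A / R * (96 * \<nu> + 18 * \<epsilon>) * T0"
    by (simp add: D_def E_def real_sqrt_mult)
  finally show ?thesis .
qed

lemma chi_limit:
  assumes i: "integrable lborel h"
  shows "(\<lambda>n. \<integral>z. h z * chi (real (Suc n)) z \<partial>lborel) \<longlonglongrightarrow> (\<integral>z. h z \<partial>lborel)"
proof (rule integral_dominated_convergence[where w = "\<lambda>z. \<bar>h z\<bar>"])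
  show "h \<in> borel_measurable lborel" using i by (rule borel_measurable_integrable)
  then show "(\<lambda>z. h z * chi (real (Suc n)) z) \<in> borel_measurable lborel" for n
    using Cc_measurable[OF Cc_chi, of "real (Suc n)"] by simp
  show "integrable lborel (\<lambda>z. \<bar>h z\<bar>)" using i by simp
  show "AE z in lborel. (\<lambda>n. h z * chi (real (Suc n)) z) \<longlonglongrightarrow> h z"
    using tendsto_mult[OF tendsto_const chi_lim, of "h z" z for z] by (intro AE_I2) simp
  show "AE z in lborel. norm (h z * chi (real (Suc n)) z) \<le> \<bar>h z\<bar>" for n
    using chi_range[of "real (Suc n)"] by (intro AE_I2) (auto simp: abs_mult intro!: mult_left_le)
qed

lemma P_facts:
  assumes adm: "admissible k \<phi>" and t: "t > 0"
  shows "P t \<phi> \<in> borel_measurable borel" "\<bar>P t \<phi> z\<bar> \<le> k" "(\<integral>z. gauss z * (P t \<phi> z)\<^sup>2 \<partial>lborel) \<le> 1"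
proof -
  have \<phi>: "Cc \<phi>" "\<And>z. \<bar>\<phi> z\<bar> \<le> k" "(\<integral>z. gauss z * (\<phi> z)\<^sup>2 \<partial>lborel) \<le> 1" using adm by (auto simp: admissible_def)
  note m = Cc_measurable[OF \<phi>(1)]
  show mP [measurable]: "P t \<phi> \<in> borel_measurable borel" by (rule P_measurable[OF t m])
  show b: "\<bar>P t \<phi> z\<bar> \<le> k" for z by (rule P_bound[OF t m \<phi>(2)])
  have k2: "\<bar>(\<phi> w)\<^sup>2\<bar> \<le> k\<^sup>2" for w using power_mono[OF \<phi>(2)[of w], of 2] by simp
  have b2: "\<bar>(P t \<phi> w)\<^sup>2\<bar> \<le> k\<^sup>2" for w using power_mono[OF b[of w], of 2] by simp
  have iP: "integrable lborel (\<lambda>z. gauss z * P t (\<lambda>w. (\<phi> w)\<^sup>2) z)"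
    "(\<integral>z. gauss z * P t (\<lambda>w. (\<phi> w)\<^sup>2) z \<partial>lborel) = (\<integral>w. gauss w * (\<phi> w)\<^sup>2 \<partial>lborel)"
    by (rule P_invariant[OF t, where k = "k\<^sup>2"]; use k2 m in simp)+
  have "(\<integral>z. gauss z * (P t \<phi> z)\<^sup>2 \<partial>lborel) \<le> (\<integral>z. gauss z * P t (\<lambda>w. (\<phi> w)\<^sup>2) z \<partial>lborel)"
  proof (rule integral_mono[OF _ iP(1)])
    show "integrable lborel (\<lambda>z. gauss z * (P t \<phi> z)\<^sup>2)" by (rule gauss_mult_integrable[OF _ b2]) measurable
    show "gauss z * (P t \<phi> z)\<^sup>2 \<le> gauss z * P t (\<lambda>w. (\<phi> w)\<^sup>2) z" for z
      using gauss_pos[of z] by (intro mult_left_mono P_square[OF t m \<phi>(2)]) (auto simp: less_imp_le)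
  qed
  then show "(\<integral>z. gauss z * (P t \<phi> z)\<^sup>2 \<partial>lborel) \<le> 1" using iP(2) \<phi>(3) by simp
qed

text \<open>\<open>P t \<phi>\<close> satisfies both bounds of an admissible function but loses
  compact support; it is cut off by \<open>chi\<close>, and the cutoff is removed in the
  limit.\<close>

lemma P_pairing:
  assumes B: "\<And>\<phi>. admissible k \<phi> \<Longrightarrow> \<bar>\<integral>z. g s z * \<phi> z \<partial>lborel\<bar> \<le> B" and adm: "admissible k \<phi>" and t: "t > 0" and s: "s \<ge> 0"
  shows "\<bar>\<integral>z. g s z * P t \<phi> z \<partial>lborel\<bar> \<le> B"
proof -
  have \<phi>: "Cc \<phi>" using adm by (auto simp: admissible_def)
  note p = P_facts[OF adm t]
  have "admissible k (\<lambda>z. P t \<phi> z * chi (real (Suc n)) z)" for n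
    unfolding admissible_def
  proof (intro conjI allI)
    have c: "\<bar>chi (real (Suc n)) z\<bar> \<le> 1" for z using chi_range[of "real (Suc n)" z] by simp
    show C: "Cc (\<lambda>z. P t \<phi> z * chi (real (Suc n)) z)"
      by (rule Cc_mult[OF Cc_chi cP_slice(1)[OF \<phi> t]]) simp
    have le: "\<bar>P t \<phi> z * chi (real (Suc n)) z\<bar> \<le> \<bar>P t \<phi> z\<bar>" for z
      using c[of z] by (simp add: abs_mult mult_left_le)
    show "\<bar>P t \<phi> z * chi (real (Suc n)) z\<bar> \<le> k" for z by (rule order_trans[OF le p(2)])
    have "(\<integral>z. gauss z * (P t \<phi> z * chi (real (Suc n)) z)\<^sup>2 \<partial>lborel) \<le> (\<integral>z. gauss z * (P t \<phi> z)\<^sup>2 \<partial>lborel)"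
    proof (rule integral_mono)
      have b2: "\<bar>(P t \<phi> w)\<^sup>2\<bar> \<le> k\<^sup>2" for w using power_mono[OF p(2)[of w], of 2] by simp
      show "integrable lborel (\<lambda>z. gauss z * (P t \<phi> z)\<^sup>2)"
        by (rule gauss_mult_integrable[OF _ b2]) (use p(1) in measurable)
      show "integrable lborel (\<lambda>z. gauss z * (P t \<phi> z * chi (real (Suc n)) z)\<^sup>2)"
        unfolding power2_eq_square mult.assoc[symmetric, of "gauss z" for z]
        by (rule Cc_integrable_mult[OF C]) (use cP_slice(1)[OF \<phi> t] cont_chi(1)[of "real (Suc n)"] in \<open>auto intro!: continuous_intros\<close>)
      show "gauss z * (P t \<phi> z * chi (real (Suc n)) z)\<^sup>2 \<le> gauss z * (P t \<phi> z)\<^sup>2" for z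
        using power_mono[OF le[of z], of 2] gauss_pos[of z] by (intro mult_left_mono) (auto simp: less_imp_le)
    qed
    then show "(\<integral>z. gauss z * (P t \<phi> z * chi (real (Suc n)) z)\<^sup>2 \<partial>lborel) \<le> 1" using p(3) by linarith
  qed
  from B[OF this] have 1: "\<bar>\<integral>z. g s z * P t \<phi> z * chi (real (Suc n)) z \<partial>lborel\<bar> \<le> B" for n by (simp add: mult.assoc)
  have "(\<lambda>n. \<bar>\<integral>z. g s z * P t \<phi> z * chi (real (Suc n)) z \<partial>lborel\<bar>) \<longlonglongrightarrow> \<bar>\<integral>z. g s z * P t \<phi> z \<partial>lborel\<bar>"
    by (intro tendsto_rabs chi_limit bounded_mult_integrable(1)[OF ig[OF s] p(1,2)])
  then show ?thesis by (rule LIMSEQ_le_const2) (use 1 in auto)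
qed

text \<open>The limits are taken in order: R to infinity at fixed \<tau> < T removes the terms
  containing k, and then \<tau> tends to T.\<close>

lemma duhamel_estimate:
  assumes adm: "admissible k \<phi>" and k: "k \<ge> 1" and t: "0 < s" "s < T" "T \<le> s + T0"
    and A: "\<And>\<tau> \<phi>. s \<le> \<tau> \<Longrightarrow> \<tau> < T \<Longrightarrow> admissible k \<phi> \<Longrightarrow> \<bar>\<integral>z. g \<tau> z * \<phi> z \<partial>lborel\<bar> \<le> A" and A0: "A \<ge> 0"
  shows "\<bar>(\<integral>z. g T z * \<phi> z \<partial>lborel) - (\<integral>z. g s z * P (T - s) \<phi> z \<partial>lborel)\<bar> \<le> A / 8"
proof -
  have \<phi>: "Cc \<phi>" "\<And>z. \<bar>\<phi> z\<bar> \<le> k" using adm by (auto simp: admissible_def)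
  have ip: "integrable lborel (\<lambda>z. g \<tau> z * P (T - r) \<phi> z)" if "0 \<le> \<tau>" "r < T" for \<tau> r
    by (rule bounded_mult_integrable(1)[OF ig[OF that(1)] P_facts(1,2)[OF adm]]) (use that in auto)
  have 1: "\<bar>(\<integral>z. g \<tau> z * P (T - \<tau>) \<phi> z \<partial>lborel) - (\<integral>z. g s z * P (T - s) \<phi> z \<partial>lborel)\<bar> \<le> A / 8"
    if \<tau>: "s \<le> \<tau>" "\<tau> < T" for \<tau>
  proof -
    have l1: "(\<lambda>n. \<bar>m (real (Suc n)) T \<phi> \<tau> - m (real (Suc n)) T \<phi> s\<bar>) \<longlonglongrightarrow>
       \<bar>(\<integral>z. g \<tau> z * P (T - \<tau>) \<phi> z \<partial>lborel) - (\<integral>z. g s z * P (T - s) \<phi> z \<partial>lborel)\<bar>"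
      unfolding m_def by (intro tendsto_rabs tendsto_diff chi_limit ip) (use t \<tau> in auto)
    have l2: "(\<lambda>n. (3 * \<epsilon> * A + (24 * \<nu> * k * A) * inverse (real (Suc n))) * (2 * sqrt (2 * C * T0))
        + (k * A * (96 * \<nu> + 18 * \<epsilon>) * T0) * inverse (real (Suc n)))
      \<longlonglongrightarrow> (3 * \<epsilon> * A + (24 * \<nu> * k * A) * 0) * (2 * sqrt (2 * C * T0)) + (k * A * (96 * \<nu> + 18 * \<epsilon>) * T0) * 0"
      by (rule tendsto_add[OF tendsto_mult[OF tendsto_add[OF tendsto_const tendsto_mult[OF tendsto_const LIMSEQ_inverse_real_of_nat]] tendsto_const]
         tendsto_mult[OF tendsto_const LIMSEQ_inverse_real_of_nat]])
    have "\<bar>(\<integral>z. g \<tau> z * P (T - \<tau>) \<phi> z \<partial>lborel) - (\<integral>z. g s z * P (T - s) \<phi> z \<partial>lborel)\<bar>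
       \<le> (3 * \<epsilon> * A + (24 * \<nu> * k * A) * 0) * (2 * sqrt (2 * C * T0)) + (k * A * (96 * \<nu> + 18 * \<epsilon>) * T0) * 0"
    proof (rule LIMSEQ_le[OF l1 l2], intro exI allI impI)
      fix n :: nat
      show "\<bar>m (real (Suc n)) T \<phi> \<tau> - m (real (Suc n)) T \<phi> s\<bar> \<le> (3 * \<epsilon> * A + (24 * \<nu> * k * A) * inverse (real (Suc n))) * (2 * sqrt (2 * C * T0))
        + (k * A * (96 * \<nu> + 18 * \<epsilon>) * T0) * inverse (real (Suc n))"
      proof -
        have "\<bar>m (real (Suc n)) T \<phi> \<tau> - m (real (Suc n)) T \<phi> s\<bar> \<le> (3 * \<epsilon> * A + 24 * \<nu> * k * A / real (Suc n)) * (2 * sqrt (2 * C * T0))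
          + k * A / real (Suc n) * (96 * \<nu> + 18 * \<epsilon>) * T0"
        proof (rule m_diff[OF adm k _ t(1) \<tau> t(3) _ A0])
          show "\<bar>\<integral>z. g r z * \<psi> z \<partial>lborel\<bar> \<le> A" if "s \<le> r" "r < T" "admissible k \<psi>" for r \<psi> by (rule A[OF that])
        qed simp
        then show ?thesis by (simp only: divide_inverse mult_ac)
      qed
    qed
    also have "\<dots> = (48 * \<epsilon> * sqrt (2 * C * T0)) * (A / 8)" by simp
    also have "\<dots> \<le> A / 8" using mult_right_mono[OF small, of "A / 8"] A0 by simp
    finally show ?thesis .
  qed
  \<comment> \<open>The remaining time T - \<tau>, kept below T - s so that \<open>1\<close>
    applies.\<close>
  define Y where "Y = (\<lambda>n. (T - s) * inverse (real (Suc (Suc n))))"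
  have Y0: "Y n > 0" for n using t by (simp add: Y_def)
  have Y1: "Y n \<le> T - s" for n
  proof -
    have "inverse (real (Suc (Suc n))) \<le> 1" by (simp add: field_simps)
    then show ?thesis unfolding Y_def using t by (intro mult_left_le) auto
  qed
  have Yl: "Y \<longlonglongrightarrow> 0"
  proof -
    have "(\<lambda>n. inverse (real (Suc (Suc n)))) \<longlonglongrightarrow> 0"
      using LIMSEQ_Suc[OF LIMSEQ_inverse_real_of_nat] by simp
    from tendsto_mult_left[OF this, of "T - s"] show ?thesis unfolding Y_def by simp
  qed
  have a1: "(\<lambda>n. \<integral>z. g T z * P (Y n) \<phi> z \<partial>lborel) \<longlonglongrightarrow> (\<integral>z. g T z * \<phi> z \<partial>lborel)"
  proof (rule integral_dominated_convergence[where w = "\<lambda>z. k * \<bar>g T z\<bar>"])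
    have mg: "g T \<in> borel_measurable lborel" using ig[of T] t by (auto dest: borel_measurable_integrable)
    show "(\<lambda>z. g T z * \<phi> z) \<in> borel_measurable lborel" using mg Cc_measurable[OF \<phi>(1)] by simp
    show "(\<lambda>z. g T z * P (Y n) \<phi> z) \<in> borel_measurable lborel" for n using mg P_facts(1)[OF adm Y0] by simp
    show "integrable lborel (\<lambda>z. k * \<bar>g T z\<bar>)" using ig[of T] t by simp
    show "AE z in lborel. (\<lambda>n. g T z * P (Y n) \<phi> z) \<longlonglongrightarrow> g T z * \<phi> z"
      by (intro AE_I2 tendsto_mult tendsto_const P_small_time[OF Yl Y0 \<phi>(1)])
    show "AE z in lborel. norm (g T z * P (Y n) \<phi> z) \<le> k * \<bar>g T z\<bar>" for n
      using mult_left_mono[OF P_facts(2)[OF adm Y0[of n]] abs_ge_zero[of "g T z" for z]]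
      by (intro AE_I2) (simp add: abs_mult mult.commute)
  qed
  \<comment> \<open>The moving time is split in two: at fixed g T the semigroup tends to the
    identity (\<open>a1\<close>), and the change of g is controlled by continuity in L^1 against the
    uniform bound k.\<close>
  have a2: "(\<lambda>n. \<integral>z. (g (T - Y n) z - g T z) * P (Y n) \<phi> z \<partial>lborel) \<longlonglongrightarrow> 0"
  proof (rule tendsto_0_le[of "\<lambda>n. \<integral>z. \<bar>g (T - Y n) z - g T z\<bar> \<partial>lborel" _ _ k])
    have "filterlim (\<lambda>n. T - Y n) (at T within {0..}) sequentially"
      unfolding filterlim_at
    proof (intro conjI always_eventually allI)
      show "T - Y n \<in> {0..}" "T - Y n \<noteq> T" for n using Y0[of n] Y1[of n] t by auto
      show "(\<lambda>n. T - Y n) \<longlonglongrightarrow> T" using tendsto_diff[OF tendsto_const Yl, of T] by simp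
    qed
    then show "(\<lambda>n. \<integral>z. \<bar>g (T - Y n) z - g T z\<bar> \<partial>lborel) \<longlonglongrightarrow> 0"
      using L1[of T] t by (auto intro: filterlim_compose)
    show "\<forall>\<^sub>F n in sequentially. norm (\<integral>z. (g (T - Y n) z - g T z) * P (Y n) \<phi> z \<partial>lborel) \<le> norm (\<integral>z. \<bar>g (T - Y n) z - g T z\<bar> \<partial>lborel) * k"
    proof (rule always_eventually, rule allI)
      fix n
      have "integrable lborel (\<lambda>z. g (T - Y n) z - g T z)" using ig[of T] ig[of "T - Y n"] Y1[of n] t by simp
      from bounded_mult_integrable(2)[OF this P_facts(1,2)[OF adm Y0[of n]]]
      show "norm (\<integral>z. (g (T - Y n) z - g T z) * P (Y n) \<phi> z \<partial>lborel) \<le> norm (\<integral>z. \<bar>g (T - Y n) z - g T z\<bar> \<partial>lborel) * k"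
        by (simp add: mult.commute)
    qed
  qed
  have "(\<lambda>n. \<integral>z. g (T - Y n) z * P (T - (T - Y n)) \<phi> z \<partial>lborel) \<longlonglongrightarrow> (\<integral>z. g T z * \<phi> z \<partial>lborel)"
  proof -
    have "(\<integral>z. g T z * P (Y n) \<phi> z \<partial>lborel) + (\<integral>z. (g (T - Y n) z - g T z) * P (Y n) \<phi> z \<partial>lborel)
        = (\<integral>z. g (T - Y n) z * P (T - (T - Y n)) \<phi> z \<partial>lborel)" for n
    proof -
      have i: "integrable lborel (\<lambda>z. g T z * P (Y n) \<phi> z)" "integrable lborel (\<lambda>z. g (T - Y n) z * P (Y n) \<phi> z)"
        using ip[of T "T - Y n"] ip[of "T - Y n" "T - Y n"] Y0[of n] Y1[of n] t by auto
      show ?thesis using i by (simp add: left_diff_distrib)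
    qed
    then show ?thesis using tendsto_add[OF a1 a2] by simp
  qed
  from tendsto_rabs[OF tendsto_diff[OF this tendsto_const]]
  have l: "(\<lambda>n. \<bar>(\<integral>z. g (T - Y n) z * P (T - (T - Y n)) \<phi> z \<partial>lborel) - (\<integral>z. g s z * P (T - s) \<phi> z \<partial>lborel)\<bar>)
     \<longlonglongrightarrow> \<bar>(\<integral>z. g T z * \<phi> z \<partial>lborel) - (\<integral>z. g s z * P (T - s) \<phi> z \<partial>lborel)\<bar>" .
  show ?thesis
  proof (rule LIMSEQ_le_const2[OF l], intro exI allI impI)
    fix n :: nat
    show "\<bar>(\<integral>z. g (T - Y n) z * P (T - (T - Y n)) \<phi> z \<partial>lborel) - (\<integral>z. g s z * P (T - s) \<phi> z \<partial>lborel)\<bar> \<le> A / 8"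
      by (rule 1) (use Y0[of n] Y1[of n] in auto)
  qed
qed

lemma admissible_zero: "k \<ge> 0 \<Longrightarrow> admissible k (\<lambda>_. 0)" by (simp add: admissible_def Cc_def)

text \<open>The supremum over the time window is finite because of the bound k and mass conservation,
  so the estimate can be absorbed.\<close>

lemma propagate_pos:
  assumes k: "k \<ge> 1" and s: "s > 0" and B: "\<And>\<phi>. admissible k \<phi> \<Longrightarrow> \<bar>\<integral>z. g s z * \<phi> z \<partial>lborel\<bar> \<le> B"
    and bd: "\<And>t. t \<ge> 0 \<Longrightarrow> L t \<le> Lm"
    and t: "s \<le> t" "t \<le> s + T0" and adm: "admissible k \<phi>"
  shows "\<bar>\<integral>z. g t z * \<phi> z \<partial>lborel\<bar> \<le> 2 * B"
proof -
  define S where "S = {\<bar>\<integral>z. g \<tau> z * \<psi> z \<partial>lborel\<bar> | \<tau> \<psi>. s \<le> \<tau> \<and> \<tau> \<le> s + T0 \<and> admissible k \<psi>}"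
  have B0: "B \<ge> 0" using B[OF admissible_zero] k by fastforce
  have bS: "bdd_above S"
  proof (rule bdd_aboveI)
    fix y assume "y \<in> S"
    then obtain \<tau> \<psi> where y: "y = \<bar>\<integral>z. g \<tau> z * \<psi> z \<partial>lborel\<bar>" "s \<le> \<tau>" "admissible k \<psi>" by (auto simp: S_def)
    have "y \<le> k * L \<tau>" unfolding y(1) L_def
      by (rule bounded_mult_integrable) (use y s in \<open>auto simp: admissible_def intro!: ig Cc_measurable\<close>)
    also have "\<dots> \<le> k * Lm" using bd[of \<tau>] y s k by (intro mult_left_mono) auto
    finally show "y \<le> k * Lm" .
  qed
  have Ssup: "\<bar>\<integral>z. g \<tau> z * \<psi> z \<partial>lborel\<bar> \<le> Sup S" if "s \<le> \<tau>" "\<tau> \<le> s + T0" "admissible k \<psi>" for \<tau> \<psi>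
    by (rule cSup_upper[OF _ bS]) (use that in \<open>auto simp: S_def\<close>)
  have S0: "Sup S \<ge> 0" using Ssup[of s "\<lambda>_. 0"] admissible_zero[of k] k T0 by simp
  have le: "\<bar>\<integral>z. g \<tau> z * \<psi> z \<partial>lborel\<bar> \<le> B + Sup S / 8" if \<tau>: "s \<le> \<tau>" "\<tau> \<le> s + T0" "admissible k \<psi>" for \<tau> \<psi>
  proof (cases "\<tau> = s")
    case True then show ?thesis using B[OF \<tau>(3)] S0 by simp
  next
    case False
    have "\<bar>(\<integral>z. g \<tau> z * \<psi> z \<partial>lborel) - (\<integral>z. g s z * P (\<tau> - s) \<psi> z \<partial>lborel)\<bar> \<le> Sup S / 8"
      by (rule duhamel_estimate[OF \<tau>(3) k s]) (use \<tau> False S0 Ssup in auto)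
    moreover have "\<bar>\<integral>z. g s z * P (\<tau> - s) \<psi> z \<partial>lborel\<bar> \<le> B"
      by (rule P_pairing[OF B \<tau>(3)]) (use \<tau> False s in auto)
    ultimately show ?thesis by linarith
  qed
  \<comment> \<open>The absorption: Sup S is at most (8/7) B, so every pairing is at most (8/7) B,
    which is rounded up to 2 B.\<close>
  have "Sup S \<le> B + Sup S / 8"
  proof (rule cSup_least)
    show "S \<noteq> {}" using adm t by (auto simp: S_def)
    show "y \<le> B + Sup S / 8" if "y \<in> S" for y using that le by (auto simp: S_def)
  qed
  then show ?thesis using le[OF t adm] B0 by linarith
qed

text \<open>The equation holds for positive times only, so \<open>propagate_pos\<close> is started
  at times tending to 0. The error k times the L^1 distance to the initial datum vanishes for each
  fixed k.\<close>

lemma propagate_zero: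
  assumes k: "k \<ge> 1" and B: "\<And>\<phi>. admissible k \<phi> \<Longrightarrow> \<bar>\<integral>z. g 0 z * \<phi> z \<partial>lborel\<bar> \<le> B"
    and bd: "\<And>t. t \<ge> 0 \<Longrightarrow> L t \<le> Lm"
    and t: "0 < t" "t \<le> T0" and adm: "admissible k \<phi>"
  shows "\<bar>\<integral>z. g t z * \<phi> z \<partial>lborel\<bar> \<le> 2 * B"
proof -
  define Y where "Y = (\<lambda>n. t * inverse (real (Suc n)))"
  have Y: "0 < Y n" "Y n \<le> t" for n
  proof -
    have "inverse (real (Suc n)) \<le> 1" by (simp add: field_simps)
    then show "0 < Y n" "Y n \<le> t" unfolding Y_def using t by (auto intro!: mult_left_le)
  qed
  have Yl: "Y \<longlonglongrightarrow> 0" using tendsto_mult_left[OF LIMSEQ_inverse_real_of_nat, of t] unfolding Y_def by simp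
  have f: "filterlim Y (at 0 within {0..}) sequentially"
    unfolding filterlim_at
  proof (intro conjI always_eventually allI)
    show "Y n \<in> {0..}" "Y n \<noteq> 0" for n using Y(1)[of n] by auto
  qed (rule Yl)
  have l: "(\<lambda>n. \<integral>z. \<bar>g (Y n) z - g 0 z\<bar> \<partial>lborel) \<longlonglongrightarrow> 0"
    using filterlim_compose[OF L1[of 0] f] by simp
  have "\<bar>\<integral>z. g t z * \<phi> z \<partial>lborel\<bar> \<le> 2 * (B + k * (\<integral>z. \<bar>g (Y n) z - g 0 z\<bar> \<partial>lborel))" for n
  proof (rule propagate_pos[where k = k and s = "Y n" and Lm = Lm])
    show "k \<ge> 1" "Y n > 0" "admissible k \<phi>" by (rule k, rule Y(1), rule adm)
    show "Y n \<le> t" "t \<le> Y n + T0" using Y[of n] t by auto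
    show "L \<tau> \<le> Lm" if "\<tau> \<ge> 0" for \<tau> by (rule bd[OF that])
    fix \<psi> assume \<psi>: "admissible k \<psi>"
    have m: "\<psi> \<in> borel_measurable borel" "\<And>z. \<bar>\<psi> z\<bar> \<le> k" using \<psi> by (auto simp: admissible_def intro: Cc_measurable)
    have i: "integrable lborel (g (Y n))" "integrable lborel (g 0)" using ig[of 0] ig[of "Y n"] Y(1)[of n] by auto
    have "(\<integral>z. g (Y n) z * \<psi> z \<partial>lborel) = (\<integral>z. g 0 z * \<psi> z \<partial>lborel) + (\<integral>z. (g (Y n) z - g 0 z) * \<psi> z \<partial>lborel)"
      using bounded_mult_integrable(1)[OF i(1) m] bounded_mult_integrable(1)[OF i(2) m] by (simp add: left_diff_distrib)
    then show "\<bar>\<integral>z. g (Y n) z * \<psi> z \<partial>lborel\<bar> \<le> B + k * (\<integral>z. \<bar>g (Y n) z - g 0 z\<bar> \<partial>lborel)"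
      using B[OF \<psi>] bounded_mult_integrable(2)[OF Bochner_Integration.integrable_diff[OF i] m] by linarith
  qed
  moreover have "(\<lambda>n. 2 * (B + k * (\<integral>z. \<bar>g (Y n) z - g 0 z\<bar> \<partial>lborel))) \<longlonglongrightarrow> 2 * (B + k * 0)"
    by (intro tendsto_intros l)
  ultimately have "\<bar>\<integral>z. g t z * \<phi> z \<partial>lborel\<bar> \<le> 2 * (B + k * 0)"
    by (intro LIMSEQ_le_const) auto
  then show ?thesis by simp
qed

section \<open>From pairings back to the weighted norm\<close>

definition E :: "real \<Rightarrow> real" where "E t = sqrt (\<integral>z. (g t z)\<^sup>2 / gauss z \<partial>lborel)"
text \<open>Carried along with \<open>E\<close>, because a non-integrable function would give
  \<open>E\<close> the value 0.\<close>

definition fin :: "real \<Rightarrow> bool" where "fin t \<longleftrightarrow> integrable lborel (\<lambda>z. (g t z)\<^sup>2 / gauss z)"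

lemma E_nonneg: "E t \<ge> 0"
  unfolding E_def using gauss_pos by (intro real_sqrt_ge_zero integral_nonneg_AE AE_I2) (auto simp: less_imp_le)

lemma E_pairing:
  assumes "fin t" "t \<ge> 0" "admissible k \<phi>"
  shows "\<bar>\<integral>z. g t z * \<phi> z \<partial>lborel\<bar> \<le> E t"
proof -
  have "\<bar>\<integral>z. g t z * \<phi> z \<partial>lborel\<bar> \<le> sqrt (\<integral>z. (g t z)\<^sup>2 / gauss z \<partial>lborel) * 1"
    by (rule L2_pairing[where k = k])
       (use assms ig[OF assms(2)] in \<open>auto simp: admissible_def fin_def intro: Cc_measurable dest: borel_measurable_integrable\<close>)
  then show ?thesis by (simp add: E_def)
qed

lemma E_from_pairing:
  assumes t: "t > 0" and B: "\<And>k \<phi>. k \<ge> 1 \<Longrightarrow> admissible k \<phi> \<Longrightarrow> \<bar>\<integral>z. g t z * \<phi> z \<partial>lborel\<bar> \<le> B"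
  shows "fin t" "E t \<le> B"
proof -
  have B': "\<bar>\<integral>z. g t z * \<phi> z \<partial>lborel\<bar> \<le> B" if "admissible k \<phi>" for k \<phi>
    by (rule B[of "max 1 k"]) (use admissible_mono[OF that] in auto)
  have B0: "B \<ge> 0" using B'[OF admissible_zero[of 0]] by simp
  note admissible_L2[OF B' cg_slice[OF t]]
  then show "fin t" "E t \<le> B" using real_le_lsqrt[OF B0] by (auto simp: fin_def E_def)
qed

text \<open>Over the first window the norm at most doubles; over a full window it is halved, by 1/4
  from the contraction and 2/8 from Duhamel's formula.\<close>

lemma E_decay_aux:
  assumes bd: "\<And>t. t \<ge> 0 \<Longrightarrow> L t \<le> Lm"
  shows "fin 0 \<Longrightarrow> 0 < t \<Longrightarrow> t \<le> T0 \<Longrightarrow> fin t \<and> E t \<le> 2 * E 0"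
    and "0 < s \<Longrightarrow> fin s \<Longrightarrow> fin (s + T0) \<and> E (s + T0) \<le> E s / 2"
proof -
  assume f: "fin 0" and t: "0 < t" "t \<le> T0"
  have "\<bar>\<integral>z. g t z * \<phi> z \<partial>lborel\<bar> \<le> 2 * E 0" if "k \<ge> 1" "admissible k \<phi>" for k \<phi>
    by (rule propagate_zero[OF that(1) _ bd t that(2)]) (auto intro: E_pairing[OF f])
  from E_from_pairing[OF t(1) this] show "fin t \<and> E t \<le> 2 * E 0" by auto
next
  assume s: "0 < s" and f: "fin s"
  have "\<bar>\<integral>z. g (s + T0) z * \<phi> z \<partial>lborel\<bar> \<le> E s / 2" if k: "k \<ge> 1" "admissible k \<phi>" for k \<phi>
  proof -
    have \<phi>: "\<phi> \<in> borel_measurable borel" "\<And>z. \<bar>\<phi> z\<bar> \<le> k" "(\<integral>z. gauss z * (\<phi> z)\<^sup>2 \<partial>lborel) \<le> 1"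
      using k(2) by (auto simp: admissible_def intro: Cc_measurable)
    \<comment> \<open>Within the window all pairings are bounded by twice the initial norm, which is
      the value of A fed into Duhamel's formula.\<close>
    have A: "\<bar>\<integral>z. g \<tau> z * \<psi> z \<partial>lborel\<bar> \<le> 2 * E s" if "s \<le> \<tau>" "\<tau> < s + T0" "admissible k \<psi>" for \<tau> \<psi>
      by (rule propagate_pos[OF k(1) s _ bd _ _ that(3)]) (use that s in \<open>auto intro: E_pairing[OF f]\<close>)
    have 1: "\<bar>(\<integral>z. g (s + T0) z * \<phi> z \<partial>lborel) - (\<integral>z. g s z * P (s + T0 - s) \<phi> z \<partial>lborel)\<bar> \<le> 2 * E s / 8"
      by (rule duhamel_estimate[OF k(2) k(1) s]) (use T0 A E_nonneg in auto)
    note p = P_facts[OF k(2) T0]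
    let ?m = "\<integral>w. gauss w * \<phi> w \<partial>lborel"
    \<comment> \<open>Since g has zero mass, the mean of \<phi> may be subtracted, and the
      contraction applies to what remains.\<close>
    have "(\<integral>z. g s z * P T0 \<phi> z \<partial>lborel) = (\<integral>z. g s z * (P T0 \<phi> z - ?m) \<partial>lborel)"
      using bounded_mult_integrable(1)[OF ig p(1,2), of s] ig[of s] mass[of s] s by (simp add: right_diff_distrib)
    also have "\<bar>\<dots>\<bar> \<le> sqrt (\<integral>z. (g s z)\<^sup>2 / gauss z \<partial>lborel) * (1 / 4)"
    proof (rule L2_pairing[where k = "k + \<bar>?m\<bar>"])
      show "g s \<in> borel_measurable borel" using ig[of s] s by (auto dest: borel_measurable_integrable)
      show "integrable lborel (\<lambda>z. (g s z)\<^sup>2 / gauss z)" using f by (simp add: fin_def)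
      show "(\<lambda>z. P T0 \<phi> z - ?m) \<in> borel_measurable borel" using p(1) by measurable
      show "\<bar>P T0 \<phi> z - ?m\<bar> \<le> k + \<bar>?m\<bar>" for z using p(2)[of z] by linarith
      show "(\<integral>z. gauss z * (P T0 \<phi> z - ?m)\<^sup>2 \<partial>lborel) \<le> (1 / 4)\<^sup>2"
        using contr[OF \<phi>(1,2)] \<phi>(3) by (simp add: power2_eq_square)
    qed simp
    finally have "\<bar>\<integral>z. g s z * P T0 \<phi> z \<partial>lborel\<bar> \<le> E s / 4" by (simp add: E_def)
    moreover have "s + T0 - s = T0" by simp
    ultimately show ?thesis using 1 by (simp only:)
  qed
  from E_from_pairing[OF _ this] show "fin (s + T0) \<and> E (s + T0) \<le> E s / 2" using s T0 by auto
qed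

lemma E_decay:
  assumes bd: "\<And>t. t \<ge> 0 \<Longrightarrow> L t \<le> Lm" and f: "fin 0" and t: "t \<ge> 0"
  shows "fin t" "E t \<le> 4 * exp (- (ln 2 / T0) * t) * E 0"
proof -
  have step: "fin (s + real n * T0) \<and> E (s + real n * T0) \<le> (1/2) ^ n * (2 * E 0)" if s: "0 < s" "s \<le> T0" for s n
  proof (induction n)
    case 0 then show ?case using E_decay_aux(1)[OF bd f s] by simp
  next
    case (Suc n)
    have "fin (s + real n * T0 + T0) \<and> E (s + real n * T0 + T0) \<le> E (s + real n * T0) / 2"
      by (rule E_decay_aux(2)[OF bd]) (use Suc s T0 in \<open>auto intro: add_pos_nonneg\<close>)
    then show ?case using Suc by (auto simp: algebra_simps)
  qed
  have "fin t \<and> E t \<le> 4 * exp (- (ln 2 / T0) * t) * E 0"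
  proof (cases "t = 0")
    case True
    then show ?thesis using f E_nonneg[of 0] by simp
  next
    case False
    then have tp: "t > 0" using t by simp
    \<comment> \<open>The ceiling minus one leaves a remainder s in (0, T0]; s must be positive
      because halving starts from positive times. The final factor 4 is 2 for the first window times
      2 for n \<ge> t / T0 - 1.\<close>
    define n where "n = nat (\<lceil>t / T0\<rceil> - 1)"
    have c1: "\<lceil>t / T0\<rceil> \<ge> 1" unfolding one_le_ceiling using tp T0 by (rule divide_pos_pos)
    have n: "real n = real_of_int \<lceil>t / T0\<rceil> - 1" using c1 by (simp add: n_def)
    have n1: "real n < t / T0" "t / T0 \<le> real n + 1" unfolding n using ceiling_correct[of "t / T0"] by linarith+
    define s where "s = t - real n * T0"
    have s: "0 < s" "s \<le> T0" using n1 T0 by (auto simp: s_def field_simps)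
    have fE: "fin t" "E t \<le> (1/2) ^ n * (2 * E 0)" using step[OF s, of n] by (auto simp: s_def)
    have "(1/2 :: real) ^ n = exp (- (ln 2) * real n)"
      using exp_of_nat_mult[of n "ln 2 :: real"] by (simp add: exp_minus power_one_over inverse_eq_divide mult.commute)
    also have "\<dots> \<le> exp (- (ln 2) * (t / T0 - 1))" using n1(2) by (simp add: mult_left_mono)
    also have "\<dots> = exp (- (ln 2 / T0) * t) * 2" by (simp add: algebra_simps exp_diff exp_minus exp_add inverse_eq_divide)
    finally have "(1/2) ^ n * (2 * E 0) \<le> (exp (- (ln 2 / T0) * t) * 2) * (2 * E 0)"
      using E_nonneg[of 0] by (intro mult_right_mono) auto
    from order_trans[OF fE(2) this] show ?thesis using fE(1) by (simp add: mult_ac)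
  qed
  then show "fin t" "E t \<le> 4 * exp (- (ln 2 / T0) * t) * E 0" by auto
qed

end

section \<open>Weak derivatives and the self-consistent force\<close>

lemma power_div_fact_le_exp:
  fixes x :: real assumes "x \<ge> 0" shows "x ^ n / fact n \<le> exp x"
proof -
  have "(\<Sum>i\<in>{n}. x ^ i /\<^sub>R fact i) \<le> (\<Sum>i. x ^ i /\<^sub>R fact i)"
    by (rule sum_le_suminf[OF summable_exp_generic]) (use assms in auto)
  then show ?thesis by (simp add: exp_def divide_inverse mult.commute)
qed

text \<open>The family is closed under differentiation, which gives smoothness of the bump function by induction.\<close>

definition bw :: "real \<Rightarrow> real \<Rightarrow> real \<Rightarrow> real" where "bw a r x = r\<^sup>2 - (x - a)\<^sup>2"
definition bump :: "real \<Rightarrow> real \<Rightarrow> real poly \<Rightarrow> nat \<Rightarrow> real \<Rightarrow> real" where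
  "bump a r p m x = (if bw a r x > 0 then poly p x / (bw a r x) ^ m * exp (- 1 / bw a r x) else 0)"
definition bpoly :: "real \<Rightarrow> real \<Rightarrow> real poly \<Rightarrow> nat \<Rightarrow> real poly" where
  "bpoly a r p m = pderiv p * [: r\<^sup>2 - a\<^sup>2, 2 * a, - 1 :] ^ 2
     + p * [: 2 * a, - 2 :] * (1 - of_nat m * [: r\<^sup>2 - a\<^sup>2, 2 * a, - 1 :])"

lemma poly_bw: "poly [: r\<^sup>2 - a\<^sup>2, 2 * a, - 1 :] x = bw a r x"
  by (simp add: bw_def power2_eq_square algebra_simps)

lemma cont_bw: "isCont (bw a r) x" unfolding bw_def by (intro continuous_intros)

text \<open>The exponential beats every negative power of w, here in the form exp (-1/w) \<le>
  (m+2)! w^(m+2). Quadratic vanishing at the edge is enough for a zero derivative there.\<close>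

lemma bump_abs_le: "\<bar>bump a r p m x\<bar> \<le> \<bar>poly p x\<bar> * fact (m + 2) * (bw a r x)\<^sup>2"
proof (cases "bw a r x > 0")
  case True
  define w where "w = bw a r x"
  have w: "w > 0" using True by (simp add: w_def)
  have "(1 / w) ^ (m + 2) / fact (m + 2) \<le> exp (1 / w)" by (rule power_div_fact_le_exp) (use w in simp)
  then have e1: "exp (- 1 / w) \<le> fact (m + 2) * w ^ (m + 2)"
  proof -
    define F where "F = (fact (m + 2) :: real)"
    define W where "W = w ^ (m + 2)"
    define Y where "Y = exp (1 / w)"
    have FW: "F > 0" "W > 0" "Y > 0" using w by (auto simp: F_def W_def Y_def)
    assume "(1 / w) ^ (m + 2) / fact (m + 2) \<le> exp (1 / w)"
    then have "1 / W / F \<le> Y" unfolding F_def[symmetric] Y_def[symmetric] power_one_over W_def[symmetric] .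
    then have "1 / Y \<le> F * W" using FW by (simp add: field_simps)
    then show ?thesis by (simp add: exp_minus F_def W_def Y_def inverse_eq_divide)
  qed
  have "exp (- 1 / w) / w ^ m \<le> fact (m + 2) * w\<^sup>2"
    using w e1 by (simp add: divide_le_eq power_add power2_eq_square mult_ac)
  then have "\<bar>poly p x\<bar> * (exp (- 1 / w) / w ^ m) \<le> \<bar>poly p x\<bar> * (fact (m + 2) * w\<^sup>2)"
    by (rule mult_left_mono) simp
  then show ?thesis using w by (simp add: bump_def w_def[symmetric] abs_mult mult_ac)
next
  case False then show ?thesis by (simp add: bump_def)
qed

lemma deriv_bump: "(bump a r p m has_real_derivative bump a r (bpoly a r p m) (m + 2) x) (at x)"
proof -
  consider "bw a r x > 0" | "bw a r x < 0" | "bw a r x = 0" by linarith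
  then show ?thesis
  proof cases
    case 1
    define w where "w = bw a r x"
    have w: "w > 0" using 1 by (simp add: w_def)
    have dw: "(bw a r has_real_derivative (- 2 * (x - a))) (at x)"
      unfolding bw_def by (auto intro!: derivative_eq_intros)
    have d1: "((\<lambda>x. poly p x / (bw a r x) ^ m) has_real_derivative
       ((poly (pderiv p) x * w ^ m - poly p x * (of_nat m * w ^ (m - 1) * (- 2 * (x - a)))) / (w ^ m * w ^ m))) (at x)"
      unfolding w_def
      by (rule DERIV_divide[OF poly_DERIV DERIV_cong[OF DERIV_power[OF dw]]]) (use 1 in auto)
    have d2: "((\<lambda>x. exp (- 1 / bw a r x)) has_real_derivative (exp (- 1 / w) * (- 2 * (x - a) / w\<^sup>2))) (at x)"
      unfolding w_def by (rule DERIV_cong[OF DERIV_fun_exp[OF DERIV_divide[OF DERIV_const dw]]]) (use 1 in \<open>auto simp: power2_eq_square\<close>)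
    have "((\<lambda>x. poly p x / (bw a r x) ^ m * exp (- 1 / bw a r x)) has_real_derivative poly (bpoly a r p m) x / w ^ (m + 2) * exp (- 1 / w)) (at x)"
    proof (rule DERIV_cong[OF DERIV_mult[OF d1 d2]])
      have pb: "poly (bpoly a r p m) x = poly (pderiv p) x * w\<^sup>2 + poly p x * (- 2 * (x - a)) * (1 - of_nat m * w)"
        unfolding bpoly_def w_def by (simp add: poly_bw[symmetric] algebra_simps)
      have pm: "of_nat m * w ^ (m - 1) * w = of_nat m * w ^ m" by (cases m) auto
      have e: "of_nat m * w ^ (m - 1) = of_nat m * w ^ m / w" using pm w by (simp add: field_simps)
      show "(poly (pderiv p) x * w ^ m - poly p x * (of_nat m * w ^ (m - 1) * (- 2 * (x - a)))) / (w ^ m * w ^ m) * exp (- 1 / bw a r x) +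
        exp (- 1 / w) * (- 2 * (x - a) / w\<^sup>2) * (poly p x / bw a r x ^ m) = poly (bpoly a r p m) x / w ^ (m + 2) * exp (- 1 / w)"
        unfolding pb e w_def[symmetric] using w by (simp add: field_simps power_add power2_eq_square)
    qed
    then have "(bump a r p m has_real_derivative poly (bpoly a r p m) x / w ^ (m + 2) * exp (- 1 / w)) (at x)"
    proof (rule has_field_derivative_transform_within_open[of _ _ _ "bw a r -` {0<..}"])
      show "open (bw a r -` {0<..})" using cont_bw by (intro open_vimage) (auto simp: continuous_on_eq_continuous_at)
    qed (use 1 in \<open>auto simp: bump_def\<close>)
    then show ?thesis using 1 by (simp add: bump_def w_def)
  next
    case 2
    have "(bump a r p m has_real_derivative 0) (at x)"
    proof (rule has_field_derivative_transform_within_open[of "\<lambda>_. 0" _ _ "bw a r -` {..<0}"])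
      show "open (bw a r -` {..<0})" using cont_bw by (intro open_vimage) (auto simp: continuous_on_eq_continuous_at)
    qed (use 2 in \<open>auto simp: bump_def\<close>)
    then show ?thesis using 2 by (simp add: bump_def)
  next
    case 3
    have b0: "bump a r q n x = 0" for q n using 3 by (simp add: bump_def)
    have "((\<lambda>y. (bump a r p m y - bump a r p m x) / (y - x)) \<longlongrightarrow> 0) (at x)"
    \<comment> \<open>At an edge point x the factor y - x divides \<open>bw a r y\<close>. One of
      the two factors \<open>bw\<close> in the bound cancels the denominator, and the other tends to
      0.\<close>
    proof (rule tendsto_0_le[of "\<lambda>y. poly p y * fact (m + 2) * (y + x - 2 * a) * bw a r y" _ _ 1])
      have "((\<lambda>y. poly p y * fact (m + 2) * (y + x - 2 * a) * bw a r y) \<longlongrightarrow> poly p x * fact (m + 2) * (x + x - 2 * a) * bw a r x) (at x)"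
        using cont_bw[where a = a and r = r and x = x] DERIV_isCont[OF poly_DERIV[of p x]] by (intro tendsto_intros) (auto simp: isCont_def)
      then show "((\<lambda>y. poly p y * fact (m + 2) * (y + x - 2 * a) * bw a r y) \<longlongrightarrow> 0) (at x)" using 3 by simp
      show "\<forall>\<^sub>F y in at x. norm ((bump a r p m y - bump a r p m x) / (y - x)) \<le> norm (poly p y * fact (m + 2) * (y + x - 2 * a) * bw a r y) * 1"
      proof (rule eventually_mono[OF eventually_neq_at_within[of x]])
        fix y assume y: "y \<noteq> x"
        have "bw a r y = - ((y - x) * (y + x - 2 * a))" using 3 unfolding bw_def by (simp add: power2_eq_square algebra_simps)
        then have "\<bar>bw a r y\<bar> = \<bar>y - x\<bar> * \<bar>y + x - 2 * a\<bar>" by (simp add: abs_mult)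
        then have "(bw a r y)\<^sup>2 = \<bar>y - x\<bar> * \<bar>y + x - 2 * a\<bar> * \<bar>bw a r y\<bar>" by (metis power2_abs power2_eq_square)
        then have "\<bar>bump a r p m y\<bar> \<le> \<bar>poly p y\<bar> * fact (m + 2) * (\<bar>y - x\<bar> * \<bar>y + x - 2 * a\<bar> * \<bar>bw a r y\<bar>)"
          using bump_abs_le[of a r p m y] by simp
        then show "norm ((bump a r p m y - bump a r p m x) / (y - x)) \<le> norm (poly p y * fact (m + 2) * (y + x - 2 * a) * bw a r y) * 1"
          using y b0 by (simp add: abs_mult abs_divide divide_le_eq mult_ac)
      qed
    qed
    then show ?thesis using b0 by (simp add: has_field_derivative_iff)
  qed
qed

lemma continuous_bump: "continuous_on S (bump a r p m)"
  by (rule DERIV_continuous_on) (rule has_field_derivative_at_within[OF deriv_bump])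

lemma bump_smult: "bump a r p m x * h = bump a r (smult h p) m x"
  by (simp add: bump_def)

text \<open>A directional derivative is the next member of the family with its polynomial scaled by
  the direction, so induction over all members closes.\<close>

lemma Ck_bump: "Ck_on n (bump a r p m) UNIV"
proof (induction n arbitrary: p m)
  case 0 show ?case by (simp add: continuous_bump)
next
  case (Suc n)
  have d: "(bump a r p m has_derivative (\<lambda>h. bump a r (bpoly a r p m) (m + 2) x * h)) (at x)" for x
    using deriv_bump[of a r p m x] by (simp add: has_field_derivative_def)
  have "(\<lambda>x. frechet_derivative (bump a r p m) (at x) h) = bump a r (smult h (bpoly a r p m)) (m + 2)" for h
    by (rule ext) (simp add: frechet_derivative_at[OF d, symmetric] bump_smult)
  then show ?case using d Suc by (auto simp: differentiable_def)
qed

lemma bump_support: assumes "r > 0" "\<bar>x - a\<bar> \<ge> r" shows "bump a r p m x = 0"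
proof -
  have "r\<^sup>2 \<le> \<bar>x - a\<bar>\<^sup>2" using assms by (intro power_mono) auto
  then show ?thesis by (simp add: bump_def bw_def)
qed

lemma test_fun_bump: assumes "r > 0" shows "test_fun (bump a r p m)"
proof -
  have "{x. bump a r p m x \<noteq> 0} \<subseteq> {a - r..a + r}"
  proof
    fix x assume "x \<in> {x. bump a r p m x \<noteq> 0}"
    then have "\<bar>x - a\<bar> < r" using bump_support[OF assms, of x a p m] by force
    then show "x \<in> {a - r..a + r}" by auto
  qed
  then have "bounded {x. bump a r p m x \<noteq> 0}" using bounded_subset bounded_closed_interval by blast
  then show ?thesis unfolding test_fun_def smooth_fun_on_def using Ck_bump by (auto simp: compact_closure)
qed

lemma bump_translate: "bump (a - y) r 1 0 u = bump a r 1 0 (u + y)"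
  "bump (a - y) r (bpoly (a - y) r 1 0) 2 u = bump a r (bpoly a r 1 0) 2 (u + y)"
proof -
  have w: "bw (a - y) r u = bw a r (u + y)" by (simp add: bw_def algebra_simps)
  show "bump (a - y) r 1 0 u = bump a r 1 0 (u + y)" by (simp add: bump_def w)
  have "poly (bpoly (a - y) r 1 0) u = poly (bpoly a r 1 0) (u + y)" by (simp add: bpoly_def)
  then show "bump (a - y) r (bpoly (a - y) r 1 0) 2 u = bump a r (bpoly a r 1 0) 2 (u + y)" by (simp add: bump_def w)
qed

lemma integrable_bump:
  fixes e :: "real \<Rightarrow> real"
  assumes r: "r > 0" and e: "continuous_on UNIV e"
  shows "integrable lborel (\<lambda>x. e x * bump a r p m x)"
proof -
  have "integrable lborel (\<lambda>x. indicator {a - r..a + r} x *\<^sub>R (e x * bump a r p m x))"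
    by (rule borel_integrable_compact) (auto intro!: continuous_intros continuous_bump continuous_on_subset[OF e])
  moreover have "indicator {a - r..a + r} x *\<^sub>R (e x * bump a r p m x) = e x * bump a r p m x" for x
  proof (cases "x \<in> {a - r..a + r}")
    case False
    then have "\<bar>x - a\<bar> \<ge> r" unfolding atLeastAtMost_iff by linarith
    then show ?thesis using bump_support[OF r, of x a p m] by simp
  qed simp
  ultimately show ?thesis by (simp only:)
qed

lemma bump_nonneg: "bump a r 1 0 x \<ge> 0" by (simp add: bump_def)

text \<open>A positive value of a continuous function persists near the point; a bump supported
  there would then have positive integral against it.\<close>

lemma fundamental_lemma_pos:
  fixes e :: "real \<Rightarrow> real"
  assumes e: "continuous_on UNIV e" and z: "\<And>a r. r > 0 \<Longrightarrow> (\<integral>x. e x * bump a r 1 0 x \<partial>lborel) = 0"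
  shows "e a \<le> 0"
proof (rule ccontr)
  assume "\<not> e a \<le> 0"
  then have ea: "e a > 0" by simp
  have "isCont e a" using e by (simp add: continuous_on_eq_continuous_at)
  then obtain r where r: "r > 0" "\<And>x. \<bar>x - a\<bar> < r \<Longrightarrow> \<bar>e x - e a\<bar> < e a / 2"
    using ea unfolding continuous_at_eps_delta by (metis dist_real_def half_gt_zero)
  \<comment> \<open>A lower bound for the bump on the half-radius interval, where \<open>bw\<close>
    is at least (3/4) r^2.\<close>
  define c where "c = exp (- 1 / (3 / 4 * r\<^sup>2))"
  have "(\<integral>x. (e a / 2 * c) * indicator {a - r / 2 .. a + r / 2} x \<partial>lborel) \<le> (\<integral>x. e x * bump a r 1 0 x \<partial>lborel)"
  proof (rule integral_mono)
    show "integrable lborel (\<lambda>x. (e a / 2 * c) * indicator {a - r / 2 .. a + r / 2} x)"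
      by (intro integrable_mult_right integrable_real_indicator) (simp_all add: emeasure_lborel_Icc_eq)
    show "integrable lborel (\<lambda>x. e x * bump a r 1 0 x)" by (rule integrable_bump[OF r(1) e])
    fix x
    show "(e a / 2 * c) * indicator {a - r / 2 .. a + r / 2} x \<le> e x * bump a r 1 0 x"
    proof (cases "\<bar>x - a\<bar> < r")
      case True
      then have ex: "e x > e a / 2" using r(2)[OF True] by (auto simp: abs_if split: if_splits)
      show ?thesis
      proof (cases "x \<in> {a - r / 2 .. a + r / 2}")
        case xin: True
        then have "\<bar>x - a\<bar> \<le> r / 2" unfolding atLeastAtMost_iff by linarith
        then have "\<bar>x - a\<bar>\<^sup>2 \<le> (r / 2)\<^sup>2" by (intro power_mono) auto
        then have "bw a r x \<ge> 3 / 4 * r\<^sup>2" by (simp add: bw_def power_divide)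
        moreover have "3 / 4 * r\<^sup>2 > 0" using r(1) by simp
        ultimately have b: "bw a r x > 0" and b2: "1 / bw a r x \<le> 1 / (3 / 4 * r\<^sup>2)"
          by (linarith, intro frac_le, simp_all)
        have "bump a r 1 0 x \<ge> c" using b b2 by (simp add: bump_def c_def)
        then have "e a / 2 * c \<le> e x * bump a r 1 0 x" using ex ea by (intro mult_mono) (auto simp: c_def)
        then show ?thesis using xin by simp
      next
        case False
        then show ?thesis using ex ea bump_nonneg[of a r x] by simp
      qed
    next
      case False
      then show ?thesis using bump_support[OF r(1), of x a 1 0] r(1) by (auto simp: indicator_def abs_if split: if_splits)
    qed
  qed
  also have "\<dots> = 0" by (rule z[OF r(1)])
  finally have "e a / 2 * c * r \<le> 0" using r(1) by simp
  moreover have "e a / 2 * c * r > 0" using ea r(1) by (simp add: c_def)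
  ultimately show False by linarith
qed

lemma fundamental_lemma:
  fixes e :: "real \<Rightarrow> real"
  assumes e: "continuous_on UNIV e" and z: "\<And>a r. r > 0 \<Longrightarrow> (\<integral>x. e x * bump a r 1 0 x \<partial>lborel) = 0"
  shows "e a = 0"
proof -
  have "- e a \<le> 0" by (rule fundamental_lemma_pos) (use e z in \<open>auto intro!: continuous_intros\<close>)
  then show ?thesis using fundamental_lemma_pos[OF e z, of a] by simp
qed

lemma in_Linf_AE:
  assumes "in_Linf g"
  shows "g \<in> borel_measurable borel" "Linf_norm g \<ge> 0" "AE x in lborel. \<bar>g x\<bar> \<le> Linf_norm g"
proof -
  let ?S = "esssup lborel (\<lambda>x. ereal \<bar>g x\<bar>)"
  show "g \<in> borel_measurable borel" using assms by (simp add: in_Linf_def)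
  have ae: "AE x in lborel. ereal \<bar>g x\<bar> \<le> ?S" by (rule esssup_AE)
  \<comment> \<open>A set of full measure is non-empty, so the essential supremum dominates some |g
    x| and is nonnegative; being finite as well, it is faithfully represented by the real number
    \<open>Linf_norm g\<close>.\<close>
  have "\<exists>x. ereal \<bar>g x\<bar> \<le> ?S"
    by (rule eventually_happens'[OF _ ae]) (simp add: ae_filter_eq_bot_iff)
  then have S0: "?S \<ge> 0" by (metis abs_ge_zero ereal_less_eq(5) order_trans)
  have S: "?S = ereal (Linf_norm g)"
    using S0 assms unfolding Linf_norm_def in_Linf_def by (cases ?S) auto
  show "Linf_norm g \<ge> 0" using S0 unfolding S by simp
  show "AE x in lborel. \<bar>g x\<bar> \<le> Linf_norm g" using ae unfolding S by simp
qed

lemma weak_deriv_props: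
  assumes "in_W1inf K"
  shows "in_Linf K" "in_Linf (weak_deriv K)" "is_weak_deriv K (weak_deriv K)"
proof -
  show "in_Linf K" using assms by (simp add: in_W1inf_def)
  have "\<exists>K'. in_Linf K' \<and> is_weak_deriv K K'" using assms by (simp add: in_W1inf_def)
  then have "in_Linf (weak_deriv K) \<and> is_weak_deriv K (weak_deriv K)"
    unfolding weak_deriv_def by (rule someI_ex)
  then show "in_Linf (weak_deriv K)" "is_weak_deriv K (weak_deriv K)" by auto
qed

text \<open>The chosen weak derivative is bounded only almost everywhere; clipping makes the bound pointwise.\<close>

definition clip :: "real \<Rightarrow> (real \<Rightarrow> real) \<Rightarrow> real \<Rightarrow> real" where "clip k B x = max (- k) (min k (B x))"

lemma clip_bound: "k \<ge> 0 \<Longrightarrow> \<bar>clip k B x\<bar> \<le> k" by (auto simp: clip_def)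
lemma clip_measurable: "B \<in> borel_measurable borel \<Longrightarrow> clip k B \<in> borel_measurable borel"
  unfolding clip_def by (intro borel_measurable_max borel_measurable_min borel_measurable_const)
lemma clip_AE: "AE x in lborel. \<bar>B x\<bar> \<le> k \<Longrightarrow> AE x in lborel. B x = clip k B x"
  by (erule AE_mp) (auto simp: clip_def intro!: AE_I2)

lemma AE_reflect:
  assumes "AE y in lborel. Q (y::real)"
  shows "AE y in lborel. Q (x - y)"
proof -
  have l: "lborel = distr lborel borel (\<lambda>y. x - y)"
    using lborel_real_affine[of "-1" x] by (simp add: density_1)
  obtain N where N: "{y. \<not> Q y} \<subseteq> N" "N \<in> sets lborel" "emeasure lborel N = 0"
    using assms by (auto elim!: AE_E)
  have "emeasure lborel ((\<lambda>y. x - y) -` N \<inter> space lborel) = emeasure (distr lborel borel (\<lambda>y. x - y)) N"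
    using N(2) by (subst emeasure_distr) auto
  then have "emeasure lborel ((\<lambda>y. x - y) -` N) = 0" using l N(3) by simp
  moreover have "(\<lambda>y. x - y) -` N \<in> sets lborel"
    using measurable_sets_borel[OF borel_measurable_continuous_onI[of "\<lambda>y. x - y"], of N] N(2) by (simp add: continuous_intros)
  ultimately have "(\<lambda>y. x - y) -` N \<in> null_sets lborel" by (intro null_setsI)
  then show ?thesis by (rule AE_I') (use N(1) in auto)
qed

lemma AE_fst:
  assumes "AE y in lborel. Q (y::real)"
  shows "AE z in (lborel :: (real \<times> real) measure). Q (fst z)"
proof -
  obtain N where N: "{y. \<not> Q y} \<subseteq> N" "N \<in> sets lborel" "emeasure lborel N = 0"
    using assms by (auto elim!: AE_E)
  have s: "N \<times> UNIV \<in> sets (lborel \<Otimes>\<^sub>M lborel :: (real \<times> real) measure)" using N(2) by (intro pair_measureI) auto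
  have "emeasure (lborel \<Otimes>\<^sub>M lborel :: (real \<times> real) measure) (N \<times> UNIV) = emeasure lborel N * emeasure (lborel :: real measure) UNIV"
    by (rule lborel.emeasure_pair_measure_Times) (use N in auto)
  then have "N \<times> UNIV \<in> null_sets (lborel \<Otimes>\<^sub>M lborel :: (real \<times> real) measure)"
    using N(3) by (intro null_setsI s) simp
  then have "N \<times> UNIV \<in> null_sets (lborel :: (real \<times> real) measure)" by (simp only: lborel_prod)
  then show ?thesis by (rule AE_I') (use N(1) in auto)
qed

lemma reflect_fst_lborel:
  "distr lborel borel (\<lambda>z. (x - fst z, snd z)) = (lborel :: (real \<times> real) measure)"
proof (rule measure_eqI)
  fix A :: "(real \<times> real) set" assume "A \<in> sets (distr lborel borel (\<lambda>z. (x - fst z, snd z)))"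
  then have A [measurable]: "A \<in> sets borel" by simp
  have T: "(\<lambda>z. (x - fst z, snd z)) \<in> borel_measurable (borel :: (real \<times> real) measure)"
    by (intro borel_measurable_continuous_onI continuous_intros)
  let ?B = "(\<lambda>z. (x - fst z, snd z)) -` A"
  have B [measurable]: "?B \<in> sets borel" by (rule measurable_sets_borel[OF T A])
  have f: "emeasure lborel S = (\<integral>\<^sup>+u. \<integral>\<^sup>+v. indicator S (u, v) \<partial>lborel \<partial>lborel)" if [measurable]: "S \<in> sets borel" for S :: "(real \<times> real) set"
  proof -
    have "emeasure lborel S = (\<integral>\<^sup>+z. indicator S z \<partial>(lborel \<Otimes>\<^sub>M lborel))" by (simp add: lborel_prod)
    also have "\<dots> = (\<integral>\<^sup>+u. \<integral>\<^sup>+v. indicator S (u, v) \<partial>lborel \<partial>lborel)"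
      by (rule lborel.nn_integral_fst[symmetric]) (simp add: lborel_prod)
    finally show ?thesis .
  qed
  have "emeasure (distr lborel borel (\<lambda>z. (x - fst z, snd z))) A = emeasure lborel ?B"
    using T by (subst emeasure_distr) auto
  also have "\<dots> = (\<integral>\<^sup>+u. \<integral>\<^sup>+v. indicator A (x + (-1) * u, v) \<partial>lborel \<partial>lborel)"
    unfolding f[OF B] by (simp add: indicator_def)
  also have "\<dots> = ennreal \<bar>-1\<bar> * (\<integral>\<^sup>+u. \<integral>\<^sup>+v. indicator A (x + (-1) * u, v) \<partial>lborel \<partial>lborel)" by simp
  also have "\<dots> = (\<integral>\<^sup>+u. \<integral>\<^sup>+v. indicator A (u, v) \<partial>lborel \<partial>lborel)"
    by (rule nn_integral_real_affine[symmetric]) auto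
  also have "\<dots> = emeasure lborel A" by (rule f[OF A, symmetric])
  finally show "emeasure (distr lborel borel (\<lambda>z. (x - fst z, snd z))) A = emeasure lborel A" .
qed simp

section \<open>The force field as a convolution\<close>

definition cforce :: "(real \<Rightarrow> real) \<Rightarrow> (real \<times> real \<Rightarrow> real) \<Rightarrow> real \<Rightarrow> real" where
  "cforce B f x = (\<integral>z. B (x - fst z) * f z \<partial>lborel)"

lemma cforce_measurable:
  assumes "B \<in> borel_measurable borel"
  shows "(\<lambda>z :: real \<times> real. B (x - fst z)) \<in> borel_measurable borel"
  by (rule measurable_compose[OF _ assms]) (intro borel_measurable_continuous_onI continuous_intros)

lemma cforce_bound:
  assumes "B \<in> borel_measurable borel" "\<And>y. \<bar>B y\<bar> \<le> k" "integrable lborel f"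
  shows "\<bar>cforce B f x\<bar> \<le> k * (\<integral>z. \<bar>f z\<bar> \<partial>lborel)" "integrable lborel (\<lambda>z. B (x - fst z) * f z)"
  unfolding cforce_def
  by (rule integrable_bounded_mult[where f = "\<lambda>z. B (x - fst z)"]; use assms cforce_measurable[of B x] in simp)+

text \<open>B is only measurable, so the shift is moved onto f, and the claim becomes continuity of
  translations in L^1. Translates have equal norms and converge pointwise, so Scheffe's lemma
  applies.\<close>

lemma cforce_continuous:
  assumes B: "B \<in> borel_measurable borel" "\<And>y. \<bar>B y\<bar> \<le> k" and f: "integrable lborel f" "continuous_on UNIV f"
  shows "continuous_on UNIV (cforce B f)"
proof -
  have T: "(\<lambda>z. (x - fst z, snd z)) \<in> borel_measurable (borel :: (real \<times> real) measure)" for x :: real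
    by (intro borel_measurable_continuous_onI continuous_intros)
  define h where "h = (\<lambda>x z. f (x - fst z, snd z))"
  have fm: "f \<in> borel_measurable borel" using f(1) by (auto dest: borel_measurable_integrable)
  have ih: "integrable lborel (h x)" for x
  proof -
    have "integrable (distr lborel borel (\<lambda>z. (x - fst z, snd z))) f" unfolding reflect_fst_lborel by (rule f)
    then show ?thesis unfolding h_def by (subst (asm) integrable_distr_eq) (use T fm in auto)
  qed
  have Bm: "(\<lambda>z :: real \<times> real. B (fst z)) \<in> borel_measurable lborel"
    using measurable_compose[OF borel_measurable_continuous_onI[OF continuous_on_fst[OF continuous_on_id]] B(1)] by simp
  have e: "cforce B f x = (\<integral>z. B (fst z) * h x z \<partial>lborel)" for x
  proof -
    have m: "(\<lambda>z. B (x - fst z) * f z) \<in> borel_measurable borel"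
      by (rule borel_measurable_times[OF cforce_measurable[OF B(1)] fm])
    have "cforce B f x = (\<integral>z. B (x - fst z) * f z \<partial>(distr lborel borel (\<lambda>z. (x - fst z, snd z))))"
      unfolding cforce_def reflect_fst_lborel ..
    also have "\<dots> = (\<integral>z. B (x - fst (x - fst z, snd z)) * f (x - fst z, snd z) \<partial>lborel)"
      by (rule integral_distr) (use T m in auto)
    finally show ?thesis by (simp add: h_def)
  qed
  have nh: "(\<integral>\<^sup>+z. norm (h x z) \<partial>lborel) = (\<integral>\<^sup>+z. norm (f z) \<partial>lborel)" for x
  proof -
    have "(\<integral>\<^sup>+z. norm (f z) \<partial>lborel) = (\<integral>\<^sup>+z. norm (f z) \<partial>(distr lborel borel (\<lambda>z. (x - fst z, snd z))))"
      unfolding reflect_fst_lborel ..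
    also have "\<dots> = (\<integral>\<^sup>+z. norm (h x z) \<partial>lborel)" unfolding h_def
      by (rule nn_integral_distr) (use T fm in auto)
    finally show ?thesis ..
  qed
  show ?thesis
  proof (rule continuous_at_imp_continuous_on, rule ballI)
    fix x :: real
    show "isCont (cforce B f) x"
    proof (rule continuous_at_sequentiallyI)
      fix X :: "nat \<Rightarrow> real" assume X: "X \<longlonglongrightarrow> x"
      have "(\<lambda>n. \<integral>\<^sup>+z. norm (h (X n) z - h x z) \<partial>lborel) \<longlonglongrightarrow> 0"
      proof (rule Scheffe_lemma2)
        show "h (X n) \<in> borel_measurable lborel" for n using ih by (rule borel_measurable_integrable)
        show "AE z in lborel. (\<lambda>n. h (X n) z) \<longlonglongrightarrow> h x z"
        proof (rule AE_I2)
          fix z :: "real \<times> real"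
          have "isCont f (x - fst z, snd z)" using f(2) by (simp add: continuous_on_eq_continuous_at del: split_paired_All)
          then show "(\<lambda>n. h (X n) z) \<longlonglongrightarrow> h x z" unfolding h_def
            by (rule isCont_tendsto_compose) (intro tendsto_intros X)
        qed
        show "(\<integral>\<^sup>+z. norm (h (X n) z) \<partial>lborel) \<le> (\<integral>\<^sup>+z. norm (h x z) \<partial>lborel)" for n unfolding nh ..
      qed (rule ih)
      moreover have "(\<integral>\<^sup>+z. norm (h (X n) z - h x z) \<partial>lborel) = ennreal (\<integral>z. \<bar>h (X n) z - h x z\<bar> \<partial>lborel)" for n
        using ih by (subst nn_integral_eq_integral[symmetric]) auto
      ultimately have "(\<lambda>n. ennreal (\<integral>z. \<bar>h (X n) z - h x z\<bar> \<partial>lborel)) \<longlonglongrightarrow> ennreal 0" by simp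
      then have l: "(\<lambda>n. \<integral>z. \<bar>h (X n) z - h x z\<bar> \<partial>lborel) \<longlonglongrightarrow> 0"
        by (subst (asm) tendsto_ennreal_iff) (auto intro!: always_eventually)
      have "(\<lambda>n. cforce B f (X n) - cforce B f x) \<longlonglongrightarrow> 0"
      proof (rule tendsto_0_le[OF l, of _ k], rule always_eventually, rule allI)
        fix n
        have i: "integrable lborel (\<lambda>z. B (fst z) * h y z)" for y
          by (rule integrable_bounded_mult(1)[OF ih Bm B(2)])
        have "cforce B f (X n) - cforce B f x = (\<integral>z. B (fst z) * (h (X n) z - h x z) \<partial>lborel)"
          unfolding e using i by (simp add: right_diff_distrib)
        then show "norm (cforce B f (X n) - cforce B f x) \<le> norm (\<integral>z. \<bar>h (X n) z - h x z\<bar> \<partial>lborel) * k"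
          using integrable_bounded_mult(2)[OF Bochner_Integration.integrable_diff[OF ih ih] Bm B(2), of "X n" x] by (simp add: mult.commute)
      qed
      then show "(\<lambda>n. cforce B f (X n)) \<longlonglongrightarrow> cforce B f x" by (simp add: LIM_zero_iff)
    qed
  qed
qed

section \<open>Steady states\<close>

lemma integrable_product2:
  fixes f g :: "real \<Rightarrow> real"
  assumes f: "integrable lborel f" and g: "integrable lborel g"
  shows "integrable lborel (\<lambda>z. f (fst z) * g (snd z))"
    and "(\<integral>z. f (fst z) * g (snd z) \<partial>lborel) = (\<integral>x. f x \<partial>lborel) * (\<integral>x. g x \<partial>lborel)"
proof -
  note [measurable] = borel_measurable_integrable[OF f] borel_measurable_integrable[OF g]
  have i: "integrable (lborel \<Otimes>\<^sub>M lborel) (\<lambda>z. f (fst z) * g (snd z))"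
  proof (rule lborel_pair.Fubini_integrable)
    show "(\<lambda>z. f (fst z) * g (snd z)) \<in> borel_measurable (lborel \<Otimes>\<^sub>M lborel)" by measurable
    show "integrable lborel (\<lambda>x. \<integral>y. norm (f (fst (x, y)) * g (snd (x, y))) \<partial>lborel)"
      using f g by (simp add: abs_mult)
    show "AE x in lborel. integrable lborel (\<lambda>y. f (fst (x, y)) * g (snd (x, y)))" using g by simp
  qed
  then show "integrable lborel (\<lambda>z. f (fst z) * g (snd z))" by (simp add: lborel_prod)
  have "(\<integral>z. f (fst z) * g (snd z) \<partial>lborel) = (\<integral>x. \<integral>y. f x * g y \<partial>lborel \<partial>lborel)"
    using lborel_pair.integral_fst'[OF i] by (simp add: lborel_prod)
  then show "(\<integral>z. f (fst z) * g (snd z) \<partial>lborel) = (\<integral>x. f x \<partial>lborel) * (\<integral>x. g x \<partial>lborel)" by simp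
qed

lemma cv_bounds:
  fixes B s :: "real \<Rightarrow> real"
  assumes B: "B \<in> borel_measurable borel" "\<And>y. \<bar>B y\<bar> \<le> k" and s: "integrable lborel s"
  shows "integrable lborel (\<lambda>y. B (x - y) * s y)" "\<bar>\<integral>y. B (x - y) * s y \<partial>lborel\<bar> \<le> k * (\<integral>y. \<bar>s y\<bar> \<partial>lborel)"
proof -
  have m: "(\<lambda>y. B (x - y)) \<in> borel_measurable lborel"
    using measurable_compose[OF borel_measurable_continuous_onI B(1), of "\<lambda>y. x - y"] by (simp add: continuous_intros)
  show "integrable lborel (\<lambda>y. B (x - y) * s y)" "\<bar>\<integral>y. B (x - y) * s y \<partial>lborel\<bar> \<le> k * (\<integral>y. \<bar>s y\<bar> \<partial>lborel)"
    by (rule integrable_bounded_mult[OF s m B(2)])+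
qed

lemma cv_swap:
  fixes B s \<psi> :: "real \<Rightarrow> real"
  assumes B: "B \<in> borel_measurable borel" "\<And>y. \<bar>B y\<bar> \<le> k" and s: "integrable lborel s" and \<psi>: "integrable lborel \<psi>"
  shows "(\<integral>x. (\<integral>y. B (x - y) * s y \<partial>lborel) * \<psi> x \<partial>lborel) = (\<integral>y. (\<integral>x. B (x - y) * \<psi> x \<partial>lborel) * s y \<partial>lborel)"
proof -
  note [measurable] = borel_measurable_integrable[OF s] borel_measurable_integrable[OF \<psi>]
  have Bm: "(\<lambda>p. B (fst p - snd p)) \<in> borel_measurable (lborel \<Otimes>\<^sub>M lborel :: (real \<times> real) measure)"
    using measurable_compose[OF borel_measurable_continuous_onI B(1), of "\<lambda>p :: real \<times> real. fst p - snd p"]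
    by (simp add: lborel_prod continuous_intros)
  have "integrable (lborel \<Otimes>\<^sub>M lborel) (\<lambda>p. \<psi> (fst p) * s (snd p))"
    using integrable_product2(1)[OF \<psi> s] by (simp add: lborel_prod)
  from integrable_bounded_mult(1)[OF this Bm B(2)]
  have i: "integrable (lborel \<Otimes>\<^sub>M lborel) (\<lambda>(x, y). B (x - y) * (\<psi> x * s y))" by (simp add: case_prod_beta')
  have "(\<integral>x. (\<integral>y. B (x - y) * s y \<partial>lborel) * \<psi> x \<partial>lborel) = (\<integral>x. \<integral>y. B (x - y) * (\<psi> x * s y) \<partial>lborel \<partial>lborel)"
    by (intro Bochner_Integration.integral_cong refl) (simp add: mult_ac flip: integral_mult_right_zero)
  also have "\<dots> = (\<integral>y. \<integral>x. B (x - y) * (\<psi> x * s y) \<partial>lborel \<partial>lborel)"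
    by (rule lborel_pair.Fubini_integral[OF i, symmetric])
  also have "\<dots> = (\<integral>y. (\<integral>x. B (x - y) * \<psi> x \<partial>lborel) * s y \<partial>lborel)"
    by (intro Bochner_Integration.integral_cong refl) (simp add: mult_ac flip: integral_mult_right_zero)
  finally show ?thesis .
qed

lemma conv_clip:
  assumes B: "AE y in lborel. \<bar>B y\<bar> \<le> k" "B \<in> borel_measurable borel" and s: "s \<in> borel_measurable borel"
  shows "conv B s x = (\<integral>y. clip k B (x - y) * s y \<partial>lborel)"
  unfolding conv_def
proof (rule integral_cong_AE)
  note [measurable] = B(2) s clip_measurable[OF B(2), of k]
  show "(\<lambda>y. B (x - y) * s y) \<in> borel_measurable lborel" "(\<lambda>y. clip k B (x - y) * s y) \<in> borel_measurable lborel" by measurable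
  show "AE y in lborel. B (x - y) * s y = clip k B (x - y) * s y"
    using AE_reflect[OF clip_AE[OF B(1)], of x] by eventually_elim simp
qed

lemma bump_measurable [measurable]: "bump a r p m \<in> borel_measurable borel"
  by (rule borel_measurable_continuous_onI[OF continuous_bump])

lemma weak_deriv_bump:
  assumes K: "in_W1inf K" and k: "Linf_norm K \<le> k" "Linf_norm (weak_deriv K) \<le> k" and r: "r > 0"
  shows "(\<integral>x. clip k K (x - y) * bump a r (bpoly a r 1 0) 2 x \<partial>lborel) = - (\<integral>x. clip k (weak_deriv K) (x - y) * bump a r 1 0 x \<partial>lborel)"
proof -
  note w = weak_deriv_props[OF K]
  note m = in_Linf_AE[OF w(1)] in_Linf_AE[OF w(2)]
  have ae: "AE x in lborel. K x = clip k K x" "AE x in lborel. weak_deriv K x = clip k (weak_deriv K) x"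
  proof -
    have "AE x in lborel. \<bar>K x\<bar> \<le> k" using m(3) by eventually_elim (use k in linarith)
    then show "AE x in lborel. K x = clip k K x" by (rule clip_AE)
    have "AE x in lborel. \<bar>weak_deriv K x\<bar> \<le> k" using m(6) by eventually_elim (use k in linarith)
    then show "AE x in lborel. weak_deriv K x = clip k (weak_deriv K) x" by (rule clip_AE)
  qed
  have "(\<integral>x. clip k K (x - y) * bump a r (bpoly a r 1 0) 2 x \<partial>lborel) = (\<integral>u. clip k K u * bump (a - y) r (bpoly (a - y) r 1 0) 2 u \<partial>lborel)"
    by (subst lborel_integral_real_affine[where c = 1 and t = y]) (simp_all add: bump_translate add.commute)
  also have "\<dots> = (\<integral>u. K u * bump (a - y) r (bpoly (a - y) r 1 0) 2 u \<partial>lborel)"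
    by (rule integral_cong_AE)
       (use ae(1) m(1) clip_measurable[OF m(1), of k] in \<open>auto intro!: borel_measurable_times elim!: eventually_mono\<close>)
  also have "\<dots> = (\<integral>u. K u * deriv (bump (a - y) r 1 0) u \<partial>lborel)"
    using DERIV_imp_deriv[OF deriv_bump[of "a - y" r 1 0]] by (simp add: numeral_2_eq_2)
  also have "\<dots> = - (\<integral>u. weak_deriv K u * bump (a - y) r 1 0 u \<partial>lborel)"
    using w(3) test_fun_bump[OF r] unfolding is_weak_deriv_def by blast
  also have "(\<integral>u. weak_deriv K u * bump (a - y) r 1 0 u \<partial>lborel) = (\<integral>u. clip k (weak_deriv K) u * bump (a - y) r 1 0 u \<partial>lborel)"
    by (rule integral_cong_AE)
       (use ae(2) m(4) clip_measurable[OF m(4), of k] in \<open>auto intro!: borel_measurable_times elim!: eventually_mono\<close>)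
  also have "\<dots> = (\<integral>x. clip k (weak_deriv K) (x - y) * bump a r 1 0 x \<partial>lborel)"
    by (subst (2) lborel_integral_real_affine[where c = 1 and t = y]) (simp_all add: bump_translate add.commute)
  finally show ?thesis .
qed

text \<open>Only a weak derivative of K is given, but \<open>conv K s\<close> is assumed to be C^1.
  Tested against bumps, its classical derivative agrees with the convolution of the weak derivative
  by Fubini; both are continuous, so the fundamental lemma gives equality at every point.\<close>

lemma conv_deriv:
  assumes K: "in_W1inf K" and k: "Linf_norm K \<le> k" "Linf_norm (weak_deriv K) \<le> k"
    and s: "integrable lborel s" "continuous_on UNIV s"
    and c: "\<And>x. (conv K s has_real_derivative c' x) (at x)" "continuous_on UNIV c'"
  shows "c' x = (\<integral>y. clip k (weak_deriv K) (x - y) * s y \<partial>lborel)" "continuous_on UNIV (\<lambda>x. \<integral>y. clip k (weak_deriv K) (x - y) * s y \<partial>lborel)"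
proof -
  note w = weak_deriv_props[OF K]
  note m = in_Linf_AE[OF w(1)] in_Linf_AE[OF w(2)]
  have k0: "k \<ge> 0" using m(2) k by linarith
  have ae: "AE x in lborel. \<bar>K x\<bar> \<le> k" using m(3) k by (auto elim!: eventually_mono)
  define B where "B = clip k (weak_deriv K)"
  have B: "B \<in> borel_measurable borel" "\<And>y. \<bar>B y\<bar> \<le> k"
    unfolding B_def by (rule clip_measurable[OF m(4)], rule clip_bound[OF k0])
  have C: "clip k K \<in> borel_measurable borel" "\<And>y. \<bar>clip k K y\<bar> \<le> k"
    by (rule clip_measurable[OF m(1)], rule clip_bound[OF k0])
  have sm: "s \<in> borel_measurable borel" using s(1) by (auto dest: borel_measurable_integrable)
  define d where "d = (\<lambda>x. \<integral>y. B (x - y) * s y \<partial>lborel)"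
  have nd: "integrable lborel std_normal_density" "(\<integral>v. std_normal_density v \<partial>lborel) = 1" by auto
  \<comment> \<open>Tensoring s with a normal density in v makes the one-dimensional convolution an
    instance of \<open>cforce\<close>, whose continuity is already known.\<close>
  have "cforce B (\<lambda>z. s (fst z) * std_normal_density (snd z)) = d"
  proof
    fix x
    have "cforce B (\<lambda>z. s (fst z) * std_normal_density (snd z)) x = (\<integral>z. (B (x - fst z) * s (fst z)) * std_normal_density (snd z) \<partial>lborel)"
      unfolding cforce_def by (simp add: mult.assoc)
    also have "\<dots> = d x * 1"
      unfolding d_def by (subst integrable_product2(2)[OF cv_bounds(1)[OF B s(1)] nd(1)]) (simp only: nd)
    finally show "cforce B (\<lambda>z. s (fst z) * std_normal_density (snd z)) x = d x" by simp
  qed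
  moreover have "continuous_on UNIV (cforce B (\<lambda>z. s (fst z) * std_normal_density (snd z)))"
    by (rule cforce_continuous[OF B integrable_product2(1)[OF s(1) nd(1)]])
       (auto intro!: continuous_intros continuous_on_compose2[OF s(2)] simp: std_normal_density_def)
  ultimately have cd: "continuous_on UNIV d" by simp
  show "continuous_on UNIV (\<lambda>x. \<integral>y. clip k (weak_deriv K) (x - y) * s y \<partial>lborel)" using cd unfolding d_def B_def .
  have cc: "continuous_on UNIV (conv K s)" using c(1) by (intro DERIV_continuous_on) (auto intro: has_field_derivative_at_within)
  have key: "(\<integral>x. (c' x - d x) * bump a r 1 0 x \<partial>lborel) = 0" if r: "r > 0" for a r
  proof -
    let ?b = "bump a r 1 0" and ?b' = "bump a r (bpoly a r 1 0) 2"
    have ib: "integrable lborel ?b" "integrable lborel ?b'"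
      using integrable_bump[OF r, of "\<lambda>_. 1"] by auto
    have i: "integrable lborel (\<lambda>x. c' x * ?b x)" "integrable lborel (\<lambda>x. d x * ?b x)" "integrable lborel (\<lambda>x. conv K s x * ?b' x)"
      by (rule integrable_bump[OF r] c cd cc)+
    have "(\<integral>x. conv K s x * ?b' x \<partial>lborel) = (\<integral>x. (\<integral>y. clip k K (x - y) * s y \<partial>lborel) * ?b' x \<partial>lborel)"
      unfolding conv_clip[OF ae m(1) sm] ..
    also have "\<dots> = (\<integral>y. (\<integral>x. clip k K (x - y) * ?b' x \<partial>lborel) * s y \<partial>lborel)"
      by (rule cv_swap[OF C s(1) ib(2)])
    also have "\<dots> = - (\<integral>y. (\<integral>x. B (x - y) * ?b x \<partial>lborel) * s y \<partial>lborel)"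
      unfolding weak_deriv_bump[OF K k r] B_def by simp
    also have "\<dots> = - (\<integral>x. d x * ?b x \<partial>lborel)"
      unfolding d_def by (subst cv_swap[OF B s(1) ib(1)]) simp
    finally have 1: "(\<integral>x. conv K s x * ?b' x \<partial>lborel) = - (\<integral>x. d x * ?b x \<partial>lborel)" .
    have db: "(?b has_real_derivative ?b' x) (at x)" for x using deriv_bump[of a r 1 0 x] by (simp add: numeral_2_eq_2)
    let ?F = "\<lambda>x. conv K s x * ?b x" and ?f = "\<lambda>x. c' x * ?b x + conv K s x * ?b' x"
    have dF: "(?F has_real_derivative ?f x) (at x)" for x
      by (rule DERIV_cong[OF DERIV_mult[OF c(1) db]]) simp
    have sup: "?f x = ?f x * indicator {a - r..a + r} x" for x
    proof (cases "x \<in> {a - r..a + r}")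
      case False
      then have "\<bar>x - a\<bar> \<ge> r" unfolding atLeastAtMost_iff by linarith
      then show ?thesis using bump_support[OF r, of x a] by simp
    qed simp
    have "(\<integral>x. ?f x \<partial>lborel) = (\<integral>x. ?f x * indicator {a - r..a + r} x \<partial>lborel)"
      by (rule Bochner_Integration.integral_cong[OF refl sup])
    also have "\<dots> = ?F (a + r) - ?F (a - r)"
    proof (rule integral_FTC_Icc_real)
      have "continuous_on UNIV ?f" by (intro continuous_intros c cc continuous_bump)
      then show "isCont ?f x" for x by (simp add: continuous_on_eq_continuous_at)
    qed (use r dF in auto)
    also have "\<dots> = 0" using bump_support[OF r, of "a + r" a] bump_support[OF r, of "a - r" a] r by simp
    finally have "(\<integral>x. c' x * ?b x \<partial>lborel) + (\<integral>x. conv K s x * ?b' x \<partial>lborel) = 0" using i by simp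
    then show ?thesis using 1 i by (simp add: left_diff_distrib)
  qed
  have "c' x - d x = 0" by (rule fundamental_lemma[of "\<lambda>x. c' x - d x"]) (use key c cd in \<open>auto intro!: continuous_intros\<close>)
  then show "c' x = (\<integral>y. clip k (weak_deriv K) (x - y) * s y \<partial>lborel)" by (simp add: d_def B_def)
qed

lemma smooth_C1:
  fixes s :: "real \<Rightarrow> real"
  assumes "smooth_fun_on s UNIV"
  obtains s' where "\<And>x. (s has_real_derivative s' x) (at x)" "continuous_on UNIV s'"
proof -
  have C: "Ck_on (Suc 0) s UNIV" using assms by (simp add: smooth_fun_on_def del: Ck_on.simps)
  show thesis
  proof (rule that[of "\<lambda>x. frechet_derivative s (at x) 1"])
    show "continuous_on UNIV (\<lambda>x. frechet_derivative s (at x) 1)" using C by simp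
    fix x
    have d: "(s has_derivative frechet_derivative s (at x)) (at x)" using C frechet_derivative_works by auto
    have "frechet_derivative s (at x) h = frechet_derivative s (at x) 1 * h" for h
      using linear_scale[OF has_derivative_linear[OF d], of h 1] by (simp add: mult.commute)
    then have e: "frechet_derivative s (at x) = (*) (frechet_derivative s (at x) 1)" by (rule ext)
    show "(s has_real_derivative frechet_derivative s (at x) 1) (at x)"
      unfolding has_field_derivative_def by (subst e[symmetric]) (rule d)
  qed
qed

lemma normal_integral:
  assumes "\<sigma> > 0"
  shows "integrable lborel (\<lambda>x. exp (- (x\<^sup>2 / (2 * \<sigma>))))" "(\<integral>x. exp (- (x\<^sup>2 / (2 * \<sigma>))) \<partial>lborel) = sqrt (2 * pi * \<sigma>)"
proof -
  have e: "exp (- (x\<^sup>2 / (2 * \<sigma>))) = sqrt (2 * pi * \<sigma>) * normal_density 0 (sqrt \<sigma>) x" for x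
    using assms by (simp add: normal_density_def)
  have "sqrt \<sigma> > 0" using assms by simp
  then show "integrable lborel (\<lambda>x. exp (- (x\<^sup>2 / (2 * \<sigma>))))" "(\<integral>x. exp (- (x\<^sup>2 / (2 * \<sigma>))) \<partial>lborel) = sqrt (2 * pi * \<sigma>)"
    unfolding e by simp_all
qed

text \<open>The logarithm of the fixed point equation expresses \<open>conv K s\<close> through s,
  so smoothness of s makes the convolution C^1 and yields the stationary equation for
  \<open>s'\<close>. In the Gaussian bounds the exponent I M k / \<theta> occurs twice, once for the
  numerator and once for the normalising integral.\<close>

lemma steady_facts:
  assumes par: "\<alpha> > 0" "\<theta> > 0" "I > 0" "M > 0"
    and K: "in_W1inf K" and k: "W1inf_norm K = k" and st: "steady_density \<alpha> \<theta> I M K s"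
  obtains s' where "k \<ge> 0" "integrable lborel s" "\<And>x. s x > 0" "(\<integral>x. s x \<partial>lborel) = 1"
    "\<And>x. (s has_real_derivative s' x) (at x)" "continuous_on UNIV s'"
    "\<And>x. s' x = s x * ((- \<alpha> * x - I * M * (\<integral>y. clip k (weak_deriv K) (x - y) * s y \<partial>lborel)) / \<theta>)"
    "\<And>x. s x \<le> exp (2 * (I * M * k) / \<theta>) * (exp (- (\<alpha> * x\<^sup>2 / (2 * \<theta>))) / sqrt (2 * pi * (\<theta> / \<alpha>)))"
    "\<And>x. exp (- (2 * (I * M * k) / \<theta>)) * (exp (- (\<alpha> * x\<^sup>2 / (2 * \<theta>))) / sqrt (2 * pi * (\<theta> / \<alpha>))) \<le> s x"
    "\<And>x. \<bar>I * M * (\<integral>y. clip k (weak_deriv K) (x - y) * s y \<partial>lborel)\<bar> \<le> I * M * k"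
    "continuous_on UNIV (\<lambda>x. \<integral>y. clip k (weak_deriv K) (x - y) * s y \<partial>lborel)"
proof -
  note w = weak_deriv_props[OF K]
  note m = in_Linf_AE[OF w(1)] in_Linf_AE[OF w(2)]
  have kk: "Linf_norm K \<le> k" "Linf_norm (weak_deriv K) \<le> k" "k \<ge> 0"
    using m(2,5) k by (auto simp: W1inf_norm_def)
  have iss: "integrable lborel s" and fp: "\<And>x. haissinski_map \<alpha> \<theta> I M K s x = s x" and sm: "smooth_fun_on s UNIV"
    using st by (auto simp: steady_density_def)
  have smm: "s \<in> borel_measurable borel" using iss by (auto dest: borel_measurable_integrable)
  have ae: "AE x in lborel. \<bar>K x\<bar> \<le> k" using m(3) kk by (auto elim!: eventually_mono)
  have C: "clip k K \<in> borel_measurable borel" "\<And>y. \<bar>clip k K y\<bar> \<le> k"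
    by (rule clip_measurable[OF m(1)], rule clip_bound[OF kk(3)])
  have cvm: "conv K s \<in> borel_measurable borel"
  proof -
    have "(\<lambda>(x, y). clip k K (x - y) * s y) \<in> borel_measurable (borel \<Otimes>\<^sub>M lborel)"
    proof -
      have "(\<lambda>p. clip k K (fst p - snd p)) \<in> borel_measurable (borel \<Otimes>\<^sub>M lborel :: (real \<times> real) measure)"
        by (rule measurable_compose[OF _ C(1)]) measurable
      moreover have "(\<lambda>p. s (snd p)) \<in> borel_measurable (borel \<Otimes>\<^sub>M lborel :: (real \<times> real) measure)"
        by (rule measurable_compose[OF _ smm]) measurable
      ultimately show ?thesis by (simp add: case_prod_beta')
    qed
    from lborel.borel_measurable_lebesgue_integral[OF this]
    show ?thesis unfolding conv_clip[OF ae m(1) smm, abs_def] by simp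
  qed
  \<comment> \<open>At this stage sign and mass of s are unknown. This rough bound makes the
    normalising integral finite and positive; positivity and unit mass follow, and the bound
    improves to k.\<close>
  let ?c0 = "k * (\<integral>y. \<bar>s y\<bar> \<partial>lborel)"
  have cb: "\<bar>conv K s x\<bar> \<le> ?c0" for x
    unfolding conv_clip[OF ae m(1) smm] by (rule cv_bounds(2)[OF C iss])
  define e where "e = (\<lambda>x. exp (- (\<alpha> * x\<^sup>2 / (2 * \<theta>)) - I * M / \<theta> * conv K s x))"
  define g where "g = (\<lambda>x::real. exp (- (\<alpha> * x\<^sup>2 / (2 * \<theta>))))"
  define Z where "Z = (\<integral>y. e y \<partial>lborel)"
  have gi: "integrable lborel g" "(\<integral>y. g y \<partial>lborel) = sqrt (2 * pi * (\<theta> / \<alpha>))"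
    using normal_integral[of "\<theta> / \<alpha>"] par unfolding g_def by (simp_all add: field_simps)
  have em: "e \<in> borel_measurable borel" unfolding e_def using cvm by measurable
  have IM: "I * M / \<theta> > 0" using par by simp
  have sw: "exp (- (I * M / \<theta> * C)) * g x \<le> e x" "e x \<le> exp (I * M / \<theta> * C) * g x" if "\<And>x. \<bar>conv K s x\<bar> \<le> C" for C x
  proof -
    have "\<bar>I * M / \<theta> * conv K s x\<bar> \<le> I * M / \<theta> * C"
      unfolding abs_mult using IM that[of x] by (intro mult_mono) auto
    then show "exp (- (I * M / \<theta> * C)) * g x \<le> e x" "e x \<le> exp (I * M / \<theta> * C) * g x"
      unfolding e_def g_def exp_add[symmetric] exp_le_cancel_iff by linarith+
  qed
  have ie: "integrable lborel e"
    by (rule Bochner_Integration.integrable_bound[OF integrable_mult_right[OF gi(1), of "exp (I * M / \<theta> * ?c0)"]])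
       (use em sw(2)[OF cb] in \<open>auto simp: e_def g_def abs_mult\<close>)
  have Zl: "exp (- (I * M / \<theta> * C)) * sqrt (2 * pi * (\<theta> / \<alpha>)) \<le> Z" if "\<And>x. \<bar>conv K s x\<bar> \<le> C" for C
    unfolding Z_def gi(2)[symmetric] integral_mult_right_zero[symmetric]
    by (rule integral_mono[OF integrable_mult_right[OF gi(1)] ie]) (rule sw(1)[OF that])
  have Zu: "Z \<le> exp (I * M / \<theta> * C) * sqrt (2 * pi * (\<theta> / \<alpha>))" if "\<And>x. \<bar>conv K s x\<bar> \<le> C" for C
    unfolding Z_def gi(2)[symmetric] integral_mult_right_zero[symmetric]
    by (rule integral_mono[OF ie integrable_mult_right[OF gi(1)]]) (rule sw(2)[OF that])
  have q0: "sqrt (2 * pi * (\<theta> / \<alpha>)) > 0" using par by simp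
  have Z0: "Z > 0" using less_le_trans[OF mult_pos_pos[OF exp_gt_zero q0] Zl[OF cb]] .
  have se: "s x = e x / Z" for x using fp[of x] by (simp add: haissinski_map_def e_def Z_def)
  have sp: "s x > 0" for x unfolding se using Z0 by (simp add: e_def)
  have i1: "(\<integral>x. s x \<partial>lborel) = 1" unfolding se using Z0 by (simp add: Z_def[symmetric])
  have "(\<integral>y. \<bar>s y\<bar> \<partial>lborel) = 1" using i1 sp by (simp add: less_imp_le)
  then have cb1: "\<bar>conv K s x\<bar> \<le> k" for x using cb[of x] by simp
  obtain s' where s': "\<And>x. (s has_real_derivative s' x) (at x)" "continuous_on UNIV s'" using smooth_C1[OF sm] by metis
  have cs: "continuous_on UNIV s" using s'(1) by (intro DERIV_continuous_on) (auto intro: has_field_derivative_at_within)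
  define L where "L = \<theta> / (I * M)"
  have L0: "L > 0" "I * M / \<theta> = 1 / L" using par by (auto simp: L_def)
  have ce: "conv K s = (\<lambda>x. - L * (ln (s x) + \<alpha> * x\<^sup>2 / (2 * \<theta>) + ln Z))"
  proof
    fix x
    have "ln (s x) = - (\<alpha> * x\<^sup>2 / (2 * \<theta>)) - I * M / \<theta> * conv K s x - ln Z"
    proof -
      have "ln (s x) = ln (e x / Z)" by (rule arg_cong[OF se])
      also have "\<dots> = ln (e x) - ln Z" by (subst ln_div) (use Z0 in \<open>auto simp: e_def\<close>)
      also have "ln (e x) = - (\<alpha> * x\<^sup>2 / (2 * \<theta>)) - I * M / \<theta> * conv K s x" unfolding e_def by (rule ln_exp)
      finally show ?thesis .
    qed
    then show "conv K s x = - L * (ln (s x) + \<alpha> * x\<^sup>2 / (2 * \<theta>) + ln Z)" unfolding L0(2) using L0(1) by simp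
  qed
  define c' where "c' = (\<lambda>x. - L * (s' x / s x + \<alpha> * x / \<theta>))"
  have dc: "(conv K s has_real_derivative c' x) (at x)" for x
    unfolding ce c'_def using par(2) sp[of x]
    by (auto intro!: derivative_eq_intros s'(1) simp: field_simps)
  have cc': "continuous_on UNIV c'" unfolding c'_def using sp par(2)
    by (intro continuous_intros s' cs) (auto simp: less_imp_neq[symmetric])
  note cd = conv_deriv[OF K kk(1,2) iss cs dc cc']
  let ?d = "\<lambda>x. \<integral>y. clip k (weak_deriv K) (x - y) * s y \<partial>lborel"
  have s'e: "s' x = s x * ((- \<alpha> * x - I * M * ?d x) / \<theta>)" for x
  proof -
    have "s' x / s x = - (1 / L) * ?d x - \<alpha> * x / \<theta>" using cd(1)[of x] L0(1) unfolding c'_def by (simp add: field_simps)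
    also have "\<dots> = (- \<alpha> * x - I * M * ?d x) / \<theta>" unfolding L0(2)[symmetric] by (simp add: diff_divide_distrib)
    finally have "s' x / s x = (- \<alpha> * x - I * M * ?d x) / \<theta>" .
    then show ?thesis using sp[of x] by (simp add: divide_eq_eq mult.commute less_imp_neq[symmetric])
  qed
  have db: "\<bar>I * M * ?d x\<bar> \<le> I * M * k" for x
  proof -
    have "\<bar>?d x\<bar> \<le> k * (\<integral>y. \<bar>s y\<bar> \<partial>lborel)"
      by (rule cv_bounds(2)[OF clip_measurable[OF m(4)] clip_bound[OF kk(3)] iss])
    then have "\<bar>?d x\<bar> \<le> k" using \<open>(\<integral>y. \<bar>s y\<bar> \<partial>lborel) = 1\<close> by simp
    then show ?thesis using par by (simp add: abs_mult)
  qed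
  define y where "y = I * M * k / \<theta>"
  have ye: "I * M / \<theta> * k = y" "2 * (I * M * k) / \<theta> = y + y" by (simp_all add: y_def)
  have ee: "(Y * G) / (inverse Y * S) = Y * Y * (G / S)" "(inverse Y * G) / (Y * S) = inverse (Y * Y) * (G / S)" if "Y \<noteq> 0" for Y G S :: real
    using that by (simp_all add: field_simps)
  have up: "s x \<le> exp (2 * (I * M * k) / \<theta>) * (exp (- (\<alpha> * x\<^sup>2 / (2 * \<theta>))) / sqrt (2 * pi * (\<theta> / \<alpha>)))" for x
  proof -
    have "s x \<le> (exp y * g x) / (exp (- y) * sqrt (2 * pi * (\<theta> / \<alpha>)))"
      unfolding se using sw(2)[OF cb1, of x] Zl[OF cb1] q0 unfolding ye by (intro frac_le) (auto simp: e_def g_def)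
    also have "\<dots> = exp (y + y) * (g x / sqrt (2 * pi * (\<theta> / \<alpha>)))"
      unfolding exp_add exp_minus by (rule ee(1)) simp
    finally show ?thesis unfolding ye g_def .
  qed
  have lo: "exp (- (2 * (I * M * k) / \<theta>)) * (exp (- (\<alpha> * x\<^sup>2 / (2 * \<theta>))) / sqrt (2 * pi * (\<theta> / \<alpha>))) \<le> s x" for x
  proof -
    have "(exp (- y) * g x) / (exp y * sqrt (2 * pi * (\<theta> / \<alpha>))) \<le> s x"
      unfolding se using sw(1)[OF cb1, of x] Zu[OF cb1] Z0 unfolding ye by (intro frac_le) (auto simp: e_def g_def)
    also have "(exp (- y) * g x) / (exp y * sqrt (2 * pi * (\<theta> / \<alpha>))) = exp (- (y + y)) * (g x / sqrt (2 * pi * (\<theta> / \<alpha>)))"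
      unfolding exp_add exp_minus by (rule ee(2)) simp
    finally show ?thesis unfolding ye g_def .
  qed
  show thesis by (rule that[OF kk(3) iss sp i1 s' s'e up lo db cd(2)])
qed

section \<open>Decay of solutions\<close>

lemma scale_lborel2:
  fixes l n :: real
  assumes "l > 0" "n > 0"
  shows "lborel = density (distr lborel borel (\<lambda>z :: real \<times> real. (l * fst z, n * snd z))) (\<lambda>_. ennreal (l * n))"
    (is "_ = density (distr lborel borel ?T) _")
proof (rule measure_eqI)
  fix A :: "(real \<times> real) set" assume "A \<in> sets lborel"
  then have A [measurable]: "A \<in> sets borel" by simp
  have T: "?T \<in> borel_measurable borel" by (intro borel_measurable_continuous_onI continuous_intros)
  have f: "emeasure lborel S = (\<integral>\<^sup>+u. \<integral>\<^sup>+v. indicator S (u, v) \<partial>lborel \<partial>lborel)" if [measurable]: "S \<in> sets borel" for S :: "(real \<times> real) set"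
    using nn_integral_lborel2[of "indicator S"] by simp
  have B [measurable]: "?T -` A \<in> sets borel" by (rule measurable_sets_borel[OF T A])
  have "emeasure lborel A = ennreal \<bar>l\<bar> * (\<integral>\<^sup>+u. \<integral>\<^sup>+v. indicator A (0 + l * u, v) \<partial>lborel \<partial>lborel)"
    unfolding f[OF A] by (rule nn_integral_real_affine) (use assms in auto)
  also have "\<dots> = ennreal \<bar>l\<bar> * (\<integral>\<^sup>+u. ennreal \<bar>n\<bar> * (\<integral>\<^sup>+v. indicator A (0 + l * u, 0 + n * v) \<partial>lborel) \<partial>lborel)"
    by (intro arg_cong[where f = "\<lambda>y. ennreal \<bar>l\<bar> * y"] nn_integral_cong nn_integral_real_affine) (use assms in auto)
  also have "\<dots> = ennreal \<bar>l\<bar> * (ennreal \<bar>n\<bar> * (\<integral>\<^sup>+u. (\<integral>\<^sup>+v. indicator A (0 + l * u, 0 + n * v) \<partial>lborel) \<partial>lborel))"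
    by (subst nn_integral_cmult) auto
  also have "(\<integral>\<^sup>+u. (\<integral>\<^sup>+v. indicator A (0 + l * u, 0 + n * v) \<partial>lborel) \<partial>lborel) = emeasure lborel (?T -` A)"
    unfolding f[OF B] by (simp add: indicator_def)
  also have "ennreal \<bar>l\<bar> * (ennreal \<bar>n\<bar> * emeasure lborel (?T -` A)) = ennreal (l * n) * emeasure lborel (?T -` A)"
    using assms by (simp add: ennreal_mult mult.assoc)
  also have "\<dots> = emeasure (density (distr lborel borel ?T) (\<lambda>_. ennreal (l * n))) A"
    using T by (subst emeasure_density_const) (auto simp: emeasure_distr)
  finally show "emeasure lborel A = emeasure (density (distr lborel borel ?T) (\<lambda>_. ennreal (l * n))) A" .
qed simp

lemma scale_integral2:
  fixes l n :: real and h :: "real \<times> real \<Rightarrow> real"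
  assumes ln: "l > 0" "n > 0" and h: "h \<in> borel_measurable borel"
  shows "integrable lborel (\<lambda>z. h (l * fst z, n * snd z)) \<longleftrightarrow> integrable lborel h"
    and "(\<integral>z. l * n * h (l * fst z, n * snd z) \<partial>lborel) = (\<integral>z. h z \<partial>lborel)"
proof -
  let ?T = "\<lambda>z :: real \<times> real. (l * fst z, n * snd z)"
  have T: "?T \<in> borel_measurable borel" by (intro borel_measurable_continuous_onI continuous_intros)
  have "integrable lborel h \<longleftrightarrow> integrable (density (distr lborel borel ?T) (\<lambda>_. ennreal (l * n))) h"
    using scale_lborel2[OF ln] by simp
  also have "\<dots> \<longleftrightarrow> integrable (distr lborel borel ?T) (\<lambda>z. l * n * h z)"
    using ln h by (subst integrable_density) auto
  also have "\<dots> \<longleftrightarrow> integrable (distr lborel borel ?T) h" using ln by simp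
  also have "\<dots> \<longleftrightarrow> integrable lborel (\<lambda>z. h (l * fst z, n * snd z))"
    using T h by (subst integrable_distr_eq) auto
  finally show "integrable lborel (\<lambda>z. h (l * fst z, n * snd z)) \<longleftrightarrow> integrable lborel h" ..
  have "(\<integral>z. h z \<partial>lborel) = (\<integral>z. h z \<partial>(density (distr lborel borel ?T) (\<lambda>_. ennreal (l * n))))"
    using scale_lborel2[OF ln] by simp
  also have "\<dots> = (\<integral>z. l * n * h z \<partial>(distr lborel borel ?T))"
    using ln h by (subst integral_density) auto
  also have "\<dots> = (\<integral>z. l * n * h (l * fst z, n * snd z) \<partial>lborel)"
    using T h by (subst integral_distr) auto
  finally show "(\<integral>z. l * n * h (l * fst z, n * snd z) \<partial>lborel) = (\<integral>z. h z \<partial>lborel)" ..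
qed

lemma directional_deriv:
  fixes \<phi> :: "'a::real_normed_vector \<Rightarrow> real" and q :: "real \<Rightarrow> 'a"
  assumes "\<phi> differentiable (at (q y))" and "(q has_derivative (\<lambda>s. s *\<^sub>R h)) (at y)"
  shows "((\<lambda>s. \<phi> (q s)) has_real_derivative frechet_derivative \<phi> (at (q y)) h) (at y)"
proof -
  have d: "(\<phi> has_derivative frechet_derivative \<phi> (at (q y))) (at (q y))" using assms(1) frechet_derivative_works by blast
  have "((\<lambda>s. \<phi> (q s)) has_derivative (\<lambda>s. frechet_derivative \<phi> (at (q y)) (s *\<^sub>R h))) (at y)"
    by (rule has_derivative_compose[OF assms(2) d])
  moreover have "frechet_derivative \<phi> (at (q y)) (s *\<^sub>R h) = frechet_derivative \<phi> (at (q y)) h * s" for s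
    using linear_scale[OF has_derivative_linear[OF d], of s h] by (simp add: mult.commute)
  ultimately show ?thesis by (simp add: has_field_derivative_def mult_commute_abs)
qed

text \<open>Smoothness is stated through Frechet derivatives on space-time; evaluating them along
  the coordinate vectors gives the partial derivatives that the equation uses, all jointly
  continuous.\<close>

lemma smooth_partials:
  fixes f :: "real \<Rightarrow> real \<times> real \<Rightarrow> real"
  assumes "smooth_fun_on (\<lambda>(t, z). f t z) ({0<..} \<times> UNIV)"
  obtains ft fx fv fvv where
    "\<And>t x v. t > 0 \<Longrightarrow> ((\<lambda>s. f s (x, v)) has_real_derivative ft t (x, v)) (at t)"
    "\<And>t x v. t > 0 \<Longrightarrow> ((\<lambda>y. f t (y, v)) has_real_derivative fx t (x, v)) (at x)"
    "\<And>t x v. t > 0 \<Longrightarrow> ((\<lambda>w. f t (x, w)) has_real_derivative fv t (x, v)) (at v)"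
    "\<And>t x v. t > 0 \<Longrightarrow> ((\<lambda>w. fv t (x, w)) has_real_derivative fvv t (x, v)) (at v)"
    "continuous_on ({0<..} \<times> UNIV) (\<lambda>p. f (fst p) (snd p))" "continuous_on ({0<..} \<times> UNIV) (\<lambda>p. ft (fst p) (snd p))"
    "continuous_on ({0<..} \<times> UNIV) (\<lambda>p. fx (fst p) (snd p))" "continuous_on ({0<..} \<times> UNIV) (\<lambda>p. fv (fst p) (snd p))"
    "continuous_on ({0<..} \<times> UNIV) (\<lambda>p. fvv (fst p) (snd p))"
proof -
  define \<Phi> where "\<Phi> = (\<lambda>(t, z). f t z)"
  define S where "S = ({0<..} \<times> UNIV :: (real \<times> real \<times> real) set)"
  define D where "D = (\<lambda>h p. frechet_derivative \<Phi> (at p) h)"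
  define D2 where "D2 = (\<lambda>p. frechet_derivative (D (0, 0, 1)) (at p) (0, 0, 1))"
  have C: "Ck_on (Suc (Suc 0)) \<Phi> S" using assms by (simp add: smooth_fun_on_def \<Phi>_def S_def del: Ck_on.simps)
  have d0: "\<And>p. p \<in> S \<Longrightarrow> \<Phi> differentiable (at p)" using C by simp
  have C1: "Ck_on (Suc 0) (D h) S" for h using C[unfolded Ck_on.simps(2)[of "Suc 0"]] unfolding D_def by blast
  have d1: "\<And>p h. p \<in> S \<Longrightarrow> D h differentiable (at p)" using C1 by simp
  have c2: "continuous_on S D2" using C1[of "(0, 0, 1)"] unfolding D2_def by simp
  have c0: "continuous_on S \<Phi>" using d0 by (intro continuous_at_imp_continuous_on ballI differentiable_imp_continuous_within) auto
  have c1: "continuous_on S (D h)" for h using d1 by (intro continuous_at_imp_continuous_on ballI differentiable_imp_continuous_within) auto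
  have q: "((\<lambda>s. (s, (x, v))) has_derivative (\<lambda>s. s *\<^sub>R (1, 0, 0))) (at t)"
    "((\<lambda>y. (t, (y, v))) has_derivative (\<lambda>s. s *\<^sub>R (0, 1, 0))) (at x)"
    "((\<lambda>w. (t, (x, w))) has_derivative (\<lambda>s. s *\<^sub>R (0, 0, 1))) (at v)" for t x v :: real
    by (auto intro!: derivative_eq_intros simp: zero_prod_def)
  have SI: "t > 0 \<Longrightarrow> (t, z) \<in> S" for t z by (simp add: S_def)
  show thesis
  proof (rule that[of "\<lambda>t z. D (1, 0, 0) (t, z)" "\<lambda>t z. D (0, 1, 0) (t, z)" "\<lambda>t z. D (0, 0, 1) (t, z)" "\<lambda>t z. D2 (t, z)"])
    fix t x v :: real assume t: "t > 0"
    note s = SI[OF t, of "(x, v)"]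
    show "((\<lambda>s. f s (x, v)) has_real_derivative D (1, 0, 0) (t, (x, v))) (at t)"
      using directional_deriv[OF d0[OF s] q(1)] by (simp add: D_def \<Phi>_def)
    show "((\<lambda>y. f t (y, v)) has_real_derivative D (0, 1, 0) (t, (x, v))) (at x)"
      using directional_deriv[OF d0[OF s] q(2)] by (simp add: D_def \<Phi>_def)
    show "((\<lambda>w. f t (x, w)) has_real_derivative D (0, 0, 1) (t, (x, v))) (at v)"
      using directional_deriv[OF d0[OF s] q(3)] by (simp add: D_def \<Phi>_def)
    show "((\<lambda>w. D (0, 0, 1) (t, (x, w))) has_real_derivative D2 (t, (x, v))) (at v)"
      using directional_deriv[OF d1[OF s] q(3)] by (simp add: D2_def)
  next
    show "continuous_on ({0<..} \<times> UNIV) (\<lambda>p. f (fst p) (snd p))"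
      using c0 by (simp add: \<Phi>_def S_def case_prod_beta')
  qed (use c1 c2 in \<open>auto simp: S_def\<close>)
qed

lemma L2_norm_mu_inf:
  assumes f: "f \<in> borel_measurable borel" "\<And>z. f z > 0" and w: "w \<in> borel_measurable borel"
  shows "in_L2 (mu_inf f) w \<longleftrightarrow> integrable lborel (\<lambda>z. (w z)\<^sup>2 / f z)"
    and "L2_norm (mu_inf f) w = sqrt (\<integral>z. (w z)\<^sup>2 / f z \<partial>lborel)"
proof -
  note [measurable] = f(1) w
  have "integrable (mu_inf f) (\<lambda>z. (w z)\<^sup>2) \<longleftrightarrow> integrable lborel (\<lambda>z. 1 / f z * (w z)\<^sup>2)"
    unfolding mu_inf_def using f(2) by (subst integrable_density) (auto simp: less_imp_le)
  then show "in_L2 (mu_inf f) w \<longleftrightarrow> integrable lborel (\<lambda>z. (w z)\<^sup>2 / f z)"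
    using w by (simp add: in_L2_def mu_inf_def)
  have "(\<integral>z. (w z)\<^sup>2 \<partial>(mu_inf f)) = (\<integral>z. 1 / f z * (w z)\<^sup>2 \<partial>lborel)"
    unfolding mu_inf_def using f(2) by (subst integral_density) (auto simp: less_imp_le)
  then show "L2_norm (mu_inf f) w = sqrt (\<integral>z. (w z)\<^sup>2 / f z \<partial>lborel)"
    by (simp add: L2_norm_def)
qed

lemma weight_comparison:
  fixes w \<gamma> f :: "real \<times> real \<Rightarrow> real"
  assumes m: "w \<in> borel_measurable borel" "\<gamma> \<in> borel_measurable borel" "f \<in> borel_measurable borel"
    and p: "\<And>z. \<gamma> z > 0" "\<And>z. f z > 0" and c: "c > 0" "\<And>z. f z \<le> c * \<gamma> z"
    and i: "integrable lborel (\<lambda>z. (w z)\<^sup>2 / f z)"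
  shows "integrable lborel (\<lambda>z. (w z)\<^sup>2 / \<gamma> z)" "(\<integral>z. (w z)\<^sup>2 / \<gamma> z \<partial>lborel) \<le> c * (\<integral>z. (w z)\<^sup>2 / f z \<partial>lborel)"
proof -
  have le: "(w z)\<^sup>2 / \<gamma> z \<le> c * ((w z)\<^sup>2 / f z)" for z
  proof -
    have "1 / \<gamma> z \<le> c / f z" using p[of z] c(2)[of z] by (simp add: field_simps)
    from mult_left_mono[OF this zero_le_power2[of "w z"]] show ?thesis by (simp add: mult.commute)
  qed
  have ic: "integrable lborel (\<lambda>z. c * ((w z)\<^sup>2 / f z))" by (rule integrable_mult_right[OF i])
  have nn: "0 \<le> (w z)\<^sup>2 / \<gamma> z" for z using p(1)[of z] by simp
  show j: "integrable lborel (\<lambda>z. (w z)\<^sup>2 / \<gamma> z)"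
  proof (rule Bochner_Integration.integrable_bound[OF ic])
    show "(\<lambda>z. (w z)\<^sup>2 / \<gamma> z) \<in> borel_measurable lborel" using m by simp
    show "AE z in lborel. norm ((w z)\<^sup>2 / \<gamma> z) \<le> norm (c * ((w z)\<^sup>2 / f z))"
      unfolding real_norm_def abs_of_nonneg[OF nn] by (intro AE_I2 order_trans[OF le abs_ge_self])
  qed
  have "(\<integral>z. (w z)\<^sup>2 / \<gamma> z \<partial>lborel) \<le> (\<integral>z. c * ((w z)\<^sup>2 / f z) \<partial>lborel)" by (rule integral_mono[OF j ic le])
  then show "(\<integral>z. (w z)\<^sup>2 / \<gamma> z \<partial>lborel) \<le> c * (\<integral>z. (w z)\<^sup>2 / f z \<partial>lborel)"
    by (simp only: integral_mult_right_zero)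
qed

lemma force_clip:
  assumes K: "in_W1inf K" and k: "Linf_norm (weak_deriv K) \<le> k" and f: "f t \<in> borel_measurable borel"
  shows "force I K f t x = - I * cforce (clip k (weak_deriv K)) (f t) x"
proof -
  note m = in_Linf_AE[OF weak_deriv_props(2)[OF K]]
  have "AE y in lborel. \<bar>weak_deriv K y\<bar> \<le> k" using m(3) by eventually_elim (use k in linarith)
  from AE_fst[OF AE_reflect[OF clip_AE[OF this], of x]]
  have ae: "AE z in (lborel :: (real \<times> real) measure). weak_deriv K (x - fst z) = clip k (weak_deriv K) (x - fst z)" .
  have "(\<integral>z. weak_deriv K (x - fst z) * f t z \<partial>lborel) = (\<integral>z. clip k (weak_deriv K) (x - fst z) * f t z \<partial>lborel)"
  proof (rule integral_cong_AE)
    show "(\<lambda>z. weak_deriv K (x - fst z) * f t z) \<in> borel_measurable lborel"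
      "(\<lambda>z. clip k (weak_deriv K) (x - fst z) * f t z) \<in> borel_measurable lborel"
      using cforce_measurable[OF m(1), of x] cforce_measurable[OF clip_measurable[OF m(1), of k], of x] f by simp_all
    show "AE z in lborel. weak_deriv K (x - fst z) * f t z = clip k (weak_deriv K) (x - fst z) * f t z"
      using ae by eventually_elim simp
  qed
  then show ?thesis by (simp add: force_def cforce_def)
qed

text \<open>Verifies the abstract perturbation locale for the rescaled difference. The first
  smallness condition bounds the forces by \<epsilon>, the second makes the two weights
  comparable.\<close>

lemma decay_estimate:
  fixes \<alpha> \<nu> \<theta> I M :: real
  assumes par: "\<alpha> > 0" "\<nu> > 0" "\<theta> > 0" "I > 0" "M > 0"
    and osc: "oscillator (sqrt \<alpha>) \<nu> a b d"
    and T0: "T0 > 0" and C: "C > 0"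
    and ND: "\<And>t. 0 < t \<Longrightarrow> t \<le> T0 \<Longrightarrow> oscillator.cN a b d t / oscillator.cD a b d t \<le> C / t"
    and contr: "\<And>\<phi> k. \<phi> \<in> borel_measurable borel \<Longrightarrow> (\<And>w. \<bar>\<phi> w\<bar> \<le> k) \<Longrightarrow>
      (\<integral>z. gauss z * (oscillator.P a b d T0 \<phi> z - (\<integral>w. gauss w * \<phi> w \<partial>lborel))\<^sup>2 \<partial>lborel) \<le> 1/16 * (\<integral>w. gauss w * (\<phi> w)\<^sup>2 \<partial>lborel)"
    and K: "in_W1inf K" and k: "W1inf_norm K = k"
    and fin: "integrable lborel f_in" "AE z in lborel. 0 \<le> f_in z" "(\<integral>z. f_in z \<partial>lborel) = M"
    and sol: "vfp_solution \<alpha> \<nu> \<theta> I K f_in f" and hs: "is_haissinski \<alpha> \<theta> I M K f_inf"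
    and small: "I * M * k \<le> sqrt \<theta> / (48 * sqrt (2 * C * T0))" "2 * (I * M * k) \<le> \<theta> * ln 2"
    and L2: "in_L2 (mu_inf f_inf) (\<lambda>z. f_in z - f_inf z)" and t: "t \<ge> 0"
  shows "in_L2 (mu_inf f_inf) (\<lambda>z. f t z - f_inf z) \<and>
     L2_norm (mu_inf f_inf) (\<lambda>z. f t z - f_inf z) \<le> 8 * exp (- (ln 2 / T0) * t) * L2_norm (mu_inf f_inf) (\<lambda>z. f_in z - f_inf z)"
proof -
  interpret oscillator "sqrt \<alpha>" \<nu> a b d by (rule osc)
  obtain s where st: "steady_density \<alpha> \<theta> I M K s" and fi: "f_inf = steady_state \<theta> M s"
    using hs by (auto simp: is_haissinski_def)
  \<comment> \<open>The standard deviations of the harmonic Maxwellian in x and v. The identities l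
    \<omega> = n and n \<omega> = \<alpha> l turn transport and confinement into one rotation with
    frequency \<omega> = sqrt \<alpha>.\<close>
  define l where "l = sqrt (\<theta> / \<alpha>)"
  define n where "n = sqrt \<theta>"
  define \<omega> where "\<omega> = sqrt \<alpha>"
  have lnp: "l > 0" "n > 0" "\<omega> > 0" "n * n = \<theta>" "l * \<omega> = n" "n * \<omega> = \<alpha> * l"
    using par by (auto simp: l_def n_def \<omega>_def real_sqrt_divide real_sqrt_mult_self) (simp add: field_simps real_sqrt_mult_self)
  obtain s' where sf: "k \<ge> 0" "integrable lborel s" "\<And>x. s x > 0" "(\<integral>x. s x \<partial>lborel) = 1"
    "\<And>x. (s has_real_derivative s' x) (at x)" "continuous_on UNIV s'"
    "\<And>x. s' x = s x * ((- \<alpha> * x - I * M * (\<integral>y. clip k (weak_deriv K) (x - y) * s y \<partial>lborel)) / \<theta>)"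
    "\<And>x. s x \<le> exp (2 * (I * M * k) / \<theta>) * (exp (- (\<alpha> * x\<^sup>2 / (2 * \<theta>))) / sqrt (2 * pi * (\<theta> / \<alpha>)))"
    "\<And>x. exp (- (2 * (I * M * k) / \<theta>)) * (exp (- (\<alpha> * x\<^sup>2 / (2 * \<theta>))) / sqrt (2 * pi * (\<theta> / \<alpha>))) \<le> s x"
    "\<And>x. \<bar>I * M * (\<integral>y. clip k (weak_deriv K) (x - y) * s y \<partial>lborel)\<bar> \<le> I * M * k"
    "continuous_on UNIV (\<lambda>x. \<integral>y. clip k (weak_deriv K) (x - y) * s y \<partial>lborel)"
    using steady_facts[OF par(1,3,4,5) K k st] by blast
  define B where "B = clip k (weak_deriv K)"
  note mK = in_Linf_AE[OF weak_deriv_props(2)[OF K]]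
  have kK: "Linf_norm (weak_deriv K) \<le> k" using in_Linf_AE(2)[OF weak_deriv_props(1)[OF K]] k by (simp add: W1inf_norm_def)
  have B: "B \<in> borel_measurable borel" "\<And>y. \<bar>B y\<bar> \<le> k"
    unfolding B_def by (rule clip_measurable[OF mK(1)], rule clip_bound[OF sf(1)])
  define Finf where "Finf = (\<lambda>x. - I * M * (\<integral>y. B (x - y) * s y \<partial>lborel))"
  have Finf: "\<bar>Finf x\<bar> \<le> I * M * k" "continuous_on UNIV Finf" for x
    using sf(10)[of x] sf(11) unfolding Finf_def B_def by (auto intro!: continuous_intros simp: abs_mult)
  have s'e: "s' x = s x * ((Finf x - \<alpha> * x) / \<theta>)" for x
    unfolding sf(7) Finf_def B_def by simp
  have cs: "continuous_on UNIV s" using sf(5) by (intro DERIV_continuous_on) (auto intro: has_field_derivative_at_within)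

  define \<eta> where "\<eta> = (\<lambda>v. M / sqrt (2 * pi * \<theta>) * exp (- (v\<^sup>2 / (2 * \<theta>))))"
  have fie: "f_inf (x, v) = \<eta> v * s x" for x v by (simp add: fi steady_state_def \<eta>_def)
  have \<eta>p: "\<eta> v > 0" for v using par by (simp add: \<eta>_def)
  have \<eta>d: "(\<eta> has_real_derivative (- v / \<theta> * \<eta> v)) (at v)" for v
    unfolding \<eta>_def using par by (auto intro!: derivative_eq_intros simp: field_simps)
  have \<eta>c: "continuous_on S \<eta>" for S unfolding \<eta>_def using par by (intro continuous_intros) auto
  have \<eta>i: "integrable lborel \<eta>" "(\<integral>v. \<eta> v \<partial>lborel) = M"
    unfolding \<eta>_def using normal_integral[OF par(3)] par by simp_all
  have fip: "f_inf z > 0" for z by (cases z) (simp add: fie \<eta>p sf(3))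
  have fie': "f_inf = (\<lambda>z. s (fst z) * \<eta> (snd z))" by (rule ext) (metis fie mult.commute prod.collapse)
  have fii: "integrable lborel f_inf" "(\<integral>z. f_inf z \<partial>lborel) = M"
    unfolding fie' using integrable_product2[OF sf(2) \<eta>i(1)] sf(4) \<eta>i(2) by simp_all
  have fic: "continuous_on UNIV f_inf" unfolding fie'
    by (intro continuous_intros continuous_on_compose2[OF cs] continuous_on_compose2[OF \<eta>c[of UNIV]]) auto
  have fim: "f_inf \<in> borel_measurable borel" by (rule borel_measurable_continuous_onI[OF fic])
  have cfi: "- I * cforce B f_inf x = Finf x" for x
  proof -
    have "cforce B f_inf x = (\<integral>z. (B (x - fst z) * s (fst z)) * \<eta> (snd z) \<partial>lborel)"
      unfolding cforce_def fie' by (simp add: mult.assoc)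
    also have "\<dots> = (\<integral>y. B (x - y) * s y \<partial>lborel) * M"
      by (subst integrable_product2(2)[OF cv_bounds(1)[OF B sf(2)] \<eta>i(1)]) (simp only: \<eta>i)
    finally show ?thesis by (simp add: Finf_def)
  qed

  have vs: "continuous_in_L1 f" "smooth_fun_on (\<lambda>(t, z). f t z) ({0<..} \<times> UNIV)" "vfp_equation \<alpha> \<nu> \<theta> I K f"
    "AE z in lborel. f 0 z = f_in z" "\<And>t. t \<ge> 0 \<Longrightarrow> AE z in lborel. 0 \<le> f t z"
    "\<And>t. t \<ge> 0 \<Longrightarrow> (\<integral>z. f t z \<partial>lborel) = M"
    using sol fin(3) by (auto simp: vfp_solution_def)
  have fti: "integrable lborel (f t)" if "t \<ge> 0" for t using vs(1) that by (simp add: continuous_in_L1_def)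
  have ftm: "f t \<in> borel_measurable borel" if "t \<ge> 0" for t using fti[OF that] by (auto dest: borel_measurable_integrable)
  have fL1: "((\<lambda>s. \<integral>z. \<bar>f s z - f t z\<bar> \<partial>lborel) \<longlongrightarrow> 0) (at t within {0..})" if "t \<ge> 0" for t
    using vs(1) that by (simp add: continuous_in_L1_def)
  have fabs: "(\<integral>z. \<bar>f t z\<bar> \<partial>lborel) = M" if "t \<ge> 0" for t
  proof -
    have "(\<integral>z. \<bar>f t z\<bar> \<partial>lborel) = (\<integral>z. f t z \<partial>lborel)"
      using ftm[OF that] vs(5)[OF that] by (intro integral_cong_AE) auto
    then show ?thesis using vs(6)[OF that] by simp
  qed
  obtain ft fx fv fvv where fd:
    "\<And>t x v. t > 0 \<Longrightarrow> ((\<lambda>s. f s (x, v)) has_real_derivative ft t (x, v)) (at t)"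
    "\<And>t x v. t > 0 \<Longrightarrow> ((\<lambda>y. f t (y, v)) has_real_derivative fx t (x, v)) (at x)"
    "\<And>t x v. t > 0 \<Longrightarrow> ((\<lambda>w. f t (x, w)) has_real_derivative fv t (x, v)) (at v)"
    "\<And>t x v. t > 0 \<Longrightarrow> ((\<lambda>w. fv t (x, w)) has_real_derivative fvv t (x, v)) (at v)"
    and fc: "continuous_on ({0<..} \<times> UNIV) (\<lambda>p. f (fst p) (snd p))" "continuous_on ({0<..} \<times> UNIV) (\<lambda>p. ft (fst p) (snd p))"
    "continuous_on ({0<..} \<times> UNIV) (\<lambda>p. fx (fst p) (snd p))" "continuous_on ({0<..} \<times> UNIV) (\<lambda>p. fv (fst p) (snd p))"
    "continuous_on ({0<..} \<times> UNIV) (\<lambda>p. fvv (fst p) (snd p))"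
    using smooth_partials[OF vs(2)] by blast
  have fcs: "continuous_on UNIV (f t)" "continuous_on UNIV (fx t)" "continuous_on UNIV (fv t)" "continuous_on UNIV (fvv t)" if "t > 0" for t
    using that by (auto intro!: continuous_on_compose2[OF fc(1), of UNIV "\<lambda>z. (t, z)", simplified]
      continuous_on_compose2[OF fc(3), of UNIV "\<lambda>z. (t, z)", simplified]
      continuous_on_compose2[OF fc(4), of UNIV "\<lambda>z. (t, z)", simplified]
      continuous_on_compose2[OF fc(5), of UNIV "\<lambda>z. (t, z)", simplified] continuous_intros)
  define FF where "FF = (\<lambda>t x. - I * cforce B (f t) x)"
  have FFe: "force I K f t x = FF t x" if "t > 0" for t x
    unfolding FF_def B_def by (rule force_clip[OF K kK ftm]) (use that in simp)
  have FFb: "\<bar>FF t x\<bar> \<le> I * M * k" if "t > 0" for t x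
  proof -
    have "\<bar>cforce B (f t) x\<bar> \<le> k * (\<integral>z. \<bar>f t z\<bar> \<partial>lborel)" by (rule cforce_bound[OF B fti]) (use that in simp)
    then have "\<bar>cforce B (f t) x\<bar> \<le> k * M" using fabs[of t] that by simp
    then have "I * \<bar>cforce B (f t) x\<bar> \<le> I * (k * M)" using par(4) by (intro mult_left_mono) auto
    then show ?thesis using par(4) by (simp add: FF_def abs_mult mult_ac)
  qed
  have FFc: "continuous_on UNIV (FF t)" if "t > 0" for t
    unfolding FF_def by (intro continuous_intros cforce_continuous[OF B fti fcs(1)]) (use that in auto)
  have FFd: "FF t x - Finf x = - I * cforce B (\<lambda>z. f t z - f_inf z) x" if "t > 0" for t x
  proof -
    have "cforce B (\<lambda>z. f t z - f_inf z) x = cforce B (f t) x - cforce B f_inf x"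
      unfolding cforce_def using cforce_bound(2)[OF B fti, of t x] cforce_bound(2)[OF B fii(1), of x] that
      by (simp add: right_diff_distrib)
    then show ?thesis unfolding FF_def cfi[symmetric] by (simp only: right_diff_distrib)
  qed
  have pde: "ft t (x, v) + v * fx t (x, v) + (FF t x - \<alpha> * x) * fv t (x, v) = 2 * \<nu> * (f t (x, v) + v * fv t (x, v) + \<theta> * fvv t (x, v))"
    if t: "t > 0" for t x v
  proof -
    have dv: "deriv (\<lambda>u. f t (x, u)) w = fv t (x, w)" for w by (rule DERIV_imp_deriv[OF fd(3)[OF t]])
    have "((\<lambda>w. w * f t (x, w) + \<theta> * fv t (x, w)) has_real_derivative (f t (x, v) + v * fv t (x, v) + \<theta> * fvv t (x, v))) (at v)"
      by (rule derivative_eq_intros fd(3)[OF t] fd(4)[OF t] refl)+ simp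
    note dd = DERIV_imp_deriv[OF this]
    have "deriv (\<lambda>s. f s (x, v)) t + v * deriv (\<lambda>y. f t (y, v)) x + (force I K f t x - \<alpha> * x) * deriv (\<lambda>w. f t (x, w)) v
        = 2 * \<nu> * deriv (\<lambda>w. w * f t (x, w) + \<theta> * deriv (\<lambda>u. f t (x, u)) w) v"
      using vs(3) t unfolding vfp_equation_def by blast
    then show ?thesis
      unfolding dv dd DERIV_imp_deriv[OF fd(1)[OF t]] DERIV_imp_deriv[OF fd(2)[OF t]] FFe[OF t] .
  qed

  define \<sigma> where "\<sigma> = (\<lambda>z :: real \<times> real. (l * fst z, n * snd z))"
  have \<sigma>c: "continuous_on S \<sigma>" for S unfolding \<sigma>_def by (intro continuous_intros)
  have \<sigma>p: "\<sigma> (x, v) = (l * x, n * v)" for x v by (simp add: \<sigma>_def)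
  define c where "c = l * n"
  have cp: "c > 0" using lnp by (simp add: c_def)
  \<comment> \<open>The factor c is the Jacobian of the rescaling, so masses and L^1 norms are
    unchanged.\<close>
  define g where "g = (\<lambda>t z. c * (f t (\<sigma> z) - f_inf (\<sigma> z)))"
  define gt where "gt = (\<lambda>t z. c * ft t (\<sigma> z))"
  define gx where "gx = (\<lambda>t z. c * l * (fx t (\<sigma> z) - \<eta> (snd (\<sigma> z)) * s' (fst (\<sigma> z))))"
  define gv where "gv = (\<lambda>t z. c * n * (fv t (\<sigma> z) - - snd (\<sigma> z) / \<theta> * f_inf (\<sigma> z)))"
  define gvv where "gvv = (\<lambda>t z. c * \<theta> * (fvv t (\<sigma> z) - ((snd (\<sigma> z))\<^sup>2 / \<theta>\<^sup>2 - 1 / \<theta>) * f_inf (\<sigma> z)))"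
  define F where "F = (\<lambda>t x. FF t (l * x) / n)"
  define G where "G = (\<lambda>t x. (FF t (l * x) - Finf (l * x)) / n)"
  define u where "u = (\<lambda>z. c * f_inf (\<sigma> z))"
  \<comment> \<open>The linear part contains the harmonic confinement only. Both self-consistent
    forces go into J, through F_f f - F_inf f_inf = F_f g + (F_f - F_inf) f_inf.\<close>
  define J where "J = (\<lambda>t z. F t (fst z) * g t z + G t (fst z) * u z)"
  define Jv where "Jv = (\<lambda>t z. F t (fst z) * gv t z + G t (fst z) * (c * n * (- snd (\<sigma> z) / \<theta> * f_inf (\<sigma> z))))"
  \<comment> \<open>The largest value allowed by the absorption condition \<open>small\<close> of
    the locale.\<close>
  define \<epsilon> where "\<epsilon> = 1 / (48 * sqrt (2 * C * T0))"
  have \<epsilon>0: "\<epsilon> > 0" using C T0 by (simp add: \<epsilon>_def)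
  have \<epsilon>1: "I * M * k / n \<le> \<epsilon>" using small(1) lnp(2) by (simp add: \<epsilon>_def n_def divide_le_eq mult.commute)
  have fiv: "((\<lambda>v. f_inf (x, v)) has_real_derivative (- v / \<theta> * f_inf (x, v))) (at v)" for x v
    unfolding fie by (rule DERIV_cong[OF DERIV_cmult_right[OF \<eta>d]]) simp
  have fix': "((\<lambda>x. f_inf (x, v)) has_real_derivative (\<eta> v * s' x)) (at x)" for x v
    unfolding fie by (rule DERIV_cmult[OF sf(5)])
  have fivv: "((\<lambda>v. - v / \<theta> * f_inf (x, v)) has_real_derivative ((v\<^sup>2 / \<theta>\<^sup>2 - 1 / \<theta>) * f_inf (x, v))) (at v)" for x v
  proof -
    have "((\<lambda>v. - v / \<theta>) has_real_derivative (- 1 / \<theta>)) (at v)" using par(3) by (auto intro!: derivative_eq_intros)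
    from DERIV_mult[OF this fiv[of x v]] show ?thesis
      by (rule DERIV_cong) (simp add: power2_eq_square algebra_simps)
  qed
  have lin: "((\<lambda>y. r * y) has_real_derivative r) (at y)" for r y :: real by (auto intro!: derivative_eq_intros)
  have gm: "g t \<in> borel_measurable borel" if "t \<ge> 0" for t
  proof -
    have "(\<lambda>z. f t (\<sigma> z)) \<in> borel_measurable borel" "(\<lambda>z. f_inf (\<sigma> z)) \<in> borel_measurable borel"
      by (rule measurable_compose[OF borel_measurable_continuous_onI[OF \<sigma>c]], rule ftm[OF that] fim)+
    then show ?thesis unfolding g_def by measurable
  qed
  have scale: "integrable lborel (\<lambda>z. h (\<sigma> z)) \<longleftrightarrow> integrable lborel h" "(\<integral>z. c * h (\<sigma> z) \<partial>lborel) = (\<integral>z. h z \<partial>lborel)"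
    if "h \<in> borel_measurable borel" for h :: "real \<times> real \<Rightarrow> real"
    unfolding \<sigma>_def c_def by (rule scale_integral2[OF lnp(1,2) that])+
  have dm: "(\<lambda>z. f t z - f_inf z) \<in> borel_measurable borel" if "t \<ge> 0" for t using ftm[OF that] fim by simp
  have gabs: "(\<integral>z. \<bar>g t z - g r z\<bar> \<partial>lborel) = (\<integral>z. \<bar>f t z - f r z\<bar> \<partial>lborel)" if "t \<ge> 0" "r \<ge> 0" for t r
  proof -
    have "\<bar>g t z - g r z\<bar> = c * \<bar>f t (\<sigma> z) - f r (\<sigma> z)\<bar>" for z
      unfolding g_def using cp by (simp add: right_diff_distrib[symmetric] abs_mult)
    then show ?thesis using scale(2)[of "\<lambda>z. \<bar>f t z - f r z\<bar>"] ftm[OF that(1)] ftm[OF that(2)] by simp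
  qed
  have gabs1: "(\<integral>z. \<bar>g t z\<bar> \<partial>lborel) = (\<integral>z. \<bar>f t z - f_inf z\<bar> \<partial>lborel)" if "t \<ge> 0" for t
  proof -
    have "\<bar>g t z\<bar> = c * \<bar>f t (\<sigma> z) - f_inf (\<sigma> z)\<bar>" for z unfolding g_def using cp by (simp add: abs_mult)
    then show ?thesis using scale(2)[of "\<lambda>z. \<bar>f t z - f_inf z\<bar>"] dm[OF that] by simp
  qed
  have gauss_eq: "c * (\<eta> (n * v) * (exp (- (\<alpha> * (l * x)\<^sup>2 / (2 * \<theta>))) / sqrt (2 * pi * (\<theta> / \<alpha>)))) = M * gauss (x, v)" for x v
  proof -
    have ll: "l * l = \<theta> / \<alpha>" using par by (simp add: l_def)
    have e1: "\<alpha> * (l * x)\<^sup>2 / (2 * \<theta>) = x\<^sup>2 / 2"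
      using ll par by (simp add: power2_eq_square field_simps)
    have e2: "(n * v)\<^sup>2 / (2 * \<theta>) = v\<^sup>2 / 2"
    proof -
      have "n\<^sup>2 = \<theta>" using lnp(4) by (simp add: power2_eq_square)
      then show ?thesis using par by (simp add: power_mult_distrib)
    qed
    have r1: "sqrt (2 * pi * (\<theta> / \<alpha>)) = sqrt (2 * pi) * l" by (simp only: l_def real_sqrt_mult)
    have r2: "sqrt (2 * pi * \<theta>) = sqrt (2 * pi) * n" by (simp only: n_def real_sqrt_mult)
    have "c * (\<eta> (n * v) * (exp (- (\<alpha> * (l * x)\<^sup>2 / (2 * \<theta>))) / sqrt (2 * pi * (\<theta> / \<alpha>)))) =
      (l * n) * (M / (sqrt (2 * pi) * n) * exp (- (v\<^sup>2 / 2)) * (exp (- (x\<^sup>2 / 2)) / (sqrt (2 * pi) * l)))"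
      unfolding c_def \<eta>_def e1 e2 r1 r2 ..
    also have "\<dots> = M * (exp (- (v\<^sup>2 / 2)) * exp (- (x\<^sup>2 / 2))) / (sqrt (2 * pi) * sqrt (2 * pi))"
      using lnp by (simp add: field_simps)
    also have "exp (- (v\<^sup>2 / 2)) * exp (- (x\<^sup>2 / 2)) = exp (- (x\<^sup>2 + v\<^sup>2) / 2)"
      by (simp add: exp_add[symmetric] field_simps)
    also have "sqrt (2 * pi) * sqrt (2 * pi) = 2 * pi" by simp
    finally show ?thesis by (simp add: gauss_def)
  qed
  \<comment> \<open>With this, the bounds on s give u \<le> 2 M \<open>gauss\<close> and M
    \<open>gauss\<close> \<le> 2 u, the comparison of weights in both directions.\<close>
  have e2: "exp (2 * (I * M * k) / \<theta>) \<le> 2"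
  proof -
    have "2 * (I * M * k) / \<theta> \<le> ln 2" using small(2) par by (simp add: divide_le_eq mult.commute)
    then have "exp (2 * (I * M * k) / \<theta>) \<le> exp (ln 2)" by (simp only: exp_le_cancel_iff)
    then show ?thesis by simp
  qed
  have u_up: "u z \<le> 2 * M * gauss z" for z
  proof -
    obtain x v where z: "z = (x, v)" by (cases z)
    let ?e = "exp (- (\<alpha> * (l * x)\<^sup>2 / (2 * \<theta>))) / sqrt (2 * pi * (\<theta> / \<alpha>))"
    have e0: "?e \<ge> 0" using par by simp
    have "s (l * x) \<le> 2 * ?e" using order_trans[OF sf(8) mult_right_mono[OF e2 e0]] .
    then have "c * (\<eta> (n * v) * s (l * x)) \<le> c * (\<eta> (n * v) * (2 * ?e))"
      using cp \<eta>p[of "n * v"] by (intro mult_left_mono) auto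
    also have "\<dots> = 2 * (c * (\<eta> (n * v) * ?e))" by simp
    finally show ?thesis unfolding gauss_eq by (simp add: u_def z \<sigma>p fie)
  qed
  have u_lo: "M * gauss z \<le> 2 * u z" for z
  proof -
    obtain x v where z: "z = (x, v)" by (cases z)
    let ?e = "exp (- (\<alpha> * (l * x)\<^sup>2 / (2 * \<theta>))) / sqrt (2 * pi * (\<theta> / \<alpha>))"
    have e0: "?e \<ge> 0" using par by simp
    have "1 / 2 \<le> exp (- (2 * (I * M * k) / \<theta>))" using e2 by (simp add: exp_minus field_simps)
    from order_trans[OF mult_right_mono[OF this e0] sf(9)] have "1 / 2 * ?e \<le> s (l * x)" .
    then have "c * (\<eta> (n * v) * (1 / 2 * ?e)) \<le> c * (\<eta> (n * v) * s (l * x))"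
      using cp \<eta>p[of "n * v"] by (intro mult_left_mono) auto
    moreover have "c * (\<eta> (n * v) * (1 / 2 * ?e)) = 1 / 2 * (c * (\<eta> (n * v) * ?e))" by simp
    ultimately show ?thesis unfolding gauss_eq by (simp add: u_def z \<sigma>p fie)
  qed
  have up: "u z > 0" for z using cp fip by (simp add: u_def)
  note c\<sigma> = continuous_on_compose2[OF _ \<sigma>c]
  have cfis: "continuous_on UNIV (\<lambda>z. f_inf (\<sigma> z))" by (rule c\<sigma>[OF fic]) simp
  have gc: "continuous_on UNIV (gx t)" "continuous_on UNIV (gv t)" "continuous_on UNIV (gvv t)" "continuous_on UNIV (g t)" if "t > 0" for t
  proof -
    note h = c\<sigma>[OF fcs(1)[OF that]] c\<sigma>[OF fcs(2)[OF that]] c\<sigma>[OF fcs(3)[OF that]] c\<sigma>[OF fcs(4)[OF that]]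
    show "continuous_on UNIV (gx t)" "continuous_on UNIV (gv t)" "continuous_on UNIV (gvv t)" "continuous_on UNIV (g t)"
      unfolding gx_def gv_def gvv_def g_def using par
      by (auto intro!: continuous_intros h cfis continuous_on_compose2[OF sf(6)] continuous_on_compose2[OF \<eta>c[of UNIV]] \<sigma>c)
  qed
  have Fc: "continuous_on UNIV (F t)" "continuous_on UNIV (G t)" if "t > 0" for t
    unfolding F_def G_def using lnp
    by (auto intro!: continuous_intros continuous_on_compose2[OF FFc[OF that]] continuous_on_compose2[OF Finf(2)])
  have uc: "continuous_on UNIV u" unfolding u_def by (intro continuous_intros cfis)
  have uv: "((\<lambda>v. u (x, v)) has_real_derivative (c * n * (- snd (\<sigma> (x, v)) / \<theta> * f_inf (\<sigma> (x, v))))) (at v)" for x v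
    unfolding u_def \<sigma>p by (rule DERIV_cong[OF DERIV_cmult[OF DERIV_chain2[OF fiv lin]]]) simp
  have dgv: "((\<lambda>v. g t (x, v)) has_real_derivative gv t (x, v)) (at v)" if "t > 0" for t x v
    unfolding g_def gv_def \<sigma>p
    by (rule DERIV_cong[OF DERIV_cmult[OF DERIV_diff[OF DERIV_chain2[OF fd(3)[OF that] lin] DERIV_chain2[OF fiv lin]]]]) (simp add: algebra_simps)
  have cc: "continuous_on ({0<..} \<times> UNIV) (\<lambda>p. f (fst p) (\<sigma> (snd p)))" "continuous_on ({0<..} \<times> UNIV) (\<lambda>p. ft (fst p) (\<sigma> (snd p)))"
    by (rule continuous_on_compose2[OF fc(1), where f = "\<lambda>p. (fst p, \<sigma> (snd p))", simplified]
        continuous_on_compose2[OF fc(2), where f = "\<lambda>p. (fst p, \<sigma> (snd p))", simplified],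
        auto intro!: continuous_intros continuous_on_compose2[OF \<sigma>c[of UNIV]])+
  interpret sp: small_perturbation "sqrt \<alpha>" \<nu> a b d g gt gx gv gvv J Jv F G u \<epsilon> M T0 C
  proof unfold_locales
    show "\<epsilon> > 0" "M > 0" "T0 > 0" "C > 0" by (fact \<epsilon>0 par T0 C)+
    show "((\<lambda>t. g t z) has_real_derivative gt t z) (at t)" if "t > 0" for t z
    proof -
      obtain x v where z: "z = (x, v)" by (cases z)
      show ?thesis unfolding g_def gt_def z \<sigma>p
        by (rule DERIV_cong[OF DERIV_cmult[OF DERIV_diff[OF fd(1)[OF that] DERIV_const]]]) simp
    qed
    show "((\<lambda>x. g t (x, v)) has_real_derivative gx t (x, v)) (at x)" if "t > 0" for t x v
      unfolding g_def gx_def \<sigma>p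
      by (rule DERIV_cong[OF DERIV_cmult[OF DERIV_diff[OF DERIV_chain2[OF fd(2)[OF that] lin] DERIV_chain2[OF fix' lin]]]]) (simp add: algebra_simps)
    show "((\<lambda>v. g t (x, v)) has_real_derivative gv t (x, v)) (at v)" if "t > 0" for t x v by (rule dgv[OF that])
    show "((\<lambda>v. gv t (x, v)) has_real_derivative gvv t (x, v)) (at v)" if "t > 0" for t x v
      unfolding gv_def gvv_def \<sigma>p snd_conv
      by (rule DERIV_cong[OF DERIV_cmult[OF DERIV_diff[OF DERIV_chain2[OF fd(4)[OF that] lin] DERIV_chain2[OF fivv lin]]]])
         (simp add: lnp(4)[symmetric] algebra_simps)
    show "((\<lambda>v. J t (x, v)) has_real_derivative Jv t (x, v)) (at v)" if "t > 0" for t x v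
      unfolding J_def Jv_def fst_conv by (rule DERIV_add[OF DERIV_cmult[OF dgv[OF that]] DERIV_cmult[OF uv]])
    have "continuous_on ({0<..} \<times> UNIV) (\<lambda>p :: real \<times> real \<times> real. f_inf (\<sigma> (snd p)))"
      by (rule continuous_on_compose2[OF cfis]) (auto intro!: continuous_intros)
    then show "continuous_on ({0<..} \<times> UNIV) (\<lambda>(t, z). g t z)"
      unfolding g_def case_prod_beta' by (intro continuous_on_mult continuous_on_const continuous_on_diff cc(1))
    show "continuous_on ({0<..} \<times> UNIV) (\<lambda>(t, z). gt t z)"
      unfolding gt_def case_prod_beta' by (intro continuous_on_mult continuous_on_const cc(2))
    show "continuous_on UNIV (gx t)" "continuous_on UNIV (gv t)" "continuous_on UNIV (gvv t)" if "t > 0" for t by (fact gc[OF that])+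
    show "continuous_on UNIV (F t)" "continuous_on UNIV (G t)" if "t > 0" for t by (fact Fc[OF that])+
    show "continuous_on UNIV u" by (fact uc)
    show "continuous_on UNIV (J t)" "continuous_on UNIV (Jv t)" if "t > 0" for t
      unfolding J_def Jv_def using par
      by (auto intro!: continuous_intros gc[OF that] uc cfis \<sigma>c continuous_on_compose2[OF Fc(1)[OF that]] continuous_on_compose2[OF Fc(2)[OF that]])
    show "gt t z = - sqrt \<alpha> * snd z * gx t z + sqrt \<alpha> * fst z * gv t z - Jv t z + 2 * \<nu> * (g t z + snd z * gv t z + gvv t z)"
      if t: "t > 0" for t z
    proof -
      obtain x v where z: "z = (x, v)" by (cases z)
      define X where "X = l * x"
      define V where "V = n * v"
      define q where "q = f_inf (X, V)"
      have p1: "ft t (X, V) = - V * fx t (X, V) - (FF t X - \<alpha> * X) * fv t (X, V) + 2 * \<nu> * (f t (X, V) + V * fv t (X, V) + \<theta> * fvv t (X, V))"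
        using pde[OF t, of X V] by linarith
      \<comment> \<open>This is where stationarity enters: the x-derivative of the steady state is
        expressed through its own force, so that transport of f_inf cancels against confinement and
        the part of \<open>F_inf\<close> hidden in J.\<close>
      have sq: "\<eta> V * s' X = q * (Finf X - \<alpha> * X) / \<theta>" unfolding q_def fie s'e by simp
      have a1: "\<omega> * v * (c * l * y) = c * (V * y)" for y using lnp(5) by (simp add: V_def mult_ac)
      have a2: "\<omega> * x * (c * n * y) = c * (\<alpha> * X * y)" for y using lnp(6) by (simp add: X_def mult_ac)
      have a3: "R / n * (c * n * y) = c * (R * y)" for R y using lnp(2) by simp
      have a4: "v * (c * n * y) = c * (V * y)" for y by (simp add: V_def mult_ac)
      have "- \<omega> * v * gx t z + \<omega> * x * gv t z - Jv t z + 2 * \<nu> * (g t z + v * gv t z + gvv t z)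
        = - (\<omega> * v * (c * l * (fx t (X, V) - \<eta> V * s' X))) + \<omega> * x * (c * n * (fv t (X, V) - - V / \<theta> * q))
          - (FF t X / n * (c * n * (fv t (X, V) - - V / \<theta> * q)) + (FF t X - Finf X) / n * (c * n * (- V / \<theta> * q)))
          + 2 * \<nu> * (c * (f t (X, V) - q) + v * (c * n * (fv t (X, V) - - V / \<theta> * q)) + c * \<theta> * (fvv t (X, V) - (V\<^sup>2 / \<theta>\<^sup>2 - 1 / \<theta>) * q))"
        unfolding gx_def gv_def gvv_def g_def Jv_def F_def G_def z \<sigma>p fst_conv snd_conv X_def[symmetric] V_def[symmetric] q_def by simp
      also have "\<dots> = - (c * (V * (fx t (X, V) - q * (Finf X - \<alpha> * X) / \<theta>))) + c * (\<alpha> * X * (fv t (X, V) - - V / \<theta> * q))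
          - (c * (FF t X * (fv t (X, V) - - V / \<theta> * q)) + c * ((FF t X - Finf X) * (- V / \<theta> * q)))
          + 2 * \<nu> * (c * (f t (X, V) - q) + c * (V * (fv t (X, V) - - V / \<theta> * q)) + c * \<theta> * (fvv t (X, V) - (V\<^sup>2 / \<theta>\<^sup>2 - 1 / \<theta>) * q))"
        unfolding a1 a2 a3 a4 sq ..
      also have "\<dots> = c * ft t (X, V)"
        unfolding p1 using par(3) by (simp add: field_simps power2_eq_square)
      finally show ?thesis by (simp add: gt_def z \<sigma>p X_def V_def \<omega>_def)
    qed
    show "J t z = F t (fst z) * g t z + G t (fst z) * u z" for t z by (simp add: J_def)
    show "\<bar>F t x\<bar> \<le> \<epsilon>" if "t > 0" for t x
    proof -
      have "\<bar>F t x\<bar> \<le> I * M * k / n" unfolding F_def using FFb[OF that, of "l * x"] lnp(2) by (simp add: abs_divide divide_right_mono)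
      then show ?thesis using \<epsilon>1 by linarith
    qed
    show "\<bar>G t x\<bar> \<le> \<epsilon> / M * (\<integral>z. \<bar>g t z\<bar> \<partial>lborel)" if t: "t > 0" for t x
    proof -
      let ?L = "\<integral>z. \<bar>f t z - f_inf z\<bar> \<partial>lborel"
      have "\<bar>cforce B (\<lambda>z. f t z - f_inf z) (l * x)\<bar> \<le> k * ?L"
        by (rule cforce_bound[OF B]) (use fti[of t] fii t in auto)
      then have "\<bar>FF t (l * x) - Finf (l * x)\<bar> \<le> I * (k * ?L)"
        unfolding FFd[OF t] using par(4) by (simp add: abs_mult)
      then have "\<bar>G t x\<bar> \<le> I * (k * ?L) / n" unfolding G_def using lnp(2) by (simp add: abs_divide divide_right_mono)
      also have "\<dots> = (I * M * k / n) / M * ?L" using par(5) by simp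
      also have "\<dots> \<le> \<epsilon> / M * ?L" using \<epsilon>1 par(5) by (intro mult_right_mono divide_right_mono) auto
      finally show ?thesis using gabs1[of t] t by simp
    qed
    show "0 \<le> u z" "u z \<le> 2 * M * gauss z" for z using up[of z] u_up[of z] by auto
    show "integrable lborel (g t)" if "t \<ge> 0" for t
    proof -
      have "integrable lborel (\<lambda>z. f t z - f_inf z)" using fti[OF that] fii(1) by simp
      then have "integrable lborel (\<lambda>z. f t (\<sigma> z) - f_inf (\<sigma> z))" using scale(1)[OF dm[OF that]] by simp
      then show ?thesis unfolding g_def by (rule integrable_mult_right)
    qed
    show "((\<lambda>r. \<integral>z. \<bar>g r z - g t z\<bar> \<partial>lborel) \<longlongrightarrow> 0) (at t within {0..})" if t: "t \<ge> 0" for t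
    proof (rule Lim_transform_eventually[OF fL1[OF t]])
      show "\<forall>\<^sub>F r in at t within {0..}. (\<integral>z. \<bar>f r z - f t z\<bar> \<partial>lborel) = (\<integral>z. \<bar>g r z - g t z\<bar> \<partial>lborel)"
        unfolding eventually_at_filter using gabs[OF _ t] by (auto intro!: always_eventually)
    qed
    show "(\<integral>z. g t z \<partial>lborel) = 0" if "t \<ge> 0" for t
      using scale(2)[OF dm[OF that]] fti[OF that] fii vs(6)[OF that] by (simp add: g_def)
    show "cN t / cD t \<le> C / t" if "0 < t" "t \<le> T0" for t by (rule ND[OF that])
    show "(\<integral>z. gauss z * (P T0 \<phi> z - (\<integral>w. gauss w * \<phi> w \<partial>lborel))\<^sup>2 \<partial>lborel) \<le> 1 / 16 * (\<integral>w. gauss w * (\<phi> w)\<^sup>2 \<partial>lborel)"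
      if "\<phi> \<in> borel_measurable borel" "\<And>w. \<bar>\<phi> w\<bar> \<le> k" for \<phi> k by (rule contr[OF that])
    show "48 * \<epsilon> * sqrt (2 * C * T0) \<le> 1" using C T0 by (simp add: \<epsilon>_def)
  qed
  have bd: "sp.L t \<le> 2 * M" if "t \<ge> 0" for t
  proof -
    have "sp.L t = (\<integral>z. \<bar>f t z - f_inf z\<bar> \<partial>lborel)" unfolding sp.L_def by (rule gabs1[OF that])
    also have "\<dots> \<le> (\<integral>z. \<bar>f t z\<bar> + \<bar>f_inf z\<bar> \<partial>lborel)"
      using fti[OF that] fii(1) by (intro integral_mono) auto
    also have "\<dots> = M + M" using fti[OF that] fii fabs[OF that] fip by (simp add: less_imp_le)
    finally show ?thesis by simp
  qed
  \<comment> \<open>The weight is taken as u, the rescaled steady state with its Jacobian; g^2 / u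
    then carries a single factor c, so the norms agree exactly.\<close>
  have wt: "in_L2 (mu_inf f_inf) (\<lambda>z. f t z - f_inf z) \<longleftrightarrow> integrable lborel (\<lambda>z. (g t z)\<^sup>2 / u z)"
    "L2_norm (mu_inf f_inf) (\<lambda>z. f t z - f_inf z) = sqrt (\<integral>z. (g t z)\<^sup>2 / u z \<partial>lborel)" if "t \<ge> 0" for t
  proof -
    let ?h = "\<lambda>z. (f t z - f_inf z)\<^sup>2 / f_inf z"
    have hm: "?h \<in> borel_measurable borel" using dm[OF that] fim by measurable
    have e: "(g t z)\<^sup>2 / u z = c * ?h (\<sigma> z)" for z
      unfolding g_def u_def using cp by (simp add: power_mult_distrib power2_eq_square)
    show "in_L2 (mu_inf f_inf) (\<lambda>z. f t z - f_inf z) \<longleftrightarrow> integrable lborel (\<lambda>z. (g t z)\<^sup>2 / u z)"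
      unfolding L2_norm_mu_inf(1)[OF fim fip dm[OF that]] e scale(1)[OF hm, symmetric]
      using cp integrable_mult_left_iff[of lborel c "\<lambda>z. ?h (\<sigma> z)"] by blast
    show "L2_norm (mu_inf f_inf) (\<lambda>z. f t z - f_inf z) = sqrt (\<integral>z. (g t z)\<^sup>2 / u z \<partial>lborel)"
      unfolding L2_norm_mu_inf(2)[OF fim fip dm[OF that]] e scale(2)[OF hm] ..
  qed
  \<comment> \<open>The initial datum is attained almost everywhere only, which suffices for
    membership and norm.\<close>
  have f0: "in_L2 (mu_inf f_inf) (\<lambda>z. f 0 z - f_inf z)"
    "L2_norm (mu_inf f_inf) (\<lambda>z. f 0 z - f_inf z) = L2_norm (mu_inf f_inf) (\<lambda>z. f_in z - f_inf z)"
  proof -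
    have inm: "f_in \<in> borel_measurable borel" using fin(1) by (auto dest: borel_measurable_integrable)
    have ae: "AE z in lborel. (f 0 z - f_inf z)\<^sup>2 / f_inf z = (f_in z - f_inf z)\<^sup>2 / f_inf z"
      using vs(4) by eventually_elim simp
    have m0: "(\<lambda>z. f_in z - f_inf z) \<in> borel_measurable borel" using inm fim by simp
    have m1: "(\<lambda>z. (f 0 z - f_inf z)\<^sup>2 / f_inf z) \<in> borel_measurable lborel" "(\<lambda>z. (f_in z - f_inf z)\<^sup>2 / f_inf z) \<in> borel_measurable lborel"
      using dm[of 0] m0 fim by auto
    show "in_L2 (mu_inf f_inf) (\<lambda>z. f 0 z - f_inf z)"
      using L2 integrable_cong_AE[OF m1 ae] unfolding L2_norm_mu_inf(1)[OF fim fip dm[OF order_refl]] L2_norm_mu_inf(1)[OF fim fip m0] by simp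
    show "L2_norm (mu_inf f_inf) (\<lambda>z. f 0 z - f_inf z) = L2_norm (mu_inf f_inf) (\<lambda>z. f_in z - f_inf z)"
      unfolding L2_norm_mu_inf(2)[OF fim fip dm[OF order_refl]] L2_norm_mu_inf(2)[OF fim fip m0] integral_cong_AE[OF m1 ae] ..
  qed
  have um: "u \<in> borel_measurable borel" by (rule borel_measurable_continuous_onI[OF uc])
  have M2: "2 * M > 0" "2 / M > 0" using par by auto
  note c1 = weight_comparison[OF gm gauss_measurable um gauss_pos up M2(1) u_up]
  have lo': "gauss z \<le> 2 / M * u z" for z using u_lo[of z] par(5) by (simp add: field_simps)
  note c2 = weight_comparison[OF gm um gauss_measurable up gauss_pos M2(2) lo']
  define N where "N = (\<lambda>t. L2_norm (mu_inf f_inf) (\<lambda>z. f t z - f_inf z))"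
  have fin0: "sp.fin 0" unfolding sp.fin_def by (rule c1(1)) (use f0(1) wt(1)[of 0] in auto)
  have E0: "sp.E 0 \<le> sqrt (2 * M) * N 0"
  proof -
    have "sp.E 0 \<le> sqrt (2 * M * (\<integral>z. (g 0 z)\<^sup>2 / u z \<partial>lborel))"
      unfolding sp.E_def by (rule real_sqrt_le_mono, rule c1(2)) (use f0(1) wt(1)[of 0] in auto)
    then show ?thesis using wt(2)[of 0] by (simp add: N_def real_sqrt_mult)
  qed
  note dec = sp.E_decay[OF bd fin0 t]
  have Et: "integrable lborel (\<lambda>z. (g t z)\<^sup>2 / u z)" by (rule c2(1)[OF t]) (use dec(1) in \<open>simp add: sp.fin_def\<close>)
  have "N t \<le> sqrt (2 / M * (\<integral>z. (g t z)\<^sup>2 / gauss z \<partial>lborel))"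
    unfolding N_def wt(2)[OF t] by (rule real_sqrt_le_mono, rule c2(2)[OF t]) (use dec(1) in \<open>simp add: sp.fin_def\<close>)
  also have "\<dots> = sqrt (2 / M) * sp.E t" by (simp only: sp.E_def real_sqrt_mult)
  \<comment> \<open>Passing to the Gaussian weight at time 0 costs sqrt (2 M), passing back at time
    t costs sqrt (2 / M). The mass cancels in the product 2, and 4 times 2 gives the constant
    8.\<close>
  also have "\<dots> \<le> sqrt (2 / M) * (4 * exp (- (ln 2 / T0) * t) * (sqrt (2 * M) * N 0))"
    by (rule mult_left_mono[OF order_trans[OF dec(2) mult_left_mono[OF E0]]]) (use M2(2) in simp_all)
  also have "\<dots> = (sqrt (2 / M) * sqrt (2 * M)) * 4 * exp (- (ln 2 / T0) * t) * N 0" by simp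
  also have "sqrt (2 / M) * sqrt (2 * M) = 2" using par(5) by (simp add: real_sqrt_mult[symmetric])
  finally have "N t \<le> 8 * exp (- (ln 2 / T0) * t) * N 0" by simp
  then show ?thesis using Et wt(1)[OF t] f0(2) by (simp add: N_def)
qed

text \<open>Dependence of constants is expressed by the order of quantifiers: \<kappa> is fixed
  before the constants, while K itself is chosen after them subject to
  \<open>W1inf_norm K = \<kappa>\<close>. Membership \<open>in_L2\<close> accompanies each norm,
  since the norm alone would be 0 for non-integrable squares.\<close>

theorem theorem1p3:
  fixes \<alpha> \<nu> \<theta> \<kappa> :: real
  assumes "\<alpha> > 0" and "\<nu> > 0" and "\<theta> > 0"
  shows "\<exists>C1>0. \<exists>C2>0. \<exists>lam>0. \<forall>M>0. \<exists>C3>1.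
    \<forall>(K :: real \<Rightarrow> real) (I :: real) (f_in :: real \<times> real \<Rightarrow> real)
      (f :: real \<Rightarrow> real \<times> real \<Rightarrow> real) (f_inf :: real \<times> real \<Rightarrow> real).
      in_W1inf K \<and> W1inf_norm K = \<kappa> \<and> I > 0 \<and>
      integrable lborel f_in \<and> (AE z in lborel. 0 \<le> f_in z) \<and> (\<integral>z. f_in z \<partial>lborel) = M \<and>
      vfp_solution \<alpha> \<nu> \<theta> I K f_in f \<and>
      is_haissinski \<alpha> \<theta> I M K f_inf \<and>
      I * M \<le> C1 \<and>
      in_L2 (mu_inf f_inf) (\<lambda>z. f_in z - f_inf z) \<and>
      sqrt M * L2_norm (mu_inf f_inf) (\<lambda>z. f_in z - f_inf z) \<le> C2
      \<longrightarrow>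
      (\<forall>t\<ge>0.
        in_L2 (mu_inf f_inf) (\<lambda>z. f t z - f_inf z) \<and>
        L2_norm (mu_inf f_inf) (\<lambda>z. f t z - f_inf z)
          \<le> C3 * exp (- lam * t) * L2_norm (mu_inf f_inf) (\<lambda>z. f_in z - f_inf z))"
proof -
  obtain a b d where osc: "oscillator (sqrt \<alpha>) \<nu> a b d"
    using oscillator_exists[of "sqrt \<alpha>" \<nu>] assms by auto
  interpret oscillator "sqrt \<alpha>" \<nu> a b d by (rule osc)
  obtain T0 where T0: "T0 > 0" "\<And>\<phi> k. \<phi> \<in> borel_measurable borel \<Longrightarrow> (\<And>w. \<bar>\<phi> w\<bar> \<le> k) \<Longrightarrow>
      (\<integral>z. gauss z * (P T0 \<phi> z - (\<integral>w. gauss w * \<phi> w \<partial>lborel))\<^sup>2 \<partial>lborel) \<le> 1/16 * (\<integral>w. gauss w * (\<phi> w)\<^sup>2 \<partial>lborel)"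
    using contraction_time by blast
  obtain C where C: "C > 0" "\<And>t. 0 < t \<Longrightarrow> t \<le> T0 \<Longrightarrow> cN t / cD t \<le> C / t"
    using cN_bound[OF T0(1)] by blast
  \<comment> \<open>The first entry is the threshold for absorbing the force terms, the second
    ensures exp (2 I M \<kappa> / \<theta>) \<le> 2.\<close>
  define C0 where "C0 = min (sqrt \<theta> / (48 * sqrt (2 * C * T0))) (\<theta> * ln 2 / 2)"
  \<comment> \<open>Division by |\<kappa>| + 1 instead of \<kappa> also covers \<kappa> = 0 and
    needs no sign of \<kappa>.\<close>
  define C1 where "C1 = C0 / (\<bar>\<kappa>\<bar> + 1)"
  have C0: "C0 > 0" using assms C(1) T0(1) by (simp add: C0_def)
  have C1: "C1 > 0" using C0 by (simp add: C1_def add_nonneg_pos)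
  show ?thesis
  proof (rule exI[of _ C1], rule conjI[OF C1], rule exI[of _ 1], rule conjI[OF zero_less_one],
      rule exI[of _ "ln 2 / T0"], rule conjI, goal_cases)
    case 1 show ?case using T0(1) by simp
  next
    case 2
    show ?case
    proof (intro allI impI, rule exI[of _ 8], rule conjI, simp, intro allI impI, (elim conjE)?, goal_cases)
      case (1 M K I f_in f f_inf t)
      have "I * M * \<kappa> \<le> C0"
      proof -
        have "I * M * \<kappa> \<le> I * M * (\<bar>\<kappa>\<bar> + 1)" using 1 by (intro mult_left_mono) auto
        also have "\<dots> \<le> C1 * (\<bar>\<kappa>\<bar> + 1)" using 1 by (intro mult_right_mono) auto
        also have "\<dots> = C0" by (simp add: C1_def)
        finally show ?thesis .
      qed
      then have small: "I * M * \<kappa> \<le> sqrt \<theta> / (48 * sqrt (2 * C * T0))" "2 * (I * M * \<kappa>) \<le> \<theta> * ln 2"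
        by (simp_all add: C0_def)
      show ?case
        by (rule decay_estimate[OF assms _ _ osc T0(1) C(1) C(2) T0(2)]) (use 1 small in auto)
    qed
  qed
qed

end
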